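(* Let $X$ be a regular diffusion on $[0,1]$ with $X_0=0$, with generator $A=\frac12 b\frac{d^2}{dx^2}+a\frac{d}{dx}$, $b\in C^1((0,1))$, and with either (instantaneously) reflecting or entrance behavior at the boundary $0$ and (instantaneously) reflecting behavior at the boundary $1$. Let the eigenpairs $(\lambda_i,v_{\lambda_i})$, $i=1,2,\dots$, with $\lambda_i>0$, satisfying $Av_{\lambda_i}+\lambda_iv_{\lambda_i}=0$ on $(0,1)$ and the boundary conditions $\frac{dv_{\lambda_i}}{dS}^+(0)=0=\frac{dv_{\lambda_i}}{dS}^-(1)$, be labeled so that $0<\lambda_1<\lambda_2<\cdots$. Let $X^*$ be a strong stationary dual of $X$ with generator $A^*$ (so that $X_0^*=0$), and let $T_1^*$ be the hitting time of state $1$ for $X^*$. Let $W_1,W_2,\dots$ be independent random variables with $W_i\sim\mathrm{Exp}(\lambda_i)$ (rate $\lambda_i$). Then for $t>0$ $$\mathrm{sep}(t)=\mathbb{P}_0(T_1^*>t)=\mathbb{P}(W>t),\qquad\text{where } W\stackrel{\mathcal{L}}{=}\sum_{i=1}^\infty W_i.$$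
   Context: Diffusions. $I=[0,1]$, $I^\circ=(0,1)$; $a,b\in C(I^\circ)$ with $b>0$. $X$ is a time-homogeneous Feller diffusion on $I$ with generator $A$ with domain $\mathcal{D}_A$. Regular means $\mathbb{P}(T_y<\infty\mid X_0=x)>0$ for all $x,y\in I^\circ$. Scale function: $S'(x)=s(x)=\exp\{-\int^x 2a/b\}$; $\frac{df}{dS}^+(0)=\lim_{x\downarrow0}f'(x)/s(x)$, $\frac{df}{dS}^-(1)=\lim_{x\uparrow1}f'(x)/s(x)$. Speed measure $M(dx)$ has density $m=1/(sb)$. With $x\in I^\circ$ fixed, $N(0)=\int_{(0,x]}[S(x)-S(\eta)]M(d\eta)$, $\Sigma(0)=\int_{(0,x]}[M(x)-M(\eta)]dS(\eta)$ and analogously at $1$. A boundary is entrance if $N<\infty,\Sigma=\infty$ and regular if $N<\infty,\Sigma<\infty$. A regular boundary $0$ is (instantaneously) reflecting if $\frac{df}{dS}^+(0)=0$ for all $f\in\mathcal{D}_A$ (similarly at $1$). When each boundary is reflecting or entrance, $\mathcal{D}_A$ is the set of $f\in C(I)\cap C^2(I^\circ)$ with $Af\in C(I)$ and $\frac{df}{dS}^+(0)=0$ if $0$ is reflecting, $\frac{df}{dS}^-(1)=0$ if $1$ is reflecting. $\Pi$, the unique invariant distribution, is $M$ normalized; it has density $\pi>0$ on $I^\circ$, and $\Pi(x)=\int_0^x\pi(y)dy$. The eigenvalues above are countably many, real and simple, with $\lambda_i\uparrow\infty$ and $\sum_i\lambda_i^{-1}<\infty$ (Sturm–Liouville theory).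 Strong stationary dual. $\mathcal{F}[0,1]$ is the space of bounded measurable real functions on $[0,1]$; $(\mu,f)=\int f\,d\mu$. For $f\in\mathcal{F}[0,1]$ let $(\Lambda f)(x)=\int_0^x\frac{\pi(y)}{\Pi(x)}f(y)dy$ for $x>0$, $(\Lambda f)(0)=f(0)$. A second Feller diffusion $X^*$ on $I$ with initial law $\Pi_0^*$ and generator $A^*$ with domain $\mathcal{D}_{A^*}$ is a strong stationary dual of $X$ (with initial law $\Pi_0$) if $\Lambda$ maps $\mathcal{D}_A$ into $\mathcal{D}_{A^*}$, $\Lambda A=A^*\Lambda$ on $\mathcal{D}_A$, and $(\Pi_0,f)=(\Pi_0^*,\Lambda f)$ for all $f\in\mathcal{F}[0,1]$. Separation. For $t>0$, let $\Pi_t$ be the law of $X_t$ (one has $\Pi_t\ll\Pi$), $R_t=d\Pi_t/d\Pi$, $a(t)=\operatorname{ess\,inf}R_t=\sup\{r:\Pi(R_t<r)=0\}$, and $\mathrm{sep}(t)=1-a(t)$. *)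

theory Defs
  imports "HOL-Probability.Probability"
begin

abbreviation unit_borel :: "real measure" where
  "unit_borel \<equiv> restrict_space borel {0..1}"

definition bounded_measurable_unit :: "(real \<Rightarrow> real) set" where
  "bounded_measurable_unit = {f. f \<in> borel_measurable unit_borel \<and> bounded (f ` {0..1})}"

text \<open>
  A diffusion is given as a Markov family: \<open>X t \<omega>\<close> is the path (time \<open>t \<ge> 0\<close>) and \<open>P x\<close> is the
  law under which the process is started at \<open>x \<in> [0,1]\<close>.
\<close>

definition transition_op ::
  "(real \<Rightarrow> 'w measure) \<Rightarrow> (real \<Rightarrow> 'w \<Rightarrow> real) \<Rightarrow> real \<Rightarrow> (real \<Rightarrow> real) \<Rightarrow> real \<Rightarrow> real" where
  "transition_op P X t f x = (\<integral>\<omega>. f (X t \<omega>) \<partial>P x)"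

definition past :: "'w measure \<Rightarrow> (real \<Rightarrow> 'w \<Rightarrow> real) \<Rightarrow> real \<Rightarrow> 'w measure" where
  "past M X s =
     sigma (space M) {X u -` B \<inter> space M | u B. 0 \<le> u \<and> u \<le> s \<and> B \<in> sets unit_borel}"

definition feller_diffusion :: "(real \<Rightarrow> 'w measure) \<Rightarrow> (real \<Rightarrow> 'w \<Rightarrow> real) \<Rightarrow> bool" where
  "feller_diffusion P X \<longleftrightarrow>
     (\<forall>x\<in>{0..1}.
        prob_space (P x) \<and>
        (\<forall>t\<ge>0. X t \<in> measurable (P x) unit_borel) \<and>
        (AE \<omega> in P x. X 0 \<omega> = x) \<and>
        (\<forall>\<omega>\<in>space (P x). continuous_on {0..} (\<lambda>t. X t \<omega>)) \<and>
        (\<forall>s\<ge>0. \<forall>t\<ge>0. \<forall>f\<in>bounded_measurable_unit.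
           AE \<omega> in P x. real_cond_exp (P x) (past (P x) X s) (\<lambda>\<omega>. f (X (s + t) \<omega>)) \<omega>
             = transition_op P X t f (X s \<omega>))) \<and>
     (\<forall>f. continuous_on {0..1} f \<longrightarrow>
        (\<forall>t\<ge>0. continuous_on {0..1} (transition_op P X t f)) \<and>
        uniform_limit {0..1} (\<lambda>t. transition_op P X t f) f (at_right 0))"

text \<open>
  The strong generator on $C(I)$.  Elements of $C(I)$ are represented by functions on the reals
  whose values outside $[0,1]$ are irrelevant.
\<close>

definition generator ::
  "(real \<Rightarrow> 'w measure) \<Rightarrow> (real \<Rightarrow> 'w \<Rightarrow> real) \<Rightarrow> (real \<Rightarrow> real) \<Rightarrow> real \<Rightarrow> real" where
  "generator P X f x = Lim (at_right 0) (\<lambda>t. (transition_op P X t f x - f x) / t)"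

definition generator_domain ::
  "(real \<Rightarrow> 'w measure) \<Rightarrow> (real \<Rightarrow> 'w \<Rightarrow> real) \<Rightarrow> (real \<Rightarrow> real) set" where
  "generator_domain P X =
     {f. continuous_on {0..1} f \<and> continuous_on {0..1} (generator P X f) \<and>
         uniform_limit {0..1} (\<lambda>t x. (transition_op P X t f x - f x) / t)
           (generator P X f) (at_right 0)}"

definition hitting_time :: "(real \<Rightarrow> 'w \<Rightarrow> real) \<Rightarrow> real \<Rightarrow> 'w \<Rightarrow> ereal" where
  "hitting_time X y \<omega> = Inf {ereal t | t. 0 \<le> t \<and> X t \<omega> = y}"

definition regular_diffusion :: "(real \<Rightarrow> 'w measure) \<Rightarrow> (real \<Rightarrow> 'w \<Rightarrow> real) \<Rightarrow> bool" where
  "regular_diffusion P X \<longleftrightarrow>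
     (\<forall>x\<in>{0<..<1}. \<forall>y\<in>{0<..<1}.
        measure (P x) {\<omega>\<in>space (P x). hitting_time X y \<omega> < \<infinity>} > 0)"

definition C2_interior :: "(real \<Rightarrow> real) \<Rightarrow> bool" where
  "C2_interior f \<longleftrightarrow>
     f C1_differentiable_on {0<..<1} \<and> deriv f C1_differentiable_on {0<..<1}"

definition diff_op ::
  "(real \<Rightarrow> real) \<Rightarrow> (real \<Rightarrow> real) \<Rightarrow> (real \<Rightarrow> real) \<Rightarrow> real \<Rightarrow> real" where
  "diff_op a b f x = 1/2 * b x * deriv (deriv f) x + a x * deriv f x"

text \<open>
  The generator acts as $\frac12 b f'' + a f'$ in the interior.  The boundary conditions that
  single out the domain are imposed separately below.
\<close>

definition has_coefficients ::
  "(real \<Rightarrow> 'w measure) \<Rightarrow> (real \<Rightarrow> 'w \<Rightarrow> real) \<Rightarrow> (real \<Rightarrow> real) \<Rightarrow> (real \<Rightarrow> real) \<Rightarrow> bool" where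
  "has_coefficients P X a b \<longleftrightarrow>
     (\<forall>f\<in>generator_domain P X. C2_interior f \<and>
        (\<forall>x\<in>{0<..<1}. generator P X f x = diff_op a b f x))"

text \<open>
  The base point $1/2$ fixes the additive constant of $\int^x$ and serves as the interior reference
  point of $N$ and $\Sigma$.  Another choice rescales \<open>s\<close> and the speed measure by constants, and
  changes neither the finiteness of $N$ and $\Sigma$ nor the vanishing of $df/dS$ at an endpoint.
\<close>

definition scale_deriv :: "(real \<Rightarrow> real) \<Rightarrow> (real \<Rightarrow> real) \<Rightarrow> real \<Rightarrow> real" where
  "scale_deriv a b x = exp (- (LBINT y=ereal (1/2)..ereal x. 2 * a y / b y))"

definition scale_fun :: "(real \<Rightarrow> real) \<Rightarrow> (real \<Rightarrow> real) \<Rightarrow> real \<Rightarrow> real" where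
  "scale_fun a b x = (LBINT y=ereal (1/2)..ereal x. scale_deriv a b y)"

definition speed_density :: "(real \<Rightarrow> real) \<Rightarrow> (real \<Rightarrow> real) \<Rightarrow> real \<Rightarrow> real" where
  "speed_density a b x = 1 / (scale_deriv a b x * b x)"

definition speed_measure :: "(real \<Rightarrow> real) \<Rightarrow> (real \<Rightarrow> real) \<Rightarrow> real measure" where
  "speed_measure a b = density (restrict_space lborel {0..1})
     (\<lambda>x. if x \<in> {0<..<1} then ennreal (speed_density a b x) else 0)"

definition N0 :: "(real \<Rightarrow> real) \<Rightarrow> (real \<Rightarrow> real) \<Rightarrow> ennreal" where
  "N0 a b = (\<integral>\<^sup>+\<eta>\<in>{0<..1/2}. ennreal (scale_fun a b (1/2) - scale_fun a b \<eta>) \<partial>speed_measure a b)"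

text \<open>
  $M(x) - M(\eta)$ is read as the mass of $(\eta, x]$, and $dS(\eta) = s(\eta)\,d\eta$.
\<close>

definition Sigma0 :: "(real \<Rightarrow> real) \<Rightarrow> (real \<Rightarrow> real) \<Rightarrow> ennreal" where
  "Sigma0 a b =
     (\<integral>\<^sup>+\<eta>\<in>{0<..1/2}. emeasure (speed_measure a b) {\<eta><..1/2} * ennreal (scale_deriv a b \<eta>) \<partial>lborel)"

definition N1 :: "(real \<Rightarrow> real) \<Rightarrow> (real \<Rightarrow> real) \<Rightarrow> ennreal" where
  "N1 a b = (\<integral>\<^sup>+\<eta>\<in>{1/2..<1}. ennreal (scale_fun a b \<eta> - scale_fun a b (1/2)) \<partial>speed_measure a b)"

definition Sigma1 :: "(real \<Rightarrow> real) \<Rightarrow> (real \<Rightarrow> real) \<Rightarrow> ennreal" where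
  "Sigma1 a b =
     (\<integral>\<^sup>+\<eta>\<in>{1/2..<1}. emeasure (speed_measure a b) {1/2<..\<eta>} * ennreal (scale_deriv a b \<eta>) \<partial>lborel)"

definition dS0_zero :: "(real \<Rightarrow> real) \<Rightarrow> (real \<Rightarrow> real) \<Rightarrow> (real \<Rightarrow> real) \<Rightarrow> bool" where
  "dS0_zero a b f \<longleftrightarrow> ((\<lambda>x. deriv f x / scale_deriv a b x) \<longlongrightarrow> 0) (at_right 0)"

definition dS1_zero :: "(real \<Rightarrow> real) \<Rightarrow> (real \<Rightarrow> real) \<Rightarrow> (real \<Rightarrow> real) \<Rightarrow> bool" where
  "dS1_zero a b f \<longleftrightarrow> ((\<lambda>x. deriv f x / scale_deriv a b x) \<longlongrightarrow> 0) (at_left 1)"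

definition entrance0 :: "(real \<Rightarrow> real) \<Rightarrow> (real \<Rightarrow> real) \<Rightarrow> bool" where
  "entrance0 a b \<longleftrightarrow> N0 a b < \<infinity> \<and> Sigma0 a b = \<infinity>"

definition reflecting0 ::
  "(real \<Rightarrow> 'w measure) \<Rightarrow> (real \<Rightarrow> 'w \<Rightarrow> real) \<Rightarrow> (real \<Rightarrow> real) \<Rightarrow> (real \<Rightarrow> real) \<Rightarrow> bool" where
  "reflecting0 P X a b \<longleftrightarrow>
     N0 a b < \<infinity> \<and> Sigma0 a b < \<infinity> \<and> (\<forall>f\<in>generator_domain P X. dS0_zero a b f)"

definition reflecting1 ::
  "(real \<Rightarrow> 'w measure) \<Rightarrow> (real \<Rightarrow> 'w \<Rightarrow> real) \<Rightarrow> (real \<Rightarrow> real) \<Rightarrow> (real \<Rightarrow> real) \<Rightarrow> bool" where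
  "reflecting1 P X a b \<longleftrightarrow>
     N1 a b < \<infinity> \<and> Sigma1 a b < \<infinity> \<and> (\<forall>f\<in>generator_domain P X. dS1_zero a b f)"

definition stat_density :: "(real \<Rightarrow> real) \<Rightarrow> (real \<Rightarrow> real) \<Rightarrow> real \<Rightarrow> real" where
  "stat_density a b x =
     speed_density a b x / measure (speed_measure a b) (space (speed_measure a b))"

definition stat_measure :: "(real \<Rightarrow> real) \<Rightarrow> (real \<Rightarrow> real) \<Rightarrow> real measure" where
  "stat_measure a b = density (restrict_space lborel {0..1})
     (\<lambda>x. if x \<in> {0<..<1} then ennreal (stat_density a b x) else 0)"

definition stat_cdf :: "(real \<Rightarrow> real) \<Rightarrow> (real \<Rightarrow> real) \<Rightarrow> real \<Rightarrow> real" where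
  "stat_cdf a b x = (LBINT y:{0<..<x}. stat_density a b y)"

definition link ::
  "(real \<Rightarrow> real) \<Rightarrow> (real \<Rightarrow> real) \<Rightarrow> (real \<Rightarrow> real) \<Rightarrow> real \<Rightarrow> real" where
  "link a b f x =
     (if x = 0 then f 0 else (LBINT y:{0<..<x}. stat_density a b y / stat_cdf a b x * f y))"

text \<open>
  The coefficients \<open>a\<close>, \<open>b\<close> of the primal diffusion \<open>(P, X)\<close> enter only through the link;
  \<open>\<mu>\<close> and \<open>\<mu>s\<close> are the initial laws of the primal and of the dual process.
\<close>

definition strong_stationary_dual ::
  "(real \<Rightarrow> real) \<Rightarrow> (real \<Rightarrow> real) \<Rightarrow>
   (real \<Rightarrow> 'w measure) \<Rightarrow> (real \<Rightarrow> 'w \<Rightarrow> real) \<Rightarrow> real measure \<Rightarrow>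
   (real \<Rightarrow> 'v measure) \<Rightarrow> (real \<Rightarrow> 'v \<Rightarrow> real) \<Rightarrow> real measure \<Rightarrow> bool" where
  "strong_stationary_dual a b P X \<mu> Ps Xs \<mu>s \<longleftrightarrow>
     feller_diffusion Ps Xs \<and> prob_space \<mu>s \<and> sets \<mu>s = sets unit_borel \<and>
     (\<forall>f\<in>generator_domain P X. link a b f \<in> generator_domain Ps Xs \<and>
        (\<forall>x\<in>{0..1}. link a b (generator P X f) x = generator Ps Xs (link a b f) x)) \<and>
     (\<forall>f\<in>bounded_measurable_unit. (\<integral>x. f x \<partial>\<mu>) = (\<integral>x. link a b f x \<partial>\<mu>s))"

text \<open>Meaningful for \<open>\<nu>\<close> absolutely continuous with respect to \<open>M\<close>: otherwise \<open>RN_deriv\<close> is the zero function.\<close>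

definition separation :: "real measure \<Rightarrow> real measure \<Rightarrow> real" where
  "separation M \<nu> =
     1 - Sup {r::real. emeasure M {x\<in>space M. RN_deriv M \<nu> x < ennreal r} = 0}"

definition eigenpair ::
  "(real \<Rightarrow> real) \<Rightarrow> (real \<Rightarrow> real) \<Rightarrow> real \<Rightarrow> (real \<Rightarrow> real) \<Rightarrow> bool" where
  "eigenpair a b l v \<longleftrightarrow>
     C2_interior v \<and> (\<exists>x\<in>{0<..<1}. v x \<noteq> 0) \<and>
     (\<forall>x\<in>{0<..<1}. diff_op a b v x + l * v x = 0) \<and>
     dS0_zero a b v \<and> dS1_zero a b v"

end

theory Submission
  imports Defs "HOL-Complex_Analysis.Complex_Analysis"
begin

text \<open>
  Let \<open>u\<close> solve \<open>A u = z u\<close> with \<open>u 0 = 1\<close> and zero flux \<open>du/dS\<close> at \<open>0\<close>, and let \<open>G z\<close> be its flux at \<open>1\<close>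
  divided by \<open>2 z M(1)\<close>. The entire function \<open>G\<close> has \<open>G 0 = 1\<close>, its zeros are simple and are the numbers
  \<open>- \<lambda>\<^sub>i\<close>, and it is of minimal exponential type; applying the Borel-Caratheodory inequality
  to the logarithm of its quotient by the partial products gives \<open>G z = \<Prod>\<^sub>i (1 + z / \<lambda>\<^sub>i)\<close>.

  The relation \<open>\<Lambda> A = A* \<Lambda>\<close> passes to resolvents and then, by uniqueness of Laplace transforms, to
  semigroups. Hence \<open>X\<^sub>t\<close> has the density \<open>y \<mapsto> E (1 {y < X*\<^sub>t} / \<Pi>(X*\<^sub>t))\<close> with respect to \<open>\<Pi>\<close>. It is
  nonincreasing, so its essential infimum is its limit at \<open>1\<close>, which is \<open>P(X*\<^sub>t = 1)\<close>, and this is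
  \<open>P(T*\<^sub>1 \<le> t)\<close> because \<open>1\<close> is absorbing for \<open>X*\<close>. Evaluating the resolvent of \<open>X\<close> at \<open>0\<close> on functions
  concentrating at \<open>1\<close> yields \<open>E exp (- \<theta> T*\<^sub>1) = 1 / G \<theta>\<close>, which is the Laplace transform of \<open>W\<close>.
\<close>

section \<open>Product expansion of entire functions of minimal exponential type\<close>

text \<open>The entrance boundary dictates the shape of the proof. There the scale density
  \<open>s\<close> is not integrable at 0, only its product with the mass function \<open>M\<close>
  is, so every estimate near 0 goes through the primitive of \<open>s * M\<close>. If
  \<open>s\<close> were integrable, the flux would grow at most like the exponential of a multiple
  of the square root of |z|. With \<open>s * M\<close> alone the Picard series gives growth of order
  at most one with a positive type, and a separate estimate near 0 is what lowers the type to zero.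
  Minimal type is just enough to rule out a factor exp (c z) in front of the product. That the zeros
  are real, simple and equal to the eigenvalues rests on one identity: the derivative of a Wronskian
  contains the speed density but not \<open>s\<close>. Duality is given through generators alone,
  and the Markov property through conditional expectations at fixed times. Hence the detour over
  resolvents, the supermartingale in place of a stopping argument, and the proof that the primal law
  has no atom at 0 before its density can be written down.\<close>

lemma Borel_Caratheodory_at_zero:
  fixes h :: "complex \<Rightarrow> complex"
  assumes hol: "h holomorphic_on ball 0 R" and h0: "h 0 = 0" and "A > 0"
    and re: "\<And>z. norm z < R \<Longrightarrow> Re (h z) < A" and z: "norm z < R"
  shows "norm (h z) * (R - norm z) \<le> 2 * A * norm z"
proof -
  have R: "R > 0" using z norm_ge_zero[of z] by linarith
  \<comment> \<open>The map \<zeta> |-> \<zeta> / (2 A - \<zeta>) sends the half plane Re \<zeta> <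
    A into the unit disc and fixes 0, so after rescaling the disc the Schwarz lemma applies to
    \<open>g\<close>.\<close>
  define g where "g w = h (of_real R * w) / (2 * of_real A - h (of_real R * w))" for w
  have inb: "norm (of_real R * w) < R" if "norm w < 1" for w :: complex
    using that R by (simp add: norm_mult)
  have nz: "2 * of_real A - h w \<noteq> 0" if "norm w < R" for w
  proof
    assume "2 * of_real A - h w = 0"
    then have "h w = 2 * of_real A" by simp
    then have "Re (h w) = 2 * A" by simp
    with re[OF that] \<open>A > 0\<close> show False by simp
  qed
  have holR: "(\<lambda>w. h (of_real R * w)) holomorphic_on ball 0 1"
    by (rule holomorphic_on_compose_gen[OF _ hol, unfolded o_def])
      (auto intro!: holomorphic_intros simp: inb)
  have "g holomorphic_on ball 0 1"
    unfolding g_def by (intro holomorphic_intros holR) (use nz inb in auto)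
  moreover have "g 0 = 0" by (simp add: g_def h0)
  moreover have lt: "norm (h w) < norm (2 * of_real A - h w)" if "norm w < R" for w
  proof -
    have "(norm (h w))\<^sup>2 < (norm (2 * of_real A - h w))\<^sup>2"
      using mult_strict_left_mono[OF re[OF that] \<open>A > 0\<close>]
      by (simp only: cmod_power2) (simp add: power2_eq_square algebra_simps)
    then show ?thesis by (simp add: power2_less_imp_less)
  qed
  have "norm (g w) < 1" if "norm w < 1" for w
    using lt[OF inb[OF that]] nz[OF inb[OF that]] by (simp add: g_def norm_divide)
  ultimately have "norm (g (z / of_real R)) \<le> norm (z / of_real R)"
    using Schwarz_Lemma(1)[of g "z / of_real R"] z R by (simp add: norm_divide)
  then have "norm (h z) / norm (2 * of_real A - h z) \<le> norm z / R"
    using R by (simp add: g_def norm_divide)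
  then have "norm (h z) * R \<le> norm z * norm (2 * of_real A - h z)"
    using nz[OF z] R by (simp add: field_simps)
  also have "\<dots> \<le> norm z * (2 * A + norm (h z))"
    using norm_triangle_ineq4[of "2 * of_real A" "h z"] \<open>A > 0\<close> by (intro mult_left_mono) auto
  finally show ?thesis by (simp add: algebra_simps)
qed

lemma holomorphic_divide_zero:
  fixes G :: "complex \<Rightarrow> complex"
  assumes "G holomorphic_on UNIV" "G c = 0"
  obtains K where "K holomorphic_on UNIV" "\<And>z. G z = (z - c) * K z"
proof
  show "(\<lambda>z. if z = c then deriv G c else (G z - G c) / (z - c)) holomorphic_on UNIV"
    using pole_lemma_open[of G UNIV c] assms by simp
qed (use assms in auto)

text \<open>The zeros are distinct, so no factor already divided out vanishes at the next zero, and
  that zero passes to the quotient. Writing the new factor as 1 + z / \<open>l n\<close> instead of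
  z + \<open>l n\<close> moves a constant into the quotient and preserves the value at 0.\<close>

lemma finite_quotient_entire:
  fixes G :: "complex \<Rightarrow> complex" and l :: "nat \<Rightarrow> real"
  assumes hol: "G holomorphic_on UNIV"
    and l: "strict_mono l" "l 0 > 0" and zeros: "\<And>i. G (- of_real (l i)) = 0"
  shows "\<exists>K. K holomorphic_on UNIV \<and> (\<forall>z. G z = (\<Prod>i<n. 1 + z / of_real (l i)) * K z)"
proof (induction n)
  case 0
  then show ?case using hol by auto
next
  case (Suc n)
  then obtain K where K: "K holomorphic_on UNIV" "\<And>z. G z = (\<Prod>i<n. 1 + z / of_real (l i)) * K z"
    by blast
  have pos: "l i > 0" for i using l strict_mono_less_eq[of l 0 i] by auto
  have ne: "(1::complex) + (- of_real (l n)) / of_real (l i) \<noteq> 0" if "i < n" for i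
  proof -
    have "l i < l n" using l(1) that by (simp add: strict_mono_less)
    then have "1 - l n / l i \<noteq> 0" using pos[of i] by simp
    then show ?thesis
      by (metis of_real_1 of_real_diff of_real_divide of_real_eq_0_iff add_uminus_conv_diff minus_divide_left)
  qed
  have "K (- of_real (l n)) = 0"
    using K(2)[of "- of_real (l n)"] zeros[of n] ne by auto
  then obtain L where L: "L holomorphic_on UNIV" "\<And>z. K z = (z - (- of_real (l n))) * L z"
    using holomorphic_divide_zero[OF K(1)] by blast
  show ?case
  proof (intro exI[of _ "\<lambda>z. of_real (l n) * L z"] conjI allI)
    show "(\<lambda>z. of_real (l n) * L z) holomorphic_on UNIV" by (intro holomorphic_intros L)
    fix z
    show "G z = (\<Prod>i<Suc n. 1 + z / of_real (l i)) * (of_real (l n) * L z)"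
      using pos[of n] by (simp add: K(2)[of z] L(2)[of z] field_simps)
  qed
qed

text \<open>Dividing by the first n factors leaves \<open>K n\<close>, which has no zero in the disc
  of radius \<open>l n\<close> and is exp (\<open>h n\<close>) there with \<open>h n 0 = 0\<close>.
  Comparison with \<open>G\<close> on a circle of twice that radius bounds Re (\<open>h n\<close>)
  by any small multiple of \<open>l n\<close>. Borel-Caratheodory divides by a radius of the same
  size, so at a fixed point \<open>h n\<close> tends to 0 and \<open>K n\<close> to 1.\<close>

theorem product_formula_minimal_type:
  fixes G :: "complex \<Rightarrow> complex" and l :: "nat \<Rightarrow> real"
  assumes hol: "G holomorphic_on UNIV" and G0: "G 0 = 1"
    and growth: "\<And>\<epsilon>. \<epsilon> > 0 \<Longrightarrow> \<exists>C. \<forall>z. norm (G z) \<le> C * exp (\<epsilon> * norm z)"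
    and l: "strict_mono l" "l 0 > 0"
    and zeros: "\<And>i. G (- of_real (l i)) = 0" "\<And>z. G z = 0 \<Longrightarrow> \<exists>i. z = - of_real (l i)"
    and simple: "\<And>i. deriv G (- of_real (l i)) \<noteq> 0"
  shows "(\<lambda>n. \<Prod>i<n. 1 + z / of_real (l i)) \<longlonglongrightarrow> G z"
proof -
  have pos: "l i > 0" for i using l strict_mono_less_eq[of l 0 i] by auto
  \<comment> \<open>Bounded distinct zeros would accumulate, and the identity theorem would give G =
    0, against G 0 = 1.\<close>
  have unb: "filterlim l at_top sequentially"
  proof (rule ccontr)
    assume "\<not> filterlim l at_top sequentially"
    then obtain B where B: "\<And>n. l n \<le> B"
      using strict_mono_mono[OF l(1)]
      by (metis filterlim_at_top_mono filterlim_at_top eventually_sequentially linear monoD order_trans)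
    have inj: "inj (\<lambda>i. - complex_of_real (l i))"
      using l(1) by (auto simp: inj_def strict_mono_eq)
    have "bounded (range (\<lambda>i. - complex_of_real (l i)))"
      using B pos by (intro boundedI[of _ B]) (auto simp: less_imp_le)
    then obtain x where "x islimpt range (\<lambda>i. - complex_of_real (l i))"
      using bounded_infinite_imp_islimpt[of "range (\<lambda>i. - complex_of_real (l i))"]
        range_inj_infinite[OF inj] by blast
    then have "G 0 = 0"
      using analytic_continuation[OF hol open_UNIV connected_UNIV, of "range (\<lambda>i. - complex_of_real (l i))" x 0]
        zeros(1) by auto
    with G0 show False by simp
  qed
  obtain K where K: "\<And>n. K n holomorphic_on UNIV"
      "\<And>n z. G z = (\<Prod>i<n. 1 + z / of_real (l i)) * K n z"
    using finite_quotient_entire[OF hol l zeros(1)] by metis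
  have K0: "K n 0 = 1" for n using K(2)[of 0 n] G0 by simp
  \<comment> \<open>A zero of \<open>K n\<close> this close to 0 is some \<open>- l i\<close> with i
    < n, a root already divided out once. It would be a double zero of \<open>G\<close>.\<close>
  have Knz: "K n z \<noteq> 0" if "norm z < l n" for n z
  proof
    assume a: "K n z = 0"
    then have "G z = 0" using K(2)[of z n] by simp
    then obtain i where i: "z = - of_real (l i)" using zeros(2) by blast
    have "i < n"
      using that i pos[of i] l(1) by (simp add: strict_mono_less)
    obtain Q where Q: "Q holomorphic_on UNIV" "\<And>w. K n w = (w - z) * Q w"
      using holomorphic_divide_zero[OF K(1) a] by blast
    define p where "p w = (\<Prod>j\<in>{..<n} - {i}. 1 + w / complex_of_real (l j)) * Q w" for w
    have ph: "p holomorphic_on UNIV" unfolding p_def by (intro holomorphic_intros Q) (use pos in \<open>auto simp: less_imp_neq[symmetric]\<close>)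
    have Geq: "G w = (w - z)\<^sup>2 * (p w / of_real (l i))" for w
    proof -
      have "(\<Prod>j<n. 1 + w / of_real (l j)) = (1 + w / of_real (l i)) * (\<Prod>j\<in>{..<n} - {i}. 1 + w / complex_of_real (l j))"
        using \<open>i < n\<close> by (subst prod.remove[of _ i]) auto
      moreover have "1 + w / of_real (l i) = (w - z) / of_real (l i)"
        using pos[of i] i by (simp add: field_simps)
      ultimately show ?thesis by (simp add: K(2)[of w n] Q(2) p_def power2_eq_square)
    qed
    have "((\<lambda>w. (w - z)\<^sup>2 * (p w / of_real (l i))) has_field_derivative 0) (at z)"
    proof -
      have "(p has_field_derivative deriv p z) (at z)"
        using ph by (simp add: holomorphic_derivI)
      then show ?thesis using pos[of i]
        by (auto intro!: derivative_eq_intros)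
    qed
    moreover have "G = (\<lambda>w. (w - z)\<^sup>2 * (p w / of_real (l i)))" by (rule ext) (rule Geq)
    ultimately have "deriv G z = 0" by (metis DERIV_imp_deriv)
    with simple[of i] i show False by simp
  qed
  \<comment> \<open>On the circle of radius 2 \<open>l n\<close> one has |z / \<open>l i\<close>|
    \<ge> 2 for i < n, so each factor has modulus at least 1 and |\<open>K n\<close>| is at most
    |\<open>G\<close>|.\<close>
  have Kb: "norm (K n w) \<le> C * exp (2 * \<epsilon> * l n)"
    if C: "\<And>z. norm (G z) \<le> C * exp (\<epsilon> * norm z)" and "\<epsilon> > 0" and w: "norm w \<le> 2 * l n" for n C \<epsilon> w
  proof (rule maximum_modulus_frontier[of "K n" "cball 0 (2 * l n)"])
    show "K n holomorphic_on interior (cball 0 (2 * l n))" using K(1) holomorphic_on_subset by blast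
    show "continuous_on (closure (cball 0 (2 * l n))) (K n)"
      using K(1) holomorphic_on_imp_continuous_on holomorphic_on_subset by blast
    show "w \<in> cball 0 (2 * l n)" using w by simp
    fix z :: complex assume "z \<in> frontier (cball 0 (2 * l n))"
    then have z: "norm z = 2 * l n" using pos[of n] by (simp add: sphere_def)
    have "1 \<le> norm (\<Prod>i<n. 1 + z / of_real (l i))"
      unfolding prod_norm[symmetric]
    proof (rule prod_ge_1)
      fix i assume "i \<in> {..<n}"
      then have "l i < l n" using l(1) by (simp add: strict_mono_less)
      then have "norm (z / of_real (l i)) \<ge> 2" using pos[of i] z by (simp add: norm_divide field_simps)
      then show "1 \<le> norm (1 + z / of_real (l i))"
        using norm_diff_ineq[of "z / of_real (l i)" 1] by (simp add: add.commute)
    qed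
    then have "norm (K n z) \<le> norm (\<Prod>i<n. 1 + z / of_real (l i)) * norm (K n z)"
      by (simp add: mult_le_cancel_right1)
    also have "\<dots> = norm (G z)" by (simp add: K(2)[of z n] norm_mult)
    also have "\<dots> \<le> C * exp (2 * \<epsilon> * l n)" using C[of z] z by (simp add: mult_ac)
    finally show "norm (K n z) \<le> C * exp (2 * \<epsilon> * l n)" .
  qed simp_all
  have logex: "\<exists>h. h holomorphic_on ball 0 (l n) \<and> h 0 = 0 \<and> (\<forall>z\<in>ball 0 (l n). K n z = exp (h z))" for n
  proof -
    have "convex (ball (0::complex) (l n))" by simp
    then have "contractible (ball (0::complex) (l n))" by (rule convex_imp_contractible)
    then obtain h where h: "h holomorphic_on ball 0 (l n)" "\<And>z. z \<in> ball 0 (l n) \<Longrightarrow> K n z = exp (h z)"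
      using contractible_imp_holomorphic_log[of "K n" "ball 0 (l n)"] K(1)[of n] Knz
      by (metis holomorphic_on_subset subset_UNIV mem_ball_0)
    have "exp (h 0) = 1" using h(2)[of 0] pos[of n] K0 by simp
    then show ?thesis using h
      by (intro exI[of _ "\<lambda>z. h z - h 0"]) (auto intro!: holomorphic_intros simp: exp_diff)
  qed
  then obtain h where h: "\<And>n. h n holomorphic_on ball 0 (l n)" "\<And>n. h n 0 = 0"
     "\<And>n z. norm z < l n \<Longrightarrow> K n z = exp (h n z)" by (metis mem_ball_0)
  have "(\<lambda>n. h n z) \<longlonglongrightarrow> 0"
  proof (rule LIMSEQ_I)
    fix e :: real assume "e > 0"
    define r where "r = norm z + 1"
    have "r > 0" by (simp add: r_def add_nonneg_pos)
    \<comment> \<open>Borel-Caratheodory will give |\<open>h n z\<close>| \<le> 2 (3 \<epsilon>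
      \<open>l n\<close>) r / (\<open>l n\<close> / 2) = 12 \<epsilon> r; the 16 leaves room for a
      strict inequality.\<close>
    define \<epsilon> where "\<epsilon> = e / (16 * r)"
    have "\<epsilon> > 0" using \<open>e > 0\<close> \<open>r > 0\<close> by (simp add: \<epsilon>_def)
    obtain C0 where C0: "\<And>z. norm (G z) \<le> C0 * exp (\<epsilon> * norm z)" using growth[OF \<open>\<epsilon> > 0\<close>] by blast
    define C where "C = max C0 1"
    have C: "norm (G z) \<le> C * exp (\<epsilon> * norm z)" for z
      using C0[of z] by (rule order_trans) (simp add: C_def)
    have C1: "C \<ge> 1" by (simp add: C_def)
    \<comment> \<open>The first summand keeps z inside half the disc, the second absorbs the
      constant \<open>C\<close> of the growth bound into \<epsilon> \<open>l n\<close>.\<close>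
    have "eventually (\<lambda>n. l n > 2 * r + (ln C + 1) / \<epsilon>) sequentially"
      using unb by (simp add: filterlim_at_top_dense)
    then obtain N where N: "\<And>n. n \<ge> N \<Longrightarrow> l n > 2 * r + (ln C + 1) / \<epsilon>"
      by (auto simp: eventually_sequentially)
    show "\<exists>no. \<forall>n\<ge>no. norm (h n z - 0) < e"
    proof (intro exI[of _ N] allI impI)
      fix n assume "N \<le> n"
      from N[OF this] have ln: "l n > 2 * r + (ln C + 1) / \<epsilon>" .
      have lnC: "ln C \<ge> 0" using C1 by simp
      have lr: "l n > 2 * r" using ln lnC \<open>\<epsilon> > 0\<close> by (smt (verit) divide_nonneg_pos)
      have A: "ln C + 1 < \<epsilon> * l n"
      proof -
        have "(ln C + 1) / \<epsilon> < l n" using ln \<open>r > 0\<close> by linarith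
        then show ?thesis using \<open>\<epsilon> > 0\<close> by (simp add: field_simps)
      qed
      have re: "Re (h n w) < 3 * \<epsilon> * l n" if "norm w < l n" for w
      proof -
        have "exp (Re (h n w)) = norm (K n w)" using h(3)[OF that] by simp
        also have "\<dots> \<le> C * exp (2 * \<epsilon> * l n)" using that pos[of n] by (intro Kb C \<open>\<epsilon> > 0\<close>) auto
        also have "\<dots> = exp (ln C + 2 * \<epsilon> * l n)" using C1 by (simp add: exp_add)
        finally show ?thesis using A by simp
      qed
      have nz: "norm z < l n" "norm z < r" using lr \<open>r > 0\<close> unfolding r_def by auto
      have "norm (h n z) * (l n / 2) \<le> norm (h n z) * (l n - norm z)"
        using lr nz by (intro mult_left_mono) auto
      also have "\<dots> \<le> 2 * (3 * \<epsilon> * l n) * norm z"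
        using \<open>\<epsilon> > 0\<close> pos[of n] by (intro Borel_Caratheodory_at_zero h re nz) auto
      also have "\<dots> \<le> 2 * (3 * \<epsilon> * l n) * r"
        using \<open>\<epsilon> > 0\<close> pos[of n] nz by (intro mult_left_mono) auto
      finally have "norm (h n z) \<le> 12 * \<epsilon> * r" using pos[of n] by (simp add: field_simps)
      also have "\<dots> < e" using \<open>r > 0\<close> \<open>e > 0\<close> by (simp add: \<epsilon>_def field_simps)
      finally show "norm (h n z - 0) < e" by simp
    qed
  qed
  then have "(\<lambda>n. G z * exp (- h n z)) \<longlonglongrightarrow> G z * exp (- 0)"
    by (intro tendsto_intros)
  moreover have "eventually (\<lambda>n. G z * exp (- h n z) = (\<Prod>i<n. 1 + z / of_real (l i))) sequentially"
  proof -
    have "eventually (\<lambda>n. l n > norm z) sequentially" using unb by (simp add: filterlim_at_top_dense)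
    then show ?thesis
    proof eventually_elim
      case (elim n)
      show ?case unfolding K(2)[of z n] h(3)[OF elim] by (simp add: exp_minus)
    qed
  qed
  ultimately show ?thesis by (simp add: tendsto_cong)
qed

section \<open>Laplace transforms\<close>

text \<open>Restricting the space to t \<ge> 0 lets functions of time that are controlled only there
  be handled without case distinctions. Integration against it is \<theta> times the Laplace
  transform at \<theta>.\<close>

definition exp_law :: "real \<Rightarrow> real measure" where
  "exp_law \<theta> = density (restrict_space lborel {0..}) (\<lambda>t. ennreal (\<theta> * exp (- \<theta> * t)))"

lemma space_exp_law [simp]: "space (exp_law \<theta>) = {0..}"
  by (simp add: exp_law_def space_restrict_space)

lemma sets_exp_law [measurable_cong, simp]: "sets (exp_law \<theta>) = sets (restrict_space borel {0..})"
  by (simp add: exp_law_def sets_restrict_space)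

lemma prob_space_exp_law:
  assumes "\<theta> > 0"
  shows "prob_space (exp_law \<theta>)"
proof
  have "emeasure (exp_law \<theta>) (space (exp_law \<theta>)) = (\<integral>\<^sup>+ t. ennreal (\<theta> * exp (- \<theta> * t)) * indicator {0..} t \<partial>lborel)"
    unfolding exp_law_def
    by (subst emeasure_density)
      (auto simp: space_restrict_space nn_integral_restrict_space sets_restrict_space
        intro!: nn_integral_cong measurable_restrict_space1 split: split_indicator)
  also have "\<dots> = (\<integral>\<^sup>+ t. ennreal (exponential_density \<theta> t) \<partial>lborel)"
    by (intro nn_integral_cong) (auto simp: exponential_density_def indicator_def mult_ac)
  also have "\<dots> = emeasure (density lborel (exponential_density \<theta>)) UNIV"
    by (simp add: emeasure_density)
  also have "\<dots> = 1"
    using prob_space.emeasure_space_1[OF prob_space_exponential_density[OF assms]] by simp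
  finally show "emeasure (exp_law \<theta>) (space (exp_law \<theta>)) = 1" .
qed

lemma integral_exp_law:
  assumes "\<theta> > 0" "f \<in> borel_measurable (restrict_space borel {0..})"
  shows "(\<integral>t. f t \<partial>exp_law \<theta>) = (LBINT t:{0..}. \<theta> * exp (- \<theta> * t) * (f t :: real))"
proof -
  have "(\<integral>t. f t \<partial>exp_law \<theta>) = (\<integral>t. (\<theta> * exp (- \<theta> * t)) *\<^sub>R f t \<partial>restrict_space lborel {0..})"
    unfolding exp_law_def
  proof (rule integral_density)
    show "f \<in> borel_measurable (restrict_space lborel {0..})"
      using assms(2) by (simp cong: measurable_cong_sets add: sets_restrict_space)
  qed (use assms in \<open>auto intro!: AE_I2 measurable_restrict_space1\<close>)
  also have "\<dots> = (LBINT t:{0..}. \<theta> * exp (- \<theta> * t) * f t)"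
    by (subst integral_restrict_space) (auto simp: set_lebesgue_integral_def)
  finally show ?thesis .
qed

lemma integrable_exp_law_bounded:
  assumes "\<theta> > 0" "f \<in> borel_measurable (restrict_space borel {0..})" "\<And>t. t \<ge> 0 \<Longrightarrow> \<bar>f t\<bar> \<le> (B::real)"
  shows "integrable (exp_law \<theta>) f"
proof -
  interpret prob_space "exp_law \<theta>" by (rule prob_space_exp_law) fact
  show ?thesis
    using assms by (intro integrable_const_bound[where B=B]) (auto cong: measurable_cong_sets)
qed

lemma set_integrable_exp_bounded:
  assumes "\<theta> > 0" "f \<in> borel_measurable (restrict_space borel {0..})" "\<And>t. t \<ge> 0 \<Longrightarrow> \<bar>f t\<bar> \<le> (B::real)"
  shows "set_integrable lborel {0..} (\<lambda>t. \<theta> * exp (- \<theta> * t) * f t)"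
proof -
  have "integrable (exp_law \<theta>) f" by (rule integrable_exp_law_bounded) fact+
  then have "integrable (restrict_space lborel {0..}) (\<lambda>t. (\<theta> * exp (- \<theta> * t)) *\<^sub>R f t)"
    unfolding exp_law_def
    by (subst (asm) integrable_density)
      (use assms in \<open>auto intro!: AE_I2 measurable_restrict_space1 simp: measurable_restrict_space1
          cong: measurable_cong_sets simp: sets_restrict_space\<close>)
  then show ?thesis
    by (subst (asm) integrable_restrict_space) (auto simp: set_integrable_def)
qed

text \<open>Memorylessness: the exponential clock either rings before h or starts afresh at h. For
  semigroups this becomes the resolvent equation.\<close>

lemma exp_law_shift:
  assumes "\<theta> > 0" "h \<ge> 0" and f: "f \<in> borel_measurable (restrict_space borel {0..})"
    and B: "\<And>t. t \<ge> 0 \<Longrightarrow> \<bar>f t\<bar> \<le> (B::real)"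
  shows "exp (- \<theta> * h) * (\<integral>t. f (t + h) \<partial>exp_law \<theta>) + (LBINT t:{0..<h}. \<theta> * exp (- \<theta> * t) * f t)
      = (\<integral>t. f t \<partial>exp_law \<theta>)"
proof -
  let ?g = "\<lambda>t. \<theta> * exp (- \<theta> * t) * f t"
  have m: "(\<lambda>t. f (t + h)) \<in> borel_measurable (restrict_space borel {0..})"
    using \<open>h \<ge> 0\<close> by (intro measurable_compose[OF _ f] measurable_restrict_space2)
      (auto simp: space_restrict_space intro!: measurable_restrict_space1)
  have "(\<integral>t. f (t + h) \<partial>exp_law \<theta>) = (LBINT t:{0..}. \<theta> * exp (- \<theta> * t) * f (t + h))"
    by (rule integral_exp_law) fact+
  then have "exp (- \<theta> * h) * (\<integral>t. f (t + h) \<partial>exp_law \<theta>) = (LBINT t:{0..}. ?g (t + h))"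
    by (simp add: exp_add[symmetric] set_integral_mult_right[symmetric] algebra_simps exp_diff
        del: set_integral_mult_right)
  also have "\<dots> = (\<integral>t. indicator {0..} (t + h - h) *\<^sub>R ?g (t + h) \<partial>lborel)"
    by (simp add: set_lebesgue_integral_def)
  also have "\<dots> = (\<integral>t. indicator {0..} (t - h) *\<^sub>R ?g t \<partial>lborel)"
    using lborel_integral_real_affine[of 1 "\<lambda>t. indicator {0..} (t - h) *\<^sub>R ?g t" h]
    by (simp add: add.commute)
  also have "\<dots> = (LBINT t:{h..}. ?g t)"
    by (auto simp: set_lebesgue_integral_def intro!: Bochner_Integration.integral_cong split: split_indicator)
  finally have 1: "exp (- \<theta> * h) * (\<integral>t. f (t + h) \<partial>exp_law \<theta>) = (LBINT t:{h..}. ?g t)" .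
  have int: "set_integrable lborel {0..} ?g" by (rule set_integrable_exp_bounded) fact+
  have "{h..} \<inter> {0..<h} = {}" "{0..} = {h..} \<union> {0..<h}" using \<open>h \<ge> 0\<close> by auto
  then have "(LBINT t:{0..}. ?g t) = (LBINT t:{h..}. ?g t) + (LBINT t:{0..<h}. ?g t)"
    using set_integral_Un[of "{h..}" "{0..<h}" lborel ?g]
      set_integrable_subset[OF int, of "{h..}"] set_integrable_subset[OF int, of "{0..<h}"] \<open>h \<ge> 0\<close>
    by auto
  with 1 integral_exp_law[OF \<open>\<theta> > 0\<close> f] show ?thesis by simp
qed

text \<open>With x = exp (-t) the transforms at 1, 2, ... are the moments of a bounded function on
  [0,1], and by Weierstrass vanishing moments annihilate every continuous test function. Right
  continuity turns vanishing almost everywhere into vanishing everywhere, the form needed for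
  distribution functions.\<close>

lemma Laplace_uniqueness:
  fixes g :: "real \<Rightarrow> real"
  assumes g: "g \<in> borel_measurable (restrict_space borel {0..})"
    and B: "\<And>t. t \<ge> 0 \<Longrightarrow> \<bar>g t\<bar> \<le> B"
    and rc: "\<And>t. t \<ge> 0 \<Longrightarrow> (g \<longlongrightarrow> g t) (at_right t)"
    and zero: "\<And>n::nat. n \<ge> 1 \<Longrightarrow> (\<integral>t. g t \<partial>exp_law (real n)) = 0"
    and "t0 \<ge> 0"
  shows "g t0 = 0"
proof (rule ccontr)
  assume "g t0 \<noteq> 0"
  let ?M = "exp_law 1"
  interpret prob_space ?M by (rule prob_space_exp_law) simp
  have B0: "B \<ge> 0" using B[of 0] by simp
  have expm [measurable]: "(\<lambda>t. exp (- t)) \<in> borel_measurable ?M" for t :: real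
    by (auto cong: measurable_cong_sets intro!: measurable_restrict_space1)
  have gm [measurable]: "g \<in> borel_measurable ?M" using g by (simp cong: measurable_cong_sets)
  have in01: "exp (- t) \<in> {0..1}" if "t \<ge> 0" for t :: real using that by simp
  have int: "integrable ?M (\<lambda>t. \<phi> (exp (- t)) * g t)" if \<phi>: "continuous_on {0..1} \<phi>" for \<phi> :: "real \<Rightarrow> real"
  proof -
    obtain C where C: "\<And>x. x \<in> {0..1} \<Longrightarrow> \<bar>\<phi> x\<bar> \<le> C"
      using compact_continuous_image[OF \<phi> compact_Icc] compact_imp_bounded
      by (metis bounded_iff imageI real_norm_def)
    have "(\<lambda>t. \<phi> (exp (- t))) \<in> borel_measurable ?M"
      by (intro measurable_compose[OF _ borel_measurable_continuous_on_restrict[OF \<phi>]] measurable_restrict_space2)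
        (use in01 in auto)
    then show ?thesis
      using C B in01 B0 by (intro integrable_const_bound[where B="C * B"] AE_I2)
        (auto simp: abs_mult intro!: mult_mono order_trans[OF abs_ge_zero C])
  qed
  \<comment> \<open>Under the unit clock exp (-t) is uniform on [0,1]. Its i-th power shifts the
    rate from 1 to i + 1, so only rates n \<ge> 1 occur.\<close>
  have pw: "(\<integral>t. exp (- t) ^ i * g t \<partial>?M) = 0" for i
  proof -
    have "(\<integral>t. exp (- t) ^ i * g t \<partial>?M) = (LBINT t:{0..}. exp (- t) * (exp (- t) ^ i * g t))"
      using gm by (subst integral_exp_law) (auto cong: measurable_cong_sets intro!: borel_measurable_times borel_measurable_power measurable_restrict_space1)
    also have "\<dots> = (1 / real (Suc i)) * (LBINT t:{0..}. real (Suc i) * exp (- real (Suc i) * t) * g t)"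
      by (subst set_integral_mult_right[symmetric])
        (auto simp: algebra_simps exp_add exp_of_nat2_mult exp_diff exp_minus
          simp del: of_nat_Suc set_integral_mult_right intro!: set_lebesgue_integral_cong;
         simp add: field_simps exp_add)
    also have "(LBINT t:{0..}. real (Suc i) * exp (- real (Suc i) * t) * g t) = (\<integral>t. g t \<partial>exp_law (real (Suc i)))"
      using g by (subst integral_exp_law) auto
    also have "\<dots> = 0" by (rule zero) simp
    finally show ?thesis by simp
  qed
  have L: "(\<integral>t. \<phi> (exp (- t)) * g t \<partial>?M) = 0" if \<phi>: "continuous_on {0..1} \<phi>" for \<phi> :: "real \<Rightarrow> real"
  proof -
    have *: "\<bar>\<integral>t. \<phi> (exp (- t)) * g t \<partial>?M\<bar> \<le> e" if "e > 0" for e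
    proof -
      have "e / (B + 1) > 0" using \<open>e > 0\<close> B0 by simp
      then obtain p where p: "real_polynomial_function p" "\<And>x. x \<in> {0..1} \<Longrightarrow> \<bar>\<phi> x - p x\<bar> < e / (B + 1)"
        using Stone_Weierstrass_real_polynomial_function[OF compact_Icc \<phi>] by metis
      then obtain a n where p_eq: "p = (\<lambda>x. \<Sum>i\<le>n. a i * x ^ i)"
        using real_polynomial_function_iff_sum[of p] by blast
      have pc: "continuous_on {0..1} p" unfolding p_eq by (intro continuous_intros)
      have "(\<integral>t. p (exp (- t)) * g t \<partial>?M) = (\<integral>t. (\<Sum>i\<le>n. a i * (exp (- t) ^ i * g t)) \<partial>?M)"
        by (intro Bochner_Integration.integral_cong) (auto simp: p_eq sum_distrib_left mult_ac)
      also have "\<dots> = (\<Sum>i\<le>n. a i * (\<integral>t. exp (- t) ^ i * g t \<partial>?M))"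
        using int[OF continuous_on_power[OF continuous_on_id]]
        by (subst Bochner_Integration.integral_sum) (auto intro!: integrable_mult_right)
      also have "\<dots> = 0" by (simp add: pw)
      finally have p0: "(\<integral>t. p (exp (- t)) * g t \<partial>?M) = 0" .
      have "\<bar>\<integral>t. \<phi> (exp (- t)) * g t \<partial>?M\<bar> = \<bar>\<integral>t. (\<phi> (exp (- t)) * g t - p (exp (- t)) * g t) \<partial>?M\<bar>"
        by (subst Bochner_Integration.integral_diff[OF int[OF \<phi>] int[OF pc]]) (simp add: p0)
      also have "\<dots> \<le> (\<integral>t. \<bar>\<phi> (exp (- t)) * g t - p (exp (- t)) * g t\<bar> \<partial>?M)"
        by (rule integral_abs_bound)
      also have "\<dots> \<le> (\<integral>t. e \<partial>?M)"
      proof (rule integral_mono)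
        show "integrable ?M (\<lambda>t. \<bar>\<phi> (exp (- t)) * g t - p (exp (- t)) * g t\<bar>)"
          using int[OF \<phi>] int[OF pc] by (intro integrable_abs Bochner_Integration.integrable_diff)
        fix t assume "t \<in> space ?M"
        then have t: "t \<ge> 0" by simp
        have "\<bar>\<phi> (exp (- t)) * g t - p (exp (- t)) * g t\<bar> = \<bar>\<phi> (exp (- t)) - p (exp (- t))\<bar> * \<bar>g t\<bar>"
          by (simp add: abs_mult[symmetric] algebra_simps)
        also have "\<dots> \<le> e / (B + 1) * (B + 1)"
          using p(2)[OF in01[OF t]] B[OF t] B0 by (intro mult_mono) auto
        also have "\<dots> = e" using B0 by simp
        finally show "\<bar>\<phi> (exp (- t)) * g t - p (exp (- t)) * g t\<bar> \<le> e" .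
      qed simp
      finally show ?thesis using prob_space by simp
    qed
    have "\<bar>\<integral>t. \<phi> (exp (- t)) * g t \<partial>?M\<bar> \<le> 0"
      by (rule field_le_epsilon, unfold add_0, rule *)
    then show ?thesis by simp
  qed
  have "((\<lambda>t. g t * g t0) \<longlongrightarrow> g t0 * g t0) (at_right t0)"
    by (intro tendsto_intros rc \<open>t0 \<ge> 0\<close>)
  moreover have "g t0 * g t0 > 0" using \<open>g t0 \<noteq> 0\<close> by (auto simp: zero_less_mult_iff)
  ultimately have "eventually (\<lambda>t. g t * g t0 > 0) (at_right t0)" by (simp add: order_tendstoD)
  then obtain b where b: "b > t0" "\<And>t. t0 < t \<Longrightarrow> t < b \<Longrightarrow> g t * g t0 > 0"
    by (auto simp: eventually_at_right_field)
  \<comment> \<open>A continuous bump in x = exp (-t), positive exactly when t0 < t < b, where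
    \<open>g\<close> keeps the sign of \<open>g t0\<close>.\<close>
  define \<phi> where "\<phi> x = max 0 ((x - exp (- b)) * (exp (- t0) - x))" for x
  have \<phi>c: "continuous_on {0..1} \<phi>" unfolding \<phi>_def by (intro continuous_intros)
  have \<phi>pos: "\<phi> (exp (- t)) > 0" if "t0 < t" "t < b" for t
    using that by (simp add: \<phi>_def zero_less_mult_iff)
  have \<phi>zero: "\<phi> (exp (- t)) = 0" if "\<not> (t0 < t \<and> t < b)" for t
  proof -
    have "t \<le> t0 \<or> b \<le> t" using that by auto
    then have "(exp (- t) - exp (- b)) * (exp (- t0) - exp (- t)) \<le> 0"
      using b(1) by (auto simp: mult_le_0_iff)
    then show ?thesis by (simp add: \<phi>_def)
  qed
  have nn: "AE t in ?M. 0 \<le> \<phi> (exp (- t)) * g t * g t0"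
  proof (rule AE_I2)
    fix t
    show "0 \<le> \<phi> (exp (- t)) * g t * g t0"
    proof (cases "t0 < t \<and> t < b")
      case True
      then show ?thesis using \<phi>pos[of t] b(2)[of t] by (simp add: mult.assoc)
    qed (simp add: \<phi>zero)
  qed
  have "(\<integral>t. \<phi> (exp (- t)) * g t * g t0 \<partial>?M) = 0"
    using L[OF \<phi>c] by simp
  moreover have "integrable ?M (\<lambda>t. \<phi> (exp (- t)) * g t * g t0)" using int[OF \<phi>c] by simp
  ultimately have "AE t in ?M. \<phi> (exp (- t)) * g t * g t0 = 0"
    using integral_nonneg_eq_0_iff_AE[OF _ nn] by simp
  then have "AE t in ?M. \<not> (t0 < t \<and> t < b)"
    by eventually_elim (metis \<phi>pos b(2) mult.assoc mult_pos_pos less_irrefl)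
  then have "AE t in restrict_space lborel {0..}. \<not> (t0 < t \<and> t < b)"
    unfolding exp_law_def by (subst (asm) AE_density) (auto intro!: measurable_restrict_space1)
  then have "AE t in lborel. t \<in> {0..} \<longrightarrow> \<not> (t0 < t \<and> t < b)"
    by (subst (asm) AE_restrict_space_iff) auto
  then have "AE t in lborel. t \<notin> {t0<..<b}"
    by eventually_elim (use \<open>t0 \<ge> 0\<close> in auto)
  then have "emeasure lborel {t0<..<b} = 0"
    by (subst (asm) AE_iff_measurable[where N="{t0<..<b}"]) auto
  then show False using b(1) by simp
qed

section \<open>Feller semigroups and resolvents\<close>

locale feller =
  fixes P :: "real \<Rightarrow> 'w measure" and X :: "real \<Rightarrow> 'w \<Rightarrow> real"
  assumes feller: "feller_diffusion P X"
begin

abbreviation T :: "real \<Rightarrow> (real \<Rightarrow> real) \<Rightarrow> real \<Rightarrow> real" where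
  "T \<equiv> transition_op P X"

definition law :: "real \<Rightarrow> real \<Rightarrow> real measure" where
  "law x t = distr (P x) unit_borel (X t)"

lemma prob_P: "x \<in> {0..1} \<Longrightarrow> prob_space (P x)"
  using feller by (auto simp: feller_diffusion_def)

lemma X_measurable: "x \<in> {0..1} \<Longrightarrow> t \<ge> 0 \<Longrightarrow> X t \<in> measurable (P x) unit_borel"
  using feller by (auto simp: feller_diffusion_def)

lemma X_in: "x \<in> {0..1} \<Longrightarrow> t \<ge> 0 \<Longrightarrow> \<omega> \<in> space (P x) \<Longrightarrow> X t \<omega> \<in> {0..1}"
  using measurable_space[OF X_measurable] by (fastforce simp: space_restrict_space)

lemma X_path: "x \<in> {0..1} \<Longrightarrow> \<omega> \<in> space (P x) \<Longrightarrow> continuous_on {0..} (\<lambda>t. X t \<omega>)"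
  using feller by (auto simp: feller_diffusion_def)

lemma X_start: "x \<in> {0..1} \<Longrightarrow> AE \<omega> in P x. X 0 \<omega> = x"
  using feller by (auto simp: feller_diffusion_def)

lemma sets_law [simp]: "sets (law x t) = sets unit_borel"
  by (simp add: law_def)

lemma space_law [simp]: "space (law x t) = {0..1}"
  by (simp add: law_def space_restrict_space)

lemma prob_law: "x \<in> {0..1} \<Longrightarrow> t \<ge> 0 \<Longrightarrow> prob_space (law x t)"
  unfolding law_def by (intro prob_space.prob_space_distr prob_P X_measurable)

lemma T_law: "f \<in> borel_measurable unit_borel \<Longrightarrow> x \<in> {0..1} \<Longrightarrow> t \<ge> 0 \<Longrightarrow> T t f x = (\<integral>y. f y \<partial>law x t)"
  unfolding law_def transition_op_def by (subst integral_distr) (auto intro: X_measurable)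

end

lemma cont_unit_measurable: "continuous_on {0..1} f \<Longrightarrow> f \<in> borel_measurable unit_borel"
  for f :: "real \<Rightarrow> real"
  by (rule borel_measurable_continuous_on_restrict)

lemma cont_unit_bounded:
  fixes f :: "real \<Rightarrow> real"
  assumes "continuous_on {0..1} f"
  obtains B where "B > 0" "\<And>x. x \<in> {0..1} \<Longrightarrow> \<bar>f x\<bar> \<le> B"
proof -
  have "bounded (f ` {0..1})"
    using assms by (intro compact_imp_bounded compact_continuous_image) auto
  then show ?thesis using that by (auto simp: bounded_pos)
qed

lemma cont_unit_bounded_measurable: "continuous_on {0..1} f \<Longrightarrow> f \<in> bounded_measurable_unit"
  unfolding bounded_measurable_unit_def
  by (auto intro: cont_unit_measurable compact_imp_bounded compact_continuous_image)

lemma integrable_prob_unit: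
  fixes f :: "real \<Rightarrow> real"
  assumes "prob_space \<mu>" "sets \<mu> = sets unit_borel" "f \<in> borel_measurable unit_borel"
    "\<And>x. x \<in> {0..1} \<Longrightarrow> \<bar>f x\<bar> \<le> B"
  shows "integrable \<mu> f"
proof -
  interpret prob_space \<mu> by fact
  have "space \<mu> = {0..1}" using sets_eq_imp_space_eq[OF assms(2)] by (simp add: space_restrict_space)
  then show ?thesis
    using assms by (intro integrable_const_bound[where B=B]) (auto cong: measurable_cong_sets)
qed

lemma integrable_cont_prob_unit:
  fixes f :: "real \<Rightarrow> real"
  assumes "prob_space \<mu>" "sets \<mu> = sets unit_borel" "continuous_on {0..1} f"
  shows "integrable \<mu> f"
proof -
  obtain B where "\<And>x. x \<in> {0..1} \<Longrightarrow> \<bar>f x\<bar> \<le> B" using cont_unit_bounded[OF assms(3)] by blast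
  then show ?thesis using assms by (intro integrable_prob_unit cont_unit_measurable)
qed

lemma prob_unit_integral_abs_le:
  fixes f :: "real \<Rightarrow> real"
  assumes "prob_space \<mu>" "sets \<mu> = sets unit_borel" "f \<in> borel_measurable unit_borel"
    "\<And>x. x \<in> {0..1} \<Longrightarrow> \<bar>f x\<bar> \<le> B"
  shows "\<bar>\<integral>x. f x \<partial>\<mu>\<bar> \<le> B"
proof -
  interpret prob_space \<mu> by fact
  have sp: "space \<mu> = {0..1}" using sets_eq_imp_space_eq[OF assms(2)] by (simp add: space_restrict_space)
  have "\<bar>\<integral>x. f x \<partial>\<mu>\<bar> \<le> (\<integral>x. \<bar>f x\<bar> \<partial>\<mu>)" by (rule integral_abs_bound)
  also have "\<dots> \<le> (\<integral>x. B \<partial>\<mu>)"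
    using integrable_prob_unit[OF assms] assms(4) sp by (intro integral_mono) auto
  finally show ?thesis by (simp add: prob_space)
qed

section \<open>Strong continuity, the Markov property and resolvents\<close>

context feller begin

lemma T_cont: "continuous_on {0..1} f \<Longrightarrow> t \<ge> 0 \<Longrightarrow> continuous_on {0..1} (T t f)"
  using feller by (auto simp: feller_diffusion_def)

lemma T_0:
  assumes "f \<in> borel_measurable unit_borel" "x \<in> {0..1}"
  shows "T 0 f x = f x"
proof -
  interpret prob_space "P x" by (rule prob_P) fact
  have "T 0 f x = (\<integral>\<omega>. f x \<partial>P x)"
    unfolding transition_op_def
    using X_start[OF assms(2)] measurable_compose[OF X_measurable[OF assms(2), of 0] assms(1)]
    by (intro integral_cong_AE) (auto elim: eventually_mono)
  then show ?thesis by (simp add: prob_space)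
qed

lemma T_uniform:
  assumes f: "continuous_on {0..1} f" and "e > 0"
  shows "\<exists>d>0. \<forall>t\<in>{0..<d}. \<forall>x\<in>{0..1}. \<bar>T t f x - f x\<bar> < e"
proof -
  have "uniform_limit {0..1} (\<lambda>t. T t f) f (at_right 0)"
    using feller f by (auto simp: feller_diffusion_def)
  then have "eventually (\<lambda>t. \<forall>x\<in>{0..1}. dist (T t f x) (f x) < e) (at_right 0)"
    using \<open>e > 0\<close> by (rule uniform_limitD)
  then obtain d where d: "d > 0" "\<And>t. 0 < t \<Longrightarrow> t < d \<Longrightarrow> \<forall>x\<in>{0..1}. dist (T t f x) (f x) < e"
    by (auto simp: eventually_at_right_field)
  show ?thesis
  proof (intro exI[of _ d] conjI ballI)
    fix t x :: real assume "t \<in> {0..<d}" "x \<in> {0..1}"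
    then show "\<bar>T t f x - f x\<bar> < e"
      using d(2)[of t] T_0[OF cont_unit_measurable[OF f], of x] \<open>e > 0\<close>
      by (cases "t = 0") (auto simp: dist_real_def)
  qed (fact d(1))
qed

lemma T_abs_le:
  assumes "f \<in> borel_measurable unit_borel" "x \<in> {0..1}" "t \<ge> 0" "\<And>y. y \<in> {0..1} \<Longrightarrow> \<bar>f y\<bar> \<le> B"
  shows "\<bar>T t f x\<bar> \<le> B"
  unfolding T_law[OF assms(1-3)] using assms by (intro prob_unit_integral_abs_le prob_law) auto

lemma T_diff:
  assumes "continuous_on {0..1} f" "continuous_on {0..1} g" "x \<in> {0..1}" "t \<ge> 0"
  shows "T t (\<lambda>y. f y - g y) x = T t f x - T t g x"
  using assms by (simp add: T_law cont_unit_measurable continuous_on_diff integrable_cont_prob_unit[OF prob_law])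

lemma T_nonneg:
  assumes "\<And>y. y \<in> {0..1} \<Longrightarrow> 0 \<le> f y" "x \<in> {0..1}" "t \<ge> 0"
  shows "0 \<le> T t f x"
  unfolding transition_op_def using assms X_in by (intro integral_nonneg_AE AE_I2) auto

lemma subalgebra_past:
  assumes "x \<in> {0..1}" "s \<ge> 0"
  shows "subalgebra (P x) (past (P x) X s)"
proof -
  have "{X u -` B \<inter> space (P x) | u B. 0 \<le> u \<and> u \<le> s \<and> B \<in> sets unit_borel} \<subseteq> sets (P x)"
    using X_measurable[OF assms(1)] by (auto intro: measurable_sets)
  moreover have "{X u -` B \<inter> space (P x) | u B. 0 \<le> u \<and> u \<le> s \<and> B \<in> sets unit_borel} \<subseteq> Pow (space (P x))"
    by auto
  ultimately show ?thesis unfolding subalgebra_def past_def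
    by (auto simp: space_measure_of sets_measure_of dest: sets.sigma_sets_subset)
qed

lemma past_vimage:
  assumes "0 \<le> u" "u \<le> s" "B \<in> sets unit_borel"
  shows "X u -` B \<inter> space (P x) \<in> sets (past (P x) X s)"
  unfolding past_def using assms by (subst sets_measure_of) auto

lemma space_past [simp]: "space (past (P x) X s) = space (P x)"
proof -
  have "{X u -` B \<inter> space (P x) | u B. 0 \<le> u \<and> u \<le> s \<and> B \<in> sets unit_borel} \<subseteq> Pow (space (P x))"
    by auto
  then show ?thesis unfolding past_def by (rule space_measure_of)
qed

text \<open>The conditional expectation tested against an event of the past. This integrated form
  yields both the semigroup property and the supermartingale inequality along a time grid.\<close>

lemma markov:
  assumes x: "x \<in> {0..1}" and s: "s \<ge> 0" and t: "t \<ge> 0" and f: "continuous_on {0..1} f"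
    and B: "B \<in> sets (past (P x) X s)"
  shows "(\<integral>\<omega>. indicator B \<omega> * f (X (s + t) \<omega>) \<partial>P x) = (\<integral>\<omega>. indicator B \<omega> * T t f (X s \<omega>) \<partial>P x)"
proof -
  interpret prob_space "P x" by (rule prob_P) fact
  interpret F: sigma_finite_subalgebra "P x" "past (P x) X s"
    by (intro finite_measure_subalgebra_is_sigma_finite finite_measure_subalgebra.intro
        finite_measure_axioms finite_measure_subalgebra_axioms.intro subalgebra_past x s)
  have BM: "B \<in> sets (P x)" using B subalgebra_past[OF x s] by (auto simp: subalgebra_def)
  have Xm: "(\<lambda>\<omega>. f (X u \<omega>)) \<in> borel_measurable (P x)" if "continuous_on {0..1} f" "u \<ge> 0" for u and f :: "real \<Rightarrow> real"
    using measurable_compose[OF X_measurable[OF x that(2)] cont_unit_measurable[OF that(1)]] .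
  obtain C where C: "C > 0" "\<And>x. x \<in> {0..1} \<Longrightarrow> \<bar>f x\<bar> \<le> C" using cont_unit_bounded[OF f] by blast
  have "integrable (P x) (\<lambda>\<omega>. indicator B \<omega> * f (X (s + t) \<omega>))"
    using C X_in[OF x, of "s + t"] s t BM Xm[OF f, of "s + t"]
    by (intro integrable_const_bound[where B=C] AE_I2) (auto split: split_indicator)
  from F.real_cond_exp_intg(2)[OF this _ Xm[OF f]]
  have "(\<integral>\<omega>. indicator B \<omega> * real_cond_exp (P x) (past (P x) X s) (\<lambda>\<omega>. f (X (s + t) \<omega>)) \<omega> \<partial>P x)
      = (\<integral>\<omega>. indicator B \<omega> * f (X (s + t) \<omega>) \<partial>P x)"
    using B s t by simp
  moreover have "AE \<omega> in P x. real_cond_exp (P x) (past (P x) X s) (\<lambda>\<omega>. f (X (s + t) \<omega>)) \<omega> = T t f (X s \<omega>)"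
    using feller x s t cont_unit_bounded_measurable[OF f] by (auto simp: feller_diffusion_def)
  then have "(\<integral>\<omega>. indicator B \<omega> * real_cond_exp (P x) (past (P x) X s) (\<lambda>\<omega>. f (X (s + t) \<omega>)) \<omega> \<partial>P x)
     = (\<integral>\<omega>. indicator B \<omega> * T t f (X s \<omega>) \<partial>P x)"
    using Xm[OF T_cont[OF f t] s] BM by (intro integral_cong_AE) (auto elim: eventually_mono)
  ultimately show ?thesis by simp
qed

lemma T_semigroup:
  assumes x: "x \<in> {0..1}" and s: "s \<ge> 0" and t: "t \<ge> 0" and f: "continuous_on {0..1} f"
  shows "T s (T t f) x = T (s + t) f x"
proof -
  have "space (P x) \<in> sets (past (P x) X s)" by (metis sets.top space_past)
  from markov[OF x s t f this] show ?thesis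
    unfolding transition_op_def[of P X s] transition_op_def[of P X "s + t"]
    by (auto cong: Bochner_Integration.integral_cong)
qed

text \<open>By contraction, \<open>T t f - T s f\<close> = \<open>T s (T (t - s) f - f)\<close> is
  no larger than the increment from time 0 to t - s, so continuity at 0 is uniform over all
  times.\<close>

lemma T_uniform_time:
  assumes f: "continuous_on {0..1} f" and "e > 0"
  obtains d where "d > 0" "\<And>s t x. s \<ge> 0 \<Longrightarrow> t \<ge> 0 \<Longrightarrow> \<bar>s - t\<bar> < d \<Longrightarrow> x \<in> {0..1} \<Longrightarrow> \<bar>T s f x - T t f x\<bar> \<le> e"
proof -
  obtain d where d: "d > 0" "\<And>t x. t \<in> {0..<d} \<Longrightarrow> x \<in> {0..1} \<Longrightarrow> \<bar>T t f x - f x\<bar> < e"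
    using T_uniform[OF assms] by blast
  have *: "\<bar>T t f x - T s f x\<bar> \<le> e" if "0 \<le> s" "s \<le> t" "t - s < d" "x \<in> {0..1}" for s t x
  proof -
    have "T t f x - T s f x = T s (T (t - s) f) x - T s f x"
      using that T_semigroup[of x s "t - s" f] f by simp
    also have "\<dots> = T s (\<lambda>y. T (t - s) f y - f y) x"
      using that f by (subst T_diff) (auto intro!: T_cont)
    finally have "\<bar>T t f x - T s f x\<bar> = \<bar>T s (\<lambda>y. T (t - s) f y - f y) x\<bar>" by simp
    also have "\<dots> \<le> e"
      using that f d(2)[of "t - s"]
      by (intro T_abs_le cont_unit_measurable continuous_intros T_cont) (auto intro: less_imp_le)
    finally show ?thesis .
  qed
  show ?thesis
  proof (rule that[OF d(1)])
    fix s t x :: real assume a: "s \<ge> 0" "t \<ge> 0" "\<bar>s - t\<bar> < d" "x \<in> {0..1}"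
    then show "\<bar>T s f x - T t f x\<bar> \<le> e"
      using *[of s t x] *[of t s x] by (cases "s \<le> t") (auto simp: abs_minus_commute)
  qed
qed

text \<open>Supplies the product measurability behind every exchange of the exponential clock with a
  spatial integral.\<close>

lemma T_jointly_continuous:
  assumes f: "continuous_on {0..1} f"
  shows "continuous_on ({0..} \<times> {0..1}) (\<lambda>(t, x). T t f x)"
proof (rule continuous_onI)
  fix p :: "real \<times> real" and e :: real
  assume p: "p \<in> {0..} \<times> {0..1}" and "e > 0"
  obtain t x where tx: "p = (t, x)" by (cases p)
  have t: "t \<ge> 0" and x: "x \<in> {0..1}" using p tx by auto
  obtain d1 where d1: "d1 > 0" "\<And>s t x. s \<ge> 0 \<Longrightarrow> t \<ge> 0 \<Longrightarrow> \<bar>s - t\<bar> < d1 \<Longrightarrow> x \<in> {0..1} \<Longrightarrow> \<bar>T s f x - T t f x\<bar> \<le> e / 2"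
    using T_uniform_time[OF f, of "e/2"] \<open>e > 0\<close> by auto
  obtain d2 where d2: "d2 > 0" "\<And>y. y \<in> {0..1} \<Longrightarrow> dist y x < d2 \<Longrightarrow> dist (T t f y) (T t f x) < e / 2"
    using T_cont[OF f t] x \<open>e > 0\<close> unfolding continuous_on_iff by (metis half_gt_zero)
  show "\<exists>d>0. \<forall>q\<in>{0..} \<times> {0..1}. dist q p < d \<longrightarrow> dist (case q of (t, x) \<Rightarrow> T t f x) (case p of (t, x) \<Rightarrow> T t f x) \<le> e"
  proof (intro exI[of _ "min d1 d2"] conjI ballI impI)
    fix q :: "real \<times> real" assume q: "q \<in> {0..} \<times> {0..1}" "dist q p < min d1 d2"
    obtain s y where sy: "q = (s, y)" by (cases q)
    have "dist s t < d1" "dist y x < d2"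
      using q(2) dist_fst_le[of q p] dist_snd_le[of q p] by (auto simp: sy tx)
    then have "\<bar>T s f y - T t f y\<bar> \<le> e / 2" "\<bar>T t f y - T t f x\<bar> < e / 2"
      using d1(2)[of s t y] d2(2)[of y] q(1) t by (auto simp: sy dist_real_def)
    then show "dist (case q of (t, x) \<Rightarrow> T t f x) (case p of (t, x) \<Rightarrow> T t f x) \<le> e"
      unfolding sy tx dist_real_def prod.case by linarith
  qed (use d1 d2 in simp)
qed

lemma T_cont_time:
  assumes "continuous_on {0..1} f" "x \<in> {0..1}"
  shows "continuous_on {0..} (\<lambda>t. T t f x)"
proof -
  have a: "continuous_on {0..} (\<lambda>t. (t, x))" by (intro continuous_intros)
  have b: "(\<lambda>t. (t, x)) ` {0..} \<subseteq> {0..} \<times> {0..1}" using assms(2) by auto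
  show ?thesis
    using continuous_on_compose2[OF T_jointly_continuous[OF assms(1)] a b] by (simp only: prod.case)
qed

lemma T_time_measurable:
  "continuous_on {0..1} f \<Longrightarrow> x \<in> {0..1} \<Longrightarrow> (\<lambda>t. T t f x) \<in> borel_measurable (restrict_space borel {0..})"
  by (intro borel_measurable_continuous_on_restrict T_cont_time)

text \<open>\<open>avg \<theta>\<close> is \<open>\<theta>\<close> times the resolvent at \<open>\<theta>\<close>.\<close>

definition avg :: "real \<Rightarrow> (real \<Rightarrow> real) \<Rightarrow> real \<Rightarrow> real" where
  "avg \<theta> f x = (\<integral>t. T t f x \<partial>exp_law \<theta>)"

lemma T_joint_measurable:
  assumes f: "continuous_on {0..1} f" and \<mu>: "sets \<mu> = sets unit_borel"
  shows "(\<lambda>(t, y). T t f y) \<in> borel_measurable (exp_law \<theta> \<Otimes>\<^sub>M \<mu>)"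
proof -
  have sp: "space (exp_law \<theta> \<Otimes>\<^sub>M \<mu>) = {0..} \<times> {0..1}"
    using sets_eq_imp_space_eq[OF \<mu>] by (simp add: space_pair_measure space_restrict_space)
  have "(\<lambda>p. (fst p, snd p)) \<in> measurable (exp_law \<theta> \<Otimes>\<^sub>M \<mu>) (borel \<Otimes>\<^sub>M borel)"
  proof (rule measurable_Pair)
    show "fst \<in> borel_measurable (exp_law \<theta> \<Otimes>\<^sub>M \<mu>)"
      by (rule measurable_compose[OF measurable_fst, of "\<lambda>x. x", simplified])
        (auto cong: measurable_cong_sets intro!: measurable_restrict_space1)
    show "snd \<in> borel_measurable (exp_law \<theta> \<Otimes>\<^sub>M \<mu>)"
      by (rule measurable_compose[OF measurable_snd, of "\<lambda>x. x", simplified])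
        (auto simp: \<mu> cong: measurable_cong_sets intro!: measurable_restrict_space1)
  qed
  then have "(\<lambda>p. p) \<in> measurable (exp_law \<theta> \<Otimes>\<^sub>M \<mu>) (restrict_space borel ({0..} \<times> {0..1}))"
    by (intro measurable_restrict_space2) (auto simp: sp borel_prod)
  from measurable_compose[OF this borel_measurable_continuous_on_restrict[OF T_jointly_continuous[OF f]]]
  show ?thesis .
qed

lemma T_avg_fubini:
  assumes f: "continuous_on {0..1} f" and "\<theta> > 0" and \<mu>: "prob_space \<mu>" "sets \<mu> = sets unit_borel"
  shows "(\<integral>y. avg \<theta> f y \<partial>\<mu>) = (\<integral>t. (\<integral>y. T t f y \<partial>\<mu>) \<partial>exp_law \<theta>)"
proof -
  interpret E: prob_space "exp_law \<theta>" by (rule prob_space_exp_law) fact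
  interpret M: prob_space \<mu> by fact
  interpret pair_prob_space "exp_law \<theta>" \<mu> ..
  obtain B where B: "B > 0" "\<And>x. x \<in> {0..1} \<Longrightarrow> \<bar>f x\<bar> \<le> B" using cont_unit_bounded[OF f] by blast
  have sp: "space (exp_law \<theta> \<Otimes>\<^sub>M \<mu>) = {0..} \<times> {0..1}"
    using sets_eq_imp_space_eq[OF \<mu>(2)] by (simp add: space_pair_measure space_restrict_space)
  have "integrable (exp_law \<theta> \<Otimes>\<^sub>M \<mu>) (\<lambda>(t, y). T t f y)"
    using T_joint_measurable[OF f \<mu>(2)] T_abs_le[OF cont_unit_measurable[OF f] _ _ B(2)]
    by (intro integrable_const_bound[where B=B] AE_I2) (auto simp: sp)
  from Fubini_integral[OF this] show ?thesis by (simp add: avg_def)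
qed

lemma avg_abs_le:
  assumes f: "continuous_on {0..1} f" and "\<theta> > 0" and x: "x \<in> {0..1}" and B: "\<And>y. y \<in> {0..1} \<Longrightarrow> \<bar>f y\<bar> \<le> B"
  shows "\<bar>avg \<theta> f x\<bar> \<le> B"
proof -
  interpret prob_space "exp_law \<theta>" by (rule prob_space_exp_law) fact
  have int: "integrable (exp_law \<theta>) (\<lambda>t. T t f x)"
    by (rule integrable_exp_law_bounded[OF \<open>\<theta> > 0\<close> T_time_measurable[OF f x]])
      (rule T_abs_le[OF cont_unit_measurable[OF f] x _ B])
  have "\<bar>avg \<theta> f x\<bar> \<le> (\<integral>t. \<bar>T t f x\<bar> \<partial>exp_law \<theta>)" unfolding avg_def by (rule integral_abs_bound)
  also have "\<dots> \<le> (\<integral>t. B \<partial>exp_law \<theta>)"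
    using int T_abs_le[OF cont_unit_measurable[OF f] x _ B] by (intro integral_mono) auto
  finally show ?thesis using prob_space by simp
qed

lemma avg_cont:
  assumes f: "continuous_on {0..1} f" and "\<theta> > 0"
  shows "continuous_on {0..1} (avg \<theta> f)"
  unfolding continuous_on_sequentially
proof (intro allI ballI impI, elim conjE)
  fix u :: "nat \<Rightarrow> real" and x :: real
  assume u: "x \<in> {0..1}" "\<forall>n. u n \<in> {0..1}" "u \<longlonglongrightarrow> x"
  interpret prob_space "exp_law \<theta>" by (rule prob_space_exp_law) fact
  obtain B where B: "B > 0" "\<And>x. x \<in> {0..1} \<Longrightarrow> \<bar>f x\<bar> \<le> B" using cont_unit_bounded[OF f] by blast
  have m: "(\<lambda>t. T t f y) \<in> borel_measurable (exp_law \<theta>)" if "y \<in> {0..1}" for y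
    using T_time_measurable[OF f that] by (simp cong: measurable_cong_sets)
  have "(\<lambda>n. \<integral>t. T t f (u n) \<partial>exp_law \<theta>) \<longlonglongrightarrow> (\<integral>t. T t f x \<partial>exp_law \<theta>)"
  proof (rule integral_dominated_convergence[where w="\<lambda>_. B"])
    show "AE t in exp_law \<theta>. (\<lambda>n. T t f (u n)) \<longlonglongrightarrow> T t f x"
    proof (rule AE_I2)
      fix t assume "t \<in> space (exp_law \<theta>)"
      then have "continuous_on {0..1} (T t f)" using f by (intro T_cont) auto
      then show "(\<lambda>n. T t f (u n)) \<longlonglongrightarrow> T t f x"
        using u unfolding continuous_on_sequentially o_def by blast
    qed
    show "AE t in exp_law \<theta>. norm (T t f (u n)) \<le> B" for n
      using T_abs_le[OF cont_unit_measurable[OF f] _ _ B(2), of "u n"] u(2) by (intro AE_I2) auto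
  qed (use u m in auto)
  then show "(avg \<theta> f \<circ> u) \<longlonglongrightarrow> avg \<theta> f x" by (simp add: avg_def o_def)
qed

lemma T_avg:
  assumes f: "continuous_on {0..1} f" and \<theta>: "\<theta> > 0" and x: "x \<in> {0..1}" and h: "h \<ge> 0"
  shows "T h (avg \<theta> f) x = (\<integral>t. T (t + h) f x \<partial>exp_law \<theta>)"
proof -
  have "T h (avg \<theta> f) x = (\<integral>y. avg \<theta> f y \<partial>law x h)"
    by (intro T_law x h cont_unit_measurable avg_cont f \<theta>)
  also have "\<dots> = (\<integral>t. (\<integral>y. T t f y \<partial>law x h) \<partial>exp_law \<theta>)"
    by (intro T_avg_fubini f \<theta> prob_law x h sets_law)
  also have "\<dots> = (\<integral>t. T (t + h) f x \<partial>exp_law \<theta>)"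
  proof (rule Bochner_Integration.integral_cong[OF refl])
    fix t assume "t \<in> space (exp_law \<theta>)"
    then have t: "t \<ge> 0" by simp
    have "(\<integral>y. T t f y \<partial>law x h) = T h (T t f) x"
      by (intro T_law[symmetric] x h cont_unit_measurable T_cont f t)
    then show "(\<integral>y. T t f y \<partial>law x h) = T (t + h) f x"
      using T_semigroup[OF x h t f] by (simp add: add.commute)
  qed
  finally show ?thesis .
qed

lemma avg_shift:
  assumes f: "continuous_on {0..1} f" and \<theta>: "\<theta> > 0" and x: "x \<in> {0..1}" and h: "h \<ge> 0"
  shows "exp (- \<theta> * h) * T h (avg \<theta> f) x + (LBINT t:{0..<h}. \<theta> * exp (- \<theta> * t) * T t f x) = avg \<theta> f x"
proof -
  obtain B where B: "B > 0" "\<And>x. x \<in> {0..1} \<Longrightarrow> \<bar>f x\<bar> \<le> B" using cont_unit_bounded[OF f] by blast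
  show ?thesis
    unfolding T_avg[OF assms] avg_def
    by (rule exp_law_shift[OF \<theta> h T_time_measurable[OF f x]])
      (rule T_abs_le[OF cont_unit_measurable[OF f] x _ B(2)])
qed

text \<open>The generator domain asks for uniform convergence of the difference quotients, so the
  limit suggested by \<open>avg_shift\<close> is estimated uniformly in x.\<close>

lemma avg_generator_uniform:
  assumes f: "continuous_on {0..1} f" and \<theta>: "\<theta> > 0"
  shows "uniform_limit {0..1} (\<lambda>h x. (T h (avg \<theta> f) x - avg \<theta> f x) / h)
    (\<lambda>x. \<theta> * (avg \<theta> f x - f x)) (at_right 0)"
proof (rule uniform_limitI)
  fix e :: real assume "e > 0"
  obtain B where B: "B > 0" "\<And>x. x \<in> {0..1} \<Longrightarrow> \<bar>f x\<bar> \<le> B" using cont_unit_bounded[OF f] by blast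
  define R where "R = avg \<theta> f"
  have Rc: "continuous_on {0..1} R" unfolding R_def by (rule avg_cont) fact+
  have RB: "\<bar>R x\<bar> \<le> B" if "x \<in> {0..1}" for x unfolding R_def by (rule avg_abs_le) (use f \<theta> that B in auto)
  have TRB: "\<bar>T h R x\<bar> \<le> B" if "x \<in> {0..1}" "h \<ge> 0" for h x
    using T_abs_le[OF cont_unit_measurable[OF Rc] that RB] .
  \<comment> \<open>Error budget: e/5 for the derivative of the exponential, e/5 for
    \<open>T h R - R\<close>, and 2e/5 for the mean of \<theta> exp (-\<theta> t)
    \<open>T t f x\<close> over {0..<h}. The total 4e/5 stays below e.\<close>
  define e1 where "e1 = e / (5 * \<theta>)"
  have "e1 > 0" using \<open>e > 0\<close> \<theta> by (simp add: e1_def)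
  obtain d1 where d1: "d1 > 0" "\<And>t x. t \<in> {0..<d1} \<Longrightarrow> x \<in> {0..1} \<Longrightarrow> \<bar>T t f x - f x\<bar> < e1"
    using T_uniform[OF f \<open>e1 > 0\<close>] by blast
  obtain d2 where d2: "d2 > 0" "\<And>t x. t \<in> {0..<d2} \<Longrightarrow> x \<in> {0..1} \<Longrightarrow> \<bar>T t R x - R x\<bar> < e1"
    using T_uniform[OF Rc \<open>e1 > 0\<close>] by blast
  have "((\<lambda>h. exp (- \<theta> * h)) has_real_derivative - \<theta>) (at 0)"
    by (auto intro!: derivative_eq_intros)
  then have "((\<lambda>h. (exp (- \<theta> * h) - exp (- \<theta> * 0)) / (h - 0)) \<longlongrightarrow> - \<theta>) (at 0)"
    by (simp only: has_field_derivative_iff)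
  then have "((\<lambda>h. (exp (- \<theta> * h) - 1) / h) \<longlongrightarrow> - \<theta>) (at_right 0)"
    by (simp add: filterlim_at_split)
  then have "eventually (\<lambda>h. dist ((exp (- \<theta> * h) - 1) / h) (- \<theta>) < e / (5 * B)) (at_right 0)"
    using \<open>e > 0\<close> B(1) by (intro tendstoD) auto
  moreover have "((\<lambda>h. exp (- \<theta> * h)) \<longlongrightarrow> exp (- \<theta> * 0)) (at_right 0)" by (intro tendsto_intros)
  then have "eventually (\<lambda>h. dist (exp (- \<theta> * h)) 1 < e1 / B) (at_right 0)"
    using \<open>e1 > 0\<close> B(1) by (intro tendstoD) auto
  moreover have "eventually (\<lambda>h. h < min d1 d2) (at_right (0::real))"
    using d1(1) d2(1) by (intro eventually_at_rightI[of 0 "min d1 d2"]) auto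
  moreover have "eventually (\<lambda>h. h > 0) (at_right (0::real))" by (simp add: eventually_at_right_less)
  ultimately show "eventually (\<lambda>h. \<forall>x\<in>{0..1}. dist ((T h (avg \<theta> f) x - avg \<theta> f x) / h) (\<theta> * (avg \<theta> f x - f x)) < e) (at_right 0)"
  proof eventually_elim
    case (elim h)
    show ?case
    proof
      fix x :: real assume x: "x \<in> {0..1}"
      let ?I = "LBINT t:{0..<h}. \<theta> * exp (- \<theta> * t) * T t f x"
      have eq: "(T h R x - R x) / h - \<theta> * (R x - f x)
         = - ((exp (- \<theta> * h) - 1) / h + \<theta>) * T h R x + \<theta> * (T h R x - R x) - (?I - h * (\<theta> * f x)) / h"
      proof -
        have "?I = R x - exp (- \<theta> * h) * T h R x"
          using avg_shift[OF f \<theta> x, of h] elim unfolding R_def by linarith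
        then show ?thesis using elim by (simp only:) (simp add: field_simps)
      qed
      have a: "\<bar>((exp (- \<theta> * h) - 1) / h + \<theta>) * T h R x\<bar> \<le> e / 5"
      proof -
        have "\<bar>(exp (- \<theta> * h) - 1) / h + \<theta>\<bar> * \<bar>T h R x\<bar> \<le> e / (5 * B) * B"
          using elim TRB[OF x, of h] \<open>e > 0\<close> B(1) by (intro mult_mono) (auto simp: dist_real_def)
        then show ?thesis using B(1) by (simp add: abs_mult)
      qed
      have b: "\<bar>\<theta> * (T h R x - R x)\<bar> \<le> e / 5"
      proof -
        have "\<theta> * \<bar>T h R x - R x\<bar> \<le> \<theta> * e1"
          using d2(2)[of h x] elim x \<theta> by (intro mult_left_mono) auto
        then show ?thesis using \<theta> by (simp add: abs_mult e1_def)
      qed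
      have cint: "set_integrable lborel {0..<h} (\<lambda>t. \<theta> * exp (- \<theta> * t) * T t f x)"
        using set_integrable_exp_bounded[OF \<theta> T_time_measurable[OF f x] T_abs_le[OF cont_unit_measurable[OF f] x _ B(2)]]
        by (rule set_integrable_subset) auto
      have c0: "set_integrable lborel {0..<h} (\<lambda>t. c)" for c :: real
        using elim by (auto simp: set_integrable_def emeasure_lborel_Ico intro!: integrable_real_indicator disjI2)
      have "h * (\<theta> * f x) = (LBINT t:{0..<h}. \<theta> * f x)"
        using elim by (simp add: set_lebesgue_integral_def)
      then have "\<bar>?I - h * (\<theta> * f x)\<bar> = \<bar>LBINT t:{0..<h}. \<theta> * exp (- \<theta> * t) * T t f x - \<theta> * f x\<bar>"
        using set_integral_diff(2)[OF cint c0, of "\<theta> * f x"] by (simp only:)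
      also have "\<dots> \<le> (LBINT t:{0..<h}. \<bar>\<theta> * exp (- \<theta> * t) * T t f x - \<theta> * f x\<bar>)"
        using set_integral_norm_bound[OF set_integral_diff(1)[OF cint c0]] by simp
      also have "\<dots> \<le> (LBINT t:{0..<h}. 2 * e / 5)"
      proof (rule set_integral_mono)
        show "set_integrable lborel {0..<h} (\<lambda>t. \<bar>\<theta> * exp (- \<theta> * t) * T t f x - \<theta> * f x\<bar>)"
          by (intro set_integrable_abs set_integral_diff(1)[OF cint c0])
        fix t assume t: "t \<in> {0..<h}"
        have "exp (- \<theta> * h) \<le> exp (- \<theta> * t)" "exp (- \<theta> * t) \<le> 1" using t \<theta> by auto
        moreover have "\<bar>exp (- \<theta> * h) - 1\<bar> < e1 / B" using elim by (simp only: dist_real_def)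
        ultimately have "\<bar>exp (- \<theta> * t) - 1\<bar> \<le> e1 / B" by linarith
        then have "\<bar>(exp (- \<theta> * t) - 1) * T t f x\<bar> \<le> e1 / B * B"
          unfolding abs_mult using T_abs_le[OF cont_unit_measurable[OF f] x _ B(2), of t] t B(1) \<open>e1 > 0\<close>
          by (intro mult_mono) auto
        then have "\<bar>(exp (- \<theta> * t) - 1) * T t f x + (T t f x - f x)\<bar> \<le> e1 + e1"
          using d1(2)[of t x] t elim x B(1) by (intro order_trans[OF abs_triangle_ineq add_mono]) auto
        then have "\<theta> * \<bar>(exp (- \<theta> * t) - 1) * T t f x + (T t f x - f x)\<bar> \<le> \<theta> * (e1 + e1)"
          using \<theta> by (intro mult_left_mono) auto
        moreover have "\<theta> * exp (- \<theta> * t) * T t f x - \<theta> * f x = \<theta> * ((exp (- \<theta> * t) - 1) * T t f x + (T t f x - f x))"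
          by (simp add: algebra_simps)
        ultimately show "\<bar>\<theta> * exp (- \<theta> * t) * T t f x - \<theta> * f x\<bar> \<le> 2 * e / 5"
          using \<theta> by (simp add: abs_mult e1_def)
      qed (rule c0)
      also have "\<dots> = h * (2 * e / 5)" using elim by (simp add: set_lebesgue_integral_def)
      finally have c: "\<bar>(?I - h * (\<theta> * f x)) / h\<bar> \<le> 2 * e / 5"
        using elim by (simp add: field_simps)
      have "\<bar>(T h R x - R x) / h - \<theta> * (R x - f x)\<bar> < e"
        unfolding eq using a b c \<open>e > 0\<close> by linarith
      then show "dist ((T h (avg \<theta> f) x - avg \<theta> f x) / h) (\<theta> * (avg \<theta> f x - f x)) < e"
        by (simp add: dist_real_def R_def)
    qed
  qed
qed

lemma generator_avg:
  assumes "continuous_on {0..1} f" "\<theta> > 0" "x \<in> {0..1}"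
  shows "generator P X (avg \<theta> f) x = \<theta> * (avg \<theta> f x - f x)"
  unfolding generator_def
  by (intro tendsto_Lim trivial_limit_at_right_real tendsto_uniform_limitI[OF avg_generator_uniform]) (use assms in auto)

lemma avg_in_domain:
  assumes f: "continuous_on {0..1} f" and \<theta>: "\<theta> > 0"
  shows "avg \<theta> f \<in> generator_domain P X"
proof -
  have "continuous_on {0..1} (generator P X (avg \<theta> f)) \<longleftrightarrow> continuous_on {0..1} (\<lambda>x. \<theta> * (avg \<theta> f x - f x))"
    by (intro continuous_on_cong generator_avg assms refl)
  moreover have "uniform_limit {0..1} (\<lambda>h x. (T h (avg \<theta> f) x - avg \<theta> f x) / h) (generator P X (avg \<theta> f)) (at_right 0)"
    using avg_generator_uniform[OF assms] generator_avg[OF assms]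
    by (subst uniform_limit_cong'[where g="\<lambda>h x. (T h (avg \<theta> f) x - avg \<theta> f x) / h"
          and i="\<lambda>x. \<theta> * (avg \<theta> f x - f x)"]) auto
  ultimately show ?thesis
    using avg_cont[OF assms] f by (auto simp: generator_domain_def intro!: continuous_intros)
qed

text \<open>Where z attains its maximum the averages \<open>T t z\<close> cannot exceed z, so the
  generator there is at most 0. Assuming a pointwise limit only, the lemma applies to differences of
  domain elements without showing that these lie in the domain.\<close>

lemma positive_maximum_le:
  assumes z: "continuous_on {0..1} z" and \<theta>: "\<theta> > 0"
    and gen: "\<And>x. x \<in> {0..1} \<Longrightarrow> ((\<lambda>t. (T t z x - z x) / t) \<longlongrightarrow> \<theta> * z x) (at_right 0)"
    and x: "x \<in> {0..1}"
  shows "z x \<le> 0"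
proof -
  obtain y where y: "y \<in> {0..1}" "\<And>x. x \<in> {0..1} \<Longrightarrow> z x \<le> z y"
    using continuous_attains_sup[OF compact_Icc _ z] by auto
  have "T t z y - z y \<le> 0" if "t \<ge> 0" for t
  proof -
    interpret prob_space "law y t" by (rule prob_law[OF y(1) that])
    have "(\<integral>x. z x \<partial>law y t) \<le> (\<integral>x. z y \<partial>law y t)"
      using integrable_cont_prob_unit[OF prob_law[OF y(1) that] _ z] y(2) by (intro integral_mono) auto
    then show ?thesis using prob_space T_law[OF cont_unit_measurable[OF z] y(1) that] by simp
  qed
  then have "eventually (\<lambda>t. (T t z y - z y) / t \<le> 0) (at_right 0)"
    by (intro eventually_at_rightI[of 0 1]) (auto simp: divide_le_0_iff)
  from tendsto_upperbound[OF gen[OF y(1)] this] have "\<theta> * z y \<le> 0" by simp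
  then have "z y \<le> 0" using \<theta> by (simp add: mult_le_0_iff)
  then show ?thesis using y(2)[OF x] by simp
qed

lemma generator_tendsto:
  assumes "g \<in> generator_domain P X" "x \<in> {0..1}"
  shows "((\<lambda>t. (T t g x - g x) / t) \<longlongrightarrow> generator P X g x) (at_right 0)"
  using assms tendsto_uniform_limitI by (fastforce simp: generator_domain_def)

text \<open>Two solutions of the resolvent equation differ by some z with generator \<theta> z; the
  maximum principle applied to z and to -z makes it zero.\<close>

lemma avg_unique:
  assumes g: "g \<in> generator_domain P X" and f: "continuous_on {0..1} f" and \<theta>: "\<theta> > 0"
    and gen: "\<And>x. x \<in> {0..1} \<Longrightarrow> generator P X g x = \<theta> * (g x - f x)"
    and x: "x \<in> {0..1}"
  shows "g x = avg \<theta> f x"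
proof -
  have gc: "continuous_on {0..1} g" using g by (simp add: generator_domain_def)
  have ac: "continuous_on {0..1} (avg \<theta> f)" by (rule avg_cont[OF f \<theta>])
  have lim: "((\<lambda>t. (T t (\<lambda>y. u y - v y) x - (u x - v x)) / t) \<longlongrightarrow> \<theta> * (u x - v x)) (at_right 0)"
    if "u \<in> generator_domain P X" "v \<in> generator_domain P X"
      "generator P X u x - generator P X v x = \<theta> * (u x - v x)" "x \<in> {0..1}" for u v x
  proof -
    have c: "continuous_on {0..1} u" "continuous_on {0..1} v" using that by (auto simp: generator_domain_def)
    have "((\<lambda>t. (T t u x - u x) / t - (T t v x - v x) / t) \<longlongrightarrow> \<theta> * (u x - v x)) (at_right 0)"
      unfolding that(3)[symmetric] by (intro tendsto_diff generator_tendsto that)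
    moreover have "eventually (\<lambda>t. (T t u x - u x) / t - (T t v x - v x) / t = (T t (\<lambda>y. u y - v y) x - (u x - v x)) / t) (at_right 0)"
      using that(4) c
      by (intro eventually_at_rightI[of 0 1]) (auto simp: T_diff diff_divide_distrib)
    ultimately show ?thesis by (rule Lim_transform_eventually)
  qed
  have dom: "avg \<theta> f \<in> generator_domain P X" by (rule avg_in_domain[OF f \<theta>])
  have "g x - avg \<theta> f x \<le> 0"
    by (rule positive_maximum_le[where z="\<lambda>x. g x - avg \<theta> f x", OF _ \<theta> _ x])
      (intro continuous_intros gc ac lim g dom; simp add: gen generator_avg[OF f \<theta>] right_diff_distrib)+
  moreover have "avg \<theta> f x - g x \<le> 0"
    by (rule positive_maximum_le[where z="\<lambda>x. avg \<theta> f x - g x", OF _ \<theta> _ x])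
      (intro continuous_intros gc ac lim g dom; simp add: gen generator_avg[OF f \<theta>] right_diff_distrib)+
  ultimately show ?thesis by simp
qed

end

section \<open>The Sturm-Liouville equation\<close>

text \<open>The open interval keeps the values of h at the endpoints of [0,1], where the
  coefficients mean nothing, out of the integral.\<close>

definition prim :: "(real \<Rightarrow> real) \<Rightarrow> real \<Rightarrow> real" where
  "prim h x = (LBINT y:{0<..<x}. h y)"

definition cint :: "(real \<Rightarrow> real) \<Rightarrow> bool" where
  "cint h \<longleftrightarrow> continuous_on {0<..<1} h \<and> set_integrable lborel {0<..<1} h"

lemma cintI: "continuous_on {0<..<1} h \<Longrightarrow> set_integrable lborel {0<..<1} h \<Longrightarrow> cint h"
  by (simp add: cint_def)

lemma cint_cont: "cint h \<Longrightarrow> continuous_on {0<..<1} h"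
  by (simp add: cint_def)

lemma cint_integrable: "cint h \<Longrightarrow> x \<le> 1 \<Longrightarrow> set_integrable lborel {0<..<x} h"
  by (auto simp: cint_def intro: set_integrable_subset)

lemma prim_0 [simp]: "prim h 0 = 0"
  by (simp add: prim_def set_lebesgue_integral_def)

lemma prim_eq_integral:
  assumes "cint h" "x \<le> 1"
  shows "prim h x = integral {0..x} h"
  using set_borel_integral_eq_integral(2)[OF cint_integrable[OF assms]]
  by (simp add: prim_def integral_open_interval_real)

lemma cint_integrable_on: "cint h \<Longrightarrow> h integrable_on {0..1}"
  using set_borel_integral_eq_integral(1)[OF cint_integrable[of h 1]]
  by (simp add: integrable_on_open_interval_real)

lemma prim_cont: "cint h \<Longrightarrow> continuous_on {0..1} (prim h)"
  using indefinite_integral_continuous_1[OF cint_integrable_on]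
  by (rule continuous_on_eq) (auto simp: prim_eq_integral)

lemma continuous_on_Icc_bounded:
  fixes g :: "real \<Rightarrow> real"
  assumes "continuous_on {a..b} g"
  obtains B where "\<And>x. x \<in> {a..b} \<Longrightarrow> \<bar>g x\<bar> \<le> B"
proof -
  have "bounded (g ` {a..b})"
    using assms by (intro compact_imp_bounded compact_continuous_image) auto
  then have "\<exists>B. \<forall>x\<in>{a..b}. \<bar>g x\<bar> \<le> B" by (simp add: bounded_iff)
  then show ?thesis using that by blast
qed

lemma prim_deriv:
  assumes h: "cint h" and x: "0 < x" "x < 1"
  shows "(prim h has_real_derivative h x) (at x)"
proof -
  have c: "continuous (at x) h"
    using cint_cont[OF h] x by (simp add: continuous_on_eq_continuous_at)
  have "((\<lambda>u. integral {0..u} h) has_vector_derivative h x) (at x within {0..1})"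
    using integral_has_vector_derivative_continuous_at[OF cint_integrable_on[OF h], of x "{}"] x c
    by (simp add: continuous_at_imp_continuous_within)
  then have d: "((\<lambda>u. integral {0..u} h) has_real_derivative h x) (at x)"
    using x by (simp add: has_real_derivative_iff_has_vector_derivative at_within_Icc_at)
  show ?thesis
  proof (rule has_field_derivative_transform_within_open[OF d, of "{0<..<1}"])
    fix u assume "u \<in> {0<..<1::real}"
    then show "integral {0..u} h = prim h u" using h by (simp add: prim_eq_integral)
  qed (use x in auto)
qed

lemma deriv_nonneg_mono:
  fixes f :: "real \<Rightarrow> real"
  assumes "continuous_on {0..1} f" "\<And>x. 0 < x \<Longrightarrow> x < 1 \<Longrightarrow> (f has_real_derivative f' x) (at x)"
    "\<And>x. 0 < x \<Longrightarrow> x < 1 \<Longrightarrow> 0 \<le> f' x" "0 \<le> x" "x \<le> y" "y \<le> 1"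
  shows "f x \<le> f y"
proof (rule DERIV_nonneg_imp_increasing_open[OF assms(5)])
  show "continuous_on {x..y} f" using assms by (auto intro: continuous_on_subset)
  fix z assume "x < z" "z < y"
  then have "0 < z" "z < 1" using assms by auto
  then show "\<exists>y. (f has_real_derivative y) (at z) \<and> 0 \<le> y" using assms by blast
qed

lemma prim_unique:
  assumes h: "cint h" and F: "continuous_on {0..1} F" "F 0 = 0"
    and d: "\<And>x. 0 < x \<Longrightarrow> x < 1 \<Longrightarrow> (F has_real_derivative h x) (at x)"
    and x: "x \<in> {0..1}"
  shows "F x = prim h x"
proof -
  have d0: "((\<lambda>y. F y - prim h y) has_real_derivative 0) (at y)" if "0 < y" "y < 1" for y
    using DERIV_diff[OF d[OF that] prim_deriv[OF h that]] by simp
  have "F x - prim h x = F 0 - prim h 0"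
    by (rule DERIV_isconst2[of 0 1 "\<lambda>y. F y - prim h y"]) (use x d0 in \<open>auto intro!: continuous_intros F prim_cont h\<close>)
  then show ?thesis using F by simp
qed

lemma cint_bound:
  assumes "cint h" "continuous_on {0<..<1} g" "\<And>x. 0 < x \<Longrightarrow> x < 1 \<Longrightarrow> \<bar>g x\<bar> \<le> C * h x"
  shows "cint g"
proof (rule cintI[OF assms(2)])
  have "set_integrable lborel {0<..<1} (\<lambda>x. C * h x)"
    using assms(1) by (simp add: cint_def)
  then show "set_integrable lborel {0<..<1} g"
  proof (rule set_integrable_bound)
    show "set_borel_measurable lborel {0<..<1} g"
      using borel_measurable_continuous_on_indicator[OF _ assms(2)] by (simp add: set_borel_measurable_def)
    show "AE x in lborel. x \<in> {0<..<1} \<longrightarrow> norm (g x) \<le> norm (C * h x)"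
      using assms(3) by (intro AE_I2) fastforce
  qed
qed

lemma cint_cmult: "cint h \<Longrightarrow> cint (\<lambda>x. c * h x)"
  by (auto simp: cint_def intro: continuous_intros)

lemma cint_mult_bounded:
  assumes h: "cint h" "\<And>x. 0 < x \<Longrightarrow> x < 1 \<Longrightarrow> 0 \<le> h x" and g: "continuous_on {0..1} g"
  shows "cint (\<lambda>x. h x * g x)"
proof -
  obtain B where B: "\<And>x. x \<in> {0..1} \<Longrightarrow> \<bar>g x\<bar> \<le> B" by (rule continuous_on_Icc_bounded[OF g]) blast
  have gc: "continuous_on {0<..<1} g" using g by (rule continuous_on_subset) auto
  show ?thesis
  proof (rule cint_bound[OF h(1), of _ B])
    show "continuous_on {0<..<1} (\<lambda>x. h x * g x)" by (intro continuous_intros gc cint_cont h)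
    fix x :: real assume x: "0 < x" "x < 1"
    have "h x * \<bar>g x\<bar> \<le> h x * B" using x B[of x] h(2)[OF x] by (intro mult_left_mono) auto
    then show "\<bar>h x * g x\<bar> \<le> B * h x" using h(2)[OF x] by (simp add: abs_mult mult.commute)
  qed
qed

lemma prim_mono_fun:
  assumes "cint g" "cint h" "\<And>x. 0 < x \<Longrightarrow> x < 1 \<Longrightarrow> g x \<le> h x" "x \<in> {0..1}"
  shows "prim g x \<le> prim h x"
  unfolding prim_def using assms by (intro set_integral_mono cint_integrable) auto

lemma prim_cmult: "prim (\<lambda>x. c * h x) x = c * prim h x"
  by (simp add: prim_def)

lemma prim_nonneg: "(\<And>x. 0 < x \<Longrightarrow> x < 1 \<Longrightarrow> 0 \<le> h x) \<Longrightarrow> x \<in> {0..1} \<Longrightarrow> 0 \<le> prim h x"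
  unfolding prim_def set_lebesgue_integral_def by (intro integral_nonneg_AE AE_I2) (auto split: split_indicator)

lemma prim_abs_le:
  assumes "cint g" "cint h" "\<And>x. 0 < x \<Longrightarrow> x < 1 \<Longrightarrow> \<bar>g x\<bar> \<le> h x" "x \<in> {0..1}"
  shows "\<bar>prim g x\<bar> \<le> prim h x"
proof -
  have "prim g x \<le> prim h x" using assms by (intro prim_mono_fun) (auto simp: abs_le_iff)
  moreover have "prim (\<lambda>x. - 1 * g x) x \<le> prim h x"
    using assms by (intro prim_mono_fun cint_cmult) (auto simp: abs_le_iff)
  ultimately show ?thesis by (simp add: prim_cmult[of "-1" g, simplified])
qed

lemma prim_mono:
  assumes "cint h" "\<And>x. 0 < x \<Longrightarrow> x < 1 \<Longrightarrow> 0 \<le> h x" "0 \<le> x" "x \<le> y" "y \<le> 1"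
  shows "prim h x \<le> prim h y"
  by (rule deriv_nonneg_mono[OF prim_cont[OF assms(1)] prim_deriv[OF assms(1)]]) (use assms in auto)

text \<open>Geometric growth is what the factorial decay of the Picard iterates can absorb. The
  class contains the powers of z, their real and imaginary parts and their derivatives in z, and is
  closed under the index shift that corresponds to applying the operator.\<close>

definition geom_bounded :: "(nat \<Rightarrow> real) \<Rightarrow> bool" where
  "geom_bounded c \<longleftrightarrow> (\<exists>K r. 0 \<le> r \<and> (\<forall>n. \<bar>c n\<bar> \<le> K * r ^ n))"

lemma geom_bounded_Suc: "geom_bounded c \<Longrightarrow> geom_bounded (\<lambda>n. c (Suc n))"
proof -
  assume "geom_bounded c"
  then obtain K r where "0 \<le> r" "\<And>n. \<bar>c n\<bar> \<le> K * r ^ n" by (auto simp: geom_bounded_def)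
  then have "\<bar>c (Suc n)\<bar> \<le> (K * r) * r ^ n" for n
    by (metis mult.assoc power_Suc)
  then show ?thesis using \<open>0 \<le> r\<close> unfolding geom_bounded_def by blast
qed

lemma geom_bounded_power: "geom_bounded (\<lambda>n. z ^ n)"
  unfolding geom_bounded_def by (rule exI[of _ 1], rule exI[of _ "\<bar>z\<bar>"]) (simp add: power_abs)

lemma geom_bounded_Re_power: "geom_bounded (\<lambda>n. Re (z ^ n))"
  unfolding geom_bounded_def
proof (rule exI[of _ 1], rule exI[of _ "norm z"], intro conjI allI)
  show "\<bar>Re (z ^ n)\<bar> \<le> 1 * norm z ^ n" for n
    using abs_Re_le_cmod[of "z ^ n"] by (simp add: norm_power)
qed simp

lemma geom_bounded_Im_power: "geom_bounded (\<lambda>n. Im (z ^ n))"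
  unfolding geom_bounded_def
proof (rule exI[of _ 1], rule exI[of _ "norm z"], intro conjI allI)
  show "\<bar>Im (z ^ n)\<bar> \<le> 1 * norm z ^ n" for n
    using abs_Im_le_cmod[of "z ^ n"] by (simp add: norm_power)
qed simp

lemma geom_bounded_diffs_power: "geom_bounded (\<lambda>n. real n * z ^ (n - 1))"
  unfolding geom_bounded_def
proof (rule exI[of _ 1], rule exI[of _ "2 * (\<bar>z\<bar> + 1)"], intro conjI allI)
  fix n
  \<comment> \<open>The factor n is absorbed by 2 ^ n and the missing power by a base of at least 1,
    whence the ratio 2 (|z| + 1).\<close>
  have "real n \<le> 2 ^ n" using of_nat_less_two_power[of n, where ?'a=real] by simp
  moreover have "\<bar>z\<bar> ^ (n - 1) \<le> (\<bar>z\<bar> + 1) ^ (n - 1)" by (intro power_mono) auto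
  moreover have "(\<bar>z\<bar> + 1) ^ (n - 1) \<le> (\<bar>z\<bar> + 1) ^ n" by (intro power_increasing) auto
  ultimately show "\<bar>real n * z ^ (n - 1)\<bar> \<le> 1 * (2 * (\<bar>z\<bar> + 1)) ^ n"
    unfolding power_mult_distrib abs_mult power_abs mult_1 by (intro mult_mono) auto
qed simp

text \<open>The assumption on \<open>s x * prim m x\<close> instead of \<open>s\<close> is what
  reflecting and entrance boundaries at 0 have in common. Near 1, where \<open>prim m\<close> is
  bounded below, it amounts to integrability of \<open>s\<close>.\<close>

locale scale_speed =
  fixes s m :: "real \<Rightarrow> real"
  assumes s_cont: "continuous_on {0<..<1} s" and s_pos: "\<And>x. 0 < x \<Longrightarrow> x < 1 \<Longrightarrow> 0 < s x"
    and m_cint: "cint m" and m_pos: "\<And>x. 0 < x \<Longrightarrow> x < 1 \<Longrightarrow> 0 < m x"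
    and sM_int: "set_integrable lborel {0<..<1} (\<lambda>x. s x * prim m x)"
begin

abbreviation M :: "real \<Rightarrow> real" where "M \<equiv> prim m"

lemma sM_cint: "cint (\<lambda>x. s x * M x)"
  using s_cont sM_int prim_cont[OF m_cint]
  by (auto intro!: cintI continuous_intros intro: continuous_on_subset)

lemma M_nonneg: "x \<in> {0..1} \<Longrightarrow> 0 \<le> M x"
  using m_pos by (intro prim_nonneg) (auto intro: less_imp_le)

lemma M_strict_mono:
  assumes a: "0 \<le> x" "x < y" "y \<le> 1"
  shows "M x < M y"
proof (rule DERIV_pos_imp_increasing_open[OF a(2)])
  show "continuous_on {x..y} M" by (rule continuous_on_subset[OF prim_cont[OF m_cint]]) (use a in auto)
  fix z assume "x < z" "z < y"
  then have "0 < z" "z < 1" using a by auto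
  then show "\<exists>y. (M has_real_derivative y) (at z) \<and> 0 < y" using prim_deriv[OF m_cint] m_pos by blast
qed

lemma M_pos: "0 < x \<Longrightarrow> x \<le> 1 \<Longrightarrow> 0 < M x"
  using M_strict_mono[of 0 x] by simp

lemma M_le: "x \<in> {0..1} \<Longrightarrow> M x \<le> M 1"
  using M_strict_mono[of x 1] by (cases "x = 1") auto

text \<open>
  Picard iteration: \<open>\<Sum>n. z ^ n * phi n x\<close> solves \<open>(1/2) d/dM d/dS u = z u\<close>, and its flux is
  \<open>\<Sum>n. z ^ Suc n * fl n x\<close>. General coefficients \<open>c n\<close> cover the real and imaginary parts
  and the \<open>z\<close>-derivatives of this solution.
\<close>

primrec phi :: "nat \<Rightarrow> real \<Rightarrow> real" where
  "phi 0 = (\<lambda>x. 1)"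
| "phi (Suc n) = prim (\<lambda>y. s y * prim (\<lambda>z. 2 * m z * phi n z) y)"

definition fl :: "nat \<Rightarrow> real \<Rightarrow> real" where
  "fl n = prim (\<lambda>z. 2 * m z * phi n z)"

lemma phi_Suc: "phi (Suc n) = prim (\<lambda>y. s y * fl n y)"
  by (simp add: fl_def)

declare phi.simps(2) [simp del]

lemma m2_cint: "cint (\<lambda>x. 2 * m x)" "\<And>x. 0 < x \<Longrightarrow> x < 1 \<Longrightarrow> 0 \<le> 2 * m x"
  using cint_cmult[OF m_cint, of 2] m_pos by (auto intro: less_imp_le)

text \<open>A source bounded by B produces a flux of size at most 2 B \<open>M\<close>. This
  compensates the possible singularity of \<open>s\<close> at 0: the product is dominated by a
  multiple of \<open>s * M\<close>.\<close>

lemma cont_flux_facts: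
  assumes g: "continuous_on {0..1} g"
  shows "cint (\<lambda>z. 2 * m z * g z)" "cint (\<lambda>y. s y * prim (\<lambda>z. 2 * m z * g z) y)"
proof -
  show c: "cint (\<lambda>z. 2 * m z * g z)" by (rule cint_mult_bounded[OF m2_cint g])
  obtain B where B: "\<And>x. x \<in> {0..1} \<Longrightarrow> \<bar>g x\<bar> \<le> B"
    by (rule continuous_on_Icc_bounded[OF g]) blast
  show "cint (\<lambda>y. s y * prim (\<lambda>z. 2 * m z * g z) y)"
  proof (rule cint_bound[OF sM_cint, of _ "2 * B"])
    show "continuous_on {0<..<1} (\<lambda>y. s y * prim (\<lambda>z. 2 * m z * g z) y)"
      by (intro continuous_intros s_cont continuous_on_subset[OF prim_cont[OF c]]) auto
    fix x :: real assume x: "0 < x" "x < 1"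
    have "\<bar>prim (\<lambda>z. 2 * m z * g z) x\<bar> \<le> prim (\<lambda>z. (2 * B) * m z) x"
    proof (rule prim_abs_le[OF c cint_cmult[OF m_cint]])
      fix z :: real assume z: "0 < z" "z < 1"
      have "2 * m z * \<bar>g z\<bar> \<le> 2 * m z * B" using z B[of z] m_pos[OF z] by (intro mult_left_mono) auto
      then show "\<bar>2 * m z * g z\<bar> \<le> 2 * B * m z" using m_pos[OF z] by (simp add: abs_mult mult_ac)
    qed (use x in auto)
    then have "s x * \<bar>prim (\<lambda>z. 2 * m z * g z) x\<bar> \<le> s x * (2 * B * M x)"
      using s_pos[OF x] by (intro mult_left_mono) (auto simp: prim_cmult)
    then show "\<bar>s x * prim (\<lambda>z. 2 * m z * g z) x\<bar> \<le> 2 * B * (s x * M x)"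
      using s_pos[OF x] by (simp add: abs_mult mult_ac)
  qed
qed

lemma phi_cont: "continuous_on {0..1} (phi n)"
proof (induction n)
  case (Suc n)
  then show ?case using prim_cont[OF cont_flux_facts(2)] by (simp add: phi.simps(2))
qed simp

lemma mphi_cint: "cint (\<lambda>z. 2 * m z * phi n z)" and sfl_cint: "cint (\<lambda>y. s y * fl n y)"
  using cont_flux_facts[OF phi_cont] by (auto simp: fl_def)

lemma fl_cont: "continuous_on {0..1} (fl n)"
  unfolding fl_def by (rule prim_cont[OF mphi_cint])

lemma fl_deriv: "0 < x \<Longrightarrow> x < 1 \<Longrightarrow> (fl n has_real_derivative 2 * m x * phi n x) (at x)"
  unfolding fl_def by (rule prim_deriv[OF mphi_cint])

lemma phi_deriv: "0 < x \<Longrightarrow> x < 1 \<Longrightarrow> (phi (Suc n) has_real_derivative s x * fl n x) (at x)"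
  unfolding phi_Suc by (rule prim_deriv[OF sfl_cint])

lemma phi_nonneg: "x \<in> {0..1} \<Longrightarrow> 0 \<le> phi n x"
  and fl_nonneg: "x \<in> {0..1} \<Longrightarrow> 0 \<le> fl n x"
proof (induction n arbitrary: x)
  case 0
  { case 1 show ?case by simp }
  { case 2 show ?case using m2_cint(2) 2 by (auto simp: fl_def intro: prim_nonneg) }
next
  case (Suc n)
  have p: "0 \<le> phi (Suc n) x" if "x \<in> {0..1}" for x
    unfolding phi_Suc by (rule prim_nonneg[OF _ that]) (use Suc s_pos in \<open>auto intro!: mult_nonneg_nonneg intro: less_imp_le\<close>)
  { case 1 show ?case by (rule p[OF 1]) }
  { case 2 show ?case unfolding fl_def
      by (rule prim_nonneg[OF _ 2]) (use p m2_cint(2) in \<open>auto intro!: mult_nonneg_nonneg\<close>) }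
qed

lemma fl_0: "fl 0 x = 2 * M x"
  by (simp add: fl_def prim_cmult)

lemma phi_mono: "0 \<le> x \<Longrightarrow> x \<le> y \<Longrightarrow> y \<le> 1 \<Longrightarrow> phi n x \<le> phi n y"
proof (cases n)
  case (Suc k)
  assume "0 \<le> x" "x \<le> y" "y \<le> 1"
  then show ?thesis unfolding Suc phi_Suc
    by (intro prim_mono sfl_cint) (auto intro!: mult_nonneg_nonneg fl_nonneg intro: less_imp_le s_pos)
qed simp

lemma fl_le: "x \<in> {0..1} \<Longrightarrow> fl n x \<le> phi n x * (2 * M x)"
proof -
  assume x: "x \<in> {0..1}"
  have "fl n x \<le> (LBINT z:{0<..<x}. phi n x * (2 * m z))"
    unfolding fl_def prim_def
  proof (rule set_integral_mono)
    show "set_integrable lborel {0<..<x} (\<lambda>z. 2 * m z * phi n z)" using x by (intro cint_integrable mphi_cint) auto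
    show "set_integrable lborel {0<..<x} (\<lambda>z. phi n x * (2 * m z))" using x by (intro cint_integrable cint_cmult m_cint) auto
    fix z assume z: "z \<in> {0<..<x}"
    then show "2 * m z * phi n z \<le> phi n x * (2 * m z)"
      using x m_pos[of z] phi_mono[of z x n] by (simp add: mult.commute)
  qed
  also have "\<dots> = phi n x * (2 * M x)" by (simp add: prim_def)
  finally show ?thesis .
qed

text \<open>The derivative of \<open>phi 1 x ^ Suc n / fact (Suc n)\<close> is
  \<open>phi 1 x ^ n / fact n\<close> times s * \<open>fl 0\<close>. It dominates s *
  \<open>fl n\<close>, because \<open>phi n\<close> is increasing and hence \<open>fl n\<close> is
  at most \<open>phi n\<close> times \<open>fl 0\<close>. Since the bound is local in x, it becomes
  sharp near 0, where \<open>phi 1\<close> is small.\<close>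

lemma phi_le: "x \<in> {0..1} \<Longrightarrow> phi n x \<le> phi 1 x ^ n / fact n"
proof (induction n arbitrary: x)
  case (Suc n)
  have 1: "(phi 1 has_real_derivative s y * fl 0 y) (at y)" if "0 < y" "y < 1" for y
    using phi_deriv[OF that, of 0] by simp
  let ?f = "\<lambda>x. phi 1 x ^ Suc n / fact (Suc n) - phi (Suc n) x"
  have c1: "continuous_on {0..1} (phi 1)" by (rule phi_cont)
  have "?f 0 \<le> ?f x"
  proof (rule deriv_nonneg_mono[where f="?f" and f'="\<lambda>x. phi 1 x ^ n / fact n * (s x * fl 0 x) - s x * fl n x"])
    show "continuous_on {0..1} ?f" by (intro continuous_intros phi_cont c1) simp
    fix y :: real assume y: "0 < y" "y < 1"
    show "(?f has_real_derivative phi 1 y ^ n / fact n * (s y * fl 0 y) - s y * fl n y) (at y)"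
    proof -
      have "((\<lambda>x. phi 1 x ^ Suc n) has_real_derivative real (Suc n) * (s y * fl 0 y * phi 1 y ^ n)) (at y)"
        using DERIV_power[OF 1[OF y], of "Suc n"] by simp
      from DERIV_diff[OF DERIV_cdivide[OF this, of "fact (Suc n)"] phi_deriv[OF y, of n]]
      show ?thesis
        by (rule DERIV_cong) (simp add: nonzero_divide_eq_eq field_simps del: of_nat_Suc)
    qed
    have "s y * fl n y \<le> s y * (phi n y * fl 0 y)"
      using s_pos[OF y] fl_le[of y n] y by (intro mult_left_mono) (auto simp: fl_0)
    also have "\<dots> \<le> s y * (phi 1 y ^ n / fact n * fl 0 y)"
      using s_pos[OF y] Suc.IH[of y] fl_nonneg[of y 0] y by (intro mult_left_mono mult_right_mono) auto
    finally show "0 \<le> phi 1 y ^ n / fact n * (s y * fl 0 y) - s y * fl n y" by (simp add: mult_ac)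
  qed (use Suc.prems in auto)
  then show ?case by (simp add: phi_Suc)
qed simp

definition U :: "(nat \<Rightarrow> real) \<Rightarrow> real \<Rightarrow> real" where
  "U c x = (\<Sum>n. c n * phi n x)"

text \<open>\<open>phi 0\<close> is constant and carries no flux; the flux of
  \<open>phi (Suc n)\<close> is \<open>fl n\<close>, hence the coefficient with index
  \<open>Suc n\<close>.\<close>

definition Fl :: "(nat \<Rightarrow> real) \<Rightarrow> real \<Rightarrow> real" where
  "Fl c x = (\<Sum>n. c (Suc n) * fl n x)"

lemma phi_le1: "x \<in> {0..1} \<Longrightarrow> phi n x \<le> phi 1 1 ^ n / fact n"
proof -
  assume x: "x \<in> {0..1}"
  have "phi n x \<le> phi n 1" using x by (intro phi_mono) auto
  also have "\<dots> \<le> phi 1 1 ^ n / fact n" by (rule phi_le) simp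
  finally show ?thesis .
qed

text \<open>The first bound does not depend on x and gives uniform convergence. The second keeps the
  factor \<open>M x\<close>, so that fluxes vanish at 0 at the rate of \<open>M\<close>.\<close>

lemma geom_majorant:
  assumes "geom_bounded c"
  obtains D where "summable D" "\<And>n. 0 \<le> D n" "\<And>n x. x \<in> {0..1} \<Longrightarrow> \<bar>c n * phi n x\<bar> \<le> D n"
    "\<And>n x. x \<in> {0..1} \<Longrightarrow> \<bar>c n * fl n x\<bar> \<le> D n * (2 * M x)"
proof -
  obtain K r where K: "0 \<le> r" "\<And>n. \<bar>c n\<bar> \<le> K * r ^ n" using assms by (auto simp: geom_bounded_def)
  have K0: "K \<ge> 0" using K(2)[of 0] by simp
  define D where "D n = K * (inverse (fact n) * (r * phi 1 1) ^ n)" for n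
  have p1: "0 \<le> phi 1 1" by (rule phi_nonneg) simp
  show ?thesis
  proof
    show "summable D" unfolding D_def by (intro summable_mult summable_exp)
    show "0 \<le> D n" for n unfolding D_def using K0 K(1) p1 by simp
    fix n and x :: real assume x: "x \<in> {0..1}"
    have "\<bar>c n\<bar> * phi n x \<le> (K * r ^ n) * (phi 1 1 ^ n / fact n)"
      using K K0 phi_le1[OF x] phi_nonneg[OF x] by (intro mult_mono) auto
    also have "\<dots> = D n" by (simp add: D_def power_mult_distrib field_simps)
    finally have *: "\<bar>c n\<bar> * phi n x \<le> D n" .
    then show "\<bar>c n * phi n x\<bar> \<le> D n" using phi_nonneg[OF x] by (simp add: abs_mult)
    have "\<bar>c n\<bar> * fl n x \<le> \<bar>c n\<bar> * (phi n x * (2 * M x))" using fl_le[OF x] by (intro mult_left_mono) auto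
    also have "\<dots> \<le> D n * (2 * M x)"
      using mult_right_mono[OF *, of "2 * M x"] M_nonneg[OF x] by (simp add: mult_ac)
    finally show "\<bar>c n * fl n x\<bar> \<le> D n * (2 * M x)" using fl_nonneg[OF x] by (simp add: abs_mult)
  qed
qed

lemma U_summable: "geom_bounded c \<Longrightarrow> x \<in> {0..1} \<Longrightarrow> summable (\<lambda>n. c n * phi n x)"
  by (erule geom_majorant) (rule summable_comparison_test', auto)

text \<open>The factor \<open>M x\<close> lets the flux kill an eigenfunction v about which only M x
  * v x \<longlongrightarrow> 0 is known at 0.\<close>

lemma Fl_bound:
  assumes "geom_bounded c"
  obtains C where "C \<ge> 0" "\<And>x. x \<in> {0..1} \<Longrightarrow> summable (\<lambda>n. c (Suc n) * fl n x)" "\<And>x. x \<in> {0..1} \<Longrightarrow> \<bar>Fl c x\<bar> \<le> C * M x"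
proof -
  obtain D where D: "summable D" "\<And>n. 0 \<le> D n"
    "\<And>n x. x \<in> {0..1} \<Longrightarrow> \<bar>c (Suc n) * fl n x\<bar> \<le> D n * (2 * M x)"
    by (rule geom_majorant[OF geom_bounded_Suc[OF assms]]) blast
  have sm: "summable (\<lambda>n. \<bar>c (Suc n) * fl n x\<bar>)" if "x \<in> {0..1}" for x
    by (rule summable_comparison_test'[OF summable_mult2[OF D(1), of "2 * M x"], of 0]) (use D(3)[OF that] in auto)
  show ?thesis
  proof
    show "2 * suminf D \<ge> 0" using suminf_nonneg[OF D(1,2)] by simp
    fix x :: real assume x: "x \<in> {0..1}"
    show "summable (\<lambda>n. c (Suc n) * fl n x)" using sm[OF x] by (rule summable_rabs_cancel)
    have "\<bar>Fl c x\<bar> \<le> (\<Sum>n. \<bar>c (Suc n) * fl n x\<bar>)" unfolding Fl_def by (rule summable_rabs[OF sm[OF x]])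
    also have "\<dots> \<le> (\<Sum>n. D n * (2 * M x))"
      by (rule suminf_le[OF D(3)[OF x] sm[OF x] summable_mult2[OF D(1)]])
    also have "\<dots> = 2 * suminf D * M x" using suminf_mult2[OF D(1), of "2 * M x"] by simp
    finally show "\<bar>Fl c x\<bar> \<le> 2 * suminf D * M x" .
  qed
qed

lemma U_cont: assumes "geom_bounded c" shows "continuous_on {0..1} (U c)"
proof -
  obtain D where D: "summable D" "\<And>n x. x \<in> {0..1} \<Longrightarrow> \<bar>c n * phi n x\<bar> \<le> D n"
    by (rule geom_majorant[OF assms]) blast
  have "uniform_limit {0..1} (\<lambda>n x. \<Sum>i<n. c i * phi i x) (\<lambda>x. \<Sum>i. c i * phi i x) sequentially"
    by (rule Weierstrass_m_test[OF _ D(1)]) (use D(2) in auto)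
  then show ?thesis unfolding U_def
    by (rule uniform_limit_theorem[rotated]) (auto intro!: always_eventually continuous_intros phi_cont)
qed

lemma Fl_cont: assumes "geom_bounded c" shows "continuous_on {0..1} (Fl c)"
proof -
  obtain D where D: "summable D" "\<And>n. 0 \<le> D n"
    "\<And>n x. x \<in> {0..1} \<Longrightarrow> \<bar>c (Suc n) * fl n x\<bar> \<le> D n * (2 * M x)"
    by (rule geom_majorant[OF geom_bounded_Suc[OF assms]]) blast
  have "uniform_limit {0..1} (\<lambda>n x. \<Sum>i<n. c (Suc i) * fl i x) (\<lambda>x. \<Sum>i. c (Suc i) * fl i x) sequentially"
  proof (rule Weierstrass_m_test[OF _ summable_mult2[OF D(1), of "2 * M 1"]])
    fix n and x :: real assume x: "x \<in> {0..1}"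
    have "D n * (2 * M x) \<le> D n * (2 * M 1)" using D(2) M_le[OF x] by (intro mult_left_mono) auto
    with D(3)[OF x, of n] show "norm (c (Suc n) * fl n x) \<le> D n * (2 * M 1)" by simp
  qed
  then show ?thesis unfolding Fl_def
    by (rule uniform_limit_theorem[rotated]) (auto intro!: always_eventually continuous_intros fl_cont)
qed

lemma U_0: "U c 0 = c 0"
proof -
  have "(\<lambda>n. c n * phi n 0) = (\<lambda>n. if n = 0 then c 0 else 0)"
  proof
    fix n show "c n * phi n 0 = (if n = 0 then c 0 else 0)" by (cases n) (simp_all add: phi_Suc)
  qed
  then show ?thesis unfolding U_def using suminf_finite[of "{0}" "\<lambda>n. if n = 0 then c 0 else 0"] by simp
qed

lemma Fl_0 [simp]: "Fl c 0 = 0"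
  by (simp add: Fl_def fl_def)

lemma Fl_deriv:
  assumes c: "geom_bounded c" and x: "0 < x" "x < 1"
  shows "(Fl c has_real_derivative 2 * m x * U (\<lambda>n. c (Suc n)) x) (at x)"
proof -
  \<comment> \<open>\<open>m\<close> may blow up at both ends, so termwise differentiation is done
    on a compact neighbourhood of x.\<close>
  let ?S = "{x/2..(x+1)/2}"
  have S: "?S \<subseteq> {0<..<1}" "convex ?S" "x \<in> interior ?S" using x by auto
  obtain D where D: "summable D" "\<And>n. 0 \<le> D n" "\<And>n x. x \<in> {0..1} \<Longrightarrow> \<bar>c (Suc n) * phi n x\<bar> \<le> D n"
    by (rule geom_majorant[OF geom_bounded_Suc[OF c]]) blast
  have "continuous_on ?S m" using cint_cont[OF m_cint] S(1) by (rule continuous_on_subset)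
  then obtain B where B: "\<And>y. y \<in> ?S \<Longrightarrow> \<bar>m y\<bar> \<le> B" by (rule continuous_on_Icc_bounded) blast
  have "(\<lambda>y. \<Sum>n. c (Suc n) * fl n y) = Fl c" by (simp add: Fl_def fun_eq_iff)
  moreover have "((\<lambda>y. \<Sum>n. c (Suc n) * fl n y) has_real_derivative (\<Sum>n. c (Suc n) * (2 * m x * phi n x))) (at x)"
  proof (rule has_field_derivative_series'(2)[OF S(2) _ _ _ _ S(3), where ?x0.0=x])
    show "((\<lambda>y. c (Suc n) * fl n y) has_real_derivative c (Suc n) * (2 * m y * phi n y)) (at y within ?S)" if "y \<in> ?S" for n y
      using that S(1) by (intro DERIV_cmult DERIV_subset[OF fl_deriv]) auto
    show "uniformly_convergent_on ?S (\<lambda>n y. \<Sum>i<n. c (Suc i) * (2 * m y * phi i y))"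
    proof (rule Weierstrass_m_test'[OF _ summable_mult[OF D(1), of "2 * B"]])
      fix n y assume y: "y \<in> ?S"
      have "2 * \<bar>m y\<bar> * \<bar>c (Suc n) * phi n y\<bar> \<le> 2 * B * D n"
        using B[OF y] D(3)[of y n] y x by (intro mult_mono) auto
      then show "norm (c (Suc n) * (2 * m y * phi n y)) \<le> 2 * B * D n" by (simp add: abs_mult mult_ac)
    qed
    show "summable (\<lambda>n. c (Suc n) * fl n x)"
      using Fl_bound[OF c] x by (metis atLeastAtMost_iff less_imp_le)
  qed (use x in auto)
  moreover have "(\<Sum>n. c (Suc n) * (2 * m x * phi n x)) = 2 * m x * U (\<lambda>n. c (Suc n)) x"
    unfolding U_def using U_summable[OF geom_bounded_Suc[OF c], of x] x
    by (subst suminf_mult[symmetric]) (auto simp: mult_ac)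
  ultimately show ?thesis by simp
qed

lemma U_deriv:
  assumes c: "geom_bounded c" and x: "0 < x" "x < 1"
  shows "(U c has_real_derivative s x * Fl c x) (at x)"
proof -
  let ?S = "{x/2..(x+1)/2}"
  have S: "?S \<subseteq> {0<..<1}" "convex ?S" "x \<in> interior ?S" using x by auto
  obtain D where D: "summable D" "\<And>n. 0 \<le> D n"
    "\<And>n x. x \<in> {0..1} \<Longrightarrow> \<bar>c (Suc n) * fl n x\<bar> \<le> D n * (2 * M x)"
    by (rule geom_majorant[OF geom_bounded_Suc[OF c]]) blast
  have "continuous_on ?S s" using s_cont S(1) by (rule continuous_on_subset)
  then obtain B where B: "\<And>y. y \<in> ?S \<Longrightarrow> \<bar>s y\<bar> \<le> B" by (rule continuous_on_Icc_bounded) blast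
  have Bp: "B \<ge> 0" using B[of x] x by auto
  have sm: "summable (\<lambda>n. c (Suc n) * phi (Suc n) y)" if "y \<in> {0..1}" for y
    using U_summable[OF c that] by (subst summable_Suc_iff[of "\<lambda>n. c n * phi n y"])
  have "((\<lambda>y. \<Sum>n. c (Suc n) * phi (Suc n) y) has_real_derivative (\<Sum>n. c (Suc n) * (s x * fl n x))) (at x)"
  proof (rule has_field_derivative_series'(2)[OF S(2) _ _ _ _ S(3), where ?x0.0=x])
    show "((\<lambda>y. c (Suc n) * phi (Suc n) y) has_real_derivative c (Suc n) * (s y * fl n y)) (at y within ?S)" if "y \<in> ?S" for n y
      using that S(1) by (intro DERIV_cmult DERIV_subset[OF phi_deriv]) auto
    show "uniformly_convergent_on ?S (\<lambda>n y. \<Sum>i<n. c (Suc i) * (s y * fl i y))"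
    proof (rule Weierstrass_m_test'[OF _ summable_mult[OF D(1), of "B * (2 * M 1)"]])
      fix n y assume y: "y \<in> ?S"
      then have y01: "y \<in> {0..1}" using x by auto
      have "\<bar>c (Suc n) * fl n y\<bar> \<le> D n * (2 * M 1)"
        using D(3)[OF y01, of n] mult_left_mono[OF M_le[OF y01] D(2)[of n]] by linarith
      then have "\<bar>s y\<bar> * \<bar>c (Suc n) * fl n y\<bar> \<le> B * (D n * (2 * M 1))"
        using B[OF y] Bp by (intro mult_mono) auto
      then show "norm (c (Suc n) * (s y * fl n y)) \<le> B * (2 * M 1) * D n" by (simp add: abs_mult mult_ac)
    qed
    show "summable (\<lambda>n. c (Suc n) * phi (Suc n) x)" using x by (intro sm) auto
  qed (use x in auto)
  moreover have "(\<Sum>n. c (Suc n) * (s x * fl n x)) = s x * Fl c x"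
  proof -
    have "summable (\<lambda>n. c (Suc n) * fl n x)" by (rule Fl_bound[OF c]) (use x in auto)
    then show ?thesis unfolding Fl_def by (subst suminf_mult[symmetric]) (auto simp: mult_ac)
  qed
  ultimately have d: "((\<lambda>y. c 0 + (\<Sum>n. c (Suc n) * phi (Suc n) y)) has_real_derivative s x * Fl c x) (at x)"
    by (auto intro!: derivative_eq_intros)
  show ?thesis
  proof (rule has_field_derivative_transform_within_open[OF d, of "{0<..<1}"])
    fix y :: real assume "y \<in> {0<..<1}"
    then have "y \<in> {0..1}" by auto
    from suminf_split_head[OF U_summable[OF c this]] show "c 0 + (\<Sum>n. c (Suc n) * phi (Suc n) y) = U c y"
      by (simp add: U_def)
  qed (use x in auto)
qed

end

lemma geom_bounded_cmult:
  assumes "geom_bounded c"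
  shows "geom_bounded (\<lambda>n. k * c n)"
proof -
  from assms obtain K r where "0 \<le> r" "\<And>n. \<bar>c n\<bar> \<le> K * r ^ n" by (auto simp: geom_bounded_def)
  then have "\<bar>k * c n\<bar> \<le> (\<bar>k\<bar> * K) * r ^ n" for n
    by (simp add: abs_mult mult.assoc mult_left_mono)
  then show ?thesis using \<open>0 \<le> r\<close> unfolding geom_bounded_def by blast
qed

section \<open>Wronskians, and the zeros and the growth of G\<close>

context scale_speed begin

text \<open>The equation (1/2) d/dM d/dS w = g as a first-order system for w and its flux F = dw/dS.
  Continuity up to the ends and F 0 = 0 encode the boundary condition at 0; the condition at 1 is
  the separate equation F 1 = 0.\<close>

definition flux_pair :: "(real \<Rightarrow> real) \<Rightarrow> (real \<Rightarrow> real) \<Rightarrow> (real \<Rightarrow> real) \<Rightarrow> bool" where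
  "flux_pair w F g \<longleftrightarrow> continuous_on {0..1} w \<and> continuous_on {0..1} F \<and> F 0 = 0 \<and>
     (\<forall>x. 0 < x \<longrightarrow> x < 1 \<longrightarrow> (w has_real_derivative s x * F x) (at x) \<and>
        (F has_real_derivative 2 * m x * g x) (at x))"

lemma flux_pairD:
  assumes "flux_pair w F g"
  shows "continuous_on {0..1} w" "continuous_on {0..1} F" "F 0 = 0"
    "\<And>x. 0 < x \<Longrightarrow> x < 1 \<Longrightarrow> (w has_real_derivative s x * F x) (at x)"
    "\<And>x. 0 < x \<Longrightarrow> x < 1 \<Longrightarrow> (F has_real_derivative 2 * m x * g x) (at x)"
  using assms by (auto simp: flux_pair_def)

lemma U_flux_pair: "geom_bounded c \<Longrightarrow> flux_pair (U c) (Fl c) (U (\<lambda>n. c (Suc n)))"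
  by (simp add: flux_pair_def U_cont Fl_cont U_deriv Fl_deriv)

lemma U_scale: "geom_bounded c \<Longrightarrow> x \<in> {0..1} \<Longrightarrow> U (\<lambda>n. k * c n) x = k * U c x"
  unfolding U_def using U_summable[of c x] by (simp add: mult.assoc suminf_mult)

lemma U_add: "geom_bounded c \<Longrightarrow> geom_bounded d \<Longrightarrow> x \<in> {0..1} \<Longrightarrow> U (\<lambda>n. c n + d n) x = U c x + U d x"
  unfolding U_def using U_summable[of c x] U_summable[of d x] by (simp add: distrib_right suminf_add)

text \<open>The two terms containing \<open>s\<close> are both s x * F * E and cancel, so the
  derivative involves only the integrable density \<open>m\<close>.\<close>

lemma wronskian_deriv:
  assumes "(w has_real_derivative s x * F) (at x)" "(f has_real_derivative 2 * m x * g) (at x)"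
    "(v has_real_derivative s x * E) (at x)" "(e has_real_derivative 2 * m x * h) (at x)"
    "f x = F" "e x = E"
  shows "((\<lambda>x. w x * e x - v x * f x) has_real_derivative 2 * m x * (w x * h - v x * g)) (at x)"
  using assms by (auto intro!: derivative_eq_intros simp: algebra_simps)

text \<open>A nondecreasing function with equal end values is constant.\<close>

lemma deriv_zero_of_equal_ends:
  fixes D :: "real \<Rightarrow> real"
  assumes c: "continuous_on {0..1} D" and d: "\<And>x. 0 < x \<Longrightarrow> x < 1 \<Longrightarrow> (D has_real_derivative d x) (at x)"
    and nn: "\<And>x. 0 < x \<Longrightarrow> x < 1 \<Longrightarrow> 0 \<le> d x" and ends: "D 0 = 0" "D 1 = 0" and x: "0 < x" "x < 1"
  shows "d x = 0"
proof -
  have D0: "D y = 0" if "y \<in> {0..1}" for y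
    using deriv_nonneg_mono[OF c d nn, of 0 y] deriv_nonneg_mono[OF c d nn, of y 1] ends that by force
  have "((\<lambda>_. 0) has_real_derivative d x) (at x)"
    by (rule has_field_derivative_transform_within_open[OF d[OF x], of "{0<..<1}"]) (use x D0 in auto)
  then show ?thesis by (metis DERIV_const DERIV_unique)
qed

lemma continuous_nonvanish_near_0:
  fixes f :: "real \<Rightarrow> real"
  assumes "continuous_on {0..1} f" "f 0 \<noteq> 0"
  obtains x where "0 < x" "x < 1" "f x \<noteq> 0"
proof -
  have "(f \<longlongrightarrow> f 0) (at 0 within {0..1})" using assms(1) by (simp add: continuous_on)
  then have "(f \<longlongrightarrow> f 0) (at_right 0)" by (simp add: at_within_Icc_at_right)
  then have "eventually (\<lambda>x. f x \<noteq> 0) (at_right 0)" using assms(2) by (rule tendsto_imp_eventually_ne)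
  moreover have "eventually (\<lambda>x. x < 1 \<and> 0 < x) (at_right (0::real))"
    by (intro eventually_at_rightI[of 0 1]) auto
  ultimately have "eventually (\<lambda>x. f x \<noteq> 0 \<and> x < 1 \<and> 0 < x) (at_right 0)" by eventually_elim auto
  then show ?thesis using that eventually_happens'[OF trivial_limit_at_right_real] by blast
qed

definition gam :: "nat \<Rightarrow> real" where
  "gam n = fl n 1 / (2 * M 1)"

definition G :: "complex \<Rightarrow> complex" where
  "G z = (\<Sum>n. of_real (gam n) * z ^ n)"

text \<open>The coefficients are nonnegative, so \<open>g\<close> at |z| dominates
  |\<open>G z\<close>|, and growth has to be estimated on the positive axis only.\<close>

definition g :: "real \<Rightarrow> real" where
  "g r = (\<Sum>n. gam n * r ^ n)"

lemma M1: "M 1 > 0"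
  by (rule M_pos) auto

lemma gam_nonneg: "0 \<le> gam n"
  using M1 fl_nonneg[of 1 n] by (simp add: gam_def)

lemma gam_le: "gam n \<le> phi 1 1 ^ n / fact n"
proof -
  have "gam n \<le> phi n 1" using M1 fl_le[of 1 n] by (simp add: gam_def divide_le_eq)
  also have "\<dots> \<le> phi 1 1 ^ n / fact n" by (rule phi_le1) simp
  finally show ?thesis .
qed

lemma gam_0: "gam 0 = 1"
  using M1 by (simp add: gam_def fl_0)

lemma gam_abs_summable: "summable (\<lambda>n. gam n * \<bar>r\<bar> ^ n)"
proof (rule summable_comparison_test'[OF summable_exp[of "phi 1 1 * \<bar>r\<bar>"], of 0])
  fix n
  have "gam n * \<bar>r\<bar> ^ n \<le> phi 1 1 ^ n / fact n * \<bar>r\<bar> ^ n" by (intro mult_right_mono gam_le) auto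
  then show "norm (gam n * \<bar>r\<bar> ^ n) \<le> inverse (fact n) * (phi 1 1 * \<bar>r\<bar>) ^ n"
    using gam_nonneg[of n] by (simp add: abs_mult power_mult_distrib field_simps)
qed

lemma g_summable: "summable (\<lambda>n. gam n * r ^ n)"
  by (rule summable_comparison_test'[OF gam_abs_summable[of r], of 0])
    (simp add: abs_mult power_abs gam_nonneg)

lemma G_summable: "summable (\<lambda>n. complex_of_real (gam n) * z ^ n)"
  by (rule summable_comparison_test'[OF g_summable[of "norm z"], of 0])
    (simp add: norm_mult norm_power gam_nonneg)

lemma G_of_real: "G (of_real r) = of_real (g r)"
  unfolding G_def g_def using g_summable[of r] by (simp add: suminf_of_real)

lemma norm_G_le: "norm (G z) \<le> g (norm z)"
  unfolding G_def g_def
  by (rule norm_suminf_le[OF _ g_summable]) (simp add: norm_mult norm_power gam_nonneg)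

lemma g_mono: "0 \<le> r \<Longrightarrow> r \<le> r' \<Longrightarrow> g r \<le> g r'"
  unfolding g_def by (intro suminf_le g_summable mult_left_mono power_mono gam_nonneg) auto

lemma g_0: "g 0 = 1"
  unfolding g_def using powser_zero[of gam] by (simp add: gam_0)

lemma g_ge_1: "0 \<le> r \<Longrightarrow> 1 \<le> g r"
  using g_mono[of 0 r] by (simp add: g_0)

lemma G_0: "G 0 = 1"
  using G_of_real[of 0] by (simp add: g_0)

lemma G_deriv: "(G has_field_derivative (\<Sum>n. diffs (\<lambda>n. complex_of_real (gam n)) n * z ^ n)) (at z)"
  unfolding G_def[abs_def] by (rule termdiffs_strong_converges_everywhere) (rule G_summable)

lemma G_holomorphic: "G holomorphic_on UNIV"
  using G_deriv by (auto simp: holomorphic_on_open)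

lemma fl_1: "fl n 1 = 2 * M 1 * gam n"
  using M1 by (simp add: gam_def)

lemma
  fixes z :: complex
  shows Fl_Re_power: "Fl (\<lambda>n. Re (z ^ n)) 1 = Re (2 * M 1 * z * G z)"
  and Fl_Im_power: "Fl (\<lambda>n. Im (z ^ n)) 1 = Im (2 * M 1 * z * G z)"
proof -
  have "(\<lambda>n. 2 * M 1 * z * (complex_of_real (gam n) * z ^ n)) sums (2 * M 1 * z * G z)"
    unfolding G_def by (intro sums_mult summable_sums G_summable)
  moreover have "(\<lambda>n. 2 * M 1 * z * (complex_of_real (gam n) * z ^ n)) = (\<lambda>n. z ^ Suc n * of_real (fl n 1))"
    by (simp add: fl_1 fun_eq_iff mult_ac)
  ultimately have *: "(\<lambda>n. z ^ Suc n * of_real (fl n 1)) sums (2 * M 1 * z * G z)" by simp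
  from sums_Re[OF *] show "Fl (\<lambda>n. Re (z ^ n)) 1 = Re (2 * M 1 * z * G z)"
    unfolding Fl_def by (simp add: sums_iff del: power_Suc)
  from sums_Im[OF *] show "Fl (\<lambda>n. Im (z ^ n)) 1 = Im (2 * M 1 * z * G z)"
    unfolding Fl_def by (simp add: sums_iff del: power_Suc)
qed

lemma Fl_power: "Fl (\<lambda>n. r ^ n) 1 = 2 * M 1 * r * g r"
  unfolding Fl_def g_def fl_1 using g_summable[of r] by (subst suminf_mult[symmetric]) (auto simp: mult_ac)

text \<open>For the solution u with parameter z the Wronskian of Re u and Im u has derivative 2 m
  (Im z) |u|^2. It vanishes at 0, and at 1 if \<open>G z = 0\<close>, so Im z \<noteq> 0 would force
  u = 0. On the nonnegative axis \<open>g\<close> is at least 1.\<close>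

lemma G_zero_real:
  assumes "G z = 0"
  shows "\<exists>l>0. z = - of_real l"
proof -
  have im: "Im z = 0"
  proof (rule ccontr)
    assume im: "Im z \<noteq> 0"
    let ?c = "\<lambda>n. Re (z ^ n)" and ?d = "\<lambda>n. Im (z ^ n)"
    have cd: "geom_bounded ?c" "geom_bounded ?d" by (rule geom_bounded_Re_power geom_bounded_Im_power)+
    note P = flux_pairD[OF U_flux_pair[OF cd(1)]] and Q = flux_pairD[OF U_flux_pair[OF cd(2)]]
    have sh: "U (\<lambda>n. Re (z ^ Suc n)) x = Re z * U ?c x - Im z * U ?d x"
      "U (\<lambda>n. Im (z ^ Suc n)) x = Im z * U ?c x + Re z * U ?d x" if x: "x \<in> {0..1}" for x
    proof -
      have "U (\<lambda>n. Re (z ^ Suc n)) x = U (\<lambda>n. Re z * Re (z ^ n) + (- Im z) * Im (z ^ n)) x" by simp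
      also have "\<dots> = Re z * U ?c x - Im z * U ?d x"
        by (simp only: U_add[OF geom_bounded_cmult[OF cd(1)] geom_bounded_cmult[OF cd(2)] x] U_scale[OF cd(1) x] U_scale[OF cd(2) x])
      finally show "U (\<lambda>n. Re (z ^ Suc n)) x = Re z * U ?c x - Im z * U ?d x" .
      have "U (\<lambda>n. Im (z ^ Suc n)) x = U (\<lambda>n. Im z * Re (z ^ n) + Re z * Im (z ^ n)) x" by (simp add: add.commute)
      also have "\<dots> = Im z * U ?c x + Re z * U ?d x"
        by (simp only: U_add[OF geom_bounded_cmult[OF cd(1)] geom_bounded_cmult[OF cd(2)] x] U_scale[OF cd(1) x] U_scale[OF cd(2) x])
      finally show "U (\<lambda>n. Im (z ^ Suc n)) x = Im z * U ?c x + Re z * U ?d x" .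
    qed
    \<comment> \<open>Dividing by Im z makes the derivative nonnegative for either sign of Im
      z.\<close>
    let ?D = "\<lambda>x. (U ?c x * Fl ?d x - U ?d x * Fl ?c x) / Im z"
    have D: "(?D has_real_derivative 2 * m x * ((U ?c x)\<^sup>2 + (U ?d x)\<^sup>2)) (at x)" if x: "0 < x" "x < 1" for x
    proof (rule DERIV_cong[OF DERIV_cdivide[OF wronskian_deriv[OF P(4,5)[OF x] Q(4,5)[OF x] refl refl]]])
      have "x \<in> {0..1}" using x by auto
      then show "2 * m x * (U ?c x * U (\<lambda>n. Im (z ^ Suc n)) x - U ?d x * U (\<lambda>n. Re (z ^ Suc n)) x) / Im z
         = 2 * m x * ((U ?c x)\<^sup>2 + (U ?d x)\<^sup>2)"
        by (simp only: sh) (use im in \<open>simp add: field_simps power2_eq_square\<close>)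
    qed
    obtain x where x: "0 < x" "x < 1" "U ?c x \<noteq> 0"
      by (rule continuous_nonvanish_near_0[OF P(1)]) (simp_all add: U_0)
    have "2 * m x * ((U ?c x)\<^sup>2 + (U ?d x)\<^sup>2) = 0"
    proof (rule deriv_zero_of_equal_ends[of ?D, OF _ D _ _ _ x(1,2)])
      show "continuous_on {0..1} ?D" using im by (intro continuous_intros P Q) auto
      show "0 \<le> 2 * m x * ((U ?c x)\<^sup>2 + (U ?d x)\<^sup>2)" if "0 < x" "x < 1" for x
        using m_pos[OF that] by simp
      show "?D 1 = 0" using assms by (simp add: Fl_Re_power Fl_Im_power)
    qed (simp_all add: P(3) Q(3))
    then show False using x m_pos[OF x(1,2)] by (simp add: sum_power2_eq_zero_iff)
  qed
  then have z: "z = of_real (Re z)" by (simp add: complex_eq_iff)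
  have "Re z < 0"
  proof (rule ccontr)
    assume "\<not> Re z < 0"
    then have "1 \<le> g (Re z)" by (intro g_ge_1) simp
    then show False using assms z G_of_real by (metis not_one_le_zero of_real_eq_0_iff)
  qed
  then show ?thesis using z by (intro exI[of _ "- Re z"]) auto
qed

text \<open>The derivative of u in the parameter solves the same equation with source u added, so
  its Wronskian with u has derivative 2 m u^2. At a double zero both fluxes vanish at 1, which would
  force u = 0.\<close>

lemma G_zero_simple:
  assumes "G (of_real r) = 0"
  shows "deriv G (of_real r) \<noteq> 0"
proof
  assume d0: "deriv G (of_real r) = 0"
  let ?c = "\<lambda>n. r ^ n" and ?d = "\<lambda>n. real n * r ^ (n - 1)"
  have cd: "geom_bounded ?c" "geom_bounded ?d" by (rule geom_bounded_power geom_bounded_diffs_power)+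
  note P = flux_pairD[OF U_flux_pair[OF cd(1)]] and Q = flux_pairD[OF U_flux_pair[OF cd(2)]]
  have gr: "g r = 0" using assms by (simp add: G_of_real)
  \<comment> \<open>Coefficients of x * \<open>g x\<close>: the flux at 1 is 2 * \<open>M 1\<close>
    times this function, and it is the flux that has to be differentiated.\<close>
  define h where "h n = (case n of 0 \<Rightarrow> 0 | Suc k \<Rightarrow> gam k)" for n
  have hs: "(\<lambda>n. h n * x ^ n) sums (x * g x)" for x
  proof -
    have "(\<lambda>n. x * (gam n * x ^ n)) sums (x * g x)"
      unfolding g_def by (intro sums_mult summable_sums g_summable)
    then have "(\<lambda>n. h (Suc n) * x ^ Suc n) sums (x * g x)" by (simp add: h_def mult_ac)
    then have "(\<lambda>n. h n * x ^ n) sums (x * g x + h 0 * x ^ 0)" 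
      by (rule sums_Suc_iff[of "\<lambda>n. h n * x ^ n", THEN iffD1])
    then show ?thesis by (simp add: h_def)
  qed
  have "((\<lambda>x. \<Sum>n. h n * x ^ n) has_real_derivative (\<Sum>n. diffs h n * r ^ n)) (at r)"
    by (rule termdiffs_strong_converges_everywhere) (use hs sums_summable in blast)
  then have 1: "((\<lambda>x. x * g x) has_real_derivative (\<Sum>n. diffs h n * r ^ n)) (at r)"
    using hs by (simp add: sums_iff)
  have "deriv G (of_real r) = (\<Sum>n. of_real (diffs gam n * r ^ n))"
    using DERIV_imp_deriv[OF G_deriv[of "of_real r"]] by (simp add: diffs_of_real)
  also have "\<dots> = of_real (\<Sum>n. diffs gam n * r ^ n)"
    by (rule suminf_of_real[symmetric]) (rule termdiff_converges_all[OF g_summable])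
  finally have "(\<Sum>n. diffs gam n * r ^ n) = 0" using d0 by simp
  moreover have "(g has_real_derivative (\<Sum>n. diffs gam n * r ^ n)) (at r)"
    unfolding g_def[abs_def] by (rule termdiffs_strong_converges_everywhere) (rule g_summable)
  ultimately have 2: "(g has_real_derivative 0) (at r)" by simp
  have "(\<Sum>n. diffs h n * r ^ n) = 0"
    using DERIV_unique[OF 1 DERIV_mult[OF DERIV_ident 2]] gr by simp
  moreover have "summable (\<lambda>n. diffs h n * r ^ n)"
    by (rule termdiff_converges_all) (use hs sums_summable in blast)
  ultimately have "(\<Sum>n. 2 * M 1 * (diffs h n * r ^ n)) = 0" by (simp add: suminf_mult)
  moreover have "diffs h n = real (Suc n) * gam n" for n by (simp add: diffs_def h_def)
  then have "(\<lambda>n. 2 * M 1 * (diffs h n * r ^ n)) = (\<lambda>n. real (Suc n) * r ^ (Suc n - 1) * (2 * M 1 * gam n))"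
    by (simp add: fun_eq_iff)
  ultimately have Fd: "Fl ?d 1 = 0" unfolding Fl_def fl_1 by (simp only:)
  have Fc: "Fl ?c 1 = 0" by (simp add: Fl_power gr)
  have shc: "U (\<lambda>n. r ^ Suc n) x = r * U ?c x" if "x \<in> {0..1}" for x
    using U_scale[OF cd(1) that] by simp
  have shd: "U (\<lambda>n. real (Suc n) * r ^ (Suc n - 1)) x = U ?c x + r * U ?d x" if x: "x \<in> {0..1}" for x
  proof -
    have "(\<lambda>n. real (Suc n) * r ^ (Suc n - 1)) = (\<lambda>n. r ^ n + r * (real n * r ^ (n - 1)))"
    proof
      fix n show "real (Suc n) * r ^ (Suc n - 1) = r ^ n + r * (real n * r ^ (n - 1))"
        by (cases n) (simp_all add: algebra_simps)
    qed
    then show ?thesis by (simp only: U_add[OF cd(1) geom_bounded_cmult[OF cd(2)] x] U_scale[OF cd(2) x])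
  qed
  let ?D = "\<lambda>x. U ?c x * Fl ?d x - U ?d x * Fl ?c x"
  have D: "(?D has_real_derivative 2 * m x * (U ?c x)\<^sup>2) (at x)" if x: "0 < x" "x < 1" for x
  proof (rule DERIV_cong[OF wronskian_deriv[OF P(4,5)[OF x] Q(4,5)[OF x] refl refl]])
    have "x \<in> {0..1}" using x by auto
    then show "2 * m x * (U ?c x * U (\<lambda>n. real (Suc n) * r ^ (Suc n - 1)) x - U ?d x * U (\<lambda>n. r ^ Suc n) x)
       = 2 * m x * (U ?c x)\<^sup>2"
      by (simp only: shc shd) (simp add: algebra_simps power2_eq_square)
  qed
  obtain x where x: "0 < x" "x < 1" "U ?c x \<noteq> 0"
    by (rule continuous_nonvanish_near_0[OF P(1)]) (simp_all add: U_0)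
  have "2 * m x * (U ?c x)\<^sup>2 = 0"
  proof (rule deriv_zero_of_equal_ends[of ?D, OF _ D _ _ _ x(1,2)])
    show "continuous_on {0..1} ?D" by (intro continuous_intros P Q)
    show "0 \<le> 2 * m x * (U ?c x)\<^sup>2" if "0 < x" "x < 1" for x
      using m_pos[OF that] by simp
    show "?D 1 = 0" by (simp only: Fd Fc)
    show "?D 0 = 0" by (simp only: P(3) Q(3))
  qed
  then show False using x m_pos[OF x(1,2)] by simp
qed

abbreviation Q :: "real \<Rightarrow> real" where "Q \<equiv> prim (\<lambda>x. s x * M x)"

lemma Q_cont: "continuous_on {0..1} Q"
  by (rule prim_cont[OF sM_cint])

lemma Q_deriv: "0 < x \<Longrightarrow> x < 1 \<Longrightarrow> (Q has_real_derivative s x * M x) (at x)"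
  by (rule prim_deriv[OF sM_cint])

text \<open>Away from 0 the primitive \<open>Q\<close> of \<open>s * M\<close>, divided by
  \<open>M x0\<close>, serves as a primitive of a majorant of \<open>s\<close>.\<close>

lemma s_le: "0 < x0 \<Longrightarrow> x0 \<le> x \<Longrightarrow> x < 1 \<Longrightarrow> s x \<le> s x * M x / M x0"
  using M_strict_mono[of x0 x] M_pos[of x0] s_pos[of x] by (cases "x = x0") (auto simp: field_simps)

lemma U_power_ge_1: "0 \<le> r \<Longrightarrow> x \<in> {0..1} \<Longrightarrow> 1 \<le> U (\<lambda>n. r ^ n) x"
proof -
  assume a: "0 \<le> r" "x \<in> {0..1}"
  have "(\<Sum>n\<in>{0}. r ^ n * phi n x) \<le> U (\<lambda>n. r ^ n) x"
    unfolding U_def by (rule sum_le_suminf[OF U_summable[OF geom_bounded_power a(2)]])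
      (use a phi_nonneg in auto)
  then show ?thesis by simp
qed

lemma Fl_power_nonneg: "0 \<le> r \<Longrightarrow> x \<in> {0..1} \<Longrightarrow> 0 \<le> Fl (\<lambda>n. r ^ n) x"
proof -
  assume a: "0 \<le> r" "x \<in> {0..1}"
  have "summable (\<lambda>n. r ^ Suc n * fl n x)" by (rule Fl_bound[OF geom_bounded_power[of r]]) (use a in blast)
  then show ?thesis unfolding Fl_def by (rule suminf_nonneg) (use a fl_nonneg in auto)
qed

lemma U_power_Suc: "x \<in> {0..1} \<Longrightarrow> U (\<lambda>n. r ^ Suc n) x = r * U (\<lambda>n. r ^ n) x"
  using U_scale[OF geom_bounded_power[of r], of x r] by simp

lemma power_flux_pair: "flux_pair (U (\<lambda>n. r ^ n)) (Fl (\<lambda>n. r ^ n)) (\<lambda>x. r * U (\<lambda>n. r ^ n) x)"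
  using U_flux_pair[OF geom_bounded_power[of r]]
  by (simp add: flux_pair_def U_power_Suc del: power_Suc)

lemma U_power_mono: "0 \<le> r \<Longrightarrow> 0 \<le> x \<Longrightarrow> x \<le> y \<Longrightarrow> y \<le> 1 \<Longrightarrow> U (\<lambda>n. r ^ n) x \<le> U (\<lambda>n. r ^ n) y"
  by (rule deriv_nonneg_mono[OF flux_pairD(1,4)[OF power_flux_pair]])
    (auto intro!: mult_nonneg_nonneg Fl_power_nonneg intro: less_imp_le s_pos)

text \<open>
  On \<open>{x0..1}\<close> the logarithmic derivative of \<open>sqrt r * u + F\<close> is \<open>O(sqrt r)\<close>, so only \<open>{0..x0}\<close>
  contributes to the exponential type, and there \<open>u\<close> is at most \<open>exp (r * phi 1 x0)\<close> with
  \<open>phi 1 x0\<close> small.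
\<close>

lemma g_growth:
  assumes "\<epsilon> > 0"
  shows "\<exists>C. \<forall>r\<ge>1. g r \<le> C * exp (2 * \<epsilon> * r)"
proof -
  have "(phi 1 \<longlongrightarrow> phi 1 0) (at 0 within {0..1})" using phi_cont[of 1] by (simp add: continuous_on)
  then have "(phi 1 \<longlongrightarrow> 0) (at_right 0)" by (simp add: at_within_Icc_at_right phi_Suc)
  then have "eventually (\<lambda>x. phi 1 x < \<epsilon>) (at_right 0)" using assms by (rule order_tendstoD)
  moreover have "eventually (\<lambda>x. x < 1 \<and> 0 < x) (at_right (0::real))"
    by (intro eventually_at_rightI[of 0 1]) auto
  ultimately have "eventually (\<lambda>x. phi 1 x < \<epsilon> \<and> x < 1 \<and> 0 < x) (at_right 0)" by eventually_elim auto
  then obtain x0 where x0: "phi 1 x0 < \<epsilon>" "x0 < 1" "0 < x0"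
    using eventually_happens'[OF trivial_limit_at_right_real] by blast
  have x01: "x0 \<in> {0..1}" using x0 by auto
  \<comment> \<open>A primitive of s * M / \<open>M x0\<close> + 2 m, which majorises s + 2 m on
    {x0..1}. Its increment times sqrt r bounds the growth of the logarithm of sqrt r * u + F
    there.\<close>
  let ?q = "\<lambda>x. Q x / M x0 + 2 * M x"
  define q where "q = Q 1 / M x0 + 2 * M 1"
  have Q0: "0 \<le> Q x" if "x \<in> {0..1}" for x
    using that M_nonneg s_pos by (intro prim_nonneg) (auto intro!: mult_nonneg_nonneg intro: less_imp_le)
  have q0: "0 \<le> ?q x" if "x \<in> {0..1}" for x
    using Q0[OF that] M_nonneg[OF that] M_pos[of x0] x0 by simp
  have main: "g r \<le> (1 + 2 * M 1) / (2 * M 1) * exp (q\<^sup>2 / (4 * \<epsilon>)) * exp (2 * \<epsilon> * r)" if r: "r \<ge> 1" for r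
  proof -
    let ?u = "U (\<lambda>n. r ^ n)" and ?F = "Fl (\<lambda>n. r ^ n)"
    note P = flux_pairD[OF power_flux_pair[of r]]
    have r0: "0 \<le> r" using r by simp
    have uF: "0 \<le> ?u x" "0 \<le> ?F x" if "x \<in> {0..1}" for x
      using U_power_ge_1[OF r0 that] Fl_power_nonneg[OF r0 that] by auto
    let ?E = "\<lambda>x. (sqrt r * ?u x + ?F x) * exp (- (sqrt r * ?q x))"
    have "?E 1 \<le> ?E x0"
    proof (rule DERIV_nonpos_imp_decreasing_open[where f="?E"])
      show "continuous_on {x0..1} ?E"
        using M_pos[of x0] x0
        by (intro continuous_intros continuous_on_subset[OF P(1)] continuous_on_subset[OF P(2)]
          continuous_on_subset[OF Q_cont] continuous_on_subset[OF prim_cont[OF m_cint]]) auto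
      fix x assume x: "x0 < x" "x < 1"
      then have xx: "0 < x" "x < 1" "x \<in> {0..1}" using x0 by auto
      let ?D = "(sqrt r * (s x * ?F x) + 2 * m x * (r * ?u x)) - sqrt r * (s x * M x / M x0 + 2 * m x) * (sqrt r * ?u x + ?F x)"
      have "(?E has_real_derivative ?D * exp (- (sqrt r * ?q x))) (at x)"
      proof -
        have qd: "(?q has_real_derivative s x * M x / M x0 + 2 * m x) (at x)"
          by (intro DERIV_add DERIV_cdivide DERIV_cmult Q_deriv prim_deriv m_cint xx)
        have ring: "a * X + (X * - (k * w)) * b = (a - k * w * b) * X" for a X k w b :: real
          by (simp add: algebra_simps)
        show ?thesis
          by (rule DERIV_cong[OF DERIV_mult[OF DERIV_add[OF DERIV_cmult[OF P(4)[OF xx(1,2)]] P(5)[OF xx(1,2)]]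
            DERIV_chain2[OF DERIV_exp DERIV_minus[OF DERIV_cmult[OF qd]]]]]) (rule ring)
      qed
      moreover have "?D \<le> 0"
      proof -
        have "sqrt r * (s x + 2 * m x) * (sqrt r * ?u x + ?F x) \<le> sqrt r * (s x * M x / M x0 + 2 * m x) * (sqrt r * ?u x + ?F x)"
          using s_le[of x0 x] x x0 uF[OF xx(3)] r0 by (intro mult_right_mono mult_left_mono add_mono) auto
        moreover have "sqrt r * (s x * ?F x) + 2 * m x * (r * ?u x) \<le> sqrt r * (s x + 2 * m x) * (sqrt r * ?u x + ?F x)"
        proof -
          have "0 \<le> r * s x * ?u x" "0 \<le> 2 * m x * sqrt r * ?F x"
            using r0 s_pos[OF xx(1,2)] m_pos[OF xx(1,2)] uF[OF xx(3)] by auto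
          moreover have ring2: "k * (a + b) * (k * u + f) = k * (a * f) + b * (c * u) + (c * a * u + b * k * f)"
            if "k * k = c" for k a b c u f :: real
            unfolding that[symmetric] by (simp add: algebra_simps)
          have "sqrt r * sqrt r = r" using r0 by simp
          then have "sqrt r * (s x + 2 * m x) * (sqrt r * ?u x + ?F x)
            = sqrt r * (s x * ?F x) + 2 * m x * (r * ?u x) + (r * s x * ?u x + 2 * m x * sqrt r * ?F x)"
            by (rule ring2)
          ultimately show ?thesis by linarith
        qed
        ultimately show ?thesis by linarith
      qed
      ultimately show "\<exists>y. (?E has_real_derivative y) (at x) \<and> y \<le> 0"
        by (meson mult_nonpos_nonneg exp_ge_zero)
    qed (use x0 in auto)
    moreover have "?E x0 \<le> sqrt r * ?u x0 + ?F x0"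
      using uF[OF x01] q0[OF x01] r0 by (intro mult_right_le_one_le) auto
    ultimately have "(sqrt r * ?u 1 + ?F 1) * exp (- (sqrt r * q)) \<le> sqrt r * ?u x0 + ?F x0"
      by (simp add: q_def)
    then have "sqrt r * ?u 1 + ?F 1 \<le> (sqrt r * ?u x0 + ?F x0) * exp (sqrt r * q)"
      by (simp add: exp_minus field_simps)
    moreover have "sqrt r \<le> r" using r real_sqrt_le_iff[of r "r\<^sup>2"] by (simp add: power2_eq_square)
    moreover have ux0: "?u x0 \<le> exp (r * \<epsilon>)"
    proof -
      have sm: "summable (\<lambda>n. inverse (fact n) * (r * \<epsilon>) ^ n)" by (rule summable_exp)
      have "?u x0 \<le> (\<Sum>n. inverse (fact n) * (r * \<epsilon>) ^ n)"
        unfolding U_def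
      proof (rule suminf_le[OF _ U_summable[OF geom_bounded_power x01] sm])
        fix n
        have "phi n x0 \<le> phi 1 x0 ^ n / fact n" by (rule phi_le[OF x01])
        also have "\<dots> \<le> \<epsilon> ^ n / fact n"
          using x0(1) phi_nonneg[OF x01, of 1] by (intro divide_right_mono power_mono) auto
        finally have "r ^ n * phi n x0 \<le> r ^ n * (\<epsilon> ^ n / fact n)" using r0 by (intro mult_left_mono) auto
        then show "r ^ n * phi n x0 \<le> inverse (fact n) * (r * \<epsilon>) ^ n" by (simp add: power_mult_distrib field_simps)
      qed
      then show ?thesis by (simp add: exp_def divide_inverse mult.commute)
    qed
    moreover have "?F x0 \<le> 2 * M 1 * r * ?u x0"
    proof -
      have sF: "summable (\<lambda>n. r ^ Suc n * fl n x0)" by (rule Fl_bound[OF geom_bounded_power[of r]]) (use x01 in blast)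
      have "?F x0 \<le> (\<Sum>n. 2 * M 1 * r * (r ^ n * phi n x0))"
        unfolding Fl_def
      proof (rule suminf_le[OF _ sF summable_mult[OF U_summable[OF geom_bounded_power x01]]])
        fix n
        have "fl n x0 \<le> phi n x0 * (2 * M x0)" by (rule fl_le[OF x01])
        also have "\<dots> \<le> phi n x0 * (2 * M 1)" using M_le[OF x01] phi_nonneg[OF x01] by (intro mult_left_mono) auto
        finally have "r ^ Suc n * fl n x0 \<le> r ^ Suc n * (phi n x0 * (2 * M 1))" using r0 by (intro mult_left_mono) auto
        then show "r ^ Suc n * fl n x0 \<le> 2 * M 1 * r * (r ^ n * phi n x0)" by (simp add: mult_ac)
      qed
      also have "\<dots> = 2 * M 1 * r * ?u x0" unfolding U_def by (rule suminf_mult[OF U_summable[OF geom_bounded_power x01]])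
      finally show ?thesis .
    qed
    ultimately have "?F 1 \<le> (r * exp (r * \<epsilon>) + 2 * M 1 * r * exp (r * \<epsilon>)) * exp (sqrt r * q)"
    proof -
      assume a: "sqrt r * ?u 1 + ?F 1 \<le> (sqrt r * ?u x0 + ?F x0) * exp (sqrt r * q)" "sqrt r \<le> r"
        "?u x0 \<le> exp (r * \<epsilon>)" "?F x0 \<le> 2 * M 1 * r * ?u x0"
      have "?F 1 \<le> (sqrt r * ?u x0 + ?F x0) * exp (sqrt r * q)" using a(1) uF[of 1] r0 
        by (smt (verit) mult_nonneg_nonneg real_sqrt_ge_zero atLeastAtMost_iff)
      also have "\<dots> \<le> (r * ?u x0 + 2 * M 1 * r * ?u x0) * exp (sqrt r * q)"
        using a uF[OF x01] by (intro mult_right_mono add_mono) auto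
      also have "\<dots> \<le> (r * exp (r * \<epsilon>) + 2 * M 1 * r * exp (r * \<epsilon>)) * exp (sqrt r * q)"
        using a(3) r0 M1 by (intro mult_right_mono add_mono mult_left_mono) auto
      finally show ?thesis .
    qed
    moreover have "(r * e + 2 * M 1 * r * e) * e' = r * ((1 + 2 * M 1) * (e * e'))" for e e'
      by (simp add: algebra_simps)
    moreover have "?F 1 = r * (2 * M 1 * g r)" by (simp add: Fl_power)
    ultimately have "r * (2 * M 1 * g r) \<le> r * ((1 + 2 * M 1) * (exp (r * \<epsilon>) * exp (sqrt r * q)))"
      by (simp only:)
    then have "2 * M 1 * g r \<le> (1 + 2 * M 1) * (exp (r * \<epsilon>) * exp (sqrt r * q))"
      using r by (subst (asm) mult_le_cancel_left_pos) auto
    also have "\<dots> \<le> (1 + 2 * M 1) * (exp (q\<^sup>2 / (4 * \<epsilon>)) * exp (2 * \<epsilon> * r))"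
    proof -
      \<comment> \<open>Completing the square gives sqrt r * q \<le> \<epsilon> r + q^2 / (4
        \<epsilon>): the interval {x0..1} costs a second \<epsilon> in the type, whence the 2
        \<epsilon> of the statement.\<close>
      have "0 \<le> (sqrt r * (2 * \<epsilon>) - q)\<^sup>2 / (4 * \<epsilon>)" using assms by simp
      also have "\<dots> = r * \<epsilon> - sqrt r * q + q\<^sup>2 / (4 * \<epsilon>)"
        using assms r0 by (simp add: power2_diff power_mult_distrib field_simps power2_eq_square)
      finally have "r * \<epsilon> + sqrt r * q \<le> q\<^sup>2 / (4 * \<epsilon>) + 2 * \<epsilon> * r" by (simp add: mult.commute)
      then show ?thesis using M1 by (simp flip: exp_add)
    qed
    finally show ?thesis using M1 by (simp add: field_simps)
  qed
  then show ?thesis by blast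
qed

lemma G_growth:
  assumes "\<epsilon> > 0"
  shows "\<exists>C. \<forall>z. norm (G z) \<le> C * exp (\<epsilon> * norm z)"
proof -
  obtain C where C: "\<And>r. r \<ge> 1 \<Longrightarrow> g r \<le> C * exp (\<epsilon> * r)"
    using g_growth[of "\<epsilon> / 2"] assms by auto
  have "g 1 \<ge> 1" by (rule g_ge_1) simp
  have "norm (G z) \<le> max C (g 1) * exp (\<epsilon> * norm z)" for z
  proof (cases "norm z \<ge> 1")
    case True
    have "norm (G z) \<le> C * exp (\<epsilon> * norm z)" using norm_G_le[of z] C[OF True] by linarith
    also have "\<dots> \<le> max C (g 1) * exp (\<epsilon> * norm z)" by (intro mult_right_mono) auto
    finally show ?thesis .
  next
    case False
    have "norm (G z) \<le> g 1 * 1" using norm_G_le[of z] g_mono[of "norm z" 1] False by simp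
    also have "\<dots> \<le> max C (g 1) * exp (\<epsilon> * norm z)" using assms \<open>g 1 \<ge> 1\<close> by (intro mult_mono) auto
    finally show ?thesis .
  qed
  then show ?thesis by blast
qed

end

lemma continuous_on_unit_lim:
  fixes f :: "real \<Rightarrow> real"
  assumes "continuous_on {0..1} f"
  shows "(f \<longlongrightarrow> f 0) (at_right 0)" "(f \<longlongrightarrow> f 1) (at_left 1)"
proof -
  have "(f \<longlongrightarrow> f 0) (at 0 within {0..1})" "(f \<longlongrightarrow> f 1) (at 1 within {0..1})"
    using assms unfolding continuous_on by auto
  then show "(f \<longlongrightarrow> f 0) (at_right 0)" "(f \<longlongrightarrow> f 1) (at_left 1)"
    by (simp_all add: at_within_Icc_at_right at_within_Icc_at_left)
qed

section \<open>Eigenvalues as zeros of G, and the resolvent at the starting point 0\<close>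

context scale_speed begin

lemma M_lim_0: "(M \<longlongrightarrow> 0) (at_right 0)"
  using continuous_on_unit_lim(1)[OF prim_cont[OF m_cint]] by simp

text \<open>|v'| = s |E| \<le> k s, and s \<le> s * M / \<open>M a\<close> to the right of a.
  Multiplying through by \<open>M a\<close> keeps the bound useful as a tends to 0.\<close>

lemma flux_increment_le:
  assumes v: "\<And>x. 0 < x \<Longrightarrow> x < 1 \<Longrightarrow> (v has_real_derivative s x * E x) (at x)"
    and E: "\<And>x. a < x \<Longrightarrow> x < b \<Longrightarrow> \<bar>E x\<bar> \<le> k" and ab: "0 < a" "a \<le> b" "b \<le> 1"
    and c: "continuous_on {a..b} v"
  shows "M a * \<bar>v b - v a\<bar> \<le> k * (Q b - Q a)"
proof -
  have Qc: "continuous_on {a..b} Q" using Q_cont by (rule continuous_on_subset) (use ab in auto)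
  \<comment> \<open>\<sigma> = 1 and \<sigma> = -1 bound the increment from above and from
    below.\<close>
  have *: "M a * (\<sigma> * v b) - k * Q b \<le> M a * (\<sigma> * v a) - k * Q a" if \<sigma>: "\<bar>\<sigma>\<bar> = 1" for \<sigma> :: real
  proof (rule DERIV_nonpos_imp_decreasing_open[OF ab(2)])
    show "continuous_on {a..b} (\<lambda>x. M a * (\<sigma> * v x) - k * Q x)"
      by (intro continuous_intros c Qc)
    fix x assume x: "a < x" "x < b"
    then have xx: "0 < x" "x < 1" using ab by auto
    have "((\<lambda>x. M a * (\<sigma> * v x) - k * Q x) has_real_derivative M a * (\<sigma> * (s x * E x)) - k * (s x * M x)) (at x)"
      by (intro DERIV_diff DERIV_cmult v Q_deriv xx)
    moreover have "M a * (\<sigma> * (s x * E x)) \<le> k * (s x * M x)"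
    proof -
      have "M a * (\<sigma> * (s x * E x)) \<le> \<bar>M a * (\<sigma> * (s x * E x))\<bar>" by simp
      also have "\<dots> = M a * (s x * \<bar>E x\<bar>)" using s_pos[OF xx] M_pos[of a] ab x \<sigma> by (simp add: abs_mult)
      also have "\<dots> \<le> M x * (s x * k)"
        using E[OF x] s_pos[OF xx] M_strict_mono[of a x] M_pos[of a] ab x by (intro mult_mono) auto
      finally show ?thesis by (simp add: mult_ac)
    qed
    ultimately show "\<exists>y. ((\<lambda>x. M a * (\<sigma> * v x) - k * Q x) has_real_derivative y) (at x) \<and> y \<le> 0"
      by (intro exI conjI) auto
  qed
  show ?thesis
    using *[of 1] *[of "-1"] M_pos[of a] ab by (cases "v b \<ge> v a") (auto simp: algebra_simps)
qed

text \<open>An eigenfunction is prescribed through its flux at 0 and may a priori be unbounded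
  there, since \<open>s\<close> need not be integrable. It still grows more slowly than 1 /
  \<open>M\<close>, which is enough for its Wronskian with the Picard solution to vanish at
  0.\<close>

lemma eigenfunction_times_M_tendsto_0:
  assumes v: "\<And>x. 0 < x \<Longrightarrow> x < 1 \<Longrightarrow> (v has_real_derivative s x * E x) (at x)"
    and E0: "(E \<longlongrightarrow> 0) (at_right 0)"
  shows "((\<lambda>x. M x * v x) \<longlongrightarrow> 0) (at_right 0)"
proof (rule tendstoI)
  fix e :: real assume "e > 0"
  have Q1: "0 \<le> Q x" if "x \<in> {0..1}" for x
    using that M_nonneg s_pos by (intro prim_nonneg) (auto intro!: mult_nonneg_nonneg intro: less_imp_le)
  define k where "k = e / (2 * (Q 1 + 1))"
  have Q11: "Q 1 + 1 > 0" using Q1[of 1] by simp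
  then have k: "k > 0" using \<open>e > 0\<close> by (simp add: k_def)
  have "eventually (\<lambda>x. dist (E x) 0 < k) (at_right 0)" using E0 k by (rule tendstoD)
  then obtain d where d: "d > 0" "\<And>x. 0 < x \<Longrightarrow> x < d \<Longrightarrow> \<bar>E x\<bar> < k"
    by (auto simp: eventually_at_right_field)
  define b where "b = min (d / 2) (1 / 2)"
  have b: "0 < b" "b < 1" "b < d" using d(1) by (auto simp: b_def)
  have "((\<lambda>x. M x * \<bar>v b\<bar>) \<longlongrightarrow> 0 * \<bar>v b\<bar>) (at_right 0)" by (intro tendsto_intros M_lim_0)
  then have "eventually (\<lambda>x. dist (M x * \<bar>v b\<bar>) (0 * \<bar>v b\<bar>) < e / 2) (at_right 0)" using \<open>e > 0\<close> by (intro tendstoD) auto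
  moreover have "eventually (\<lambda>x. x < b \<and> 0 < x) (at_right (0::real))"
    using b by (intro eventually_at_rightI[of 0 b]) auto
  ultimately show "eventually (\<lambda>x. dist (M x * v x) 0 < e) (at_right 0)"
  proof eventually_elim
    case (elim x)
    have "M x * \<bar>v b - v x\<bar> \<le> k * (Q b - Q x)"
    proof (rule flux_increment_le[OF v])
      show "continuous_on {x..b} v"
        using v elim b by (intro continuous_at_imp_continuous_on ballI DERIV_isCont[OF v]) auto
      show "\<bar>E y\<bar> \<le> k" if "x < y" "y < b" for y using d(2)[of y] that elim b by auto
    qed (use elim b in auto)
    also have "\<dots> \<le> k * (Q 1 + 1)"
    proof -
      have "Q b \<le> Q 1" using b M_nonneg s_pos
        by (intro prim_mono sM_cint) (auto intro!: mult_nonneg_nonneg intro: less_imp_le)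
      then show ?thesis using k Q1[of x] elim b by (intro mult_left_mono) auto
    qed
    also have "\<dots> = e / 2" using Q11 by (simp add: k_def field_simps)
    finally have 1: "M x * \<bar>v b - v x\<bar> \<le> e / 2" .
    have Mx: "M x > 0" using elim b by (intro M_pos) auto
    have "\<bar>M x * v x\<bar> = M x * \<bar>v x\<bar>" using Mx by (simp add: abs_mult)
    also have "\<dots> \<le> M x * (\<bar>v b\<bar> + \<bar>v b - v x\<bar>)" using Mx by (intro mult_left_mono) auto
    also have "\<dots> < e" using 1 elim Mx by (simp add: distrib_left dist_real_def)
    finally show ?case by (simp add: dist_real_def)
  qed
qed

text \<open>Uniqueness for the Cauchy problem at 1, by a Gronwall argument: (v^2 + E^2) exp q is
  nondecreasing to the right of x, where q is a primitive of s * M / \<open>M x\<close> + 2 l m, and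
  it tends to 0 at 1.\<close>

lemma zero_Cauchy_data_at_1:
  assumes v: "\<And>x. 0 < x \<Longrightarrow> x < 1 \<Longrightarrow> (v has_real_derivative s x * E x) (at x)"
    and E: "\<And>x. 0 < x \<Longrightarrow> x < 1 \<Longrightarrow> (E has_real_derivative 2 * m x * (- l * v x)) (at x)"
    and l: "l > 0" and v1: "(v \<longlongrightarrow> 0) (at_left 1)" and E1: "(E \<longlongrightarrow> 0) (at_left 1)"
    and x: "0 < x" "x < 1"
  shows "v x = 0"
proof -
  let ?q = "\<lambda>y. Q y / M x + 2 * l * M y"
  let ?R = "\<lambda>y. ((v y)\<^sup>2 + (E y)\<^sup>2) * exp (?q y)"
  have inc: "?R x \<le> ?R y" if y: "x < y" "y < 1" for y
  proof (rule DERIV_nonneg_imp_nondecreasing[where f="?R"])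
    fix z assume z: "x \<le> z" "z \<le> y"
    then have zz: "0 < z" "z < 1" using x y by auto
    let ?D = "2 * v z * (s z * E z) + 2 * E z * (2 * m z * (- l * v z))
       + (s z * M z / M x + 2 * l * m z) * ((v z)\<^sup>2 + (E z)\<^sup>2)"
    have qd: "(?q has_real_derivative s z * M z / M x + 2 * l * m z) (at z)"
      by (intro DERIV_add DERIV_cdivide DERIV_cmult Q_deriv prim_deriv m_cint zz)
    have sq: "((\<lambda>y. (v y)\<^sup>2 + (E y)\<^sup>2) has_real_derivative 2 * v z * (s z * E z) + 2 * E z * (2 * m z * (- l * v z))) (at z)"
      by (rule DERIV_cong[OF DERIV_add[OF DERIV_power[OF v[OF zz], of 2] DERIV_power[OF E[OF zz], of 2]]]) (simp add: algebra_simps)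
    have d: "(?R has_real_derivative ?D * exp (?q z)) (at z)"
    proof -
      have ring: "a * X + (X * w) * b = (a + w * b) * X" for a X w b :: real by (simp add: algebra_simps)
      show ?thesis by (rule DERIV_cong[OF DERIV_mult[OF sq DERIV_chain2[OF DERIV_exp qd]]]) (rule ring)
    qed
    have "0 \<le> ?D"
    proof -
      have a: "(s z + 2 * l * m z) * ((v z)\<^sup>2 + (E z)\<^sup>2) \<le> (s z * M z / M x + 2 * l * m z) * ((v z)\<^sup>2 + (E z)\<^sup>2)"
        using s_le[OF x(1) z(1) zz(2)] by (intro mult_right_mono add_right_mono) auto
      have b: "0 \<le> s z * (v z + E z)\<^sup>2" "0 \<le> 2 * l * m z * (v z - E z)\<^sup>2"
        using s_pos[OF zz] m_pos[OF zz] l by simp_all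
      \<comment> \<open>Each of the two cross terms is completed to a square with its own
        density.\<close>
      have "s z * (v z + E z)\<^sup>2 + 2 * l * m z * (v z - E z)\<^sup>2
         = 2 * v z * (s z * E z) + 2 * E z * (2 * m z * (- l * v z)) + (s z + 2 * l * m z) * ((v z)\<^sup>2 + (E z)\<^sup>2)"
        by (simp add: power2_eq_square algebra_simps)
      with a b show ?thesis by linarith
    qed
    then have "0 \<le> ?D * exp (?q z)" by (rule mult_nonneg_nonneg) simp
    then show "\<exists>y. (?R has_real_derivative y) (at z) \<and> 0 \<le> y" using d by blast
  qed (use y in auto)
  note lim1 = continuous_on_unit_lim(2)
  have "(?R \<longlongrightarrow> (0\<^sup>2 + 0\<^sup>2) * exp (Q 1 / M x + 2 * l * M 1)) (at_left 1)"
    using M_pos[of x] x by (intro tendsto_intros v1 E1 lim1 Q_cont prim_cont m_cint) auto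
  moreover have "eventually (\<lambda>y. ?R x \<le> ?R y) (at_left 1)"
    using x inc by (intro eventually_at_leftI[of x 1]) auto
  ultimately have "?R x \<le> (0\<^sup>2 + 0\<^sup>2) * exp (Q 1 / M x + 2 * l * M 1)"
    by (rule tendsto_lowerbound) simp
  then have "(v x)\<^sup>2 + (E x)\<^sup>2 \<le> 0" by (simp add: mult_le_0_iff)
  then show ?thesis by (metis sum_power2_le_zero_iff)
qed

text \<open>The Wronskian of v with the Picard solution u is constant and tends to 0 at 0, so it
  vanishes. A nonzero flux F of u at 1 would give v = u E / F \<longlongrightarrow> 0 there.
  Together with E \<longlongrightarrow> 0 this is zero Cauchy data, and v = 0.\<close>

lemma eigenvalue_imp_G_zero:
  assumes v: "\<And>x. 0 < x \<Longrightarrow> x < 1 \<Longrightarrow> (v has_real_derivative s x * E x) (at x)"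
    and E: "\<And>x. 0 < x \<Longrightarrow> x < 1 \<Longrightarrow> (E has_real_derivative 2 * m x * (- l * v x)) (at x)"
    and l: "l > 0" and E0: "(E \<longlongrightarrow> 0) (at_right 0)" and E1: "(E \<longlongrightarrow> 0) (at_left 1)"
    and nz: "0 < x1" "x1 < 1" "v x1 \<noteq> 0"
  shows "G (- of_real l) = 0"
proof -
  let ?u = "U (\<lambda>n. (- l) ^ n)" and ?F = "Fl (\<lambda>n. (- l) ^ n)"
  note P = flux_pairD[OF power_flux_pair[of "- l"]]
  let ?D = "\<lambda>x. v x * ?F x - ?u x * E x"
  have D': "(?D has_real_derivative 0) (at x)" if x: "0 < x" "x < 1" for x
    by (rule DERIV_cong[OF wronskian_deriv[OF v[OF x] E[OF x] P(4,5)[OF x] refl refl]]) simp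
  obtain C where C: "C \<ge> 0" "\<And>x. x \<in> {0..1} \<Longrightarrow> \<bar>?F x\<bar> \<le> C * M x"
    by (rule Fl_bound[OF geom_bounded_power[of "- l"]]) blast
  note u0 = continuous_on_unit_lim(1)[OF P(1)]
  note lim1 = continuous_on_unit_lim(2)
  have "((\<lambda>x. v x * ?F x) \<longlongrightarrow> 0) (at_right 0)"
  proof (rule Lim_null_comparison)
    show "((\<lambda>x. C * \<bar>M x * v x\<bar>) \<longlongrightarrow> 0) (at_right 0)"
      using tendsto_mult_left[OF tendsto_rabs[OF eigenfunction_times_M_tendsto_0[OF v E0]], of C] by simp
    show "eventually (\<lambda>x. norm (v x * ?F x) \<le> C * \<bar>M x * v x\<bar>) (at_right 0)"
    proof (rule eventually_at_rightI[of 0 1])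
      fix x :: real assume "x \<in> {0<..<1}"
      then have x: "x \<in> {0..1}" by auto
      have "\<bar>v x\<bar> * \<bar>?F x\<bar> \<le> \<bar>v x\<bar> * (C * M x)" using C(2)[OF x] by (intro mult_left_mono) auto
      then show "norm (v x * ?F x) \<le> C * \<bar>M x * v x\<bar>" using M_nonneg[OF x] by (simp add: abs_mult mult_ac)
    qed simp
  qed
  moreover have "((\<lambda>x. ?u x * E x) \<longlongrightarrow> ?u 0 * 0) (at_right 0)" by (intro tendsto_intros u0 E0)
  ultimately have "(?D \<longlongrightarrow> 0 - ?u 0 * 0) (at_right 0)" by (rule tendsto_diff)
  then have Dlim: "(?D \<longlongrightarrow> 0) (at_right 0)" by simp
  have D0: "?D x = 0" if x: "0 < x" "x < 1" for x
  proof -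
    have "?D y = ?D x" if y: "y \<in> {0<..<x}" for y
      by (rule DERIV_isconst3[of 0 1]) (use x y D' in auto)
    then have "eventually (\<lambda>y. ?D y = ?D x) (at_right 0)" using x by (intro eventually_at_rightI[of 0 x]) auto
    then have "(?D \<longlongrightarrow> ?D x) (at_right 0)" by (rule tendsto_eventually)
    from tendsto_unique[OF trivial_limit_at_right_real this Dlim] show ?thesis .
  qed
  have "?F 1 = 0"
  proof (rule ccontr)
    assume F1: "?F 1 \<noteq> 0"
    have lim: "((\<lambda>x. ?u x * E x / ?F x) \<longlongrightarrow> ?u 1 * 0 / ?F 1) (at_left 1)"
      by (intro tendsto_intros lim1 P E1 F1)
    have "eventually (\<lambda>x. ?F x \<noteq> 0) (at_left 1)"
      by (rule tendsto_imp_eventually_ne[OF lim1[OF P(2)] F1])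
    moreover have "eventually (\<lambda>x. 0 < x \<and> x < 1) (at_left (1::real))"
      by (rule eventually_at_leftI[of 0]) auto
    ultimately have "eventually (\<lambda>x. ?u x * E x / ?F x = v x) (at_left 1)"
    proof eventually_elim
      case (elim x)
      then show ?case using D0[of x] by (simp add: field_simps)
    qed
    with lim have "(v \<longlongrightarrow> ?u 1 * 0 / ?F 1) (at_left 1)" by (rule Lim_transform_eventually)
    then have "v x1 = 0" by (intro zero_Cauchy_data_at_1[OF v E l _ E1 nz(1,2)]) auto
    with nz(3) show False by simp
  qed
  then have "g (- l) = 0" using M1 l by (simp add: Fl_power)
  then show ?thesis using G_of_real[of "- l"] by simp
qed

lemma G_zero_imp_eigenfunction:
  assumes "G (- of_real l) = 0"
  shows "flux_pair (U (\<lambda>n. (- l) ^ n)) (Fl (\<lambda>n. (- l) ^ n)) (\<lambda>x. - l * U (\<lambda>n. (- l) ^ n) x)"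
    "Fl (\<lambda>n. (- l) ^ n) 1 = 0" "U (\<lambda>n. (- l) ^ n) 0 = 1"
proof -
  have "g (- l) = 0" using assms G_of_real[of "- l"] by simp
  then show "Fl (\<lambda>n. (- l) ^ n) 1 = 0" by (simp add: Fl_power)
qed (use power_flux_pair[of "- l"] in \<open>simp_all add: U_0\<close>)

lemma flux_pair_prim:
  assumes "flux_pair w F h" "continuous_on {0..1} h" "x \<in> {0..1}"
  shows "F x = prim (\<lambda>y. 2 * m y * h y) x"
  using assms by (intro prim_unique cont_flux_facts(1) flux_pairD[OF assms(1)])

text \<open>Bounds the resolvent at 0 of a function of little mass; for tents at 0 it excludes time
  spent at 0. The flux is at least -\<theta> * \<open>fl 0\<close>, so w 0 exceeds w y by at most
  \<theta> * \<open>phi 1 y\<close>. Averaging this over {0..x} against \<open>m\<close> brings in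
  the mass of w, which equals that of f.\<close>

lemma resolvent_start_le:
  assumes P: "flux_pair w F (\<lambda>x. \<theta> * (w x - f x))" and \<theta>: "\<theta> > 0" and F1: "F 1 = 0"
    and f: "continuous_on {0..1} f" and f01: "\<And>x. x \<in> {0..1} \<Longrightarrow> 0 \<le> f x \<and> f x \<le> 1"
    and w01: "\<And>x. x \<in> {0..1} \<Longrightarrow> 0 \<le> w x \<and> w x \<le> 1" and x: "0 < x" "x < 1"
  shows "w 0 \<le> \<theta> * phi 1 x + prim (\<lambda>y. 2 * m y * f y) 1 / (2 * M x)"
proof -
  note W = flux_pairD[OF P]
  have hc: "continuous_on {0..1} (\<lambda>x. \<theta> * (w x - f x))" by (intro continuous_intros W f)
  \<comment> \<open>Zero flux at both ends means that \<theta> (w - f) has total mass 0 against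
    \<open>m\<close>.\<close>
  have tot: "prim (\<lambda>y. 2 * m y * w y) 1 = prim (\<lambda>y. 2 * m y * f y) 1"
  proof -
    have "0 = prim (\<lambda>y. 2 * m y * (\<theta> * (w y - f y))) 1" using flux_pair_prim[OF P hc, of 1] F1 by simp
    also have "\<dots> = (LBINT y:{0<..<1}. \<theta> * (2 * m y * w y) - \<theta> * (2 * m y * f y))"
      unfolding prim_def by (simp add: algebra_simps)
    also have "\<dots> = \<theta> * prim (\<lambda>y. 2 * m y * w y) 1 - \<theta> * prim (\<lambda>y. 2 * m y * f y) 1"
      unfolding prim_def
      by (subst set_integral_diff(2))
        (use cint_integrable[OF cint_cmult[OF cont_flux_facts(1)[OF W(1)]], of 1 \<theta>]
             cint_integrable[OF cint_cmult[OF cont_flux_facts(1)[OF f]], of 1 \<theta>] in auto)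
    finally show ?thesis using \<theta> by simp
  qed
  have Fb: "\<bar>F y\<bar> \<le> \<theta> * fl 0 y" if y: "y \<in> {0..1}" for y
  proof -
    have "\<bar>F y\<bar> \<le> prim (\<lambda>z. \<theta> * (2 * m z)) y"
      unfolding flux_pair_prim[OF P hc y]
    proof (rule prim_abs_le[OF cont_flux_facts(1)[OF hc] cint_cmult[OF m2_cint(1)] _ y])
      fix z :: real assume z: "0 < z" "z < 1"
      have "\<bar>w z - f z\<bar> \<le> 1" using f01[of z] w01[of z] z by auto
      then have "2 * m z * \<theta> * \<bar>w z - f z\<bar> \<le> 2 * m z * \<theta> * 1"
        using m_pos[OF z] \<theta> by (intro mult_left_mono) auto
      then show "\<bar>2 * m z * (\<theta> * (w z - f z))\<bar> \<le> \<theta> * (2 * m z)"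
        using m_pos[OF z] \<theta> by (simp add: abs_mult mult_ac)
    qed
    then show ?thesis by (simp add: prim_cmult fl_0)
  qed
  have inc: "w 0 \<le> w y + \<theta> * phi 1 y" if y: "y \<in> {0..1}" for y
  proof -
    have "w 0 + \<theta> * phi 1 0 \<le> w y + \<theta> * phi 1 y"
    proof (rule deriv_nonneg_mono[where f="\<lambda>y. w y + \<theta> * phi 1 y" and f'="\<lambda>y. s y * F y + \<theta> * (s y * fl 0 y)"])
      show "continuous_on {0..1} (\<lambda>y. w y + \<theta> * phi 1 y)" by (intro continuous_intros W phi_cont)
      fix z :: real assume z: "0 < z" "z < 1"
      show "((\<lambda>y. w y + \<theta> * phi 1 y) has_real_derivative s z * F z + \<theta> * (s z * fl 0 z)) (at z)"
        using phi_deriv[OF z, of 0] by (intro DERIV_add DERIV_cmult W z) simp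
      have "0 \<le> s z * (F z + \<theta> * fl 0 z)" using Fb[of z] s_pos[OF z] z by (intro mult_nonneg_nonneg) auto
      then show "0 \<le> s z * F z + \<theta> * (s z * fl 0 z)" by (simp add: algebra_simps)
    qed (use y in auto)
    then show ?thesis by (simp add: phi_Suc)
  qed
  have "w 0 * (2 * M x) = (LBINT y:{0<..<x}. w 0 * (2 * m y))" by (simp add: prim_def)
  also have "\<dots> \<le> (LBINT y:{0<..<x}. 2 * m y * w y + \<theta> * phi 1 x * (2 * m y))"
  proof (rule set_integral_mono)
    show "set_integrable lborel {0<..<x} (\<lambda>y. w 0 * (2 * m y))"
      using x by (intro cint_integrable cint_cmult m_cint) auto
    show "set_integrable lborel {0<..<x} (\<lambda>y. 2 * m y * w y + \<theta> * phi 1 x * (2 * m y))"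
      using x by (intro set_integral_add cint_integrable cint_cmult m_cint cont_flux_facts W) auto
    fix y assume y: "y \<in> {0<..<x}"
    have "w 0 \<le> w y + \<theta> * phi 1 y" using inc[of y] y x by auto
    also have "\<dots> \<le> w y + \<theta> * phi 1 x" using phi_mono[of y x 1] y x \<theta> by (intro add_mono mult_left_mono) auto
    finally have "(2 * m y) * w 0 \<le> (2 * m y) * (w y + \<theta> * phi 1 x)"
      using m_pos[of y] y x by (intro mult_left_mono) auto
    then show "w 0 * (2 * m y) \<le> 2 * m y * w y + \<theta> * phi 1 x * (2 * m y)" by (simp add: algebra_simps)
  qed
  also have "\<dots> = prim (\<lambda>y. 2 * m y * w y) x + \<theta> * phi 1 x * (2 * M x)"
    unfolding prim_def
    by (subst set_integral_add(2))
      (use x cint_integrable[OF cont_flux_facts(1)[OF W(1)], of x] cint_integrable[OF cint_cmult[OF m_cint], of x 2] in auto)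
  also have "prim (\<lambda>y. 2 * m y * w y) x \<le> prim (\<lambda>y. 2 * m y * w y) 1"
    using w01 m_pos x by (intro prim_mono cont_flux_facts W) (auto intro!: mult_nonneg_nonneg intro: less_imp_le)
  finally have "w 0 * (2 * M x) \<le> prim (\<lambda>y. 2 * m y * f y) 1 + \<theta> * phi 1 x * (2 * M x)" using tot by simp
  then show ?thesis using M_pos[of x] x by (simp add: field_simps)
qed

text \<open>
  On \<open>{0..x0}\<close> the resolvent \<open>w\<close> is \<open>w 0\<close> times the solution \<open>u\<close>, and the constancy of the Wronskian up to
  the source term on \<open>{x0..1}\<close> determines \<open>w 0\<close> as \<open>x0\<close> tends to \<open>1\<close>.
\<close>

lemma resolvent_start_limit:
  assumes \<theta>: "\<theta> > 0" and "e > 0"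
  shows "\<exists>x1. 0 < x1 \<and> x1 < 1 \<and> (\<forall>x0 w F f. x1 \<le> x0 \<and> x0 < 1 \<and> flux_pair w F (\<lambda>x. \<theta> * (w x - f x)) \<and>
    F 1 = 0 \<and> continuous_on {0..1} f \<and> (\<forall>x\<in>{0..1}. 0 \<le> f x) \<and> (\<forall>x\<in>{0..x0}. f x = 0) \<and>
    prim (\<lambda>x. 2 * m x * f x) 1 = 2 * M 1 \<and> (\<forall>x\<in>{0..1}. 0 \<le> w x) \<longrightarrow> \<bar>w 0 - 1 / g \<theta>\<bar> < e)"
proof -
  let ?u = "U (\<lambda>n. \<theta> ^ n)" and ?F = "Fl (\<lambda>n. \<theta> ^ n)"
  note P = flux_pairD[OF power_flux_pair[of \<theta>]]
  have th0: "0 \<le> \<theta>" using \<theta> by simp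
  \<comment> \<open>Bound for |F|: the masses of w and f against 2 m are both 2 *
    \<open>M 1\<close>, so \<theta> times their sum is 4 \<theta> * \<open>M 1\<close>.\<close>
  define K where "K = 4 * \<theta> * M 1"
  define \<delta> where "\<delta> x = K * (Q 1 - Q x) / M (1/2) + 2 * (?u 1 - ?u x)" for x
  have Mh: "M (1/2) > 0" by (rule M_pos) auto
  have g1: "1 \<le> g \<theta>" by (rule g_ge_1[OF th0])
  have "(\<delta> \<longlongrightarrow> K * (Q 1 - Q 1) / M (1/2) + 2 * (?u 1 - ?u 1)) (at_left 1)"
    unfolding \<delta>_def[abs_def] using Mh
    by (intro tendsto_intros continuous_on_unit_lim Q_cont P) auto
  then have "(\<delta> \<longlongrightarrow> 0) (at_left 1)" by simp
  then have "eventually (\<lambda>x. \<delta> x < e) (at_left 1)" using \<open>e > 0\<close> by (rule order_tendstoD)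
  then obtain b where b: "b < 1" "\<And>x. b < x \<Longrightarrow> x < 1 \<Longrightarrow> \<delta> x < e"
    by (auto simp: eventually_at_left_field)
  define x1 where "x1 = max (1/2) ((b + 1) / 2)"
  have x1: "1/2 \<le> x1" "x1 < 1" "b < x1" using b(1) by (auto simp: x1_def less_max_iff_disj)
  have "\<bar>w 0 - 1 / g \<theta>\<bar> < e"
    if x0: "x1 \<le> x0" "x0 < 1" and W: "flux_pair w F (\<lambda>x. \<theta> * (w x - f x))" and F1: "F 1 = 0"
      and f: "continuous_on {0..1} f" "\<And>x. x \<in> {0..1} \<Longrightarrow> 0 \<le> f x" "\<And>x. x \<in> {0..x0} \<Longrightarrow> f x = 0"
      and mf: "prim (\<lambda>x. 2 * m x * f x) 1 = 2 * M 1" and w0: "\<And>x. x \<in> {0..1} \<Longrightarrow> 0 \<le> w x" for x0 w F f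
  proof -
    note W' = flux_pairD[OF W]
    have x0': "0 < x0" "1/2 \<le> x0" "x0 \<in> {0..1}" using x0 x1 by auto
    have upos: "1 \<le> ?u x" if "x \<in> {0..1}" for x by (rule U_power_ge_1[OF th0 that])
    let ?D = "\<lambda>x. w x * ?F x - ?u x * F x"
    have Dd: "(?D has_real_derivative 2 * m x * (\<theta> * (?u x * f x))) (at x)" if x: "0 < x" "x < 1" for x
      by (rule DERIV_cong[OF wronskian_deriv[OF W'(4,5)[OF x] P(4,5)[OF x] refl refl]]) (simp add: algebra_simps)
    have ufc: "continuous_on {0..1} (\<lambda>x. \<theta> * (?u x * f x))" by (intro continuous_intros P f)
    have Dc: "continuous_on {0..1} ?D" by (intro continuous_intros P W')
    have Dp: "?D x = prim (\<lambda>x. 2 * m x * (\<theta> * (?u x * f x))) x" if "x \<in> {0..1}" for x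
      by (rule prim_unique[OF cont_flux_facts(1)[OF ufc] Dc _ Dd that]) (simp_all add: P(3) W'(3))
    have D0: "?D x = 0" if x: "x \<in> {0..x0}" for x
    proof -
      have "prim (\<lambda>x. 2 * m x * (\<theta> * (?u x * f x))) x = prim (\<lambda>x. 0) x"
        unfolding prim_def by (rule set_lebesgue_integral_cong) (use x f(3) in auto)
      then show ?thesis using Dp[of x] x x0 by (simp add: prim_def set_lebesgue_integral_def)
    qed
    have wx0: "w x0 = w 0 * ?u x0"
    proof -
      have "w x0 / ?u x0 = w 0 / ?u 0"
      proof (rule DERIV_isconst_end[of 0 x0 "\<lambda>x. w x / ?u x"])
        show "continuous_on {0..x0} (\<lambda>x. w x / ?u x)"
        proof (rule continuous_on_divide)
          show "\<forall>x\<in>{0..x0}. ?u x \<noteq> 0"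
          proof
            fix x assume "x \<in> {0..x0}"
            then have "1 \<le> ?u x" using upos[of x] x0 by auto
            then show "?u x \<noteq> 0" by linarith
          qed
        qed (use x0 in \<open>auto intro: continuous_on_subset[OF W'(1)] continuous_on_subset[OF P(1)]\<close>)
        fix x assume x: "0 < x" "x < x0"
        then have xx: "0 < x" "x < 1" using x0 by auto
        have "1 \<le> ?u x" using upos[of x] xx by auto
        then have "?u x \<noteq> 0" by linarith
        from DERIV_divide[OF W'(4)[OF xx] P(4)[OF xx] this]
        show "((\<lambda>x. w x / ?u x) has_real_derivative 0) (at x)"
          by (rule DERIV_cong) (use D0[of x] x in \<open>simp add: algebra_simps\<close>)
      qed (use x0' in auto)
      then show ?thesis using upos[OF x0'(3)] by (simp add: U_0 field_simps)
    qed
    have Fone: "?F 1 = 2 * M 1 * \<theta> * g \<theta>" by (rule Fl_power)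
    have D1: "w 1 * (2 * M 1 * \<theta> * g \<theta>) = prim (\<lambda>x. 2 * m x * (\<theta> * (?u x * f x))) 1"
      using Dp[of 1] F1 Fone by simp
    \<comment> \<open>The source sits in {x0..1}, where u lies between u x0 and u 1. Hence
      \<open>w 1 * g \<theta>\<close> lies between these two values.\<close>
    have up: "prim (\<lambda>x. 2 * m x * (\<theta> * (?u x * f x))) 1 \<le> prim (\<lambda>x. (\<theta> * ?u 1) * (2 * m x * f x)) 1"
    proof (rule prim_mono_fun[OF cont_flux_facts(1)[OF ufc] cint_cmult[OF cont_flux_facts(1)[OF f(1)]]])
      fix x :: real assume x: "0 < x" "x < 1"
      have "?u x \<le> ?u 1" using x by (intro U_power_mono[OF th0]) auto
      then have "(\<theta> * (2 * m x * f x)) * ?u x \<le> (\<theta> * (2 * m x * f x)) * ?u 1"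
        using \<theta> m_pos[OF x] f(2)[of x] x by (intro mult_left_mono) auto
      then show "2 * m x * (\<theta> * (?u x * f x)) \<le> (\<theta> * ?u 1) * (2 * m x * f x)" by (simp add: mult_ac)
    qed simp
    have lo: "prim (\<lambda>x. (\<theta> * ?u x0) * (2 * m x * f x)) 1 \<le> prim (\<lambda>x. 2 * m x * (\<theta> * (?u x * f x))) 1"
    proof (rule prim_mono_fun[OF cint_cmult[OF cont_flux_facts(1)[OF f(1)]] cont_flux_facts(1)[OF ufc]])
      fix x :: real assume x: "0 < x" "x < 1"
      show "(\<theta> * ?u x0) * (2 * m x * f x) \<le> 2 * m x * (\<theta> * (?u x * f x))"
      proof (cases "x \<le> x0")
        case True
        then show ?thesis using f(3)[of x] x by simp
      next
        case False
        then have "?u x0 \<le> ?u x" using x x0' by (intro U_power_mono[OF th0]) auto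
        then have "(\<theta> * (2 * m x * f x)) * ?u x0 \<le> (\<theta> * (2 * m x * f x)) * ?u x"
          using \<theta> m_pos[OF x] f(2)[of x] x by (intro mult_left_mono) auto
        then show ?thesis by (simp add: mult_ac)
      qed
    qed simp
    have k: "0 < 2 * M 1 * \<theta>" using M1 \<theta> by simp
    have "(2 * M 1 * \<theta>) * (w 1 * g \<theta>) \<le> (2 * M 1 * \<theta>) * ?u 1"
      using up unfolding D1[symmetric] prim_cmult mf by (simp add: mult_ac)
    then have hi': "w 1 * g \<theta> \<le> ?u 1" using k by (rule mult_left_le_imp_le)
    have "(2 * M 1 * \<theta>) * ?u x0 \<le> (2 * M 1 * \<theta>) * (w 1 * g \<theta>)"
      using lo unfolding D1[symmetric] prim_cmult mf by (simp add: mult_ac)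
    then have lo': "?u x0 \<le> w 1 * g \<theta>" using k by (rule mult_left_le_imp_le)
    have hc: "continuous_on {0..1} (\<lambda>x. \<theta> * (w x - f x))" by (intro continuous_intros W' f)
    have ci: "cint (\<lambda>y. \<theta> * (2 * m y * w y))" "cint (\<lambda>y. \<theta> * (2 * m y * f y))"
      by (intro cint_cmult cont_flux_facts W' f)+
    have mw: "prim (\<lambda>y. 2 * m y * w y) 1 = 2 * M 1"
    proof -
      have "0 = prim (\<lambda>y. 2 * m y * (\<theta> * (w y - f y))) 1" using flux_pair_prim[OF W hc, of 1] F1 by simp
      also have "\<dots> = (LBINT y:{0<..<1}. \<theta> * (2 * m y * w y) - \<theta> * (2 * m y * f y))"
        unfolding prim_def by (simp add: algebra_simps)
      also have "\<dots> = \<theta> * prim (\<lambda>y. 2 * m y * w y) 1 - \<theta> * prim (\<lambda>y. 2 * m y * f y) 1"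
        unfolding prim_def
        by (subst set_integral_diff(2)) (use ci[THEN cint_integrable, of 1] in auto)
      finally show ?thesis using \<theta> mf by simp
    qed
    have Fb: "\<bar>F x\<bar> \<le> K" if x: "x \<in> {0..1}" for x
    proof -
      have cs: "cint (\<lambda>y. 2 * m y * (\<theta> * (w y + f y)))"
        by (intro cont_flux_facts continuous_intros W' f)
      have "\<bar>F x\<bar> \<le> prim (\<lambda>y. 2 * m y * (\<theta> * (w y + f y))) x"
        unfolding flux_pair_prim[OF W hc x]
      proof (rule prim_abs_le[OF cont_flux_facts(1)[OF hc] cs _ x])
        fix y :: real assume y: "0 < y" "y < 1"
        have "\<bar>w y - f y\<bar> \<le> w y + f y" using w0[of y] f(2)[of y] y by auto
        then have "(2 * m y * \<theta>) * \<bar>w y - f y\<bar> \<le> (2 * m y * \<theta>) * (w y + f y)"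
          using m_pos[OF y] \<theta> by (intro mult_left_mono) auto
        moreover have "\<bar>2 * m y * (\<theta> * (w y - f y))\<bar> = (2 * m y * \<theta>) * \<bar>w y - f y\<bar>"
          using m_pos[OF y] \<theta> by (subst mult.assoc[symmetric], subst abs_mult) simp
        ultimately show "\<bar>2 * m y * (\<theta> * (w y - f y))\<bar> \<le> 2 * m y * (\<theta> * (w y + f y))"
          by (simp only: mult.assoc)
      qed
      also have "\<dots> \<le> prim (\<lambda>y. 2 * m y * (\<theta> * (w y + f y))) 1"
        using x w0 f(2) m_pos \<theta> by (intro prim_mono cs) (auto intro!: mult_nonneg_nonneg add_nonneg_nonneg intro: less_imp_le)
      also have "\<dots> = (LBINT y:{0<..<1}. \<theta> * (2 * m y * w y) + \<theta> * (2 * m y * f y))"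
        unfolding prim_def by (simp add: algebra_simps)
      also have "\<dots> = \<theta> * prim (\<lambda>y. 2 * m y * w y) 1 + \<theta> * prim (\<lambda>y. 2 * m y * f y) 1"
        unfolding prim_def
        by (subst set_integral_add(2)) (use ci[THEN cint_integrable, of 1] in auto)
      also have "\<dots> = K" by (simp add: mw mf K_def)
      finally show ?thesis .
    qed
    have "M x0 * \<bar>w 1 - w x0\<bar> \<le> K * (Q 1 - Q x0)"
      by (rule flux_increment_le[OF W'(4)]) (use x0 x0' Fb in \<open>auto intro: continuous_on_subset[OF W'(1)]\<close>)
    moreover have "M (1/2) * \<bar>w 1 - w x0\<bar> \<le> M x0 * \<bar>w 1 - w x0\<bar>"
      using x0' x0 by (intro mult_right_mono prim_mono m_cint) (auto intro: less_imp_le m_pos)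
    ultimately have a: "\<bar>w 1 - w x0\<bar> \<le> K * (Q 1 - Q x0) / M (1/2)"
      using Mh by (simp add: field_simps)
    have u01: "?u x0 \<le> ?u 1" using x0' x0 by (intro U_power_mono[OF th0]) auto
    have "\<bar>w 1 - ?u x0 / g \<theta>\<bar> \<le> (?u 1 - ?u x0) / g \<theta>"
    proof -
      have "?u x0 / g \<theta> \<le> w 1" "w 1 \<le> ?u 1 / g \<theta>" using hi' lo' g1 by (simp_all add: field_simps)
      then show ?thesis by (simp add: diff_divide_distrib)
    qed
    also have "\<dots> \<le> ?u 1 - ?u x0" using g1 u01 divide_left_mono[of 1 "g \<theta>" "?u 1 - ?u x0"] by simp
    finally have b': "\<bar>w 1 - ?u x0 / g \<theta>\<bar> \<le> ?u 1 - ?u x0" .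
    \<comment> \<open>u x0 is at least 1, so passing from w 0 to w x0 = w 0 * u x0 can only enlarge
      the error.\<close>
    have "\<bar>w 0 - 1 / g \<theta>\<bar> * 1 \<le> \<bar>w 0 - 1 / g \<theta>\<bar> * ?u x0"
      using upos[OF x0'(3)] by (intro mult_left_mono) auto
    also have "\<dots> = \<bar>(w 0 - 1 / g \<theta>) * ?u x0\<bar>"
      using upos[OF x0'(3)] by (simp add: abs_mult)
    also have "\<dots> = \<bar>w x0 - ?u x0 / g \<theta>\<bar>"
      by (simp add: wx0 left_diff_distrib)
    also have "\<dots> \<le> \<delta> x0"
    proof -
      have "\<bar>q - c\<bar> \<le> A + 2 * B" if "\<bar>p - q\<bar> \<le> A" "\<bar>p - c\<bar> \<le> B" "0 \<le> B" for p q c A B :: real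
        using that by linarith
      from this[OF a b'] u01 show ?thesis by (simp add: \<delta>_def)
    qed
    also have "\<dots> < e" using b(2)[of x0] x0 x1 by auto
    finally show ?thesis by simp
  qed
  then show ?thesis using x1 by (intro exI[of _ x1]) auto
qed

end

text \<open>Translates finiteness of the boundary functionals, which are extended nonnegative
  integrals, into Lebesgue integrability. Continuity inside (0,1) supplies measurability.\<close>

lemma set_integrable_of_nn_finite:
  fixes h :: "real \<Rightarrow> real"
  assumes c: "continuous_on {0<..<1} h" and nn: "\<And>x. 0 < x \<Longrightarrow> x < 1 \<Longrightarrow> 0 \<le> h x"
    and A: "A \<in> sets borel" "A \<subseteq> {0<..<1}" and fin: "(\<integral>\<^sup>+x\<in>A. ennreal (h x) \<partial>lborel) < \<infinity>"
  shows "set_integrable lborel A h"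
  unfolding set_integrable_def
proof (rule integrableI_nonneg)
  have "(\<lambda>x. indicator {0<..<1} x *\<^sub>R h x) \<in> borel_measurable borel"
    using borel_measurable_continuous_on_indicator[OF _ c] by simp
  then have "(\<lambda>x. indicator A x *\<^sub>R (indicator {0<..<1} x *\<^sub>R h x)) \<in> borel_measurable borel"
    using A(1) by measurable
  moreover have "(\<lambda>x. indicator A x *\<^sub>R (indicator {0<..<1} x *\<^sub>R h x)) = (\<lambda>x. indicator A x *\<^sub>R h x)"
    using A(2) by (auto simp: fun_eq_iff indicator_def)
  ultimately show "(\<lambda>x. indicator A x *\<^sub>R h x) \<in> borel_measurable lborel" by simp
  show "AE x in lborel. 0 \<le> indicator A x *\<^sub>R h x"
  proof (rule AE_I2)
    fix x show "0 \<le> indicator A x *\<^sub>R h x" using nn[of x] A(2) by (cases "x \<in> A") auto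
  qed
  have "(\<integral>\<^sup>+x. ennreal (indicator A x *\<^sub>R h x) \<partial>lborel) = (\<integral>\<^sup>+x\<in>A. ennreal (h x) \<partial>lborel)"
    by (intro nn_integral_cong) (auto split: split_indicator)
  then show "(\<integral>\<^sup>+x. ennreal (indicator A x *\<^sub>R h x) \<partial>lborel) < \<infinity>" using fin by simp
qed

lemma nn_finite_of_set_integrable:
  fixes h :: "real \<Rightarrow> real"
  assumes "set_integrable lborel A h" "\<And>x. x \<in> A \<Longrightarrow> 0 \<le> h x"
  shows "(\<integral>\<^sup>+x\<in>A. ennreal (h x) \<partial>lborel) = ennreal (LBINT x:A. h x)"
proof -
  have "(\<integral>\<^sup>+x\<in>A. ennreal (h x) \<partial>lborel) = (\<integral>\<^sup>+x. ennreal (indicator A x *\<^sub>R h x) \<partial>lborel)"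
    by (intro nn_integral_cong) (auto split: split_indicator)
  also have "\<dots> = ennreal (LBINT x:A. h x)"
    unfolding set_lebesgue_integral_def
    using assms by (intro nn_integral_eq_integral AE_I2) (auto simp: set_integrable_def split: split_indicator)
  finally show ?thesis .
qed

section \<open>Scale and speed\<close>

locale coefficients =
  fixes a b :: "real \<Rightarrow> real"
  assumes a_cont: "continuous_on {0<..<1} a" and b_cont: "continuous_on {0<..<1} b"
    and b_pos: "\<And>x. 0 < x \<Longrightarrow> x < 1 \<Longrightarrow> 0 < b x"
begin

abbreviation s :: "real \<Rightarrow> real" where "s \<equiv> scale_deriv a b"
abbreviation m :: "real \<Rightarrow> real" where "m \<equiv> speed_density a b"
abbreviation S :: "real \<Rightarrow> real" where "S \<equiv> scale_fun a b"

lemma interval_integral_deriv: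
  assumes c: "continuous_on {0<..<1} (h :: real \<Rightarrow> real)" and x: "0 < x" "x < 1"
  shows "((\<lambda>u. LBINT y=ereal (1/2)..ereal u. h y) has_real_derivative h x) (at x)"
proof -
  \<comment> \<open>A compact interval inside (0,1) that contains both x and the base point 1/2, on
    which the fundamental theorem of calculus applies.\<close>
  define l where "l = min (x / 2) (1 / 4)"
  define r where "r = max ((x + 1) / 2) (3 / 4)"
  have lr: "0 < l" "l < x" "x < r" "r < 1" "l \<le> 1/2" "1/2 \<le> r"
    using x by (auto simp: l_def r_def min_def max_def)
  have "continuous_on {l..r} h" using c by (rule continuous_on_subset) (use lr in auto)
  from interval_integral_FTC2[OF lr(5,6) this, of x]
  have "((\<lambda>u. LBINT y=ereal (1/2)..ereal u. h y) has_vector_derivative h x) (at x within {l..r})" using lr by simp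
  then show ?thesis using lr
    by (simp add: has_real_derivative_iff_has_vector_derivative at_within_Icc_at)
qed

lemma s_pos [simp]: "0 < s x"
  by (simp add: scale_deriv_def)

lemma s_deriv: "0 < x \<Longrightarrow> x < 1 \<Longrightarrow> (s has_real_derivative - (2 * a x / b x) * s x) (at x)"
proof -
  assume x: "0 < x" "x < 1"
  have bn: "\<forall>x\<in>{0<..<1}. b x \<noteq> 0" using b_pos by (auto simp: less_imp_neq[symmetric])
  have "((\<lambda>u. LBINT y=ereal (1/2)..ereal u. 2 * a y / b y) has_real_derivative 2 * a x / b x) (at x)"
    by (intro interval_integral_deriv x continuous_intros a_cont b_cont bn)
  from DERIV_chain2[OF DERIV_exp DERIV_minus[OF this]]
  show ?thesis unfolding scale_deriv_def[abs_def] by (simp add: mult.commute)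
qed

lemma s_cont: "continuous_on {0<..<1} s"
  by (intro continuous_at_imp_continuous_on ballI DERIV_isCont[OF s_deriv]) auto

lemma m_pos: "0 < x \<Longrightarrow> x < 1 \<Longrightarrow> 0 < m x"
  using b_pos[of x] by (simp add: speed_density_def)

lemma m_cont: "continuous_on {0<..<1} m"
  unfolding speed_density_def[abs_def]
  by (intro continuous_intros s_cont b_cont) (use b_pos in \<open>auto simp: less_imp_neq[symmetric] scale_deriv_def\<close>)

lemma S_deriv: "0 < x \<Longrightarrow> x < 1 \<Longrightarrow> (S has_real_derivative s x) (at x)"
  unfolding scale_fun_def[abs_def] by (rule interval_integral_deriv[OF s_cont])

lemma S_strict_mono: "0 < x \<Longrightarrow> x < y \<Longrightarrow> y < 1 \<Longrightarrow> S x < S y"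
  by (rule DERIV_pos_imp_increasing[of x y S]) (auto intro!: exI S_deriv)

lemma S_mono: "0 < x \<Longrightarrow> x \<le> y \<Longrightarrow> y < 1 \<Longrightarrow> S x \<le> S y"
  using S_strict_mono[of x y] by (cases "x = y") auto

lemma S_diff: "0 < x \<Longrightarrow> x \<le> y \<Longrightarrow> y < 1 \<Longrightarrow> (\<integral>\<^sup>+z\<in>{x..y}. ennreal (s z) \<partial>lborel) = ennreal (S y - S x)"
proof -
  assume x: "0 < x" "x \<le> y" "y < 1"
  have "(\<integral>\<^sup>+z. ennreal (s z) * indicator {x..y} z \<partial>lborel)
      = (\<integral>\<^sup>+z. ennreal (indicator {0<..<1} z * s z) * indicator {x..y} z \<partial>lborel)"
    using x by (intro nn_integral_cong) (auto split: split_indicator)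
  also have "\<dots> = ennreal (S y - S x)"
  proof (rule nn_integral_FTC_Icc)
    show "(\<lambda>z. indicator {0<..<1} z * s z) \<in> borel_measurable borel"
      using borel_measurable_continuous_on_indicator[OF _ s_cont] by simp
    fix z assume "z \<in> {x..y}"
    then have z: "x \<le> z" "z \<le> y" by auto
    then have "0 < z" "z < 1" using x by auto
    then show "DERIV S z :> indicator {0<..<1} z * s z" using S_deriv[of z] by simp
    show "0 \<le> indicator {0<..<1} z * s z" by (simp add: less_imp_le)
  qed (use x in \<open>auto simp: less_imp_le\<close>)
  finally show ?thesis .
qed

text \<open>The drift \<open>a\<close> cancels against the logarithmic derivative -2 a / b of
  \<open>s\<close>, which puts the generator into the form (1/2) d/dM d/dS.\<close>

lemma flux_deriv:
  assumes f: "C2_interior f" and x: "0 < x" "x < 1"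
  shows "(f has_real_derivative deriv f x) (at x)"
    "((\<lambda>x. deriv f x / s x) has_real_derivative 2 * m x * diff_op a b f x) (at x)"
proof -
  have *: "(h has_real_derivative deriv h x) (at x)" if h: "h C1_differentiable_on {0<..<1}" for h :: "real \<Rightarrow> real"
    using h x unfolding C1_differentiable_on_def
    by (metis DERIV_imp_deriv greaterThanLessThan_iff has_real_derivative_iff_has_vector_derivative)
  show 1: "(f has_real_derivative deriv f x) (at x)" using f * by (simp add: C2_interior_def)
  have 2: "(deriv f has_real_derivative deriv (deriv f) x) (at x)" using f * by (simp add: C2_interior_def)
  show "((\<lambda>x. deriv f x / s x) has_real_derivative 2 * m x * diff_op a b f x) (at x)"
    by (rule DERIV_cong[OF DERIV_divide[OF 2 s_deriv[OF x]]])
      (use s_pos[of x] b_pos[OF x] in \<open>simp_all add: speed_density_def diff_op_def field_simps less_imp_neq[symmetric] del: s_pos\<close>)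
qed

lemma nn_integral_speed_measure:
  assumes "f \<in> borel_measurable borel"
  shows "(\<integral>\<^sup>+x. f x \<partial>speed_measure a b) = (\<integral>\<^sup>+x\<in>{0<..<1}. ennreal (m x) * f x \<partial>lborel)"
proof -
  have m: "(\<lambda>x. if x \<in> {0<..<1} then ennreal (m x) else 0) \<in> borel_measurable borel"
  proof -
    have "(\<lambda>x. indicator {0<..<1} x *\<^sub>R m x) \<in> borel_measurable borel"
      using borel_measurable_continuous_on_indicator[OF _ m_cont] by simp
    then have "(\<lambda>x. ennreal (indicator {0<..<1} x *\<^sub>R m x)) \<in> borel_measurable borel" by measurable
    moreover have "(\<lambda>x. ennreal (indicator {0<..<1} x *\<^sub>R m x)) = (\<lambda>x. if x \<in> {0<..<1} then ennreal (m x) else 0)"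
      by (auto simp: fun_eq_iff)
    ultimately show ?thesis by simp
  qed
  have "(\<integral>\<^sup>+x. f x \<partial>speed_measure a b) = (\<integral>\<^sup>+x. (if x \<in> {0<..<1} then ennreal (m x) else 0) * f x \<partial>restrict_space lborel {0..1})"
    unfolding speed_measure_def
    by (rule nn_integral_density) (use m assms in \<open>auto intro!: measurable_restrict_space1\<close>)
  also have "\<dots> = (\<integral>\<^sup>+x\<in>{0<..<1}. ennreal (m x) * f x \<partial>lborel)"
    by (subst nn_integral_restrict_space) (auto intro!: nn_integral_cong split: split_indicator)
  finally show ?thesis .
qed

lemma sets_speed_measure: "sets (speed_measure a b) = sets unit_borel"
  by (simp add: speed_measure_def sets_restrict_space)

lemma emeasure_speed_measure:
  assumes "A \<in> sets borel" "A \<subseteq> {0..1}"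
  shows "emeasure (speed_measure a b) A = (\<integral>\<^sup>+x\<in>A \<inter> {0<..<1}. ennreal (m x) \<partial>lborel)"
proof -
  have "A \<in> sets (speed_measure a b)"
    using assms by (auto simp: sets_speed_measure sets_restrict_space)
  then have "emeasure (speed_measure a b) A = (\<integral>\<^sup>+x. indicator A x \<partial>speed_measure a b)" by simp
  also have "\<dots> = (\<integral>\<^sup>+x\<in>{0<..<1}. ennreal (m x) * indicator A x \<partial>lborel)"
    using assms by (intro nn_integral_speed_measure) auto
  also have "\<dots> = (\<integral>\<^sup>+x\<in>A \<inter> {0<..<1}. ennreal (m x) \<partial>lborel)"
    by (intro nn_integral_cong) (auto split: split_indicator)
  finally show ?thesis .
qed

lemma S_cont: "continuous_on {0<..<1} S"
  by (intro continuous_at_imp_continuous_on ballI DERIV_isCont[OF S_deriv]) auto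

lemma N0_eq: "N0 a b = (\<integral>\<^sup>+x\<in>{0<..1/2}. ennreal (m x) * ennreal (S (1/2) - S x) \<partial>lborel)"
proof -
  have "(\<lambda>x. indicator {0<..<1} x *\<^sub>R S x) \<in> borel_measurable borel"
    using borel_measurable_continuous_on_indicator[OF _ S_cont] by simp
  then have [measurable]: "(\<lambda>x. ennreal (S (1/2) - indicator {0<..<1} x *\<^sub>R S x) * indicator {0<..1/2} x) \<in> borel_measurable borel"
    by measurable
  have "N0 a b = (\<integral>\<^sup>+x. ennreal (S (1/2) - indicator {0<..<1} x *\<^sub>R S x) * indicator {0<..1/2} x \<partial>speed_measure a b)"
    unfolding N0_def by (intro nn_integral_cong) (auto split: split_indicator)
  also have "\<dots> = (\<integral>\<^sup>+x\<in>{0<..<1}. ennreal (m x) * (ennreal (S (1/2) - indicator {0<..<1} x *\<^sub>R S x) * indicator {0<..1/2} x) \<partial>lborel)"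
    by (rule nn_integral_speed_measure) measurable
  also have "\<dots> = (\<integral>\<^sup>+x\<in>{0<..1/2}. ennreal (m x) * ennreal (S (1/2) - S x) \<partial>lborel)"
    by (intro nn_integral_cong) (auto split: split_indicator)
  finally show ?thesis .
qed

lemma N1_eq: "N1 a b = (\<integral>\<^sup>+x\<in>{1/2..<1}. ennreal (m x) * ennreal (S x - S (1/2)) \<partial>lborel)"
proof -
  have "(\<lambda>x. indicator {0<..<1} x *\<^sub>R S x) \<in> borel_measurable borel"
    using borel_measurable_continuous_on_indicator[OF _ S_cont] by simp
  then have [measurable]: "(\<lambda>x. ennreal (indicator {0<..<1} x *\<^sub>R S x - S (1/2)) * indicator {1/2..<1} x) \<in> borel_measurable borel"
    by measurable
  have "N1 a b = (\<integral>\<^sup>+x. ennreal (indicator {0<..<1} x *\<^sub>R S x - S (1/2)) * indicator {1/2..<1} x \<partial>speed_measure a b)"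
    unfolding N1_def by (intro nn_integral_cong) (auto split: split_indicator)
  also have "\<dots> = (\<integral>\<^sup>+x\<in>{0<..<1}. ennreal (m x) * (ennreal (indicator {0<..<1} x *\<^sub>R S x - S (1/2)) * indicator {1/2..<1} x) \<partial>lborel)"
    by (rule nn_integral_speed_measure) measurable
  also have "\<dots> = (\<integral>\<^sup>+x\<in>{1/2..<1}. ennreal (m x) * ennreal (S x - S (1/2)) \<partial>lborel)"
    by (intro nn_integral_cong) (auto split: split_indicator)
  finally show ?thesis .
qed

text \<open>In \<open>N0\<close> and \<open>N1\<close> the density \<open>m\<close> is weighted with
  a scale difference that is bounded below away from 1/2. Their finiteness thus gives finite speed
  mass near the ends.\<close>

lemma m_nn_finite_of_weight:
  assumes fin: "(\<integral>\<^sup>+x\<in>B. ennreal (m x) * ennreal (h x) \<partial>lborel) < \<infinity>" and A: "A \<in> sets borel" "A \<subseteq> {0<..<1}" "A \<subseteq> B"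
    and k: "k > 0" "\<And>x. x \<in> A \<Longrightarrow> k \<le> h x"
  shows "set_integrable lborel A m"
proof (rule set_integrable_of_nn_finite[OF m_cont _ A(1,2)])
  have mm: "(\<lambda>x. ennreal (m x) * indicator A x) \<in> borel_measurable borel"
  proof -
    have "(\<lambda>x. indicator {0<..<1} x *\<^sub>R m x) \<in> borel_measurable borel"
      using borel_measurable_continuous_on_indicator[OF _ m_cont] by simp
    then have "(\<lambda>x. ennreal (indicator {0<..<1} x *\<^sub>R m x) * indicator A x) \<in> borel_measurable borel" using A by measurable
    moreover have "(\<lambda>x. ennreal (indicator {0<..<1} x *\<^sub>R m x) * indicator A x) = (\<lambda>x. ennreal (m x) * indicator A x)"
      using A by (auto simp: fun_eq_iff indicator_def)
    ultimately show ?thesis by simp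
  qed
  have "(\<integral>\<^sup>+x\<in>A. ennreal (m x) \<partial>lborel) * ennreal k = (\<integral>\<^sup>+x. (ennreal (m x) * indicator A x) * ennreal k \<partial>lborel)"
    by (rule nn_integral_multc[symmetric]) (use mm in simp)
  also have "\<dots> \<le> (\<integral>\<^sup>+x\<in>B. ennreal (m x) * ennreal (h x) \<partial>lborel)"
    using A k by (intro nn_integral_mono) (auto split: split_indicator intro!: mult_left_mono ennreal_leI)
  finally have "(\<integral>\<^sup>+x\<in>A. ennreal (m x) \<partial>lborel) * ennreal k < \<infinity>" using fin by (rule order_le_less_trans)
  then show "(\<integral>\<^sup>+x\<in>A. ennreal (m x) \<partial>lborel) < \<infinity>"
    using k(1) by (auto simp: ennreal_mult_less_top top.not_eq_extremum)
qed (use m_pos in \<open>auto intro: less_imp_le\<close>)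

lemma sm_measurable:
  "(\<lambda>x. ennreal (indicator {0<..<1} x *\<^sub>R s x)) \<in> borel_measurable borel"
  "(\<lambda>x. ennreal (indicator {0<..<1} x *\<^sub>R m x)) \<in> borel_measurable borel"
proof -
  have "(\<lambda>x. indicator {0<..<1} x *\<^sub>R s x) \<in> borel_measurable borel"
    "(\<lambda>x. indicator {0<..<1} x *\<^sub>R m x) \<in> borel_measurable borel"
    using borel_measurable_continuous_on_indicator[OF _ s_cont] borel_measurable_continuous_on_indicator[OF _ m_cont]
    by simp_all
  then show "(\<lambda>x. ennreal (indicator {0<..<1} x *\<^sub>R s x)) \<in> borel_measurable borel"
    "(\<lambda>x. ennreal (indicator {0<..<1} x *\<^sub>R m x)) \<in> borel_measurable borel" by measurable
qed

end

text \<open>At 0 the requirement is \<open>N0\<close>, which is finite for reflecting and entrance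
  boundaries alike, whereas \<open>Sigma0\<close> is infinite at an entrance boundary.\<close>

locale regular_boundaries = coefficients +
  assumes N0: "N0 a b < \<infinity>" and N1: "N1 a b < \<infinity>" and Sigma1: "Sigma1 a b < \<infinity>"
begin

lemma m_integrable: "set_integrable lborel {0<..<1} m"
proof -
  have 1: "set_integrable lborel {0<..1/4} m"
  proof (rule m_nn_finite_of_weight[OF N0[unfolded N0_eq]])
    show "S (1/2) - S (1/4) > 0" using S_strict_mono[of "1/4" "1/2"] by simp
    show "S (1/2) - S (1/4) \<le> S (1/2) - S x" if "x \<in> {0<..1/4}" for x
      using S_mono[of x "1/4"] that by auto
  qed auto
  have 2: "set_integrable lborel {3/4..<1} m"
  proof (rule m_nn_finite_of_weight[OF N1[unfolded N1_eq]])
    show "S (3/4) - S (1/2) > 0" using S_strict_mono[of "1/2" "3/4"] by simp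
    show "S (3/4) - S (1/2) \<le> S x - S (1/2)" if "x \<in> {3/4..<1}" for x
      using S_mono[of "3/4" x] that by auto
  qed auto
  have 3: "set_integrable lborel {1/4..3/4} m"
    by (rule borel_integrable_atLeastAtMost') (rule continuous_on_subset[OF m_cont], auto)
  have "set_integrable lborel ({0<..1/4} \<union> {1/4..3/4} \<union> {3/4..<1}) m"
    by (intro set_integrable_Un 1 2 3) auto
  moreover have "{0<..1/4} \<union> {1/4..3/4} \<union> {3/4..<1} = {0<..<1::real}" by auto
  ultimately show ?thesis by simp
qed

lemma m_cint: "cint m"
  by (intro cintI m_cont m_integrable)

lemma M_nonneg': "x \<in> {0..1} \<Longrightarrow> 0 \<le> prim m x"
  using m_pos by (intro prim_nonneg) (auto intro: less_imp_le)

lemma M_nn: "x \<in> {0..1} \<Longrightarrow> ennreal (prim m x) = (\<integral>\<^sup>+z\<in>{0<..<x}. ennreal (m z) \<partial>lborel)"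
  unfolding prim_def
  by (rule nn_finite_of_set_integrable[symmetric]) (use cint_integrable[OF m_cint] m_pos in \<open>auto intro: less_imp_le\<close>)

text \<open>In \<open>Sigma1\<close> the density \<open>s\<close> is weighted with the mass of
  {1/2<..x}, which from 3/4 on is at least the positive mass c of {1/2<..3/4}.\<close>

lemma s_integrable_1: "set_integrable lborel {3/4..<1} s"
proof (rule set_integrable_of_nn_finite[OF s_cont])
  define c where "c = emeasure (speed_measure a b) {1/2<..3/4}"
  have c_eq: "c = (\<integral>\<^sup>+x\<in>{1/2<..3/4}. ennreal (m x) \<partial>lborel)"
    unfolding c_def by (subst emeasure_speed_measure) (auto intro!: nn_integral_cong split: split_indicator)
  have "c \<noteq> 0"
  proof
    assume "c = 0"
    moreover have mm: "(\<lambda>x. ennreal (indicator {0<..<1} x *\<^sub>R m x) * indicator {1/2<..3/4} x) \<in> borel_measurable lborel"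
      using sm_measurable(2) by measurable
    moreover have "c = (\<integral>\<^sup>+x. ennreal (indicator {0<..<1} x *\<^sub>R m x) * indicator {1/2<..3/4} x \<partial>lborel)"
      unfolding c_eq by (intro nn_integral_cong) (auto split: split_indicator)
    ultimately have "AE x in lborel. ennreal (indicator {0<..<1} x *\<^sub>R m x) * indicator {1/2<..3/4} x = 0"
      using nn_integral_0_iff_AE[OF mm] by simp
    then have "AE x in lborel. x \<notin> {1/2<..3/4::real}"
    proof eventually_elim
      case (elim x)
      show ?case
      proof
        assume x: "x \<in> {1/2<..3/4}"
        with elim m_pos[of x] show False by (auto split: split_indicator_asm)
      qed
    qed
    then have "emeasure lborel {1/2<..3/4::real} = 0"
      by (subst (asm) AE_iff_measurable[where N="{1/2<..3/4}"]) auto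
    then show False by simp
  qed
  have sm: "(\<lambda>x. ennreal (s x) * indicator {3/4..<1} x) \<in> borel_measurable lborel"
  proof -
    have "(\<lambda>x. ennreal (indicator {0<..<1} x *\<^sub>R s x) * indicator {3/4..<1} x) \<in> borel_measurable borel"
      using sm_measurable(1) by measurable
    moreover have "(\<lambda>x. ennreal (indicator {0<..<1} x *\<^sub>R s x) * indicator {3/4..<1} x) = (\<lambda>x. ennreal (s x) * indicator {3/4..<1} x)"
      by (auto simp: fun_eq_iff indicator_def)
    ultimately show ?thesis by simp
  qed
  have "c * (\<integral>\<^sup>+x\<in>{3/4..<1}. ennreal (s x) \<partial>lborel) = (\<integral>\<^sup>+x. c * (ennreal (s x) * indicator {3/4..<1} x) \<partial>lborel)"
    by (rule nn_integral_cmult[symmetric]) (rule sm)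
  also have "\<dots> \<le> Sigma1 a b"
    unfolding Sigma1_def
  proof (intro nn_integral_mono)
    fix x :: real
    show "c * (ennreal (s x) * indicator {3/4..<1} x) \<le> emeasure (speed_measure a b) {1/2<..x} * ennreal (s x) * indicator {1/2..<1} x"
    proof (cases "x \<in> {3/4..<1}")
      case True
      then have "c \<le> emeasure (speed_measure a b) {1/2<..x}"
        unfolding c_def by (intro emeasure_mono) (auto simp: sets_speed_measure sets_restrict_space)
      then show ?thesis using True by (auto intro: mult_right_mono)
    qed simp
  qed
  finally have "c * (\<integral>\<^sup>+x\<in>{3/4..<1}. ennreal (s x) \<partial>lborel) < \<infinity>" using Sigma1 by (rule order_le_less_trans)
  then show "(\<integral>\<^sup>+x\<in>{3/4..<1}. ennreal (s x) \<partial>lborel) < \<infinity>"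
    using \<open>c \<noteq> 0\<close> by (auto simp: ennreal_mult_less_top)
qed (auto simp: less_imp_le)

text \<open>On {0<..1/2} Tonelli turns the integral of \<open>s * M\<close> into that of
  \<open>m\<close> times scale differences, which is \<open>N0\<close>. Near 1 \<open>s\<close> is
  integrable and \<open>M\<close> bounded.\<close>

lemma sM_integrable: "set_integrable lborel {0<..<1} (\<lambda>x. s x * prim m x)"
proof -
  have c: "continuous_on {0<..<1} (\<lambda>x. s x * prim m x)"
    by (intro continuous_intros s_cont continuous_on_subset[OF prim_cont[OF m_cint]]) auto
  have nn: "0 \<le> s x * prim m x" if "0 < x" "x < 1" for x
    using M_nonneg'[of x] that by (intro mult_nonneg_nonneg) (auto simp: less_imp_le)
  have 1: "set_integrable lborel {0<..1/2} (\<lambda>x. s x * prim m x)"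
  proof (rule set_integrable_of_nn_finite[OF c nn])
    let ?s = "\<lambda>x. ennreal (indicator {0<..<1} x *\<^sub>R s x)" and ?m = "\<lambda>x. ennreal (indicator {0<..<1} x *\<^sub>R m x)"
    note [measurable] = sm_measurable
    \<comment> \<open>The integrand of the double integral over 0 < z < y \<le> 1/2. The indicators
      of {0<..<1} in \<open>?s\<close> and \<open>?m\<close> make it measurable on the whole
      plane.\<close>
    define f where "f = (\<lambda>(y, z). ?s y * ?m z * (if 0 < z \<and> z < y \<and> y \<le> 1/2 then 1 else 0))"
    have fm: "f \<in> borel_measurable (lborel \<Otimes>\<^sub>M lborel)" unfolding f_def by measurable
    have "(\<integral>\<^sup>+x\<in>{0<..1/2}. ennreal (s x * prim m x) \<partial>lborel) = (\<integral>\<^sup>+y. (\<integral>\<^sup>+z. f (y, z) \<partial>lborel) \<partial>lborel)"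
    proof (rule nn_integral_cong)
      fix y :: real
      show "ennreal (s y * prim m y) * indicator {0<..1/2} y = (\<integral>\<^sup>+z. f (y, z) \<partial>lborel)"
      proof (cases "y \<in> {0<..1/2}")
        case True
        then have y: "0 < y" "y \<le> 1/2" by auto
        have "ennreal (s y * prim m y) = ennreal (s y) * (\<integral>\<^sup>+z\<in>{0<..<y}. ennreal (m z) \<partial>lborel)"
          using y M_nonneg'[of y] M_nn[of y] by (simp add: ennreal_mult less_imp_le)
        also have "(\<integral>\<^sup>+z\<in>{0<..<y}. ennreal (m z) \<partial>lborel) = (\<integral>\<^sup>+z. ?m z * indicator {0<..<y} z \<partial>lborel)"
          using y by (intro nn_integral_cong) (auto split: split_indicator)
        also have "ennreal (s y) * \<dots> = (\<integral>\<^sup>+z. ennreal (s y) * (?m z * indicator {0<..<y} z) \<partial>lborel)"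
          by (rule nn_integral_cmult[symmetric]) measurable
        also have "\<dots> = (\<integral>\<^sup>+z. f (y, z) \<partial>lborel)"
          using y by (intro nn_integral_cong) (auto simp: f_def mult.assoc split: split_indicator)
        finally show ?thesis using y by simp
      next
        case False
        then have "f (y, z) = 0" for z by (auto simp: f_def)
        then show ?thesis using False by simp
      qed
    qed
    also have "\<dots> = (\<integral>\<^sup>+z. (\<integral>\<^sup>+y. f (y, z) \<partial>lborel) \<partial>lborel)"
      using lborel_pair.Fubini'[of "\<lambda>y z. f (y, z)"] fm by simp
    also have "\<dots> \<le> (\<integral>\<^sup>+z\<in>{0<..1/2}. ennreal (m z) * ennreal (S (1/2) - S z) \<partial>lborel)"
    proof (rule nn_integral_mono)
      fix z :: real
      show "(\<integral>\<^sup>+y. f (y, z) \<partial>lborel) \<le> ennreal (m z) * ennreal (S (1/2) - S z) * indicator {0<..1/2} z"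
      proof (cases "z \<in> {0<..1/2}")
        case True
        then have z: "0 < z" "z \<le> 1/2" by auto
        have "(\<integral>\<^sup>+y. f (y, z) \<partial>lborel) \<le> (\<integral>\<^sup>+y. ennreal (m z) * (?s y * indicator {z..1/2} y) \<partial>lborel)"
          using z by (intro nn_integral_mono) (auto simp: f_def mult_ac split: split_indicator)
        also have "\<dots> = ennreal (m z) * (\<integral>\<^sup>+y. ?s y * indicator {z..1/2} y \<partial>lborel)"
          by (rule nn_integral_cmult) measurable
        also have "(\<integral>\<^sup>+y. ?s y * indicator {z..1/2} y \<partial>lborel) = (\<integral>\<^sup>+y\<in>{z..1/2}. ennreal (s y) \<partial>lborel)"
          using z by (intro nn_integral_cong) (auto split: split_indicator)
        also have "\<dots> = ennreal (S (1/2) - S z)" using z by (intro S_diff) auto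
        finally show ?thesis using True by simp
      next
        case False
        then have "f (y, z) = 0" for y by (auto simp: f_def)
        then show ?thesis by simp
      qed
    qed
    also have "\<dots> < \<infinity>" using N0 by (simp add: N0_eq)
    finally show "(\<integral>\<^sup>+x\<in>{0<..1/2}. ennreal (s x * prim m x) \<partial>lborel) < \<infinity>" .
  qed auto
  have 3: "set_integrable lborel {1/2..3/4} (\<lambda>x. s x * prim m x)"
    by (rule borel_integrable_atLeastAtMost') (rule continuous_on_subset[OF c], auto)
  have 2: "set_integrable lborel {3/4..<1} (\<lambda>x. s x * prim m x)"
  proof (rule set_integrable_bound)
    show "set_integrable lborel {3/4..<1} (\<lambda>x. s x * prim m 1)" using s_integrable_1 by simp
    have "(\<lambda>x. indicator {0<..<1} x *\<^sub>R (s x * prim m x)) \<in> borel_measurable borel"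
      using borel_measurable_continuous_on_indicator[OF _ c] by simp
    then have "(\<lambda>x. indicator {3/4..<1} x *\<^sub>R (indicator {0<..<1} x *\<^sub>R (s x * prim m x))) \<in> borel_measurable borel"
      by measurable
    moreover have "(\<lambda>x. indicator {3/4..<1} x *\<^sub>R (indicator {0<..<1} x *\<^sub>R (s x * prim m x))) = (\<lambda>x. indicator {3/4..<1} x *\<^sub>R (s x * prim m x))"
      by (auto simp: fun_eq_iff indicator_def)
    ultimately show "set_borel_measurable lborel {3/4..<1} (\<lambda>x. s x * prim m x)" by (simp add: set_borel_measurable_def)
    show "AE x in lborel. x \<in> {3/4..<1} \<longrightarrow> norm (s x * prim m x) \<le> norm (s x * prim m 1)"
    proof (intro AE_I2 impI)
      fix x :: real assume x: "x \<in> {3/4..<1}"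
      have "0 \<le> prim m x" "prim m x \<le> prim m 1"
        using x m_pos by (intro M_nonneg' prim_mono m_cint; auto intro: less_imp_le)+
      then show "norm (s x * prim m x) \<le> norm (s x * prim m 1)"
        by (auto simp: abs_mult intro!: mult_left_mono)
    qed
  qed
  have "set_integrable lborel ({0<..1/2} \<union> {1/2..3/4} \<union> {3/4..<1}) (\<lambda>x. s x * prim m x)"
    by (intro set_integrable_Un 1 2 3) auto
  moreover have "{0<..1/2} \<union> {1/2..3/4} \<union> {3/4..<1} = {0<..<1::real}" by auto
  ultimately show ?thesis by simp
qed

lemma scale_speed: "scale_speed s m"
  by (intro scale_speed.intro s_cont s_pos m_cint m_pos sM_integrable)

end

sublocale regular_boundaries \<subseteq> sp: scale_speed "scale_deriv a b" "speed_density a b"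
  by (rule scale_speed)

section \<open>Vanishing flux at an entrance boundary; the link as a family of laws\<close>

context regular_boundaries begin

abbreviation M :: "real \<Rightarrow> real" where "M \<equiv> prim m"

lemma const_on_unit_interior:
  fixes D :: "real \<Rightarrow> real"
  assumes "\<And>x. 0 < x \<Longrightarrow> x < 1 \<Longrightarrow> (D has_real_derivative 0) (at x)" "0 < x" "x < 1" "0 < y" "y < 1"
  shows "D x = D y"
  by (rule DERIV_isconst3[of 0 1]) (use assms in auto)

text \<open>The flux has a limit c at 0, since its derivative 2 m h is integrable. If c were not 0,
  f' would be comparable to c s near 0; as f is continuous at 0, \<open>s\<close> would be
  integrable there and \<open>Sigma0\<close> finite.\<close>

lemma entrance_flux_zero:
  assumes ent: "entrance0 a b" and f: "continuous_on {0..1} f" "C2_interior f"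
    and h: "continuous_on {0..1} h" and fh: "\<And>x. 0 < x \<Longrightarrow> x < 1 \<Longrightarrow> diff_op a b f x = h x"
  shows "dS0_zero a b f"
proof -
  let ?E = "\<lambda>x. deriv f x / s x" and ?J = "prim (\<lambda>y. 2 * m y * h y)"
  have hc: "cint (\<lambda>y. 2 * m y * h y)" by (rule sp.cont_flux_facts(1)[OF h])
  have Ed: "(?E has_real_derivative 2 * m x * h x) (at x)" if "0 < x" "x < 1" for x
    using flux_deriv(2)[OF f(2) that] fh[OF that] by simp
  define c where "c = ?E (1/2) - ?J (1/2)"
  have Ec: "?E x = c + ?J x" if x: "0 < x" "x < 1" for x
  proof -
    have "?E x - ?J x = c" unfolding c_def
      by (rule const_on_unit_interior[of "\<lambda>x. ?E x - ?J x"])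
        (use x in \<open>auto intro!: DERIV_diff[OF Ed prim_deriv[OF hc], THEN DERIV_cong]\<close>)
    then show ?thesis by simp
  qed
  have "((\<lambda>x. c + ?J x) \<longlongrightarrow> c + ?J 0) (at_right 0)"
    by (intro tendsto_intros continuous_on_unit_lim prim_cont hc)
  moreover have ev01: "eventually (\<lambda>x. 0 < x \<and> x < 1) (at_right (0::real))"
    by (rule eventually_at_rightI[of 0 1]) auto
  then have "eventually (\<lambda>x. c + ?J x = ?E x) (at_right 0)" by eventually_elim (simp add: Ec)
  ultimately have Elim: "(?E \<longlongrightarrow> c) (at_right 0)" by (auto intro: Lim_transform_eventually)
  have "c = 0"
  proof (rule ccontr)
    assume "c \<noteq> 0"
    define \<sigma> where "\<sigma> = sgn c"
    have \<sigma>: "\<sigma> * c = \<bar>c\<bar>" "\<bar>\<sigma>\<bar> = 1" using \<open>c \<noteq> 0\<close> by (auto simp: \<sigma>_def sgn_if)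
    have "((\<lambda>x. \<sigma> * ?E x) \<longlongrightarrow> \<sigma> * c) (at_right 0)" by (intro tendsto_intros Elim)
    then have "eventually (\<lambda>x. \<bar>c\<bar> / 2 < \<sigma> * ?E x) (at_right 0)"
      by (rule order_tendstoD(1)) (use \<sigma> \<open>c \<noteq> 0\<close> in simp)
    then obtain d0 where d0: "d0 > 0" "\<And>x. 0 < x \<Longrightarrow> x < d0 \<Longrightarrow> \<bar>c\<bar> / 2 < \<sigma> * ?E x"
      by (auto simp: eventually_at_right_field)
    define d where "d = min d0 (1/2)"
    have d: "0 < d" "d \<le> 1/2" "d \<le> d0" using d0(1) by (auto simp: d_def)
    let ?f' = "\<lambda>x. \<sigma> * (s x * (c + ?J x))"
    have sf: "s x * (\<bar>c\<bar> / 2) \<le> ?f' x" if x: "0 < x" "x < d" for x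
    proof -
      have "s x * (\<bar>c\<bar> / 2) \<le> s x * (\<sigma> * ?E x)"
        using d0(2)[of x] x d by (intro mult_left_mono) (auto simp: less_imp_le)
      then show ?thesis using Ec[of x] x d by (simp add: mult_ac)
    qed
    \<comment> \<open>For an integrand of constant sign the limits of f at both ends already yield
      integrability. This is where continuity of f at 0 enters.\<close>
    have int: "set_integrable lborel (einterval (ereal 0) (ereal d)) ?f'"
    proof (rule interval_integral_FTC_nonneg(1)[where F="\<lambda>x. \<sigma> * f x" and A="\<sigma> * f 0" and B="\<sigma> * f d"])
      show "ereal 0 < ereal d" using d by simp
      fix x assume "ereal 0 < ereal x" "ereal x < ereal d"
      then have x: "0 < x" "x < 1" using d by auto
      have "deriv f x = s x * ?E x" using s_pos[of x] by (simp add: less_imp_neq[symmetric] del: s_pos)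
      then show "((\<lambda>x. \<sigma> * f x) has_real_derivative ?f' x) (at x)"
        using DERIV_cmult[OF flux_deriv(1)[OF f(2) x], of \<sigma>] Ec[OF x] by simp
      have "continuous_on {0<..<1} ?f'"
        by (intro continuous_intros s_cont continuous_on_subset[OF prim_cont[OF hc]]) auto
      then show "isCont ?f' x" using x by (simp add: continuous_on_eq_continuous_at)
    next
      show "AE x in lborel. ereal 0 < ereal x \<longrightarrow> ereal x < ereal d \<longrightarrow> 0 \<le> ?f' x"
      proof (intro AE_I2 impI)
        fix x assume "ereal 0 < ereal x" "ereal x < ereal d"
        then have "s x * (\<bar>c\<bar> / 2) \<le> ?f' x" by (intro sf) auto
        moreover have "0 \<le> s x * (\<bar>c\<bar> / 2)" by (simp add: less_imp_le)
        ultimately show "0 \<le> ?f' x" by linarith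
      qed
      have "((\<lambda>x. \<sigma> * f x) \<longlongrightarrow> \<sigma> * f 0) (at_right 0)"
        by (intro tendsto_intros continuous_on_unit_lim f)
      then show "(((\<lambda>x. \<sigma> * f x) \<circ> real_of_ereal) \<longlongrightarrow> \<sigma> * f 0) (at_right (ereal 0))"
        by (simp only: ereal_tendsto_simps)
      have "isCont f d" using flux_deriv(1)[OF f(2), of d] d by (intro DERIV_isCont) auto
      then have "((\<lambda>x. \<sigma> * f x) \<longlongrightarrow> \<sigma> * f d) (at_left d)"
        by (intro tendsto_intros) (simp add: isCont_def filterlim_at_split)
      then show "(((\<lambda>x. \<sigma> * f x) \<circ> real_of_ereal) \<longlongrightarrow> \<sigma> * f d) (at_left (ereal d))"
        by (simp only: ereal_tendsto_simps)
    qed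
    have ei: "einterval (ereal 0) (ereal d) = {0<..<d}" by (auto simp: einterval_def)
    have si: "set_integrable lborel {0<..<d} s"
    proof (rule set_integrable_bound)
      show "set_integrable lborel {0<..<d} (\<lambda>x. (2 / \<bar>c\<bar>) * ?f' x)"
        using int unfolding ei by simp
      have "(\<lambda>x. indicator {0<..<d} x *\<^sub>R s x) \<in> borel_measurable borel"
        by (rule borel_measurable_continuous_on_indicator) (use d in \<open>auto intro: continuous_on_subset[OF s_cont]\<close>)
      then show "set_borel_measurable lborel {0<..<d} s" by (simp add: set_borel_measurable_def)
      show "AE x in lborel. x \<in> {0<..<d} \<longrightarrow> norm (s x) \<le> norm ((2 / \<bar>c\<bar>) * ?f' x)"
      proof (intro AE_I2 impI)
        fix x assume x: "x \<in> {0<..<d}"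
        then have "(2 / \<bar>c\<bar>) * (s x * (\<bar>c\<bar> / 2)) \<le> (2 / \<bar>c\<bar>) * ?f' x"
          by (intro mult_left_mono sf) auto
        then have "s x \<le> (2 / \<bar>c\<bar>) * ?f' x" using \<open>c \<noteq> 0\<close> by simp
        then have "s x \<le> \<bar>(2 / \<bar>c\<bar>) * ?f' x\<bar>" by linarith
        then show "norm (s x) \<le> norm ((2 / \<bar>c\<bar>) * ?f' x)" by (simp add: abs_of_pos)
      qed
    qed
    have fin1: "(\<integral>\<^sup>+x\<in>{0<..<d}. ennreal (s x) \<partial>lborel) < \<infinity>"
      using nn_finite_of_set_integrable[OF si] by (simp add: less_imp_le)
    have fin2: "(\<integral>\<^sup>+x\<in>{d..1/2}. ennreal (s x) \<partial>lborel) < \<infinity>"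
      using S_diff[of d "1/2"] d by simp
    note [measurable] = sm_measurable
    let ?s = "\<lambda>x. ennreal (indicator {0<..<1} x *\<^sub>R s x)"
    have "Sigma0 a b \<le> (\<integral>\<^sup>+x. ennreal (M 1) * (?s x * indicator {0<..1/2} x) \<partial>lborel)"
      unfolding Sigma0_def
    proof (rule nn_integral_mono)
      fix x :: real
      show "emeasure (speed_measure a b) {x<..1/2} * ennreal (s x) * indicator {0<..1/2} x
         \<le> ennreal (M 1) * (?s x * indicator {0<..1/2} x)"
      proof (cases "x \<in> {0<..1/2}")
        case True
        have "emeasure (speed_measure a b) {x<..1/2} = (\<integral>\<^sup>+z\<in>{x<..1/2} \<inter> {0<..<1}. ennreal (m z) \<partial>lborel)"
          using True by (intro emeasure_speed_measure) auto
        also have "\<dots> \<le> (\<integral>\<^sup>+z\<in>{0<..<1}. ennreal (m z) \<partial>lborel)"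
          by (intro nn_integral_mono) (auto split: split_indicator)
        also have "\<dots> = ennreal (M 1)" by (rule M_nn[symmetric]) simp
        finally show ?thesis using True by (auto intro: mult_right_mono)
      qed simp
    qed
    also have "\<dots> = ennreal (M 1) * (\<integral>\<^sup>+x. ?s x * indicator {0<..1/2} x \<partial>lborel)"
      by (rule nn_integral_cmult) measurable
    also have "(\<integral>\<^sup>+x. ?s x * indicator {0<..1/2} x \<partial>lborel)
        = (\<integral>\<^sup>+x. ?s x * indicator {0<..<d} x + ?s x * indicator {d..1/2} x \<partial>lborel)"
      using d by (intro nn_integral_cong) (auto split: split_indicator)
    also have "\<dots> = (\<integral>\<^sup>+x. ?s x * indicator {0<..<d} x \<partial>lborel) + (\<integral>\<^sup>+x. ?s x * indicator {d..1/2} x \<partial>lborel)"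
      by (rule nn_integral_add) measurable
    also have "(\<integral>\<^sup>+x. ?s x * indicator {0<..<d} x \<partial>lborel) = (\<integral>\<^sup>+x\<in>{0<..<d}. ennreal (s x) \<partial>lborel)"
      using d by (intro nn_integral_cong) (auto split: split_indicator)
    also have "(\<integral>\<^sup>+x. ?s x * indicator {d..1/2} x \<partial>lborel) = (\<integral>\<^sup>+x\<in>{d..1/2}. ennreal (s x) \<partial>lborel)"
      using d by (intro nn_integral_cong) (auto split: split_indicator)
    also have "ennreal (M 1) * ((\<integral>\<^sup>+x\<in>{0<..<d}. ennreal (s x) \<partial>lborel) + (\<integral>\<^sup>+x\<in>{d..1/2}. ennreal (s x) \<partial>lborel)) < \<infinity>"
      using fin1 fin2 by (simp add: ennreal_mult_less_top)
    finally show False using ent by (simp add: entrance0_def)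
  qed
  then show ?thesis using Elim by (simp add: dS0_zero_def)
qed

lemma prim_M1: "stat_density a b x = m x / M 1"
proof -
  have "emeasure (speed_measure a b) {0..1} = ennreal (M 1)"
    by (subst emeasure_speed_measure) (auto simp: M_nn intro!: nn_integral_cong split: split_indicator)
  moreover have "space (speed_measure a b) = {0..1}" by (simp add: speed_measure_def space_restrict_space)
  ultimately have "measure (speed_measure a b) (space (speed_measure a b)) = M 1"
    using M_nonneg'[of 1] by (simp add: measure_def)
  then show ?thesis by (simp add: stat_density_def)
qed

lemma stat_cdf_eq: "stat_cdf a b x = M x / M 1"
  unfolding stat_cdf_def prim_M1 prim_def by simp

text \<open>The link at x as a probability law: the speed measure on {0<..<x}, normalised, with a
  point mass at 0 for x = 0 as in \<open>link\<close>. The total mass in \<open>stat_density\<close>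
  and \<open>stat_cdf\<close> cancels.\<close>

definition link_law :: "real \<Rightarrow> real measure" where
  "link_law x = (if x = 0 then return unit_borel 0 else
     density (restrict_space lborel {0..1}) (\<lambda>y. if y \<in> {0<..<x} then ennreal (m y / M x) else 0))"

lemma link_density_measurable:
  "x \<in> {0<..1} \<Longrightarrow> (\<lambda>y. if y \<in> {0<..<x} then m y / M x else 0) \<in> borel_measurable borel"
proof -
  assume x: "x \<in> {0<..1}"
  have "(\<lambda>y. indicator {0<..<x} y *\<^sub>R (m y / M x)) \<in> borel_measurable borel"
    by (rule borel_measurable_continuous_on_indicator)
      (use x sp.M_pos[of x] in \<open>auto intro!: continuous_intros continuous_on_subset[OF m_cont]\<close>)
  moreover have "(\<lambda>y. indicator {0<..<x} y *\<^sub>R (m y / M x)) = (\<lambda>y. if y \<in> {0<..<x} then m y / M x else 0)"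
    by (auto simp: fun_eq_iff)
  ultimately show ?thesis by simp
qed

lemma link_density_measurable':
  "x \<in> {0<..1} \<Longrightarrow> (\<lambda>y. if y \<in> {0<..<x} then ennreal (m y / M x) else 0) \<in> borel_measurable borel"
proof -
  assume "x \<in> {0<..1}"
  note link_density_measurable[OF this]
  then have "(\<lambda>y. ennreal (if y \<in> {0<..<x} then m y / M x else 0)) \<in> borel_measurable borel" by measurable
  moreover have "(\<lambda>y. ennreal (if y \<in> {0<..<x} then m y / M x else 0)) = (\<lambda>y. if y \<in> {0<..<x} then ennreal (m y / M x) else 0)"
    by (auto simp: fun_eq_iff)
  ultimately show ?thesis by simp
qed

lemma sets_link_law: "sets (link_law x) = sets unit_borel"
  by (simp add: link_law_def sets_restrict_space)

lemma nn_integral_link_law: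
  assumes x: "x \<in> {0<..1}" and f: "f \<in> borel_measurable unit_borel"
  shows "(\<integral>\<^sup>+y. f y \<partial>link_law x) = (\<integral>\<^sup>+y\<in>{0<..<x}. ennreal (m y / M x) * f y \<partial>lborel)"
proof -
  have "(\<integral>\<^sup>+y. f y \<partial>link_law x) = (\<integral>\<^sup>+y. (if y \<in> {0<..<x} then ennreal (m y / M x) else 0) * f y \<partial>restrict_space lborel {0..1})"
  proof -
    have eq: "link_law x = density (restrict_space lborel {0..1}) (\<lambda>y. if y \<in> {0<..<x} then ennreal (m y / M x) else 0)"
      using x by (simp add: link_law_def)
    show ?thesis unfolding eq
    proof (rule nn_integral_density)
      show "(\<lambda>y. if y \<in> {0<..<x} then ennreal (m y / M x) else 0) \<in> borel_measurable (restrict_space lborel {0..1})"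
        by (rule measurable_restrict_space1) (use link_density_measurable'[OF x] in simp)
      show "f \<in> borel_measurable (restrict_space lborel {0..1})"
        using f by (simp add: sets_restrict_space cong: measurable_cong_sets)
    qed
  qed
  also have "\<dots> = (\<integral>\<^sup>+y\<in>{0<..<x}. ennreal (m y / M x) * f y \<partial>lborel)"
    using x by (subst nn_integral_restrict_space) (auto intro!: nn_integral_cong split: split_indicator)
  finally show ?thesis .
qed

lemma prob_link_law:
  assumes x: "x \<in> {0..1}"
  shows "prob_space (link_law x)"
proof (cases "x = 0")
  case True
  then show ?thesis by (auto simp: link_law_def space_restrict_space intro!: prob_space_return)
next
  case False
  with x have x': "x \<in> {0<..1}" by auto
  show ?thesis
  proof
    have "emeasure (link_law x) (space (link_law x)) = (\<integral>\<^sup>+y. 1 \<partial>link_law x)" by simp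
    also have "\<dots> = (\<integral>\<^sup>+y\<in>{0<..<x}. ennreal (m y / M x) * 1 \<partial>lborel)"
      by (rule nn_integral_link_law[OF x']) simp
    also have "\<dots> = (\<integral>\<^sup>+y\<in>{0<..<x}. ennreal (m y / M x) \<partial>lborel)" by simp
    also have "\<dots> = ennreal (LBINT y:{0<..<x}. m y / M x)"
      using x' m_pos sp.M_pos[of x] cint_integrable[OF m_cint, of x]
      by (intro nn_finite_of_set_integrable) (auto intro!: divide_nonneg_nonneg intro: less_imp_le)
    also have "(LBINT y:{0<..<x}. m y / M x) = 1"
      using sp.M_pos[of x] x' by (simp add: prim_def)
    finally show "emeasure (link_law x) (space (link_law x)) = 1" by simp
  qed
qed

lemma link_eq_integral:
  assumes x: "x \<in> {0..1}" and f: "f \<in> borel_measurable unit_borel"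
  shows "link a b f x = (\<integral>y. f y \<partial>link_law x)"
proof (cases "x = 0")
  case True
  then show ?thesis using f by (simp add: link_def link_law_def integral_return space_restrict_space)
next
  case False
  with x have x': "x \<in> {0<..1}" by auto
  let ?d = "\<lambda>y. if y \<in> {0<..<x} then m y / M x else 0"
  have Mx: "M x > 0" "M 1 > 0" using sp.M_pos x' by auto
  have ee: "(\<lambda>y. if y \<in> {0<..<x} then ennreal (m y / M x) else 0) = (\<lambda>y. ennreal (?d y))" by auto
  have "(\<integral>y. f y \<partial>link_law x) = (\<integral>y. ?d y *\<^sub>R f y \<partial>restrict_space lborel {0..1})"
    unfolding link_law_def ee if_not_P[OF False]
  proof (rule integral_density)
    show "f \<in> borel_measurable (restrict_space lborel {0..1})"
      using f by (simp add: sets_restrict_space cong: measurable_cong_sets)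
    show "?d \<in> borel_measurable (restrict_space lborel {0..1})"
      using link_density_measurable[OF x'] by (intro measurable_restrict_space1) simp
    show "AE y in restrict_space lborel {0..1}. 0 \<le> ?d y"
      using m_pos Mx x' by (intro AE_I2) (auto intro!: divide_nonneg_nonneg intro: less_imp_le)
  qed
  also have "\<dots> = (LBINT y:{0..1}. ?d y * f y)"
    by (subst integral_restrict_space) (auto simp: set_lebesgue_integral_def)
  also have "\<dots> = (LBINT y:{0<..<x}. stat_density a b y / stat_cdf a b x * f y)"
    unfolding set_lebesgue_integral_def prim_M1 stat_cdf_eq using x' Mx
    by (intro Bochner_Integration.integral_cong) (auto split: split_indicator)
  finally show ?thesis using False by (simp add: link_def)
qed

text \<open>At x = 1 the link integrates against the stationary law, which will make 1 absorbing for
  the dual.\<close>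

lemma stat_measure_eq: "stat_measure a b = link_law 1"
  unfolding stat_measure_def link_law_def prim_M1 by simp

lemma link_eq_prim:
  assumes x: "x \<in> {0<..1}"
  shows "link a b f x = prim (\<lambda>y. m y * f y) x / M x"
proof -
  have p: "M x > 0" "M 1 > 0" using sp.M_pos x by auto
  then have eq: "m y / M 1 / (M x / M 1) * f y = m y * f y / M x" for y by (simp add: field_simps)
  show ?thesis using x unfolding link_def prim_M1 stat_cdf_eq prim_def[of "\<lambda>y. m y * f y"] eq by simp
qed

end

section \<open>Intertwining of the semigroups\<close>

lemma continuous_Laplace_uniqueness:
  fixes g h :: "real \<Rightarrow> real"
  assumes g: "continuous_on {0..} g" "\<And>t. t \<ge> 0 \<Longrightarrow> \<bar>g t\<bar> \<le> B"
    and h: "continuous_on {0..} h" "\<And>t. t \<ge> 0 \<Longrightarrow> \<bar>h t\<bar> \<le> C"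
    and eq: "\<And>n::nat. n \<ge> 1 \<Longrightarrow> (\<integral>t. g t \<partial>exp_law (real n)) = (\<integral>t. h t \<partial>exp_law (real n))"
    and t: "t \<ge> 0"
  shows "g t = h t"
proof -
  have gh: "continuous_on {0..} (\<lambda>t. g t - h t)" by (intro continuous_intros g h)
  have "g t - h t = 0"
  proof (rule Laplace_uniqueness[where g="\<lambda>t. g t - h t" and B="B + C"])
    show "(\<lambda>t. g t - h t) \<in> borel_measurable (restrict_space borel {0..})"
      by (rule borel_measurable_continuous_on_restrict[OF gh])
    show "\<bar>g t - h t\<bar> \<le> B + C" if "t \<ge> 0" for t using g(2)[OF that] h(2)[OF that] by linarith
    show "((\<lambda>t. g t - h t) \<longlongrightarrow> g t - h t) (at_right t)" if "t \<ge> 0" for t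
    proof -
      have "((\<lambda>t. g t - h t) \<longlongrightarrow> g t - h t) (at t within {0..})" using gh that by (auto simp: continuous_on)
      then show ?thesis by (rule tendsto_mono[rotated]) (use that in \<open>auto intro: at_le\<close>)
    qed
    fix n :: nat assume n: "n \<ge> 1"
    then have n': "real n > 0" by simp
    show "(\<integral>t. g t - h t \<partial>exp_law (real n)) = 0"
      using eq[OF n] integrable_exp_law_bounded[OF n' borel_measurable_continuous_on_restrict[OF g(1)] g(2)]
        integrable_exp_law_bounded[OF n' borel_measurable_continuous_on_restrict[OF h(1)] h(2)]
      by simp
  qed (rule t)
  then show ?thesis by simp
qed

lemma (in feller) T_integral_cont:
  assumes \<mu>: "prob_space \<mu>" "sets \<mu> = sets unit_borel" and f: "continuous_on {0..1} f"
  shows "continuous_on {0..} (\<lambda>t. \<integral>y. T t f y \<partial>\<mu>)"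
proof (rule continuous_onI)
  fix t e :: real assume t: "t \<in> {0..}" and "e > 0"
  obtain d where d: "d > 0" "\<And>s t x. s \<ge> 0 \<Longrightarrow> t \<ge> 0 \<Longrightarrow> \<bar>s - t\<bar> < d \<Longrightarrow> x \<in> {0..1} \<Longrightarrow> \<bar>T s f x - T t f x\<bar> \<le> e"
    using T_uniform_time[OF f \<open>e > 0\<close>] by blast
  show "\<exists>d>0. \<forall>s\<in>{0..}. dist s t < d \<longrightarrow> dist (\<integral>y. T s f y \<partial>\<mu>) (\<integral>y. T t f y \<partial>\<mu>) \<le> e"
  proof (intro exI[of _ d] conjI ballI impI)
    fix s assume s: "s \<in> {0..}" "dist s t < d"
    have c: "continuous_on {0..1} (T s f)" "continuous_on {0..1} (T t f)" using s t f by (auto intro: T_cont)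
    have "(\<integral>y. T s f y \<partial>\<mu>) - (\<integral>y. T t f y \<partial>\<mu>) = (\<integral>y. T s f y - T t f y \<partial>\<mu>)"
      by (intro Bochner_Integration.integral_diff[symmetric] integrable_cont_prob_unit[OF \<mu>] c)
    moreover have "\<bar>\<integral>y. T s f y - T t f y \<partial>\<mu>\<bar> \<le> e"
      by (intro prob_unit_integral_abs_le[OF \<mu>] cont_unit_measurable continuous_intros c)
        (use s t d in \<open>auto simp: dist_real_def\<close>)
    ultimately show "dist (\<integral>y. T s f y \<partial>\<mu>) (\<integral>y. T t f y \<partial>\<mu>) \<le> e" by (simp add: dist_real_def)
  qed (rule d)
qed

lemma (in feller) T_integral_abs_le:
  assumes \<mu>: "prob_space \<mu>" "sets \<mu> = sets unit_borel" and f: "continuous_on {0..1} f"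
    and B: "\<And>x. x \<in> {0..1} \<Longrightarrow> \<bar>f x\<bar> \<le> B" and t: "t \<ge> 0"
  shows "\<bar>\<integral>y. T t f y \<partial>\<mu>\<bar> \<le> B"
  by (intro prob_unit_integral_abs_le[OF \<mu>] cont_unit_measurable T_cont f t T_abs_le B)

locale reflecting_diffusion = regular_boundaries a b + feller P X
  for a b :: "real \<Rightarrow> real" and P :: "real \<Rightarrow> 'w measure" and X :: "real \<Rightarrow> 'w \<Rightarrow> real" +
  assumes coeff: "has_coefficients P X a b"
    and left: "reflecting0 P X a b \<or> entrance0 a b"
    and right: "reflecting1 P X a b"
begin

text \<open>Setting the flux to 0 at both ends extends it continuously: at a reflecting boundary by
  definition, at an entrance boundary by \<open>entrance_flux_zero\<close>.\<close>

lemma domain_flux: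
  assumes f: "f \<in> generator_domain P X"
  shows "\<exists>F. sp.flux_pair f F (generator P X f) \<and> F 1 = 0"
proof -
  have fc: "continuous_on {0..1} f" and hc: "continuous_on {0..1} (generator P X f)"
    using f by (auto simp: generator_domain_def)
  have C2: "C2_interior f" and gen: "\<And>x. 0 < x \<Longrightarrow> x < 1 \<Longrightarrow> diff_op a b f x = generator P X f x"
    using f coeff by (auto simp: has_coefficients_def)
  have z1: "dS1_zero a b f" using right f by (simp add: reflecting1_def)
  have z0: "dS0_zero a b f"
    using left
  proof
    assume "reflecting0 P X a b" then show ?thesis using f by (simp add: reflecting0_def)
  next
    assume "entrance0 a b" then show ?thesis by (rule entrance_flux_zero[OF _ fc C2 hc gen])
  qed
  let ?E = "\<lambda>x. deriv f x / s x"
  define F where "F x = (if 0 < x \<and> x < 1 then ?E x else 0)" for x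
  have Ed: "(?E has_real_derivative 2 * m x * generator P X f x) (at x)" if "0 < x" "x < 1" for x
    using flux_deriv(2)[OF C2 that] gen[OF that] by simp
  have Fd: "(F has_real_derivative 2 * m x * generator P X f x) (at x)" if "0 < x" "x < 1" for x
    by (rule has_field_derivative_transform_within_open[OF Ed[OF that], of "{0<..<1}"]) (use that in \<open>auto simp: F_def\<close>)
  have "continuous_on {0..1} F"
    unfolding continuous_on
  proof
    fix x :: real assume x: "x \<in> {0..1}"
    consider "x = 0" | "x = 1" | "0 < x" "x < 1" using x by force
    then show "(F \<longlongrightarrow> F x) (at x within {0..1})"
    proof cases
      case 1
      have "eventually (\<lambda>x. ?E x = F x) (at_right 0)" by (rule eventually_at_rightI[of 0 1]) (auto simp: F_def)
      with z0 have "(F \<longlongrightarrow> 0) (at_right 0)" unfolding dS0_zero_def by (rule Lim_transform_eventually)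
      then show ?thesis using 1 by (simp add: at_within_Icc_at_right F_def)
    next
      case 2
      have "eventually (\<lambda>x. ?E x = F x) (at_left 1)" by (rule eventually_at_leftI[of 0 1]) (auto simp: F_def)
      with z1 have "(F \<longlongrightarrow> 0) (at_left 1)" unfolding dS1_zero_def by (rule Lim_transform_eventually)
      then show ?thesis using 2 by (simp add: at_within_Icc_at_left F_def)
    next
      case 3
      then show ?thesis using DERIV_isCont[OF Fd[OF 3]] by (simp add: isCont_def at_within_Icc_at)
    qed
  qed
  moreover have "(f has_real_derivative s x * F x) (at x)" if "0 < x" "x < 1" for x
    using flux_deriv(1)[OF C2 that] that s_pos[of x] by (simp add: F_def less_imp_neq[symmetric] del: s_pos)
  ultimately have "sp.flux_pair f F (generator P X f)"
    using Fd fc by (simp add: sp.flux_pair_def) (simp add: F_def)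
  moreover have "F 1 = 0" by (simp add: F_def)
  ultimately show ?thesis by blast
qed

lemma avg_flux:
  assumes f: "continuous_on {0..1} f" and \<theta>: "\<theta> > 0"
  obtains F where "sp.flux_pair (avg \<theta> f) F (\<lambda>x. \<theta> * (avg \<theta> f x - f x))" "F 1 = 0"
proof -
  obtain F where "sp.flux_pair (avg \<theta> f) F (generator P X (avg \<theta> f))" "F 1 = 0"
    using domain_flux[OF avg_in_domain[OF f \<theta>]] by blast
  then show ?thesis using generator_avg[OF f \<theta>] by (intro that[of F]) (auto simp: sp.flux_pair_def)
qed

text \<open>With zero flux at both ends \<theta> (w - f) has integral 0 against \<open>m\<close>, so
  the resolvent preserves the stationary law.\<close>

lemma stat_avg:
  assumes f: "continuous_on {0..1} f" and \<theta>: "\<theta> > 0"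
  shows "(\<integral>y. avg \<theta> f y \<partial>link_law 1) = (\<integral>y. f y \<partial>link_law 1)"
proof -
  obtain F where F: "sp.flux_pair (avg \<theta> f) F (\<lambda>x. \<theta> * (avg \<theta> f x - f x))" "F 1 = 0"
    by (rule avg_flux[OF f \<theta>])
  have ac: "continuous_on {0..1} (avg \<theta> f)" by (rule avg_cont[OF f \<theta>])
  have hc: "continuous_on {0..1} (\<lambda>x. \<theta> * (avg \<theta> f x - f x))" by (intro continuous_intros ac f)
  have mc: "cint (\<lambda>y. m y * h y)" if "continuous_on {0..1} h" for h
    by (rule cint_mult_bounded[OF m_cint _ that]) (use m_pos in \<open>auto intro: less_imp_le\<close>)
  have "0 = prim (\<lambda>y. 2 * m y * (\<theta> * (avg \<theta> f y - f y))) 1"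
    using sp.flux_pair_prim[OF F(1) hc, of 1] F(2) by simp
  also have "\<dots> = (LBINT y:{0<..<1}. 2 * \<theta> * (m y * avg \<theta> f y) - 2 * \<theta> * (m y * f y))"
    unfolding prim_def by (simp add: algebra_simps)
  also have "\<dots> = 2 * \<theta> * prim (\<lambda>y. m y * avg \<theta> f y) 1 - 2 * \<theta> * prim (\<lambda>y. m y * f y) 1"
    unfolding prim_def
    by (subst set_integral_diff(2))
      (use cint_integrable[OF cint_cmult[OF mc[OF ac]], of 1 "2 * \<theta>"] cint_integrable[OF cint_cmult[OF mc[OF f]], of 1 "2 * \<theta>"] in auto)
  finally have "prim (\<lambda>y. m y * avg \<theta> f y) 1 = prim (\<lambda>y. m y * f y) 1" using \<theta> by simp
  then have "link a b (avg \<theta> f) 1 = link a b f 1" by (simp add: link_eq_prim)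
  then show ?thesis using f ac by (simp add: link_eq_integral cont_unit_measurable)
qed

text \<open>Invariance of the normalised speed measure, lifted from the resolvent to the semigroup
  by uniqueness of Laplace transforms.\<close>

lemma stat_invariant:
  assumes f: "continuous_on {0..1} f" and t: "t \<ge> 0"
  shows "(\<integral>y. T t f y \<partial>link_law 1) = (\<integral>y. f y \<partial>link_law 1)"
proof -
  obtain B where B: "\<And>x. x \<in> {0..1} \<Longrightarrow> \<bar>f x\<bar> \<le> B" using cont_unit_bounded[OF f] by blast
  have \<pi>: "prob_space (link_law 1)" by (rule prob_link_law) simp
  show ?thesis
  proof (rule continuous_Laplace_uniqueness[where g="\<lambda>t. \<integral>y. T t f y \<partial>link_law 1" and B=B and C="\<bar>\<integral>y. f y \<partial>link_law 1\<bar>" and h="\<lambda>_. \<integral>y. f y \<partial>link_law 1"])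
    show "continuous_on {0..} (\<lambda>t. \<integral>y. T t f y \<partial>link_law 1)" by (intro T_integral_cont \<pi> sets_link_law f)
    show "\<bar>\<integral>y. T t f y \<partial>link_law 1\<bar> \<le> B" if "t \<ge> 0" for t by (intro T_integral_abs_le \<pi> sets_link_law f B that)
    fix n :: nat assume "n \<ge> 1"
    then have n: "real n > 0" by simp
    interpret E: prob_space "exp_law (real n)" by (rule prob_space_exp_law[OF n])
    show "(\<integral>t. \<integral>y. T t f y \<partial>link_law 1 \<partial>exp_law (real n)) = (\<integral>t. \<integral>y. f y \<partial>link_law 1 \<partial>exp_law (real n))"
      using T_avg_fubini[OF f n \<pi> sets_link_law] stat_avg[OF f n] E.prob_space by simp
  qed (use t in auto)
qed

end

locale dual_diffusion = reflecting_diffusion a b P X + D: feller Ps Xs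
  for a b :: "real \<Rightarrow> real" and P :: "real \<Rightarrow> 'w measure" and X :: "real \<Rightarrow> 'w \<Rightarrow> real"
    and Ps :: "real \<Rightarrow> 'v measure" and Xs :: "real \<Rightarrow> 'v \<Rightarrow> real" +
  assumes dual_domain: "\<And>f. f \<in> generator_domain P X \<Longrightarrow> link a b f \<in> generator_domain Ps Xs"
    and dual_generator: "\<And>f x. f \<in> generator_domain P X \<Longrightarrow> x \<in> {0..1} \<Longrightarrow>
      link a b (generator P X f) x = generator Ps Xs (link a b f) x"
begin

lemma link_lin:
  assumes "continuous_on {0..1} f" "continuous_on {0..1} g" "x \<in> {0..1}"
  shows "link a b (\<lambda>y. k * (f y - g y)) x = k * (link a b f x - link a b g x)"
  using assms integrable_cont_prob_unit[OF prob_link_law sets_link_law, of x]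
  by (simp add: link_eq_integral cont_unit_measurable continuous_on_diff continuous_on_mult continuous_on_const)

text \<open>With w = \<open>avg \<theta> f\<close>, duality says that the dual generator maps
  \<Lambda> w to \<theta> (\<Lambda> w - \<Lambda> f). Solving for \<Lambda> f exhibits it as
  continuous, and uniqueness for the resolvent equation of the dual identifies \<Lambda> w.\<close>

lemma link_avg:
  assumes f: "continuous_on {0..1} f" and \<theta>: "\<theta> > 0"
  shows "continuous_on {0..1} (link a b f)"
    "\<And>x. x \<in> {0..1} \<Longrightarrow> link a b (avg \<theta> f) x = D.avg \<theta> (link a b f) x"
proof -
  let ?w = "avg \<theta> f"
  have dom: "?w \<in> generator_domain P X" by (rule avg_in_domain[OF f \<theta>])
  have wc: "continuous_on {0..1} ?w" by (rule avg_cont[OF f \<theta>])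
  have gen: "generator Ps Xs (link a b ?w) x = \<theta> * (link a b ?w x - link a b f x)" if x: "x \<in> {0..1}" for x
  proof -
    have "generator Ps Xs (link a b ?w) x = link a b (generator P X ?w) x" by (rule dual_generator[symmetric, OF dom x])
    also have "\<dots> = link a b (\<lambda>x. \<theta> * (?w x - f x)) x"
    proof (cases "x = 0")
      case True
      then show ?thesis using generator_avg[OF f \<theta>, of 0] by (simp add: link_def)
    next
      case False
      then show ?thesis using x generator_avg[OF f \<theta>] unfolding link_def
        by (auto intro!: set_lebesgue_integral_cong)
    qed
    also have "\<dots> = \<theta> * (link a b ?w x - link a b f x)" by (rule link_lin[OF wc f x])
    finally show ?thesis .
  qed
  have d: "link a b ?w \<in> generator_domain Ps Xs" by (rule dual_domain[OF dom])
  then have "continuous_on {0..1} (link a b ?w)" "continuous_on {0..1} (generator Ps Xs (link a b ?w))"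
    by (auto simp: generator_domain_def)
  then have "continuous_on {0..1} (\<lambda>x. link a b ?w x - generator Ps Xs (link a b ?w) x / \<theta>)"
    using \<theta> by (intro continuous_intros) auto
  then show lc: "continuous_on {0..1} (link a b f)"
    by (rule continuous_on_eq) (use gen \<theta> in \<open>simp add: field_simps\<close>)
  show "\<And>x. x \<in> {0..1} \<Longrightarrow> link a b ?w x = D.avg \<theta> (link a b f) x"
    by (rule D.avg_unique[OF d lc \<theta> gen])
qed

lemma link_cont: "continuous_on {0..1} f \<Longrightarrow> continuous_on {0..1} (link a b f)"
  by (rule link_avg(1)[of f 1]) auto

lemma intertwining:
  assumes f: "continuous_on {0..1} f" and t: "t \<ge> 0" and x: "x \<in> {0..1}"
  shows "link a b (T t f) x = D.T t (link a b f) x"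
proof -
  obtain B where B: "\<And>x. x \<in> {0..1} \<Longrightarrow> \<bar>f x\<bar> \<le> B" using cont_unit_bounded[OF f] by blast
  have lc: "continuous_on {0..1} (link a b f)" by (rule link_cont[OF f])
  obtain C where C: "\<And>x. x \<in> {0..1} \<Longrightarrow> \<bar>link a b f x\<bar> \<le> C" using cont_unit_bounded[OF lc] by blast
  note \<mu> = prob_link_law[OF x] sets_link_law
  have eq: "link a b (T t f) x = (\<integral>y. T t f y \<partial>link_law x)" if "t \<ge> 0" for t
    using that f x by (intro link_eq_integral cont_unit_measurable T_cont)
  have "(\<integral>y. T t f y \<partial>link_law x) = D.T t (link a b f) x"
  proof (rule continuous_Laplace_uniqueness[where g="\<lambda>t. \<integral>y. T t f y \<partial>link_law x" and B=B and C=C and h="\<lambda>t. D.T t (link a b f) x"])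
    show "continuous_on {0..} (\<lambda>t. \<integral>y. T t f y \<partial>link_law x)" by (intro T_integral_cont \<mu> f)
    show "\<bar>\<integral>y. T t f y \<partial>link_law x\<bar> \<le> B" if "t \<ge> 0" for t by (intro T_integral_abs_le \<mu> f B that)
    show "continuous_on {0..} (\<lambda>t. D.T t (link a b f) x)" by (rule D.T_cont_time[OF lc x])
    show "\<bar>D.T t (link a b f) x\<bar> \<le> C" if "t \<ge> 0" for t by (intro D.T_abs_le cont_unit_measurable lc x that C)
    fix n :: nat assume "n \<ge> 1"
    then have n: "real n > 0" by simp
    have "(\<integral>t. \<integral>y. T t f y \<partial>link_law x \<partial>exp_law (real n)) = link a b (avg (real n) f) x"
      using T_avg_fubini[OF f n \<mu>] link_eq_integral[OF x cont_unit_measurable[OF avg_cont[OF f n]]] by simp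
    also have "\<dots> = D.avg (real n) (link a b f) x" by (rule link_avg(2)[OF f n x])
    finally show "(\<integral>t. \<integral>y. T t f y \<partial>link_law x \<partial>exp_law (real n)) = (\<integral>t. D.T t (link a b f) x \<partial>exp_law (real n))"
      by (simp add: D.avg_def)
  qed (rule t)
  then show ?thesis using eq[OF t] by simp
qed

text \<open>\<Lambda> at 0 is evaluation at 0, so intertwining at 0 writes the primal law as the
  mixture of the laws \<open>link_law x\<close> over the law of the dual.\<close>

lemma T_start_0: "continuous_on {0..1} f \<Longrightarrow> t \<ge> 0 \<Longrightarrow> T t f 0 = (\<integral>y. link a b f y \<partial>D.law 0 t)"
  using intertwining[of f t 0] D.T_law[OF cont_unit_measurable[OF link_cont], of f 0 t]
  by (simp add: link_def)

end

section \<open>Absorption of the dual at 1\<close>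

text \<open>Path continuity makes the set of visiting times closed, so its infimum is attained
  unless the set is empty, in which case the hitting time is infinite.\<close>

lemma hitting_time_le_iff:
  assumes c: "continuous_on {0..} (\<lambda>t. X t \<omega>)" and t: "t \<ge> 0"
  shows "hitting_time X y \<omega> \<le> ereal t \<longleftrightarrow> (\<exists>s\<in>{0..t}. X s \<omega> = y)"
proof
  assume "\<exists>s\<in>{0..t}. X s \<omega> = y"
  then obtain s where s: "0 \<le> s" "s \<le> t" "X s \<omega> = y" by auto
  then have "hitting_time X y \<omega> \<le> ereal s" unfolding hitting_time_def by (intro Inf_lower) auto
  also have "\<dots> \<le> ereal t" using s by simp
  finally show "hitting_time X y \<omega> \<le> ereal t" .
next
  assume le: "hitting_time X y \<omega> \<le> ereal t"
  let ?K = "{s. 0 \<le> s \<and> X s \<omega> = y}"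
  have "?K = {0..} \<inter> (\<lambda>t. X t \<omega>) -` {y}" by auto
  then have cl: "closed ?K" using continuous_closed_preimage[OF c closed_atLeast closed_singleton] by simp
  have ne: "?K \<noteq> {}"
  proof
    assume "?K = {}"
    then have "{ereal t |t. 0 \<le> t \<and> X t \<omega> = y} = {}" by auto
    then have "hitting_time X y \<omega> = \<infinity>" unfolding hitting_time_def by (simp only: Inf_empty top_ereal_def)
    then show False using le by simp
  qed
  have bd: "bdd_below ?K" by (rule bdd_belowI[of _ 0]) auto
  have k: "Inf ?K \<in> ?K" by (rule closed_contains_Inf[OF ne bd cl])
  have "ereal (Inf ?K) \<le> hitting_time X y \<omega>"
    unfolding hitting_time_def by (rule Inf_greatest) (use cInf_lower[OF _ bd] in auto)
  then have "ereal (Inf ?K) \<le> ereal t" using le by (rule order_trans)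
  then show "\<exists>s\<in>{0..t}. X s \<omega> = y" using k by (intro bexI[of _ "Inf ?K"]) auto
qed

section \<open>Absorption at the zero of a nonnegative supermartingale\<close>

context feller begin

lemma comp_measurable: "continuous_on {0..1} f \<Longrightarrow> x \<in> {0..1} \<Longrightarrow> u \<ge> 0 \<Longrightarrow> (\<lambda>\<omega>. f (X u \<omega>)) \<in> borel_measurable (P x)"
  for f :: "real \<Rightarrow> real"
  using measurable_compose[OF X_measurable cont_unit_measurable] .

lemma comp_indicator_integrable:
  fixes f :: "real \<Rightarrow> real"
  assumes "continuous_on {0..1} f" "x \<in> {0..1}" "u \<ge> 0" "A \<in> sets (P x)"
  shows "integrable (P x) (\<lambda>\<omega>. indicator A \<omega> * f (X u \<omega>))"
proof -
  interpret prob_space "P x" by (rule prob_P) fact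
  obtain B where B: "\<And>x. x \<in> {0..1} \<Longrightarrow> \<bar>f x\<bar> \<le> B" using cont_unit_bounded[OF assms(1)] by blast
  have "0 \<le> B" using B[of 0] by simp
  then show ?thesis
    using comp_measurable[OF assms(1-3)] assms B X_in[OF assms(2,3)]
    by (intro integrable_const_bound[where B=B] AE_I2) (auto split: split_indicator)
qed

text \<open>A maximal inequality along a grid, in place of a stopping time: once h has dropped to
  \<epsilon> at some grid time, its later expectation exceeds \<epsilon> by no more than the growth
  factor of the semigroup.\<close>

lemma grid_supermartingale:
  assumes h: "continuous_on {0..1} h" "\<And>y. y \<in> {0..1} \<Longrightarrow> 0 \<le> h y"
    and super: "\<And>u y. u \<ge> 0 \<Longrightarrow> y \<in> {0..1} \<Longrightarrow> T u h y \<le> exp u * h y"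
    and x: "x \<in> {0..1}" and \<delta>: "\<delta> \<ge> 0" and \<epsilon>: "\<epsilon> \<ge> 0"
  defines "A \<equiv> \<lambda>k. {\<omega>\<in>space (P x). \<exists>j\<le>k. h (X (real j * \<delta>) \<omega>) \<le> \<epsilon>}"
  shows "A k \<in> sets (past (P x) X (real k * \<delta>))"
    and "(\<integral>\<omega>. indicator (A k) \<omega> * h (X (real k * \<delta>) \<omega>) \<partial>P x) \<le> \<epsilon> * exp (real k * \<delta>)"
proof -
  interpret prob_space "P x" by (rule prob_P) fact
  have lev: "{y\<in>{0..1}. h y \<le> \<epsilon>} \<in> sets unit_borel"
  proof -
    have "h -` {..\<epsilon>} \<inter> space unit_borel \<in> sets unit_borel"
      by (rule measurable_sets[OF cont_unit_measurable[OF h(1)]]) simp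
    moreover have "h -` {..\<epsilon>} \<inter> space unit_borel = {y\<in>{0..1}. h y \<le> \<epsilon>}" by (auto simp: space_restrict_space)
    ultimately show ?thesis by simp
  qed
  have past: "A k \<in> sets (past (P x) X (real k * \<delta>))" for k
  proof -
    have "A k = (\<Union>j\<in>{..k}. X (real j * \<delta>) -` {y\<in>{0..1}. h y \<le> \<epsilon>} \<inter> space (P x))"
      using X_in[OF x] \<delta> by (auto simp: A_def)
    also have "\<dots> \<in> sets (past (P x) X (real k * \<delta>))"
      using \<delta> lev by (intro sets.finite_UN past_vimage) (auto intro: mult_right_mono)
    finally show ?thesis .
  qed
  then show "A k \<in> sets (past (P x) X (real k * \<delta>))" .
  have AM: "A k \<in> sets (P x)" for k
    using past[of k] subalgebra_past[OF x, of "real k * \<delta>"] \<delta> by (auto simp: subalgebra_def)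
  \<comment> \<open>Keeping the factor \<open>prob (A k)\<close> lets two contributions add up to
    \<open>prob (A (Suc k))\<close>: the old event, handled by the Markov property, and the new one,
    where h \<le> \<epsilon> holds at this very time.\<close>
  have "(\<integral>\<omega>. indicator (A k) \<omega> * h (X (real k * \<delta>) \<omega>) \<partial>P x) \<le> \<epsilon> * exp (real k * \<delta>) * prob (A k)" for k
  proof (induction k)
    case 0
    have "(\<integral>\<omega>. indicator (A 0) \<omega> * h (X (real 0 * \<delta>) \<omega>) \<partial>P x) \<le> (\<integral>\<omega>. indicator (A 0) \<omega> * \<epsilon> \<partial>P x)"
      using AM[of 0] by (intro integral_mono comp_indicator_integrable h x) (auto simp: A_def \<delta> split: split_indicator)
    then show ?case using AM[of 0] by (simp add: mult.commute)
  next
    case (Suc k)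
    let ?B = "A (Suc k) - A k"
    have BM: "?B \<in> sets (P x)" using AM by auto
    have sub: "A k \<subseteq> A (Suc k)" by (auto simp: A_def intro: le_SucI)
    have t: "real (Suc k) * \<delta> = real k * \<delta> + \<delta>" by (simp add: algebra_simps)
    have p: "0 \<le> real k * \<delta>" "0 \<le> real (Suc k) * \<delta>" using \<delta> by auto
    have "(\<integral>\<omega>. indicator (A (Suc k)) \<omega> * h (X (real (Suc k) * \<delta>) \<omega>) \<partial>P x)
      = (\<integral>\<omega>. indicator (A k) \<omega> * h (X (real (Suc k) * \<delta>) \<omega>) + indicator ?B \<omega> * h (X (real (Suc k) * \<delta>) \<omega>) \<partial>P x)"
      using sub by (intro Bochner_Integration.integral_cong) (auto split: split_indicator)
    also have "\<dots> = (\<integral>\<omega>. indicator (A k) \<omega> * h (X (real (Suc k) * \<delta>) \<omega>) \<partial>P x)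
       + (\<integral>\<omega>. indicator ?B \<omega> * h (X (real (Suc k) * \<delta>) \<omega>) \<partial>P x)"
      by (intro Bochner_Integration.integral_add comp_indicator_integrable h x AM BM p)
    also have "(\<integral>\<omega>. indicator (A k) \<omega> * h (X (real (Suc k) * \<delta>) \<omega>) \<partial>P x)
        = (\<integral>\<omega>. indicator (A k) \<omega> * T \<delta> h (X (real k * \<delta>) \<omega>) \<partial>P x)"
      unfolding t by (rule markov[OF x p(1) \<delta> h(1) past])
    also have "\<dots> \<le> (\<integral>\<omega>. exp \<delta> * (indicator (A k) \<omega> * h (X (real k * \<delta>) \<omega>)) \<partial>P x)"
    proof (intro integral_mono integrable_mult_right comp_indicator_integrable h x AM p T_cont \<delta>)
      fix \<omega> assume "\<omega> \<in> space (P x)"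
      then have "T \<delta> h (X (real k * \<delta>) \<omega>) \<le> exp \<delta> * h (X (real k * \<delta>) \<omega>)" by (rule super[OF \<delta> X_in[OF x p(1)]])
      then show "indicator (A k) \<omega> * T \<delta> h (X (real k * \<delta>) \<omega>) \<le> exp \<delta> * (indicator (A k) \<omega> * h (X (real k * \<delta>) \<omega>))"
        by (auto split: split_indicator)
    qed
    also have "\<dots> = exp \<delta> * (\<integral>\<omega>. indicator (A k) \<omega> * h (X (real k * \<delta>) \<omega>) \<partial>P x)" by simp
    also have "\<dots> \<le> exp \<delta> * (\<epsilon> * exp (real k * \<delta>) * prob (A k))" by (intro mult_left_mono Suc.IH) simp
    also have "\<dots> = \<epsilon> * exp (real (Suc k) * \<delta>) * prob (A k)" unfolding t exp_add by simp
    also have "(\<integral>\<omega>. indicator ?B \<omega> * h (X (real (Suc k) * \<delta>) \<omega>) \<partial>P x) \<le> (\<integral>\<omega>. indicator ?B \<omega> * \<epsilon> \<partial>P x)"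
    proof (rule integral_mono[OF comp_indicator_integrable[OF h(1) x p(2) BM]])
      show "integrable (P x) (\<lambda>\<omega>. indicator ?B \<omega> * \<epsilon>)"
        using comp_indicator_integrable[OF continuous_on_const x p(1) BM, of \<epsilon>] .
      fix \<omega> assume "\<omega> \<in> space (P x)"
      have "h (X (real (Suc k) * \<delta>) \<omega>) \<le> \<epsilon>" if "\<omega> \<in> ?B"
        using that by (force simp: A_def le_Suc_eq simp del: of_nat_Suc)
      then show "indicator ?B \<omega> * h (X (real (Suc k) * \<delta>) \<omega>) \<le> indicator ?B \<omega> * \<epsilon>"
        by (auto simp del: of_nat_Suc split: split_indicator)
    qed
    also have "\<dots> = \<epsilon> * 1 * prob ?B" using BM by simp
    also have "\<dots> \<le> \<epsilon> * exp (real (Suc k) * \<delta>) * prob ?B"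
      using p(2) \<epsilon> by (intro mult_right_mono mult_left_mono) auto
    also have "\<epsilon> * exp (real (Suc k) * \<delta>) * prob (A k) + \<epsilon> * exp (real (Suc k) * \<delta>) * prob ?B
       = \<epsilon> * exp (real (Suc k) * \<delta>) * (prob (A k) + prob ?B)" by (simp add: algebra_simps)
    also have "prob (A k) + prob ?B = prob (A (Suc k))"
      using finite_measure_Diff[OF AM[of "Suc k"] AM[of k] sub] by simp
    finally show ?case by simp
  qed
  then have "(\<integral>\<omega>. indicator (A k) \<omega> * h (X (real k * \<delta>) \<omega>) \<partial>P x) \<le> \<epsilon> * exp (real k * \<delta>) * prob (A k)" .
  also have "\<dots> \<le> \<epsilon> * exp (real k * \<delta>) * 1" using \<epsilon> by (intro mult_left_mono) auto
  finally show "(\<integral>\<omega>. indicator (A k) \<omega> * h (X (real k * \<delta>) \<omega>) \<partial>P x) \<le> \<epsilon> * exp (real k * \<delta>)" by simp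
qed

text \<open>By path continuity a visit to c up to time t is the event that for every level 1 / (n +
  1) some dyadic grid sees h at or below it. On this event the expectation of h at time t is at most
  exp t / (n + 1) for every n, hence 0, and h vanishes only at c.\<close>

lemma absorption_of_supermartingale:
  assumes h: "continuous_on {0..1} h" "\<And>y. y \<in> {0..1} \<Longrightarrow> 0 \<le> h y"
    and z: "\<And>y. y \<in> {0..1} \<Longrightarrow> h y = 0 \<longleftrightarrow> y = c"
    and super: "\<And>u y. u \<ge> 0 \<Longrightarrow> y \<in> {0..1} \<Longrightarrow> T u h y \<le> exp u * h y"
    and x: "x \<in> {0..1}" and t: "t \<ge> 0"
  defines "H \<equiv> {\<omega>\<in>space (P x). \<exists>s\<in>{0..t}. X s \<omega> = c}"
  shows "H \<in> sets (P x)" "AE \<omega> in P x. \<omega> \<in> H \<longrightarrow> X t \<omega> = c"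
proof -
  interpret prob_space "P x" by (rule prob_P) fact
  \<comment> \<open>2 ^ N steps of length t / 2 ^ N end exactly at t, and dyadic grids are nested,
    so the events increase with N.\<close>
  define A where "A n N = {\<omega>\<in>space (P x). \<exists>j\<le>2 ^ N. h (X (real j * (t / 2 ^ N)) \<omega>) \<le> 1 / real (Suc n)}" for n N :: nat
  have d: "0 \<le> t / 2 ^ N" for N using t by simp
  have AM: "A n N \<in> sets (P x)" for n N
  proof -
    have "0 \<le> 1 / real (Suc n)" by simp
    from grid_supermartingale(1)[OF h super x d[of N] this, of "2 ^ N"]
    have "A n N \<in> sets (past (P x) X (real (2 ^ N) * (t / 2 ^ N)))" unfolding A_def .
    moreover have "subalgebra (P x) (past (P x) X (real (2 ^ N) * (t / 2 ^ N)))"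
      using d[of N] by (intro subalgebra_past x mult_nonneg_nonneg) auto
    ultimately show ?thesis unfolding subalgebra_def by blast
  qed
  have inc: "A n N \<subseteq> A n (Suc N)" for n N
  proof
    fix \<omega> assume "\<omega> \<in> A n N"
    then obtain j where j: "\<omega> \<in> space (P x)" "j \<le> 2 ^ N" "h (X (real j * (t / 2 ^ N)) \<omega>) \<le> 1 / real (Suc n)"
      by (auto simp: A_def)
    have "real (2 * j) * (t / 2 ^ Suc N) = real j * (t / 2 ^ N)" by simp
    then have "h (X (real (2 * j) * (t / 2 ^ Suc N)) \<omega>) \<le> 1 / real (Suc n)" using j(3) by (simp only:)
    moreover have "2 * j \<le> 2 ^ Suc N" using j(2) by simp
    ultimately show "\<omega> \<in> A n (Suc N)" using j(1) unfolding A_def by blast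
  qed
  have path: "continuous_on {0..} (\<lambda>u. h (X u \<omega>))" if "\<omega> \<in> space (P x)" for \<omega>
  proof (rule continuous_on_compose2[OF h(1) X_path[OF x that]])
    show "(\<lambda>u. X u \<omega>) ` {0..} \<subseteq> {0..1}"
    proof
      fix y assume "y \<in> (\<lambda>u. X u \<omega>) ` {0..}"
      then obtain u where "u \<ge> 0" "y = X u \<omega>" by auto
      then show "y \<in> {0..1}" using X_in[OF x _ that] by simp
    qed
  qed
  have Heq: "H = (\<Inter>n. \<Union>N. A n N)"
  proof (intro equalityI subsetI INT_I)
    fix \<omega> n assume "\<omega> \<in> H"
    then obtain u where u: "\<omega> \<in> space (P x)" "0 \<le> u" "u \<le> t" "X u \<omega> = c" by (auto simp: H_def)
    have "X u \<omega> \<in> {0..1}" by (rule X_in[OF x u(2,1)])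
    then have hu: "h (X u \<omega>) = 0" using z u(4) by auto
    have "1 / real (Suc n) > 0" by simp
    then obtain r where r: "r > 0" "\<And>v. v \<in> {0..} \<Longrightarrow> dist v u < r \<Longrightarrow> dist (h (X v \<omega>)) (h (X u \<omega>)) < 1 / real (Suc n)"
      using path[OF u(1)] u(2) unfolding continuous_on_iff by (metis atLeast_iff)
    \<comment> \<open>The mesh is below the modulus of continuity r, so at the last grid point
      before u the function h is below the level.\<close>
    obtain N where N: "t / r < 2 ^ N" using real_arch_pow[of 2 "t / r"] by auto
    have tr: "t / 2 ^ N < r" using N r by (simp add: field_simps)
    show "\<omega> \<in> (\<Union>N. A n N)"
    proof (cases "t = 0")
      case True
      then have "u = 0" using u by simp
      then have "\<omega> \<in> A n 0" using u hu True by (auto simp: A_def intro!: exI[of _ 0])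
      then show ?thesis by blast
    next
      case False
      then have tp: "0 < t / 2 ^ N" using t by simp
      define j where "j = nat \<lfloor>u / (t / 2 ^ N)\<rfloor>"
      have fl: "0 \<le> u / (t / 2 ^ N)" using u tp by simp
      have j1: "real j \<le> u / (t / 2 ^ N)" "u / (t / 2 ^ N) < real j + 1"
        unfolding j_def using fl by (simp_all add: of_nat_nat le_floor_iff)
      then have j2: "real j * (t / 2 ^ N) \<le> u" "u < real j * (t / 2 ^ N) + t / 2 ^ N"
        using tp by (simp_all only: pos_le_divide_eq pos_divide_less_eq distrib_right mult_1)
      have "real j * (t / 2 ^ N) \<le> t" using j2 u by simp
      then have "real j \<le> 2 ^ N" using False t by (simp add: field_simps)
      then have "j \<le> 2 ^ N" by (metis of_nat_le_iff of_nat_numeral of_nat_power)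
      moreover have "dist (h (X (real j * (t / 2 ^ N)) \<omega>)) (h (X u \<omega>)) < 1 / real (Suc n)"
      proof (rule r(2))
        show "real j * (t / 2 ^ N) \<in> {0..}" using tp by (simp del: times_divide_eq_right)
        have "\<bar>q - u\<bar> < r" if "q \<le> u" "u < q + e" "e < r" for q e using that by linarith
        from this[OF j2 tr] show "dist (real j * (t / 2 ^ N)) u < r" by (simp only: dist_real_def)
      qed
      ultimately have "\<omega> \<in> A n N" using u hu by (auto simp: A_def dist_real_def intro!: exI[of _ j])
      then show ?thesis by blast
    qed
  next
    fix \<omega> assume a: "\<omega> \<in> (\<Inter>n. \<Union>N. A n N)"
    then have sp: "\<omega> \<in> space (P x)" by (auto simp: A_def)
    have "continuous_on {0..t} (\<lambda>u. h (X u \<omega>))" using path[OF sp] by (rule continuous_on_subset) auto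
    then obtain u where u: "u \<in> {0..t}" "\<And>v. v \<in> {0..t} \<Longrightarrow> h (X u \<omega>) \<le> h (X v \<omega>)"
      using continuous_attains_inf[of "{0..t}" "\<lambda>u. h (X u \<omega>)"] t by auto
    have Xu: "X u \<omega> \<in> {0..1}" using u(1) by (intro X_in[OF x _ sp]) auto
    have "h (X u \<omega>) \<le> 1 / real (Suc n)" for n
    proof -
      obtain N j where j: "j \<le> 2 ^ N" "h (X (real j * (t / 2 ^ N)) \<omega>) \<le> 1 / real (Suc n)"
      proof -
        have "\<omega> \<in> (\<Union>N. A n N)" using a by blast
        then obtain N where "\<omega> \<in> A n N" by blast
        then show thesis using that unfolding A_def by blast
      qed
      have "real j \<le> 2 ^ N" using j(1) by (metis of_nat_le_iff of_nat_numeral of_nat_power)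
      then have "real j * (t / 2 ^ N) \<le> 2 ^ N * (t / 2 ^ N)" using t by (intro mult_right_mono) auto
      then have "real j * (t / 2 ^ N) \<in> {0..t}" using t by simp
      from u(2)[OF this] j(2) show ?thesis by linarith
    qed
    moreover have "(\<lambda>n. 1 / real (Suc n)) \<longlonglongrightarrow> 0" using LIMSEQ_inverse_real_of_nat by (simp add: inverse_eq_divide)
    ultimately have "h (X u \<omega>) \<le> 0" by (intro LIMSEQ_le_const[of "\<lambda>n. 1 / real (Suc n)" 0]) auto
    then have "X u \<omega> = c" using h(2)[OF Xu] z[OF Xu] by auto
    then show "\<omega> \<in> H" using sp u(1) by (auto simp: H_def)
  qed
  show HM: "H \<in> sets (P x)" unfolding Heq using AM by auto
  have bound: "(\<integral>\<omega>. indicator H \<omega> * h (X t \<omega>) \<partial>P x) \<le> (1 / real (Suc n)) * exp t" for n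
  proof -
    have "(\<integral>\<omega>. indicator H \<omega> * h (X t \<omega>) \<partial>P x) \<le> (\<integral>\<omega>. indicator (\<Union>N. A n N) \<omega> * h (X t \<omega>) \<partial>P x)"
    proof (intro integral_mono comp_indicator_integrable h x t HM)
      show "(\<Union>N. A n N) \<in> sets (P x)" using AM by auto
      fix \<omega> assume "\<omega> \<in> space (P x)"
      then have "0 \<le> h (X t \<omega>)" by (rule h(2)[OF X_in[OF x t]])
      then show "indicator H \<omega> * h (X t \<omega>) \<le> indicator (\<Union>N. A n N) \<omega> * h (X t \<omega>)"
        using Heq by (auto split: split_indicator)
    qed
    also have "\<dots> \<le> (1 / real (Suc n)) * exp t"
    proof (rule LIMSEQ_le_const2)
      obtain B where B: "\<And>x. x \<in> {0..1} \<Longrightarrow> \<bar>h x\<bar> \<le> B" using cont_unit_bounded[OF h(1)] by blast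
      have B0: "0 \<le> B" using B[of 0] by simp
      show "(\<lambda>N. \<integral>\<omega>. indicator (A n N) \<omega> * h (X t \<omega>) \<partial>P x) \<longlonglongrightarrow> (\<integral>\<omega>. indicator (\<Union>N. A n N) \<omega> * h (X t \<omega>) \<partial>P x)"
      proof (rule integral_dominated_convergence[where w="\<lambda>_. B"])
        show "AE \<omega> in P x. (\<lambda>N. indicator (A n N) \<omega> * h (X t \<omega>)) \<longlonglongrightarrow> indicator (\<Union>N. A n N) \<omega> * h (X t \<omega>)"
          using inc by (intro AE_I2 tendsto_mult_right LIMSEQ_indicator_incseq incseq_SucI) auto
        show "AE \<omega> in P x. norm (indicator (A n N) \<omega> * h (X t \<omega>)) \<le> B" for N
          using B X_in[OF x t] B0 by (intro AE_I2) (auto split: split_indicator)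
      qed (use AM comp_measurable[OF h(1) x t] in auto)
      show "\<exists>N. \<forall>k\<ge>N. (\<integral>\<omega>. indicator (A n k) \<omega> * h (X t \<omega>) \<partial>P x) \<le> (1 / real (Suc n)) * exp t"
      proof (intro exI[of _ 0] allI impI)
        fix k :: nat
        have "real (2 ^ k) * (t / 2 ^ k) = t" by simp
        then show "(\<integral>\<omega>. indicator (A n k) \<omega> * h (X t \<omega>) \<partial>P x) \<le> (1 / real (Suc n)) * exp t"
          using grid_supermartingale(2)[OF h super x d[of k], of "1 / real (Suc n)" "2 ^ k"]
          unfolding A_def by simp
      qed
    qed
    finally show ?thesis .
  qed
  have "(\<lambda>n. (1 / real (Suc n)) * exp t) \<longlonglongrightarrow> 0 * exp t"
    using LIMSEQ_inverse_real_of_nat by (intro tendsto_mult_right) (simp add: inverse_eq_divide)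
  then have le0: "(\<integral>\<omega>. indicator H \<omega> * h (X t \<omega>) \<partial>P x) \<le> 0"
    by (intro LIMSEQ_le_const[of _ "0 * exp t", simplified]) (use bound in auto)
  have nn: "AE \<omega> in P x. 0 \<le> indicator H \<omega> * h (X t \<omega>)"
    using h(2) X_in[OF x t] by (intro AE_I2) (auto split: split_indicator)
  have "(\<integral>\<omega>. indicator H \<omega> * h (X t \<omega>) \<partial>P x) = 0"
    using le0 integral_nonneg_AE[OF nn] by linarith
  then have "AE \<omega> in P x. indicator H \<omega> * h (X t \<omega>) = 0"
    using integral_nonneg_eq_0_iff_AE[OF comp_indicator_integrable[OF h(1) x t HM] nn] by simp
  moreover have "AE \<omega> in P x. \<omega> \<in> space (P x)" by (rule AE_space)
  ultimately show "AE \<omega> in P x. \<omega> \<in> H \<longrightarrow> X t \<omega> = c"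
    by eventually_elim (use z X_in[OF x t] in auto)
qed

end

section \<open>A supermartingale of the dual that vanishes only at 1\<close>

context dual_diffusion begin

lemma M_div_cont: "continuous_on {0..1} (\<lambda>y. M y / M 1)"
  using sp.M1 by (intro continuous_intros prim_cont m_cint) auto

lemma link_M: "x \<in> {0..1} \<Longrightarrow> link a b (\<lambda>y. 1 - M y / M 1) x = 1 - M x / (2 * M 1)"
proof (cases "x = 0")
  case False
  assume "x \<in> {0..1}"
  with False have x: "x \<in> {0<..1}" "x \<in> {0..1}" by auto
  have c: "cint (\<lambda>y. m y * (1 - M y / M 1))"
    by (rule cint_mult_bounded[OF m_cint]) (use m_pos M_div_cont in \<open>auto intro: less_imp_le intro!: continuous_intros\<close>)
  have "M x - (M x)\<^sup>2 / (2 * M 1) = prim (\<lambda>y. m y * (1 - M y / M 1)) x"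
  proof (rule prim_unique[OF c _ _ _ x(2)])
    show "continuous_on {0..1} (\<lambda>x. M x - (M x)\<^sup>2 / (2 * M 1))"
      using sp.M1 by (intro continuous_intros prim_cont m_cint) auto
    fix y :: real assume y: "0 < y" "y < 1"
    have M': "(M has_real_derivative m y) (at y)" by (rule prim_deriv[OF m_cint y])
    show "((\<lambda>x. M x - (M x)\<^sup>2 / (2 * M 1)) has_real_derivative m y * (1 - M y / M 1)) (at y)"
      by (rule DERIV_cong[OF DERIV_diff[OF M' DERIV_cdivide[OF DERIV_power[OF M', of 2]]]])
        (use sp.M1 in \<open>simp add: field_simps\<close>)
  qed simp
  moreover have "(M x - (M x)\<^sup>2 / (2 * M 1)) / M x = 1 - M x / (2 * M 1)"
    using x sp.M_pos[of x] sp.M1 by (simp add: field_simps power2_eq_square)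
  ultimately show ?thesis using link_eq_prim[OF x(1), of "\<lambda>y. 1 - M y / M 1"] by simp
qed (simp add: link_def)

text \<open>\<Lambda> at 1 is integration against the invariant law, so functions in the range of
  \<Lambda> keep their value at 1 under the dual semigroup.\<close>

lemma absorbed_at_1:
  assumes t: "t \<ge> 0" and f: "continuous_on {0..1} f"
  shows "D.T t (link a b f) 1 = link a b f 1"
proof -
  have "D.T t (link a b f) 1 = link a b (T t f) 1" by (rule intertwining[symmetric, OF f t]) simp
  also have "\<dots> = (\<integral>y. T t f y \<partial>link_law 1)" by (intro link_eq_integral cont_unit_measurable T_cont f t) simp
  also have "\<dots> = (\<integral>y. f y \<partial>link_law 1)" by (rule stat_invariant[OF f t])
  also have "\<dots> = link a b f 1" by (intro link_eq_integral[symmetric] cont_unit_measurable f) simp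
  finally show ?thesis .
qed

text \<open>This is \<Lambda> (1 - M / \<open>M 1\<close>) minus its value 1/2 at 1. Being in the
  range of \<Lambda> up to a constant, it has dual expectation 0 when started at 1; strict
  monotonicity of \<open>M\<close> makes it positive elsewhere.\<close>

definition gap :: "real \<Rightarrow> real" where
  "gap x = 1/2 - M x / (2 * M 1)"

lemma gap_cont: "continuous_on {0..1} gap"
  unfolding gap_def[abs_def] using sp.M1 by (intro continuous_intros prim_cont m_cint) auto

lemma gap_nonneg: "x \<in> {0..1} \<Longrightarrow> 0 \<le> gap x"
  using sp.M_le[of x] sp.M1 by (simp add: gap_def field_simps)

lemma gap_pos: "x \<in> {0..1} \<Longrightarrow> x \<noteq> 1 \<Longrightarrow> 0 < gap x"
  using sp.M_strict_mono[of x 1] sp.M1 by (simp add: gap_def field_simps)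

lemma T_gap_1: "t \<ge> 0 \<Longrightarrow> D.T t gap 1 = 0"
proof -
  assume t: "t \<ge> 0"
  let ?f = "\<lambda>y. 1 - M y / M 1"
  have fc: "continuous_on {0..1} ?f" by (intro continuous_intros M_div_cont)
  have lc: "continuous_on {0..1} (link a b ?f)" by (rule link_cont[OF fc])
  have "prob_space (D.law 1 t)" using t by (intro D.prob_law) auto
  then interpret prob_space "D.law 1 t" .
  have "D.T t gap 1 = (\<integral>y. gap y \<partial>D.law 1 t)" using t by (intro D.T_law cont_unit_measurable gap_cont) auto
  also have "\<dots> = (\<integral>y. link a b ?f y - 1/2 \<partial>D.law 1 t)"
    by (intro Bochner_Integration.integral_cong) (simp_all add: link_M gap_def)
  also have "\<dots> = (\<integral>y. link a b ?f y \<partial>D.law 1 t) - 1/2"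
    using integrable_cont_prob_unit[OF prob_space_axioms _ lc] prob_space by simp
  also have "(\<integral>y. link a b ?f y \<partial>D.law 1 t) = D.T t (link a b ?f) 1"
    using t by (intro D.T_law[symmetric] cont_unit_measurable lc) auto
  also have "\<dots> = 1/2" unfolding absorbed_at_1[OF t fc] using sp.M1 by (simp add: link_M)
  finally show ?thesis by simp
qed

text \<open>
  \<open>pot\<close> vanishes only at \<open>1\<close>, and \<open>exp (- t) * pot (Xs t)\<close> is a supermartingale; this replaces the
  strong Markov property in the proof that \<open>Xs\<close> stays at \<open>1\<close>.
\<close>

abbreviation pot :: "real \<Rightarrow> real" where "pot \<equiv> D.avg 1 gap"

lemma pot_nonneg: "x \<in> {0..1} \<Longrightarrow> 0 \<le> pot x"
  unfolding D.avg_def using gap_nonneg by (intro integral_nonneg_AE AE_I2 D.T_nonneg) auto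

lemma pot_cont: "continuous_on {0..1} pot"
  by (rule D.avg_cont[OF gap_cont]) simp

text \<open>At a zero of the nonnegative function \<open>pot\<close> its difference quotients are
  nonnegative, so its generator \<open>pot - gap\<close> is at least 0. This leaves
  \<open>gap\<close> = 0, that is, the point 1.\<close>

lemma pot_zero_iff:
  assumes x: "x \<in> {0..1}"
  shows "pot x = 0 \<longleftrightarrow> x = 1"
proof
  assume "x = 1"
  then have "pot x = (\<integral>t. 0 \<partial>exp_law 1)"
    unfolding D.avg_def by (intro Bochner_Integration.integral_cong) (auto simp: T_gap_1)
  then show "pot x = 0" by simp
next
  assume p0: "pot x = 0"
  have "((\<lambda>t. (D.T t pot x - pot x) / t) \<longlongrightarrow> 1 * (pot x - gap x)) (at_right 0)"
    using D.generator_tendsto[OF D.avg_in_domain[OF gap_cont, of 1] x] D.generator_avg[OF gap_cont _ x, of 1] by simp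
  moreover have "eventually (\<lambda>t. 0 \<le> (D.T t pot x - pot x) / t) (at_right 0)"
    using D.T_nonneg[OF pot_nonneg x] p0 by (intro eventually_at_rightI[of 0 1]) (auto intro!: divide_nonneg_pos)
  ultimately have "0 \<le> 1 * (pot x - gap x)" by (rule tendsto_lowerbound) simp
  then show "x = 1" using gap_pos[OF x] p0 by force
qed

lemma pot_super:
  assumes u: "u \<ge> 0" and x: "x \<in> {0..1}"
  shows "D.T u pot x \<le> exp u * pot x"
proof -
  \<comment> \<open>The part of \<open>pot\<close> collected before time u. Dropping it leaves exp
    (-u) times the expectation of \<open>pot\<close> at time u.\<close>
  have "0 \<le> (LBINT t:{0..<u}. 1 * exp (- 1 * t) * D.T t gap x)"
    unfolding set_lebesgue_integral_def
    using D.T_nonneg[OF gap_nonneg x] by (intro integral_nonneg_AE AE_I2) (auto split: split_indicator)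
  then have "exp (- u) * D.T u pot x \<le> pot x"
    using D.avg_shift[OF gap_cont _ x u, of 1] by simp
  then have "exp u * (exp (- u) * D.T u pot x) \<le> exp u * pot x" by (intro mult_left_mono) auto
  then show ?thesis by (simp add: exp_minus field_simps)
qed

definition hit :: "real \<Rightarrow> 'v set" where
  "hit t = {\<omega>\<in>space (Ps 0). \<exists>s\<in>{0..t}. Xs s \<omega> = 1}"

lemma hit_measurable: "t \<ge> 0 \<Longrightarrow> hit t \<in> sets (Ps 0)"
  and hit_absorbed: "t \<ge> 0 \<Longrightarrow> AE \<omega> in Ps 0. \<omega> \<in> hit t \<longrightarrow> Xs t \<omega> = 1"
  using D.absorption_of_supermartingale[OF pot_cont pot_nonneg pot_zero_iff pot_super, of 0 t]
  unfolding hit_def by auto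

lemma hitting_time_le: "\<omega> \<in> space (Ps 0) \<Longrightarrow> t \<ge> 0 \<Longrightarrow> hitting_time Xs 1 \<omega> \<le> ereal t \<longleftrightarrow> \<omega> \<in> hit t"
  using hitting_time_le_iff[of Xs \<omega> t 1] D.X_path[of 0 \<omega>] by (simp add: hit_def)

lemma measure_hit:
  assumes t: "t \<ge> 0"
  shows "measure (Ps 0) (hit t) = measure (D.law 0 t) {1}"
proof -
  interpret prob_space "Ps 0" by (rule D.prob_P) simp
  have X: "Xs t \<in> measurable (Ps 0) unit_borel" using t by (intro D.X_measurable) auto
  have one: "{1} \<in> sets unit_borel" by (auto simp: sets_restrict_space)
  have "measure (D.law 0 t) {1} = measure (Ps 0) (Xs t -` {1} \<inter> space (Ps 0))"
    unfolding D.law_def by (rule measure_distr[OF X one])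
  also have "\<dots> = measure (Ps 0) (hit t)"
  proof (rule finite_measure_eq_AE)
    show "AE \<omega> in Ps 0. \<omega> \<in> Xs t -` {1} \<inter> space (Ps 0) \<longleftrightarrow> \<omega> \<in> hit t"
      using hit_absorbed[OF t] AE_space by eventually_elim (use t in \<open>auto simp: hit_def\<close>)
  qed (use measurable_sets[OF X one] hit_measurable[OF t] in auto)
  finally show ?thesis by simp
qed

lemma measure_hitting_time:
  assumes t: "t \<ge> 0"
  shows "measure (Ps 0) {\<omega>\<in>space (Ps 0). hitting_time Xs 1 \<omega> > ereal t} = 1 - measure (Ps 0) (hit t)"
proof -
  interpret prob_space "Ps 0" by (rule D.prob_P) simp
  have "{\<omega>\<in>space (Ps 0). hitting_time Xs 1 \<omega> > ereal t} = space (Ps 0) - hit t"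
    using hitting_time_le[OF _ t] by (auto simp: not_le[symmetric])
  then show ?thesis using prob_compl[OF hit_measurable[OF t]] by simp
qed

end

section \<open>The Laplace transform of the absorption time\<close>

text \<open>\<open>Laplace_uniqueness\<close> asks for right continuity; the two distribution
  functions to be compared both obtain it from here.\<close>

lemma (in prob_space) measure_right_continuous:
  assumes H: "\<And>t. t \<ge> 0 \<Longrightarrow> H t \<in> events" and mono: "\<And>s t. 0 \<le> s \<Longrightarrow> s \<le> t \<Longrightarrow> H s \<subseteq> H t"
    and rc: "\<And>t \<omega>. t \<ge> 0 \<Longrightarrow> (\<And>u. u > t \<Longrightarrow> \<omega> \<in> H u) \<Longrightarrow> \<omega> \<in> H t" and t: "(t::real) \<ge> 0"
  shows "((\<lambda>u. prob (H u)) \<longlongrightarrow> prob (H t)) (at_right t)"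
proof (rule tendsto_at_right_sequentially[of t "t + 1"])
  fix S :: "nat \<Rightarrow> real"
  assume S: "\<And>n. t < S n" "\<And>n. S n < t + 1" "decseq S" "S \<longlonglongrightarrow> t"
  have S0: "0 \<le> S n" for n using S(1)[of n] t by simp
  have "(\<Inter>n. H (S n)) = H t"
  proof (intro equalityI subsetI)
    fix \<omega> assume \<omega>: "\<omega> \<in> (\<Inter>n. H (S n))"
    show "\<omega> \<in> H t"
    proof (rule rc[OF t])
      fix u assume "u > t"
      then have "eventually (\<lambda>n. S n < u) sequentially" using S(4) by (simp add: order_tendstoD)
      then obtain n where "S n < u" by (auto simp: eventually_sequentially)
      then show "\<omega> \<in> H u" using mono[OF S0[of n], of u] \<omega> by auto
    qed
  next
    fix \<omega> assume "\<omega> \<in> H t"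
    then show "\<omega> \<in> (\<Inter>n. H (S n))" using mono[OF t] S(1) by (auto intro: less_imp_le dest: subsetD[OF mono[OF t less_imp_le[OF S(1)]]])
  qed
  moreover have "(\<lambda>n. prob (H (S n))) \<longlonglongrightarrow> prob (\<Inter>n. H (S n))"
  proof (rule finite_Lim_measure_decseq)
    show "range (\<lambda>n. H (S n)) \<subseteq> events" using H S0 by auto
    show "decseq (\<lambda>n. H (S n))" using S(3) S0 mono by (auto simp: decseq_def)
  qed
  ultimately show "(\<lambda>n. prob (H (S n))) \<longlonglongrightarrow> prob (H t)" by simp
qed simp

section \<open>Test functions concentrating at 1\<close>

context dual_diffusion begin

lemma measure_hit_right_continuous:
  assumes t: "t \<ge> 0"
  shows "((\<lambda>u. measure (Ps 0) (hit u)) \<longlongrightarrow> measure (Ps 0) (hit t)) (at_right t)"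
proof -
  interpret prob_space "Ps 0" by (rule D.prob_P) simp
  show ?thesis
  proof (rule measure_right_continuous[OF hit_measurable _ _ t])
    show "hit s \<subseteq> hit u" if "0 \<le> s" "s \<le> u" for s u using that by (force simp: hit_def)
    fix t \<omega> assume t: "t \<ge> 0" and a: "\<And>u. u > t \<Longrightarrow> \<omega> \<in> hit u"
    have sp: "\<omega> \<in> space (Ps 0)" using a[of "t + 1"] by (simp add: hit_def)
    have le: "hitting_time Xs 1 \<omega> \<le> ereal u" if "u > t" for u
      using hitting_time_le[OF sp, of u] a[OF that] t that by simp
    have "hitting_time Xs 1 \<omega> \<le> ereal t"
    proof (rule ccontr)
      assume "\<not> hitting_time Xs 1 \<omega> \<le> ereal t"
      then obtain u where "ereal t < ereal u" "ereal u < hitting_time Xs 1 \<omega>"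
        using ereal_dense2[of "ereal t"] by (auto simp: not_le)
      with le[of u] show False by auto
    qed
    then show "\<omega> \<in> hit t" using hitting_time_le[OF sp t] by simp
  qed
qed

lemma mult_m_cint: "continuous_on {0..1} h \<Longrightarrow> cint (\<lambda>y. m y * h y)"
  by (rule cint_mult_bounded[OF m_cint]) (use m_pos in \<open>auto intro: less_imp_le\<close>)

text \<open>Normalised to stationary mean 1, so that \<Lambda> of it is 1 at the point 1. As x0
  tends to 1 it plays the role of a point mass at 1.\<close>

definition bump :: "real \<Rightarrow> real \<Rightarrow> real" where
  "bump x0 y = M 1 / prim (\<lambda>y. m y * max 0 (y - x0)) 1 * max 0 (y - x0)"

lemma bump_mass_pos:
  assumes x0: "0 < x0" "x0 < 1"
  shows "0 < prim (\<lambda>y. m y * max 0 (y - x0)) 1"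
proof -
  have c: "cint (\<lambda>y. m y * max 0 (y - x0))" by (intro mult_m_cint continuous_intros)
  have "prim (\<lambda>y. m y * max 0 (y - x0)) x0 < prim (\<lambda>y. m y * max 0 (y - x0)) 1"
  proof (rule DERIV_pos_imp_increasing_open[OF x0(2)])
    show "continuous_on {x0..1} (prim (\<lambda>y. m y * max 0 (y - x0)))"
      by (rule continuous_on_subset[OF prim_cont[OF c]]) (use x0 in auto)
    fix x assume x: "x0 < x" "x < 1"
    then have "0 < m x * max 0 (x - x0)" using m_pos[of x] x0 by simp
    then show "\<exists>y. (prim (\<lambda>y. m y * max 0 (y - x0)) has_real_derivative y) (at x) \<and> 0 < y"
      using prim_deriv[OF c, of x] x x0 by auto
  qed
  moreover have "0 \<le> prim (\<lambda>y. m y * max 0 (y - x0)) x0"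
    using x0 m_pos by (intro prim_nonneg) (auto intro!: mult_nonneg_nonneg intro: less_imp_le)
  ultimately show ?thesis by linarith
qed

lemma bump_cont: "continuous_on {0..1} (bump x0)"
  unfolding bump_def[abs_def] by (intro continuous_intros)

lemma bump_nonneg: "0 < x0 \<Longrightarrow> x0 < 1 \<Longrightarrow> 0 \<le> bump x0 y"
  using bump_mass_pos[of x0] sp.M1 by (auto simp: bump_def)

lemma bump_zero: "y \<le> x0 \<Longrightarrow> bump x0 y = 0"
  by (simp add: bump_def)

lemma bump_mass: "0 < x0 \<Longrightarrow> x0 < 1 \<Longrightarrow> prim (\<lambda>y. m y * bump x0 y) 1 = M 1"
proof -
  assume x0: "0 < x0" "x0 < 1"
  have "(\<lambda>y. m y * bump x0 y) = (\<lambda>y. M 1 / prim (\<lambda>y. m y * max 0 (y - x0)) 1 * (m y * max 0 (y - x0)))"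
    by (simp add: bump_def fun_eq_iff)
  then have "prim (\<lambda>y. m y * bump x0 y) 1 = M 1 / prim (\<lambda>y. m y * max 0 (y - x0)) 1 * prim (\<lambda>y. m y * max 0 (y - x0)) 1"
    by (simp only: prim_cmult)
  then show ?thesis using bump_mass_pos[OF x0] by simp
qed

text \<open>\<Lambda> of the bumps tends boundedly to the indicator of {1}. The upper bound holds
  because the average over {0..x} with x > x0 divides a mass of at most \<open>M 1\<close> by at
  least \<open>M x0\<close>.\<close>

lemma link_bump:
  assumes x0: "0 < x0" "x0 < 1" and x: "x \<in> {0..1}"
  shows "link a b (bump x0) 1 = 1" "x \<le> x0 \<Longrightarrow> link a b (bump x0) x = 0"
    "0 \<le> link a b (bump x0) x" "link a b (bump x0) x \<le> M 1 / M x0"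
proof -
  show "link a b (bump x0) 1 = 1" using bump_mass[OF x0] sp.M1 by (simp add: link_eq_prim)
  show z: "link a b (bump x0) x = 0" if "x \<le> x0"
  proof (cases "x = 0")
    case False
    have "prim (\<lambda>y. m y * bump x0 y) x = prim (\<lambda>y. 0) x"
      unfolding prim_def by (rule set_lebesgue_integral_cong) (use that in \<open>auto simp: bump_zero\<close>)
    then show ?thesis using x False by (simp add: link_eq_prim prim_def set_lebesgue_integral_def)
  qed (use x0 in \<open>simp add: link_def bump_zero\<close>)
  have nn: "0 \<le> m y * bump x0 y" if "0 < y" "y < 1" for y
    using m_pos[OF that] bump_nonneg[OF x0, of y] by simp
  show n: "0 \<le> link a b (bump x0) x"
  proof (cases "x = 0")
    case False
    then have "0 \<le> prim (\<lambda>y. m y * bump x0 y) x" using x by (intro prim_nonneg nn) auto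
    then show ?thesis using x False sp.M_pos[of x] by (simp add: link_eq_prim)
  qed (use x0 in \<open>simp add: link_def bump_zero\<close>)
  have pos: "0 < M x0" using x0 by (intro sp.M_pos) auto
  show "link a b (bump x0) x \<le> M 1 / M x0"
  proof (cases "x \<le> x0")
    case True
    then show ?thesis using z pos sp.M1 by simp
  next
    case False
    then have x': "x \<in> {0<..1}" "x0 < x" using x x0 by auto
    have "prim (\<lambda>y. m y * bump x0 y) x \<le> prim (\<lambda>y. m y * bump x0 y) 1"
      using x by (intro prim_mono nn mult_m_cint bump_cont) auto
    moreover have "M x0 \<le> M x" using sp.M_strict_mono[of x0 x] x' x0 by simp
    ultimately have "prim (\<lambda>y. m y * bump x0 y) x / M x \<le> M 1 / M x0"
      using bump_mass[OF x0] pos sp.M1 by (intro frac_le) auto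
    then show ?thesis using x' by (simp add: link_eq_prim)
  qed
qed

text \<open>The resolvent at 0 of a bump is computed twice. Read through the dual it tends to the
  transform of the probability of \<open>hit t\<close>; read through the Sturm-Liouville equation it
  tends to \<open>1 / sp.g \<theta>\<close>.\<close>

lemma Laplace_hit:
  assumes \<theta>: "\<theta> > 0"
  shows "(\<integral>t. measure (Ps 0) (hit t) \<partial>exp_law \<theta>) = 1 / sp.g \<theta>"
proof -
  \<comment> \<open>The shift by 2 keeps \<open>x0 k\<close> in {1/2..<1}, so that
    \<open>M 1 / M (1/2)\<close> is one bound for all k.\<close>
  define x0 where "x0 k = 1 - 1 / real (k + 2)" for k :: nat
  have x0: "0 < x0 k" "x0 k < 1" "1/2 \<le> x0 k" for k by (auto simp: x0_def field_simps)
  have x0_lim: "x0 \<longlonglongrightarrow> 1"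
  proof -
    have "(\<lambda>k. 1 - 1 / real (k + 2)) \<longlonglongrightarrow> 1 - 0"
      by (intro tendsto_intros LIMSEQ_ignore_initial_segment[OF lim_1_over_n])
    then show ?thesis by (simp add: x0_def[abs_def])
  qed
  define L where "L k = link a b (bump (x0 k))" for k
  have Lc: "continuous_on {0..1} (L k)" for k unfolding L_def by (intro link_cont bump_cont)
  have LB: "\<bar>L k x\<bar> \<le> M 1 / M (1/2)" if x: "x \<in> {0..1}" for k x
  proof -
    have "M (1/2) \<le> M (x0 k)" using x0[of k] m_pos by (intro prim_mono m_cint) (auto intro: less_imp_le)
    moreover have "0 < M (1/2)" by (rule sp.M_pos) auto
    ultimately have "M 1 / M (x0 k) \<le> M 1 / M (1/2)" using sp.M1 by (intro frac_le) auto
    then show ?thesis using link_bump(3,4)[OF x0(1,2)[of k] x] by (simp add: L_def)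
  qed
  have inner: "(\<lambda>k. D.T t (L k) 0) \<longlonglongrightarrow> measure (Ps 0) (hit t)" if t: "t \<ge> 0" for t
  proof -
    have \<rho>: "prob_space (D.law 0 t)" using t by (intro D.prob_law) auto
    then interpret \<rho>: prob_space "D.law 0 t" .
    have "(\<lambda>k. \<integral>y. L k y \<partial>D.law 0 t) \<longlonglongrightarrow> (\<integral>y. indicator {1} y \<partial>D.law 0 t)"
    proof (rule integral_dominated_convergence[where w="\<lambda>_. M 1 / M (1/2)"])
      show "AE y in D.law 0 t. (\<lambda>k. L k y) \<longlonglongrightarrow> indicator {1} y"
      proof (rule AE_I2)
        fix y assume "y \<in> space (D.law 0 t)"
        then have y: "y \<in> {0..1}" by simp
        show "(\<lambda>k. L k y) \<longlonglongrightarrow> indicator {1} y"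
        proof (cases "y = 1")
          case True
          then show ?thesis using link_bump(1)[OF x0(1,2) y] by (simp add: L_def)
        next
          case False
          then have "y < 1" using y by simp
          then have "eventually (\<lambda>k. y < x0 k) sequentially" using x0_lim by (simp add: order_tendstoD)
          then have "eventually (\<lambda>k. L k y = indicator {1} y) sequentially"
            by eventually_elim (use False link_bump(2)[OF x0(1,2) y] in \<open>auto simp: L_def\<close>)
          then show ?thesis by (rule tendsto_eventually)
        qed
      qed
      show "AE y in D.law 0 t. norm (L k y) \<le> M 1 / M (1/2)" for k using LB by (intro AE_I2) auto
      show "(\<lambda>y. indicator {1} y :: real) \<in> borel_measurable (D.law 0 t)"
        by (rule borel_measurable_indicator) (auto simp: sets_restrict_space)
      show "L k \<in> borel_measurable (D.law 0 t)" for k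
        using cont_unit_measurable[OF Lc] by (simp cong: measurable_cong_sets)
    qed simp
    moreover have "(\<integral>y. indicator {1} y \<partial>D.law 0 t) = measure (D.law 0 t) {1}"
      by (simp add: sets_restrict_space)
    moreover have "D.T t (L k) 0 = (\<integral>y. L k y \<partial>D.law 0 t)" for k
      using t by (intro D.T_law cont_unit_measurable Lc) auto
    ultimately show ?thesis using measure_hit[OF t] by simp
  qed
  have Tm: "(\<lambda>t. D.T t (L k) 0) \<in> borel_measurable (exp_law \<theta>)" for k
    using D.T_time_measurable[OF Lc, of 0] by (simp cong: measurable_cong_sets)
  have "(\<lambda>k. \<integral>t. D.T t (L k) 0 \<partial>exp_law \<theta>) \<longlonglongrightarrow> (\<integral>t. measure (Ps 0) (hit t) \<partial>exp_law \<theta>)"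
  proof (rule integral_dominated_convergence[where w="\<lambda>_. M 1 / M (1/2)"])
    show "AE t in exp_law \<theta>. (\<lambda>k. D.T t (L k) 0) \<longlonglongrightarrow> measure (Ps 0) (hit t)"
      using inner by (intro AE_I2) auto
    show "(\<lambda>t. measure (Ps 0) (hit t)) \<in> borel_measurable (exp_law \<theta>)"
      by (rule borel_measurable_LIMSEQ_real[OF _ Tm]) (use inner in auto)
    show "AE t in exp_law \<theta>. norm (D.T t (L k) 0) \<le> M 1 / M (1/2)" for k
      using D.T_abs_le[OF cont_unit_measurable[OF Lc] _ _ LB] by (intro AE_I2) auto
    interpret E: prob_space "exp_law \<theta>" by (rule prob_space_exp_law[OF \<theta>])
    show "integrable (exp_law \<theta>) (\<lambda>_. M 1 / M (1/2))" by simp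
  qed (rule Tm)
  moreover have "(\<integral>t. D.T t (L k) 0 \<partial>exp_law \<theta>) = avg \<theta> (bump (x0 k)) 0" for k
    using link_avg(2)[OF bump_cont \<theta>, of 0 "x0 k"] by (simp add: link_def[of a b "avg \<theta> _"] D.avg_def L_def)
  ultimately have l1: "(\<lambda>k. avg \<theta> (bump (x0 k)) 0) \<longlonglongrightarrow> (\<integral>t. measure (Ps 0) (hit t) \<partial>exp_law \<theta>)" by simp
  have "(\<lambda>k. avg \<theta> (bump (x0 k)) 0) \<longlonglongrightarrow> 1 / sp.g \<theta>"
  proof (rule LIMSEQ_I)
    fix e :: real assume "e > 0"
    obtain x1 where x1: "x1 < 1" "\<And>x0 w F f. x1 \<le> x0 \<Longrightarrow> x0 < 1 \<Longrightarrow> sp.flux_pair w F (\<lambda>x. \<theta> * (w x - f x)) \<Longrightarrow>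
      F 1 = 0 \<Longrightarrow> continuous_on {0..1} f \<Longrightarrow> (\<forall>x\<in>{0..1}. 0 \<le> f x) \<Longrightarrow> (\<forall>x\<in>{0..x0}. f x = 0) \<Longrightarrow>
      prim (\<lambda>x. 2 * m x * f x) 1 = 2 * M 1 \<Longrightarrow> (\<forall>x\<in>{0..1}. 0 \<le> w x) \<Longrightarrow> \<bar>w 0 - 1 / sp.g \<theta>\<bar> < e"
      using sp.resolvent_start_limit[OF \<theta> \<open>e > 0\<close>] by blast
    have "eventually (\<lambda>k. x1 < x0 k) sequentially" using x0_lim x1(1) by (simp add: order_tendstoD)
    then obtain N where N: "\<And>k. k \<ge> N \<Longrightarrow> x1 < x0 k" by (auto simp: eventually_sequentially)
    show "\<exists>N. \<forall>k\<ge>N. norm (avg \<theta> (bump (x0 k)) 0 - 1 / sp.g \<theta>) < e"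
    proof (intro exI[of _ N] allI impI)
      fix k assume "N \<le> k"
      obtain F where F: "sp.flux_pair (avg \<theta> (bump (x0 k))) F (\<lambda>x. \<theta> * (avg \<theta> (bump (x0 k)) x - bump (x0 k) x))" "F 1 = 0"
        by (rule avg_flux[OF bump_cont \<theta>])
      have "\<bar>avg \<theta> (bump (x0 k)) 0 - 1 / sp.g \<theta>\<bar> < e"
      proof (rule x1(2)[OF _ x0(2) F bump_cont])
        show "x1 \<le> x0 k" using N[OF \<open>N \<le> k\<close>] by simp
        show "\<forall>x\<in>{0..1}. 0 \<le> bump (x0 k) x" using bump_nonneg[OF x0(1,2)] by simp
        show "\<forall>x\<in>{0..x0 k}. bump (x0 k) x = 0" by (simp add: bump_zero)
        have "prim (\<lambda>x. 2 * (m x * bump (x0 k) x)) 1 = 2 * M 1" using bump_mass[OF x0(1,2)] by (simp add: prim_cmult)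
        then show "prim (\<lambda>x. 2 * m x * bump (x0 k) x) 1 = 2 * M 1" by (simp add: mult.assoc)
        show "\<forall>x\<in>{0..1}. 0 \<le> avg \<theta> (bump (x0 k)) x"
          unfolding avg_def using bump_nonneg[OF x0(1,2)] by (intro ballI integral_nonneg_AE AE_I2 T_nonneg) auto
      qed
      then show "norm (avg \<theta> (bump (x0 k)) 0 - 1 / sp.g \<theta>) < e" by simp
    qed
  qed
  from LIMSEQ_unique[OF l1 this] show ?thesis .
qed

end

section \<open>Separation\<close>

lemma prob_unit_DCT:
  fixes f :: "nat \<Rightarrow> real \<Rightarrow> real"
  assumes \<mu>: "prob_space \<mu>" "sets \<mu> = sets unit_borel"
    and m: "\<And>n. f n \<in> borel_measurable unit_borel" and lim: "\<And>y. y \<in> {0..1} \<Longrightarrow> (\<lambda>n. f n y) \<longlonglongrightarrow> g y"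
    and B: "\<And>n y. y \<in> {0..1} \<Longrightarrow> \<bar>f n y\<bar> \<le> B"
  shows "(\<lambda>n. \<integral>y. f n y \<partial>\<mu>) \<longlonglongrightarrow> (\<integral>y. g y \<partial>\<mu>)"
proof -
  interpret prob_space \<mu> by fact
  have sp: "space \<mu> = {0..1}" using sets_eq_imp_space_eq[OF \<mu>(2)] by (simp add: space_restrict_space)
  have m': "f n \<in> borel_measurable \<mu>" for n using m \<mu>(2) by (simp cong: measurable_cong_sets)
  show ?thesis
  proof (rule integral_dominated_convergence[where w="\<lambda>_. B"])
    show "g \<in> borel_measurable \<mu>" by (rule borel_measurable_LIMSEQ_real[where u=f, OF _ m']) (use lim sp in auto)
    show "AE y in \<mu>. (\<lambda>n. f n y) \<longlonglongrightarrow> g y" using lim sp by (intro AE_I2) auto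
    show "AE y in \<mu>. norm (f n y) \<le> B" for n using B sp by (intro AE_I2) auto
  qed (use m' in auto)
qed

text \<open>Transported to the real line, a law is determined by its distribution function, and only
  arguments in [0,1] carry information.\<close>

lemma measure_unit_eqI:
  assumes \<mu>: "prob_space \<mu>" "sets \<mu> = sets unit_borel" and \<nu>: "prob_space \<nu>" "sets \<nu> = sets unit_borel"
    and eq: "\<And>c. c \<in> {0..1} \<Longrightarrow> measure \<mu> {0..c} = measure \<nu> {0..c}"
  shows "\<mu> = \<nu>"
proof (rule measure_eqI)
  have id: "(\<lambda>x. x) \<in> measurable \<kappa> borel" if "sets \<kappa> = sets unit_borel" for \<kappa>
    using that by (auto cong: measurable_cong_sets intro!: measurable_restrict_space1)
  have sp: "space \<kappa> = {0..1}" if "sets \<kappa> = sets unit_borel" for \<kappa>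
    using sets_eq_imp_space_eq[OF that] by (simp add: space_restrict_space)
  have rd: "real_distribution (distr \<kappa> borel (\<lambda>x. x))" if "prob_space \<kappa>" "sets \<kappa> = sets unit_borel" for \<kappa>
    using prob_space.prob_space_distr[OF that(1) id[OF that(2)]]
    by (intro real_distribution.intro real_distribution_axioms.intro) auto
  have cdf_eq: "cdf (distr \<kappa> borel (\<lambda>x. x)) c = measure \<kappa> ({..c} \<inter> {0..1})" if "sets \<kappa> = sets unit_borel" for \<kappa> c
    unfolding cdf_def by (subst measure_distr[OF id[OF that]]) (auto simp: sp[OF that] vimage_def)
  have "cdf (distr \<mu> borel (\<lambda>x. x)) = cdf (distr \<nu> borel (\<lambda>x. x))"
  proof
    fix c :: real
    consider "c < 0" | "c \<in> {0..1}" | "c > 1" by force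
    then have "measure \<mu> ({..c} \<inter> {0..1}) = measure \<nu> ({..c} \<inter> {0..1})"
    proof cases
      case 1
      then have "{..c} \<inter> {0..1} = {}" by auto
      then show ?thesis by (simp only: measure_empty)
    next
      case 2
      then have "{..c} \<inter> {0..1} = {0..c}" by auto
      then show ?thesis using eq[OF 2] by (simp only:)
    next
      case 3
      then have "{..c} \<inter> {0..1} = {0..1}" by auto
      then show ?thesis using eq[of 1] by (simp only: atLeastAtMost_iff zero_le_one order_refl simp_thms)
    qed
    then show "cdf (distr \<mu> borel (\<lambda>x. x)) c = cdf (distr \<nu> borel (\<lambda>x. x)) c"
      by (simp add: cdf_eq \<mu> \<nu>)
  qed
  then have deq: "distr \<mu> borel (\<lambda>x. x) = distr \<nu> borel (\<lambda>x. x)"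
    by (rule cdf_unique[OF rd[OF \<mu>] rd[OF \<nu>]])
  fix A assume A: "A \<in> sets \<mu>"
  then have A': "A \<in> sets borel" "A \<subseteq> {0..1}" using \<mu>(2) by (auto simp: sets_restrict_space)
  have "emeasure \<kappa> A = emeasure (distr \<kappa> borel (\<lambda>x. x)) A" if "sets \<kappa> = sets unit_borel" for \<kappa>
    using A' by (subst emeasure_distr[OF id[OF that]]) (auto simp: sp[OF that] Int_absorb2 vimage_def)
  then show "emeasure \<mu> A = emeasure \<nu> A" using \<mu>(2) \<nu>(2) deq by simp
qed (use \<mu> \<nu> in simp)

section \<open>The dual has no atom at 0 at positive times\<close>

context dual_diffusion begin

text \<open>Continuous functions decreasing to the indicator of {0}. Semigroups and resolvents are
  controlled on continuous functions, so the atom is reached through their limit.\<close>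

definition tent :: "nat \<Rightarrow> real \<Rightarrow> real" where
  "tent n y = max 0 (1 - real n * y)"

lemma tent_cont: "continuous_on {0..1} (tent n)"
  unfolding tent_def[abs_def] by (intro continuous_intros)

lemma tent_bounds: "0 \<le> y \<Longrightarrow> 0 \<le> tent n y \<and> tent n y \<le> 1"
  by (simp add: tent_def)

lemma tent_abs: "y \<in> {0..1} \<Longrightarrow> \<bar>tent n y\<bar> \<le> 1"
  using tent_bounds[of y n] by simp

lemma tent_lim: "0 \<le> y \<Longrightarrow> (\<lambda>n. tent n y) \<longlonglongrightarrow> indicator {0} y"
proof (cases "y = 0")
  case False
  assume "0 \<le> y"
  with False have y: "y > 0" by simp
  obtain N where N: "real N > 1 / y" using reals_Archimedean2 by blast
  have "tent n y = indicator {0} y" if "n \<ge> N" for n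
  proof -
    have "real n > 1 / y" using N that by (meson of_nat_le_iff order_less_le_trans)
    then show ?thesis using y by (simp add: tent_def field_simps)
  qed
  then have "eventually (\<lambda>n. tent n y = indicator {0} y) sequentially" by (auto simp: eventually_sequentially)
  then show ?thesis by (rule tendsto_eventually)
qed (simp add: tent_def)

lemma space_link_law [simp]: "space (link_law x) = {0..1}"
  using sets_eq_imp_space_eq[OF sets_link_law] by (simp add: space_restrict_space)

lemma link_abs_le:
  assumes "continuous_on {0..1} f" "x \<in> {0..1}" "\<And>y. y \<in> {0..1} \<Longrightarrow> \<bar>f y\<bar> \<le> B"
  shows "\<bar>link a b f x\<bar> \<le> B"
  unfolding link_eq_integral[OF assms(2) cont_unit_measurable[OF assms(1)]]
  by (intro prob_unit_integral_abs_le[OF prob_link_law[OF assms(2)] sets_link_law cont_unit_measurable[OF assms(1)]] assms)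

lemma link_law_0:
  assumes x: "x \<in> {0<..1}"
  shows "measure (link_law x) {0} = 0"
proof -
  have A: "{0} \<in> sets unit_borel" by (auto simp: sets_restrict_space)
  then have "emeasure (link_law x) {0} = (\<integral>\<^sup>+y. indicator {0} y \<partial>link_law x)" by (simp add: sets_link_law)
  also have "\<dots> = (\<integral>\<^sup>+y\<in>{0<..<x}. ennreal (m y / M x) * indicator {0} y \<partial>lborel)"
    using A by (intro nn_integral_link_law[OF x] borel_measurable_indicator)
  also have "\<dots> = (\<integral>\<^sup>+(y::real). 0 \<partial>lborel)" by (intro nn_integral_cong) (auto split: split_indicator)
  finally show ?thesis by (simp add: measure_def)
qed

lemma link_tent_lim:
  assumes x: "x \<in> {0..1}"
  shows "(\<lambda>n. link a b (tent n) x) \<longlonglongrightarrow> indicator {0} x"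
proof (cases "x = 0")
  case True
  then show ?thesis by (simp add: link_def tent_def)
next
  case False
  have "(\<lambda>n. \<integral>y. tent n y \<partial>link_law x) \<longlonglongrightarrow> (\<integral>y. indicator {0} y \<partial>link_law x)"
    by (intro prob_unit_DCT[where B=1] prob_link_law x sets_link_law cont_unit_measurable tent_cont tent_lim tent_abs) auto
  moreover have "(\<integral>y. indicator {0} y \<partial>link_law x) = (0::real)"
    using link_law_0[of x] x False by (simp add: sets_link_law sets_restrict_space)
  ultimately show ?thesis using False x by (simp add: link_eq_integral cont_unit_measurable tent_cont)
qed

text \<open>\<Lambda> f x is an average over {0..x}, a set of stationary mass
  \<open>M x / M 1\<close>, so for f \<ge> 0 it is at most the full mean divided by that
  mass.\<close>

lemma link_le_stat:
  assumes f: "continuous_on {0..1} f" "\<And>y. y \<in> {0..1} \<Longrightarrow> 0 \<le> f y" and x: "x \<in> {0<..1}"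
  shows "link a b f x \<le> M 1 / M x * link a b f 1"
proof -
  have "prim (\<lambda>y. m y * f y) x \<le> prim (\<lambda>y. m y * f y) 1"
    using x m_pos f(2) by (intro prim_mono cint_mult_bounded[OF m_cint _ f(1)])
      (auto intro!: mult_nonneg_nonneg intro: less_imp_le)
  then have "prim (\<lambda>y. m y * f y) x / M x \<le> prim (\<lambda>y. m y * f y) 1 / M x"
    using sp.M_pos[of x] x by (intro divide_right_mono) auto
  then show ?thesis using x sp.M1 by (simp add: link_eq_prim)
qed

text \<open>
  As \<open>link\<close> at \<open>0\<close> is evaluation at \<open>0\<close>, the law of \<open>X\<^sub>t\<close> under \<open>P 0\<close> is absolutely continuous only
  if \<open>X*\<^sub>t\<close> has no atom at \<open>0\<close>. The mass of the atom is multiplicative in \<open>t\<close> and has a vanishing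
  Laplace transform, so it is zero.
\<close>

definition atom0 :: "real \<Rightarrow> real" where
  "atom0 t = measure (D.law 0 t) {0}"

lemma T_tent_0_lim:
  assumes t: "t \<ge> 0"
  shows "(\<lambda>n. T t (tent n) 0) \<longlonglongrightarrow> atom0 t"
proof -
  have "prob_space (D.law 0 t)" using t by (intro D.prob_law) auto
  then have "(\<lambda>n. \<integral>y. link a b (tent n) y \<partial>D.law 0 t) \<longlonglongrightarrow> (\<integral>y. indicator {0} y \<partial>D.law 0 t)"
    by (rule prob_unit_DCT[where B=1])
      (auto intro!: cont_unit_measurable link_cont tent_cont link_tent_lim link_abs_le tent_abs)
  moreover have "(\<integral>y. indicator {0} y \<partial>D.law 0 t) = atom0 t"
    by (simp add: atom0_def sets_restrict_space)
  ultimately show ?thesis using T_start_0[OF tent_cont t] by simp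
qed

text \<open>For x > 0 the average is dominated by a multiple of the stationary mean of
  \<open>T t (tent n)\<close>, which by invariance is that of \<open>tent n\<close> and tends to 0.
  Only x = 0 survives the limit.\<close>

lemma link_T_tent_lim:
  assumes t: "t \<ge> 0" and x: "x \<in> {0..1}"
  shows "(\<lambda>n. link a b (T t (tent n)) x) \<longlonglongrightarrow> indicator {0} x * atom0 t"
proof (cases "x = 0")
  case True
  then show ?thesis using T_tent_0_lim[OF t] by (simp add: link_def)
next
  case False
  then have x': "x \<in> {0<..1}" using x by auto
  have c: "continuous_on {0..1} (T t (tent n))" for n by (intro T_cont tent_cont t)
  have nn: "0 \<le> T t (tent n) y" if "y \<in> {0..1}" for n y
    using that t by (intro T_nonneg) (auto simp: tent_def)
  have "link a b (T t (tent n)) 1 = link a b (tent n) 1" for n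
    using stat_invariant[OF tent_cont t] c by (simp add: link_eq_integral cont_unit_measurable tent_cont)
  then have up: "link a b (T t (tent n)) x \<le> M 1 / M x * link a b (tent n) 1" for n
    using link_le_stat[OF c nn x', of n] by simp
  have lo: "0 \<le> link a b (T t (tent n)) x" for n
  proof -
    have "0 \<le> (\<integral>y. T t (tent n) y \<partial>link_law x)" using nn by (intro integral_nonneg_AE AE_I2) auto
    then show ?thesis using x c by (simp add: link_eq_integral cont_unit_measurable)
  qed
  have "(\<lambda>n. M 1 / M x * link a b (tent n) 1) \<longlonglongrightarrow> M 1 / M x * indicator {0} (1::real)"
  proof -
    have "(\<lambda>n. link a b (tent n) 1) \<longlonglongrightarrow> indicator {0} (1::real)" by (rule link_tent_lim) simp
    then show ?thesis by (rule tendsto_mult_left)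
  qed
  then have "(\<lambda>n. M 1 / M x * link a b (tent n) 1) \<longlonglongrightarrow> 0" by simp
  then have "(\<lambda>n. link a b (T t (tent n)) x) \<longlonglongrightarrow> 0"
    by (rule tendsto_sandwich[OF always_eventually[OF allI[OF lo]] always_eventually[OF allI[OF up]] tendsto_const])
  then show ?thesis using False by simp
qed

text \<open>The semigroup property at the start 0, with the first u units of time read through the
  dual: in the limit of tents only a dual sitting at 0 at time u contributes, with weight
  \<open>atom0 t\<close>.\<close>

lemma atom0_mult:
  assumes "u \<ge> 0" "t \<ge> 0"
  shows "atom0 (u + t) = atom0 u * atom0 t"
proof -
  have c: "continuous_on {0..1} (T t (tent n))" for n by (intro T_cont tent_cont assms)
  have "prob_space (D.law 0 u)" using assms by (intro D.prob_law) auto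
  then have "(\<lambda>n. \<integral>y. link a b (T t (tent n)) y \<partial>D.law 0 u) \<longlonglongrightarrow> (\<integral>y. indicator {0} y * atom0 t \<partial>D.law 0 u)"
  proof (rule prob_unit_DCT[where B=1])
    fix n and y :: real assume y: "y \<in> {0..1}"
    show "(\<lambda>n. link a b (T t (tent n)) y) \<longlonglongrightarrow> indicator {0} y * atom0 t" by (rule link_T_tent_lim[OF assms(2) y])
    have "\<bar>T t (tent n) x\<bar> \<le> 1" if "x \<in> {0..1}" for x
      by (rule T_abs_le[OF cont_unit_measurable[OF tent_cont] that assms(2) tent_abs])
    then show "\<bar>link a b (T t (tent n)) y\<bar> \<le> 1" by (rule link_abs_le[OF c y])
  qed (auto intro!: cont_unit_measurable link_cont c)
  moreover have "(\<integral>y. indicator {0} y * atom0 t \<partial>D.law 0 u) = atom0 u * atom0 t"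
    by (simp add: atom0_def sets_restrict_space)
  moreover have "T (u + t) (tent n) 0 = (\<integral>y. link a b (T t (tent n)) y \<partial>D.law 0 u)" for n
    using T_semigroup[OF _ assms tent_cont, of 0] T_start_0[OF c assms(1)] by simp
  ultimately have "(\<lambda>n. T (u + t) (tent n) 0) \<longlonglongrightarrow> atom0 u * atom0 t" by (simp only:)
  moreover have "(\<lambda>n. T (u + t) (tent n) 0) \<longlonglongrightarrow> atom0 (u + t)" using assms by (intro T_tent_0_lim) auto
  ultimately show ?thesis using LIMSEQ_unique by blast
qed

text \<open>\<open>resolvent_start_le\<close> applied to tents: for fixed x the mass term vanishes
  as n grows, and the remaining \<open>sp.phi 1 x\<close> tends to 0 with x.\<close>

lemma atom0_integral:
  "integrable (exp_law 1) atom0" "(\<integral>t. atom0 t \<partial>exp_law 1) = 0"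
proof -
  interpret E: prob_space "exp_law 1" by (rule prob_space_exp_law) simp
  have Tm: "(\<lambda>t. T t (tent n) 0) \<in> borel_measurable (exp_law 1)" for n
    using T_time_measurable[OF tent_cont, of 0] by (simp cong: measurable_cong_sets)
  have am: "atom0 \<in> borel_measurable (exp_law 1)"
    by (rule borel_measurable_LIMSEQ_real[OF _ Tm]) (use T_tent_0_lim in auto)
  have a01: "0 \<le> atom0 t" "atom0 t \<le> 1" if "t \<ge> 0" for t
  proof -
    have "prob_space (D.law 0 t)" using that by (intro D.prob_law) auto
    then show "0 \<le> atom0 t" "atom0 t \<le> 1" by (auto simp: atom0_def prob_space.prob_le_1)
  qed
  show "integrable (exp_law 1) atom0"
    using am a01 by (intro E.integrable_const_bound[where B=1] AE_I2) auto
  have lim: "(\<lambda>n. avg 1 (tent n) 0) \<longlonglongrightarrow> (\<integral>t. atom0 t \<partial>exp_law 1)"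
    unfolding avg_def
  proof (rule integral_dominated_convergence[where w="\<lambda>_. 1"])
    show "AE t in exp_law 1. (\<lambda>n. T t (tent n) 0) \<longlonglongrightarrow> atom0 t" using T_tent_0_lim by (intro AE_I2) auto
    show "AE t in exp_law 1. norm (T t (tent n) 0) \<le> 1" for n
      using T_abs_le[OF cont_unit_measurable[OF tent_cont] _ _ tent_abs, of 0] by (intro AE_I2) auto
  qed (use Tm am in auto)
  have le: "(\<integral>t. atom0 t \<partial>exp_law 1) \<le> sp.phi 1 x" if x: "0 < x" "x < 1" for x
  proof -
    have "avg 1 (tent n) 0 \<le> sp.phi 1 x + 2 * (M 1 * link a b (tent n) 1) / (2 * M x)" for n
    proof -
      obtain F where F: "sp.flux_pair (avg 1 (tent n)) F (\<lambda>x. 1 * (avg 1 (tent n) x - tent n x))" "F 1 = 0"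
        by (rule avg_flux[OF tent_cont[of n] zero_less_one])
      have "avg 1 (tent n) 0 \<le> 1 * sp.phi 1 x + prim (\<lambda>y. 2 * m y * tent n y) 1 / (2 * M x)"
      proof (rule sp.resolvent_start_le[OF F(1) _ F(2) tent_cont _ _ x])
        show "0 \<le> tent n y \<and> tent n y \<le> 1" if "y \<in> {0..1}" for y using tent_bounds that by auto
        show "0 \<le> avg 1 (tent n) y \<and> avg 1 (tent n) y \<le> 1" if "y \<in> {0..1}" for y
        proof
          show "0 \<le> avg 1 (tent n) y"
            unfolding avg_def using that by (intro integral_nonneg_AE AE_I2 T_nonneg) (auto simp: tent_def)
          show "avg 1 (tent n) y \<le> 1" using avg_abs_le[OF tent_cont _ that tent_abs, of 1 n] by simp
        qed
      qed simp
      also have "prim (\<lambda>y. 2 * m y * tent n y) 1 = 2 * (M 1 * link a b (tent n) 1)"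
        using prim_cmult[of 2 "\<lambda>y. m y * tent n y" 1] sp.M1 by (simp add: link_eq_prim mult.assoc)
      finally show ?thesis by simp
    qed
    moreover have "(\<lambda>n. sp.phi 1 x + 2 * (M 1 * link a b (tent n) 1) / (2 * M x))
       \<longlonglongrightarrow> sp.phi 1 x + 2 * (M 1 * indicator {0} (1::real)) / (2 * M x)"
    proof -
      have "(\<lambda>n. link a b (tent n) 1) \<longlonglongrightarrow> indicator {0} (1::real)" by (rule link_tent_lim) simp
      then show ?thesis using sp.M_pos[of x] x by (intro tendsto_intros) auto
    qed
    ultimately have "(\<integral>t. atom0 t \<partial>exp_law 1) \<le> sp.phi 1 x + 2 * (M 1 * indicator {0} (1::real)) / (2 * M x)"
      using lim by (intro LIMSEQ_le[OF lim]) auto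
    then show ?thesis by simp
  qed
  have "(sp.phi 1 \<longlongrightarrow> sp.phi 1 0) (at_right 0)" by (rule continuous_on_unit_lim(1)[OF sp.phi_cont])
  then have "(sp.phi 1 \<longlongrightarrow> 0) (at_right 0)" by (simp add: sp.phi_Suc)
  moreover have "eventually (\<lambda>x. (\<integral>t. atom0 t \<partial>exp_law 1) \<le> sp.phi 1 x) (at_right 0)"
    using le by (intro eventually_at_rightI[of 0 1]) auto
  ultimately have "(\<integral>t. atom0 t \<partial>exp_law 1) \<le> 0" by (rule tendsto_lowerbound) simp
  moreover have "0 \<le> (\<integral>t. atom0 t \<partial>exp_law 1)" using a01 by (intro integral_nonneg_AE AE_I2) auto
  ultimately show "(\<integral>t. atom0 t \<partial>exp_law 1) = 0" by simp
qed

text \<open>By multiplicativity a nonzero value at t forces nonzero values on all of (0, t), against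
  vanishing almost everywhere.\<close>

lemma atom0_zero:
  assumes t: "t > 0"
  shows "atom0 t = 0"
proof (rule ccontr)
  assume nz: "atom0 t \<noteq> 0"
  have nz': "atom0 u \<noteq> 0" if "u \<in> {0<..<t}" for u
    using atom0_mult[of u "t - u"] that nz by auto
  have "AE u in exp_law 1. atom0 u = 0"
    using integral_nonneg_eq_0_iff_AE[OF atom0_integral(1)] atom0_integral(2)
    by (auto simp: atom0_def)
  then have "AE u in exp_law 1. u \<notin> {0<..<t}"
    by eventually_elim (use nz' in auto)
  then have "AE u in restrict_space lborel {0..}. u \<notin> {0<..<t}"
    unfolding exp_law_def by (subst (asm) AE_density) (auto intro!: measurable_restrict_space1)
  then have "AE u in lborel. u \<in> {0..} \<longrightarrow> u \<notin> {0<..<t}"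
    by (subst (asm) AE_restrict_space_iff) auto
  then have "AE u in lborel. u \<notin> {0<..<t}"
    by eventually_elim auto
  then have "emeasure lborel {0<..<t} = 0"
    by (subst (asm) AE_iff_measurable[where N="{0<..<t}"]) auto
  then show False using t by simp
qed

end

lemma unit_borel_setsI: "A \<in> sets borel \<Longrightarrow> A \<subseteq> {0..1} \<Longrightarrow> A \<in> sets unit_borel"
  for A :: "real set"
  by (simp add: sets_restrict_space_iff)

section \<open>The density of the primal law and its essential infimum\<close>

context dual_diffusion begin

text \<open>Relative to the stationary law, \<open>link_law x\<close> has the density
  \<open>M 1 / M x\<close> on y < x; here it is averaged over the dual at time t. The strict
  inequality makes the value at y = 1 zero, which concerns a null set only.\<close>

definition ratio :: "real \<Rightarrow> real \<Rightarrow> ennreal" where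
  "ratio t y = (\<integral>\<^sup>+x. (if y < x then ennreal (M 1 / M x) else 0) \<partial>D.law 0 t)"

definition ramp :: "real \<Rightarrow> nat \<Rightarrow> real \<Rightarrow> real" where
  "ramp c n y = max 0 (min 1 (1 - real n * (y - c)))"

lemma ramp_cont: "continuous_on {0..1} (ramp c n)"
  unfolding ramp_def[abs_def] by (intro continuous_intros)

lemma ramp_abs: "\<bar>ramp c n y\<bar> \<le> 1"
  by (simp add: ramp_def)

lemma ramp_lim:
  assumes y: "0 \<le> y"
  shows "(\<lambda>n. ramp c n y) \<longlonglongrightarrow> indicator {0..c} y"
proof (cases "y \<le> c")
  case True
  then have "real n * (y - c) \<le> 0" for n by (simp add: mult_nonneg_nonpos)
  then have "ramp c n y = 1" for n by (auto simp: ramp_def min_def max_def)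
  then show ?thesis using True y by simp
next
  case False
  then have d: "y - c > 0" by simp
  obtain N where N: "real N > 1 / (y - c)" using reals_Archimedean2 by blast
  have "ramp c n y = indicator {0..c} y" if "n \<ge> N" for n
  proof -
    have "real n > 1 / (y - c)" using N that by (meson of_nat_le_iff order_less_le_trans)
    then have "real n * (y - c) > 1" using d by (simp add: field_simps)
    then show ?thesis using False by (simp add: ramp_def)
  qed
  then have "eventually (\<lambda>n. ramp c n y = indicator {0..c} y) sequentially" by (auto simp: eventually_sequentially)
  then show ?thesis by (rule tendsto_eventually)
qed

lemma Icc_unit: "c \<in> {0..1} \<Longrightarrow> {0..c} \<in> sets unit_borel" for c :: real
  by (intro unit_borel_setsI) auto

lemma prob_unit_ramp_lim:
  assumes \<mu>: "prob_space \<mu>" "sets \<mu> = sets unit_borel" and c: "c \<in> {0..1}"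
  shows "(\<lambda>n. \<integral>y. ramp c n y \<partial>\<mu>) \<longlonglongrightarrow> measure \<mu> {0..c}"
proof -
  have "(\<lambda>n. \<integral>y. ramp c n y \<partial>\<mu>) \<longlonglongrightarrow> (\<integral>y. indicator {0..c} y \<partial>\<mu>)"
    by (rule prob_unit_DCT[OF \<mu>, where B=1]) (auto intro: cont_unit_measurable ramp_cont ramp_lim ramp_abs)
  moreover have "(\<integral>y. indicator {0..c} y \<partial>\<mu>) = measure \<mu> {0..c}" using Icc_unit[OF c] \<mu>(2) by simp
  ultimately show ?thesis by simp
qed

lemma law_0_Icc:
  assumes t: "t \<ge> 0" and c: "c \<in> {0..1}"
  shows "(\<lambda>x. measure (link_law x) {0..c}) \<in> borel_measurable (D.law 0 t)"
    "measure (law 0 t) {0..c} = (\<integral>x. measure (link_law x) {0..c} \<partial>D.law 0 t)"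
proof -
  have lim: "(\<lambda>n. link a b (ramp c n) x) \<longlonglongrightarrow> measure (link_law x) {0..c}" if x: "x \<in> {0..1}" for x
    using prob_unit_ramp_lim[OF prob_link_law[OF x] sets_link_law c] x
    by (simp add: link_eq_integral cont_unit_measurable ramp_cont)
  have m: "link a b (ramp c n) \<in> borel_measurable (D.law 0 t)" for n
    using cont_unit_measurable[OF link_cont[OF ramp_cont]] by (simp cong: measurable_cong_sets)
  show "(\<lambda>x. measure (link_law x) {0..c}) \<in> borel_measurable (D.law 0 t)"
    by (rule borel_measurable_LIMSEQ_real[where u="\<lambda>n. link a b (ramp c n)", OF _ m]) (use lim in auto)
  have \<rho>: "prob_space (D.law 0 t)" "prob_space (law 0 t)" using t by (auto intro: D.prob_law prob_law)
  have "(\<lambda>n. \<integral>x. link a b (ramp c n) x \<partial>D.law 0 t) \<longlonglongrightarrow> (\<integral>x. measure (link_law x) {0..c} \<partial>D.law 0 t)"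
  proof (rule prob_unit_DCT[OF \<rho>(1), where B=1])
    fix n and y :: real assume y: "y \<in> {0..1}"
    show "\<bar>link a b (ramp c n) y\<bar> \<le> 1"
      by (rule link_abs_le[OF ramp_cont y ramp_abs])
  qed (auto intro: lim cont_unit_measurable link_cont ramp_cont)
  moreover have "T t (ramp c n) 0 = (\<integral>x. link a b (ramp c n) x \<partial>D.law 0 t)" for n
    by (rule T_start_0[OF ramp_cont t])
  moreover have "T t (ramp c n) 0 = (\<integral>y. ramp c n y \<partial>law 0 t)" for n
    using t by (intro T_law cont_unit_measurable ramp_cont) auto
  ultimately have "(\<lambda>n. \<integral>y. ramp c n y \<partial>law 0 t) \<longlonglongrightarrow> (\<integral>x. measure (link_law x) {0..c} \<partial>D.law 0 t)" by simp
  with prob_unit_ramp_lim[OF \<rho>(2) _ c] show "measure (law 0 t) {0..c} = (\<integral>x. measure (link_law x) {0..c} \<partial>D.law 0 t)"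
    using LIMSEQ_unique by auto
qed

lemma kernel_measurable:
  assumes A: "A \<in> sets unit_borel" and \<rho>: "sets \<rho> = sets unit_borel" and \<pi>: "sets \<pi> = sets unit_borel"
  shows "(\<lambda>(x, y). (if y < x then ennreal (M 1 / M x) else 0) * indicator A y) \<in> borel_measurable (\<rho> \<Otimes>\<^sub>M \<pi>)"
proof -
  have f: "fst \<in> measurable (\<rho> \<Otimes>\<^sub>M \<pi>) unit_borel" and g: "snd \<in> measurable (\<rho> \<Otimes>\<^sub>M \<pi>) unit_borel"
    using measurable_fst[of \<rho> \<pi>] measurable_snd[of \<rho> \<pi>] \<rho> \<pi> by (simp_all cong: measurable_cong_sets)
  have id: "(\<lambda>x. x) \<in> borel_measurable unit_borel" by (intro measurable_restrict_space1) simp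
  have [measurable]: "fst \<in> borel_measurable (\<rho> \<Otimes>\<^sub>M \<pi>)" "snd \<in> borel_measurable (\<rho> \<Otimes>\<^sub>M \<pi>)"
    using measurable_compose[OF f id] measurable_compose[OF g id] by simp_all
  have [measurable]: "(\<lambda>p. M (fst p)) \<in> borel_measurable (\<rho> \<Otimes>\<^sub>M \<pi>)"
    by (rule measurable_compose[OF f cont_unit_measurable[OF prim_cont[OF m_cint]]])
  have [measurable]: "(\<lambda>p. indicator A (snd p) :: ennreal) \<in> borel_measurable (\<rho> \<Otimes>\<^sub>M \<pi>)"
    by (rule measurable_compose[OF g borel_measurable_indicator[OF A]])
  show ?thesis unfolding case_prod_beta by measurable
qed

lemma ratio_measurable: "ratio t \<in> borel_measurable unit_borel" if t: "t \<ge> 0"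
proof -
  have "prob_space (D.law 0 t)" using t by (intro D.prob_law) auto
  then interpret prob_space "D.law 0 t" .
  have k: "(\<lambda>(y, x). (if y < x then ennreal (M 1 / M x) else 0) * indicator {0..1} y) \<in> borel_measurable (unit_borel \<Otimes>\<^sub>M D.law 0 t)"
    using kernel_measurable[of "{0..1}" "D.law 0 t" unit_borel, OF Icc_unit] measurable_pair_swap_iff[of _ "D.law 0 t" unit_borel]
    by (auto simp: case_prod_beta)
  from borel_measurable_nn_integral_fst[OF k]
  have "(\<lambda>y. \<integral>\<^sup>+x. (if y < x then ennreal (M 1 / M x) else 0) * indicator {0..1} y \<partial>D.law 0 t) \<in> borel_measurable unit_borel"
    by simp
  then show ?thesis
    by (rule measurable_cong[THEN iffD1, rotated]) (auto simp: ratio_def space_restrict_space)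
qed

text \<open>Tonelli exchanges the average over the dual with integration over {0..c}. At x = 0 the
  link is a point mass without a density, and this is where the absence of an atom enters.\<close>

lemma stat_density_ratio:
  assumes t: "t > 0" and c: "c \<in> {0..1}"
  shows "emeasure (density (stat_measure a b) (ratio t)) {0..c} = ennreal (measure (law 0 t) {0..c})"
proof -
  let ?\<rho> = "D.law 0 t" and ?\<pi> = "link_law 1" and ?A = "{0..c}"
  have \<rho>: "prob_space ?\<rho>" using t by (intro D.prob_law) auto
  interpret R: prob_space ?\<rho> by fact
  interpret L1: prob_space ?\<pi> by (rule prob_link_law) simp
  interpret pair_prob_space ?\<rho> ?\<pi> ..
  have A: "?A \<in> sets unit_borel" by (rule Icc_unit[OF c])
  have rm: "ratio t \<in> borel_measurable ?\<pi>" using ratio_measurable[of t] t by (simp add: sets_link_law cong: measurable_cong_sets)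
  have id: "(\<lambda>x. x) \<in> borel_measurable unit_borel" by (intro measurable_restrict_space1) simp
  have "emeasure (density (stat_measure a b) (ratio t)) ?A = (\<integral>\<^sup>+y. ratio t y * indicator ?A y \<partial>?\<pi>)"
    unfolding stat_measure_eq using A rm by (intro emeasure_density) (auto simp: sets_link_law)
  also have "\<dots> = (\<integral>\<^sup>+y. (\<integral>\<^sup>+x. (if y < x then ennreal (M 1 / M x) else 0) * indicator ?A y \<partial>?\<rho>) \<partial>?\<pi>)"
  proof (rule nn_integral_cong)
    fix y
    show "ratio t y * indicator ?A y = (\<integral>\<^sup>+x. (if y < x then ennreal (M 1 / M x) else 0) * indicator ?A y \<partial>?\<rho>)"
      by (cases "y \<in> ?A") (auto simp: ratio_def)
  qed
  also have "\<dots> = (\<integral>\<^sup>+x. (\<integral>\<^sup>+y. (if y < x then ennreal (M 1 / M x) else 0) * indicator ?A y \<partial>?\<pi>) \<partial>?\<rho>)"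
    by (rule Fubini') (rule kernel_measurable[OF A D.sets_law sets_link_law])
  also have "\<dots> = (\<integral>\<^sup>+x. ennreal (measure (link_law x) ?A) \<partial>?\<rho>)"
  proof (rule nn_integral_cong_AE)
    have "AE x in ?\<rho>. x \<noteq> 0"
    proof -
      have "emeasure ?\<rho> {0} = 0" using atom0_zero[OF t] by (simp add: atom0_def R.emeasure_eq_measure)
      then show ?thesis
        by (subst AE_iff_measurable[where N="{0}"]) (auto simp: sets_restrict_space)
    qed
    then show "AE x in ?\<rho>. (\<integral>\<^sup>+y. (if y < x then ennreal (M 1 / M x) else 0) * indicator ?A y \<partial>?\<pi>) = ennreal (measure (link_law x) ?A)"
      using AE_space
    proof eventually_elim
      case (elim x)
      then have x: "x \<in> {0<..1}" by auto
      have "emeasure (link_law x) ?A = (\<integral>\<^sup>+y. indicator ?A y \<partial>link_law x)" using A by (simp add: sets_link_law)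
      also have "\<dots> = (\<integral>\<^sup>+y\<in>{0<..<x}. ennreal (m y / M x) * indicator ?A y \<partial>lborel)"
        by (rule nn_integral_link_law[OF x]) (use A in simp)
      also have "\<dots> = (\<integral>\<^sup>+y\<in>{0<..<1}. ennreal (m y / M 1) * ((if y < x then ennreal (M 1 / M x) else 0) * indicator ?A y) \<partial>lborel)"
      proof (rule nn_integral_cong)
        fix y :: real
        show "ennreal (m y / M x) * indicator ?A y * indicator {0<..<x} y
          = ennreal (m y / M 1) * ((if y < x then ennreal (M 1 / M x) else 0) * indicator ?A y) * indicator {0<..<1} y"
        proof (cases "y \<in> {0<..<x}")
          case True
          have "ennreal (m y / M 1) * ennreal (M 1 / M x) = ennreal (m y / M 1 * (M 1 / M x))"
            using m_pos[of y] True x sp.M1 sp.M_pos[of x] by (intro ennreal_mult[symmetric] divide_nonneg_nonneg) auto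
          also have "m y / M 1 * (M 1 / M x) = m y / M x" using sp.M1 by simp
          finally show ?thesis using True x by (simp add: mult.assoc[symmetric])
        next
          case False
          then show ?thesis by (auto split: split_indicator)
        qed
      qed
      also have "\<dots> = (\<integral>\<^sup>+y. (if y < x then ennreal (M 1 / M x) else 0) * indicator ?A y \<partial>?\<pi>)"
      proof (rule nn_integral_link_law[symmetric])
        have [measurable]: "(\<lambda>y. y) \<in> borel_measurable unit_borel" by (rule id)
        have [measurable]: "?A \<in> sets unit_borel" by (rule A)
        show "(\<lambda>y. (if y < x then ennreal (M 1 / M x) else 0) * indicator ?A y) \<in> borel_measurable unit_borel" by measurable
      qed simp
      finally have e: "emeasure (link_law x) ?A = \<dots>" .
      have "prob_space (link_law x)" using x by (intro prob_link_law) auto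
      then interpret L: prob_space "link_law x" .
      show ?case using e by (simp add: L.emeasure_eq_measure)
    qed
  qed
  also have "\<dots> = ennreal (\<integral>x. measure (link_law x) ?A \<partial>?\<rho>)"
  proof (rule nn_integral_eq_integral)
    show "integrable ?\<rho> (\<lambda>x. measure (link_law x) ?A)"
      using law_0_Icc(1)[OF less_imp_le[OF t] c] prob_space.prob_le_1[OF prob_link_law]
      by (intro R.integrable_const_bound[where B=1] AE_I2) auto
  qed simp
  finally show ?thesis using law_0_Icc(2)[OF less_imp_le[OF t] c] by simp
qed

lemma law_eq_density:
  assumes t: "t > 0"
  shows "density (stat_measure a b) (ratio t) = law 0 t"
proof (rule measure_unit_eqI)
  have l: "prob_space (law 0 t)" using t by (intro prob_law) auto
  then interpret L: prob_space "law 0 t" .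
  have sp: "space (stat_measure a b) = {0..1}" by (simp add: stat_measure_def space_restrict_space)
  show p: "prob_space (density (stat_measure a b) (ratio t))"
  proof
    show "emeasure (density (stat_measure a b) (ratio t)) (space (density (stat_measure a b) (ratio t))) = 1"
      using stat_density_ratio[OF t, of 1] L.prob_space by (simp add: sp)
  qed
  then interpret D': prob_space "density (stat_measure a b) (ratio t)" .
  show "sets (density (stat_measure a b) (ratio t)) = sets unit_borel" by (simp add: stat_measure_eq sets_link_law)
  show "prob_space (law 0 t)" by fact
  show "measure (density (stat_measure a b) (ratio t)) {0..c} = measure (law 0 t) {0..c}" if c: "c \<in> {0..1}" for c
    using stat_density_ratio[OF t c] by (simp add: D'.emeasure_eq_measure)
qed simp

lemma ratio_antimono: "y \<le> z \<Longrightarrow> ratio t z \<le> ratio t y"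
  unfolding ratio_def by (intro nn_integral_mono) auto

lemma ratio_ge:
  assumes t: "t \<ge> 0" and y: "y < 1"
  shows "ennreal (measure (D.law 0 t) {1}) \<le> ratio t y"
proof -
  have "prob_space (D.law 0 t)" using t by (intro D.prob_law) auto
  then interpret prob_space "D.law 0 t" .
  have one: "{1} \<in> sets (D.law 0 t)" by (auto simp: sets_restrict_space)
  have "ennreal (measure (D.law 0 t) {1}) = (\<integral>\<^sup>+x. indicator {1} x \<partial>D.law 0 t)"
    using one by (simp add: emeasure_eq_measure)
  also have "\<dots> \<le> ratio t y" unfolding ratio_def
    using y sp.M1 by (intro nn_integral_mono) (auto split: split_indicator)
  finally show ?thesis .
qed

text \<open>Only dual states beyond y contribute: the state 1 with weight 1, the others with weight
  at most \<open>M 1 / M (1/2)\<close> and a probability that vanishes as y tends to 1.\<close>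

lemma ratio_le:
  assumes t: "t \<ge> 0" and y: "1/2 \<le> y" "y < 1"
  shows "ratio t y \<le> ennreal (measure (D.law 0 t) {1} + M 1 / M (1/2) * measure (D.law 0 t) {y<..<1})"
proof -
  have "prob_space (D.law 0 t)" using t by (intro D.prob_law) auto
  then interpret prob_space "D.law 0 t" .
  have s: "{1} \<in> sets (D.law 0 t)" "{y<..<1} \<in> sets (D.law 0 t)"
    using y by (auto intro!: unit_borel_setsI)
  have Mh: "0 < M (1/2)" by (rule sp.M_pos) auto
  have k: "0 \<le> M 1 / M (1/2)" using Mh sp.M1 by simp
  have "ratio t y \<le> (\<integral>\<^sup>+x. indicator {1} x + ennreal (M 1 / M (1/2)) * indicator {y<..<1} x \<partial>D.law 0 t)"
    unfolding ratio_def
  proof (rule nn_integral_mono)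
    fix x assume "x \<in> space (D.law 0 t)"
    then have x: "0 \<le> x" "x \<le> 1" by auto
    show "(if y < x then ennreal (M 1 / M x) else 0) \<le> indicator {1} x + ennreal (M 1 / M (1/2)) * indicator {y<..<1} x"
    proof (cases "y < x \<and> x < 1")
      case True
      have "M (1/2) \<le> M x" using True y m_pos by (intro prim_mono m_cint) (auto intro: less_imp_le)
      then have "M 1 / M x \<le> M 1 / M (1/2)" using Mh sp.M1 by (intro frac_le) auto
      then show ?thesis using True by (simp add: ennreal_leI)
    next
      case False
      then show ?thesis using x y sp.M1 by (auto split: split_indicator)
    qed
  qed
  also have "\<dots> = (\<integral>\<^sup>+x. indicator {1} x \<partial>D.law 0 t) + (\<integral>\<^sup>+x. ennreal (M 1 / M (1/2)) * indicator {y<..<1} x \<partial>D.law 0 t)"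
  proof -
    note [measurable] = s
    show ?thesis by (rule nn_integral_add) measurable
  qed
  also have "\<dots> = emeasure (D.law 0 t) {1} + ennreal (M 1 / M (1/2)) * emeasure (D.law 0 t) {y<..<1}"
    using s by (simp add: nn_integral_cmult_indicator)
  also have "\<dots> = ennreal (measure (D.law 0 t) {1} + M 1 / M (1/2) * measure (D.law 0 t) {y<..<1})"
    unfolding emeasure_eq_measure
    by (simp only: ennreal_mult[OF k measure_nonneg] ennreal_plus[OF measure_nonneg mult_nonneg_nonneg[OF k measure_nonneg]])
  finally show ?thesis .
qed

lemma stat_measure_pos:
  assumes y: "0 < y" "y < 1"
  shows "emeasure (stat_measure a b) {y..<1} \<noteq> 0"
proof
  have A: "{y..<1} \<in> sets unit_borel" using y by (intro unit_borel_setsI) auto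
  have int: "set_integrable lborel {y..<1} m" "set_integrable lborel {0<..<y} m"
    using y by (auto intro: set_integrable_subset[OF m_integrable])
  assume z: "emeasure (stat_measure a b) {y..<1} = 0"
  have ls: "prob_space (link_law 1)" by (rule prob_link_law) simp
  then interpret prob_space "link_law 1" .
  have "emeasure (link_law 1) {y..<1} = (\<integral>\<^sup>+x. indicator {y..<1} x \<partial>link_law 1)" using A by (simp add: sets_link_law)
  also have "\<dots> = (\<integral>\<^sup>+x\<in>{0<..<1}. ennreal (m x / M 1) * indicator {y..<1} x \<partial>lborel)"
    by (rule nn_integral_link_law) (use A in auto)
  also have "\<dots> = (\<integral>\<^sup>+x\<in>{y..<1}. ennreal (m x / M 1) \<partial>lborel)"
    using y by (intro nn_integral_cong) (auto split: split_indicator)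
  also have "\<dots> = ennreal (LBINT x:{y..<1}. m x / M 1)"
  proof (rule nn_finite_of_set_integrable)
    show "set_integrable lborel {y..<1} (\<lambda>x. m x / M 1)"
      by (intro set_integrable_divide int)
    show "0 \<le> m x / M 1" if "x \<in> {y..<1}" for x using that y m_pos[of x] sp.M1 by simp
  qed
  finally have e: "ennreal (LBINT x:{y..<1}. m x / M 1) = 0" using z by (simp add: stat_measure_eq)
  have "(LBINT x:{0<..<1}. m x) = (LBINT x:{0<..<y}. m x) + (LBINT x:{y..<1}. m x)"
  proof -
    have "{0<..<1} = {0<..<y} \<union> {y..<1}" "{0<..<y} \<inter> {y..<1} = {}" using y by auto
    then show ?thesis using set_integral_Un[OF _ int(2,1)] by simp
  qed
  then have "(LBINT x:{y..<1}. m x) > 0" using sp.M_strict_mono[of y 1] y by (simp add: prim_def)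
  then have "(LBINT x:{y..<1}. m x / M 1) > 0" using sp.M1 by simp
  moreover from e have "(LBINT x:{y..<1}. m x / M 1) \<le> 0" by (simp only: ennreal_eq_0_iff)
  ultimately show False by linarith
qed

text \<open>A level up to the mass at 1 is undercut at most at the point 1, a null set. A larger
  level is undercut, by monotonicity, on a whole interval {y..<1}, which has positive stationary
  mass.\<close>

lemma separation_eq:
  assumes t: "t > 0"
  shows "separation (stat_measure a b) (law 0 t) = 1 - measure (D.law 0 t) {1}"
proof -
  let ?\<Pi> = "stat_measure a b" and ?\<alpha> = "measure (D.law 0 t) {1}"
  have t0: "0 \<le> t" using t by simp
  have "prob_space ?\<Pi>" unfolding stat_measure_eq by (rule prob_link_law) simp
  then interpret P: prob_space ?\<Pi> .
  have sp: "space ?\<Pi> = {0..1}" by (simp add: stat_measure_def space_restrict_space)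
  have sets: "sets ?\<Pi> = sets unit_borel" by (simp add: stat_measure_eq sets_link_law)
  have rm: "ratio t \<in> borel_measurable ?\<Pi>" using ratio_measurable[OF t0] by (simp add: sets cong: measurable_cong_sets)
  have AE: "AE x in ?\<Pi>. ratio t x = RN_deriv ?\<Pi> (law 0 t) x"
    by (rule P.RN_deriv_unique[OF rm law_eq_density[OF t]])
  \<comment> \<open>\<open>RN_deriv\<close> is fixed only almost everywhere, which the measure of a
    sublevel set does not see.\<close>
  have eq: "emeasure ?\<Pi> {x\<in>space ?\<Pi>. RN_deriv ?\<Pi> (law 0 t) x < ennreal r} = emeasure ?\<Pi> {x\<in>space ?\<Pi>. ratio t x < ennreal r}" for r
  proof (rule emeasure_eq_AE)
    show "AE x in ?\<Pi>. x \<in> {x\<in>space ?\<Pi>. RN_deriv ?\<Pi> (law 0 t) x < ennreal r} \<longleftrightarrow> x \<in> {x\<in>space ?\<Pi>. ratio t x < ennreal r}"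
      using AE by eventually_elim auto
    note [measurable] = rm borel_measurable_RN_deriv[of ?\<Pi> "law 0 t"]
    show "{x\<in>space ?\<Pi>. RN_deriv ?\<Pi> (law 0 t) x < ennreal r} \<in> sets ?\<Pi>" by measurable
    show "{x\<in>space ?\<Pi>. ratio t x < ennreal r} \<in> sets ?\<Pi>" by measurable
  qed
  have "{r. emeasure ?\<Pi> {x\<in>space ?\<Pi>. ratio t x < ennreal r} = 0} = {..?\<alpha>}"
  proof (intro equalityI subsetI)
    fix r assume "r \<in> {..?\<alpha>}"
    then have r: "r \<le> ?\<alpha>" by simp
    have one: "{1} \<in> sets ?\<Pi>" by (auto simp: sets sets_restrict_space)
    have "emeasure ?\<Pi> {1} = (\<integral>\<^sup>+y. indicator {1} y \<partial>link_law 1)" using one by (simp add: stat_measure_eq)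
    also have "\<dots> = (\<integral>\<^sup>+y\<in>{0<..<1}. ennreal (m y / M 1) * indicator {1} y \<partial>lborel)"
      using one by (intro nn_integral_link_law) (auto simp: sets)
    also have "\<dots> = (\<integral>\<^sup>+(y::real). 0 \<partial>lborel)" by (intro nn_integral_cong) (auto split: split_indicator)
    finally have "emeasure ?\<Pi> {1} = 0" by simp
    moreover have "{x\<in>space ?\<Pi>. ratio t x < ennreal r} \<subseteq> {1}"
    proof
      fix x assume x: "x \<in> {x\<in>space ?\<Pi>. ratio t x < ennreal r}"
      have "\<not> x < 1"
      proof
        assume "x < 1"
        from ennreal_leI[OF r] ratio_ge[OF t0 this] have "ennreal r \<le> ratio t x" by (rule order_trans)
        then show False using x by (auto simp: not_le[symmetric])
      qed
      then show "x \<in> {1}" using x sp by auto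
    qed
    ultimately have "emeasure ?\<Pi> {x\<in>space ?\<Pi>. ratio t x < ennreal r} = 0"
      using emeasure_mono[OF _ one] by (metis le_zero_eq)
    then show "r \<in> {r. emeasure ?\<Pi> {x\<in>space ?\<Pi>. ratio t x < ennreal r} = 0}" by simp
  next
    fix r assume r0: "r \<in> {r. emeasure ?\<Pi> {x\<in>space ?\<Pi>. ratio t x < ennreal r} = 0}"
    show "r \<in> {..?\<alpha>}"
    proof (rule ccontr)
      assume "r \<notin> {..?\<alpha>}"
      then have r: "?\<alpha> < r" by simp
      have "prob_space (D.law 0 t)" using t by (intro D.prob_law) auto
      then interpret R: prob_space "D.law 0 t" .
      \<comment> \<open>Points tending to 1 and kept at or above 1/2, as \<open>ratio_le\<close>
        requires.\<close>
      define y where "y k = 1 - 1 / real (k + 2)" for k :: nat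
      have y: "0 < y k" "y k < 1" "1/2 \<le> y k" for k by (auto simp: y_def field_simps)
      have y_lim: "y \<longlonglongrightarrow> 1"
      proof -
        have "(\<lambda>k. 1 - 1 / real (k + 2)) \<longlonglongrightarrow> 1 - 0"
          by (intro tendsto_intros LIMSEQ_ignore_initial_segment[OF lim_1_over_n])
        then show ?thesis by (simp add: y_def[abs_def])
      qed
      have "(\<lambda>k. measure (D.law 0 t) {y k<..<1}) \<longlonglongrightarrow> measure (D.law 0 t) (\<Inter>k. {y k<..<1})"
      proof (rule R.finite_Lim_measure_decseq)
        show "range (\<lambda>k. {y k<..<1}) \<subseteq> sets (D.law 0 t)"
        proof
          fix S assume "S \<in> range (\<lambda>k. {y k<..<1})"
          then obtain k where "S = {y k<..<1}" by auto
          then show "S \<in> sets (D.law 0 t)"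
            using y[of k] by (auto intro!: unit_borel_setsI)
        qed
        show "decseq (\<lambda>k. {y k<..<1})"
        proof (rule decseq_SucI)
          fix k
          have "y k \<le> y (Suc k)" by (simp add: y_def frac_le)
          then show "{y (Suc k)<..<1} \<subseteq> {y k<..<1}" by auto
        qed
      qed
      moreover have "(\<Inter>k. {y k<..<1}) = {}"
      proof (rule ccontr)
        assume "(\<Inter>k. {y k<..<1}) \<noteq> {}"
        then obtain x where "x \<in> (\<Inter>k. {y k<..<1})" by blast
        then have x: "\<And>k. y k < x" "x < 1" by auto
        have "1 \<le> x" by (rule LIMSEQ_le_const2[OF y_lim]) (use x(1) in \<open>auto intro: less_imp_le\<close>)
        then show False using x(2) by simp
      qed
      ultimately have "(\<lambda>k. measure (D.law 0 t) {y k<..<1}) \<longlonglongrightarrow> 0" by simp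
      then have "(\<lambda>k. ?\<alpha> + M 1 / M (1/2) * measure (D.law 0 t) {y k<..<1}) \<longlonglongrightarrow> ?\<alpha> + M 1 / M (1/2) * 0"
        by (intro tendsto_intros)
      then have "eventually (\<lambda>k. ?\<alpha> + M 1 / M (1/2) * measure (D.law 0 t) {y k<..<1} < r) sequentially"
        by (rule order_tendstoD) (use r in simp)
      then obtain k where k: "?\<alpha> + M 1 / M (1/2) * measure (D.law 0 t) {y k<..<1} < r"
        by (auto simp: eventually_sequentially)
      \<comment> \<open>\<open>ennreal\<close> truncates at 0, so a strict inequality between reals
        survives only below a positive r.\<close>
      have rp: "0 < r" using r measure_nonneg[of "D.law 0 t" "{1}"] by linarith
      have "ratio t (y k) < ennreal r"
        using ratio_le[OF t0 y(3,2)[of k]] ennreal_lessI[OF rp k] by (rule order_le_less_trans)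
      then have "ratio t x < ennreal r" if "y k \<le> x" for x
        using ratio_antimono[OF that, of t] by (rule order_le_less_trans[rotated])
      then have sub: "{y k..<1} \<subseteq> {x\<in>space ?\<Pi>. ratio t x < ennreal r}"
        using y(1)[of k] by (auto simp: sp)
      have "{x\<in>space ?\<Pi>. ratio t x < ennreal r} \<in> sets ?\<Pi>"
      proof -
        note [measurable] = rm
        show ?thesis by measurable
      qed
      from emeasure_mono[OF sub this] r0 have "emeasure ?\<Pi> {y k..<1} \<le> 0" by simp
      then show False using stat_measure_pos[OF y(1,2)[of k]] by simp
    qed
  qed
  then show ?thesis unfolding separation_def eq by simp
qed

end

section \<open>Sums of independent exponential variables\<close>

lemma exp_law_tail:
  assumes \<theta>: "\<theta> > 0" and z: "z \<ge> 0"
  shows "measure (exp_law \<theta>) {z..} = exp (- \<theta> * z)"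
proof -
  interpret prob_space "exp_law \<theta>" by (rule prob_space_exp_law[OF \<theta>])
  have A: "{z..} \<in> sets (exp_law \<theta>)" using z by (simp add: sets_restrict_space_iff)
  have m: "(indicator {z..} :: real \<Rightarrow> real) \<in> borel_measurable (restrict_space borel {0..})"
    by (intro measurable_restrict_space1) simp
  have "measure (exp_law \<theta>) {z..} = (\<integral>t. indicator {z..} t \<partial>exp_law \<theta>)"
    using z by (simp add: Int_absorb2)
  also have "\<dots> = exp (- \<theta> * z) * (\<integral>t. indicator {z..} (t + z) \<partial>exp_law \<theta>)
      + (LBINT t:{0..<z}. \<theta> * exp (- \<theta> * t) * indicator {z..} t)"
    by (rule exp_law_shift[OF \<theta> z m, of 1, symmetric]) (simp add: indicator_def)
  also have "(\<integral>t. indicator {z..} (t + z) \<partial>exp_law \<theta>) = (\<integral>t. (1::real) \<partial>exp_law \<theta>)"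
    by (intro Bochner_Integration.integral_cong) auto
  also have "\<dots> = 1" using prob_space by simp
  also have "(LBINT t:{0..<z}. \<theta> * exp (- \<theta> * t) * indicator {z..} t) = (LBINT t:{0..<z}. 0)"
    by (intro set_lebesgue_integral_cong) auto
  finally show ?thesis by simp
qed

text \<open>Both sides are the probability that Z is at most an independent exponential clock of
  rate \<theta>. The clock never reaches infinity, hence the value 0 where Z is infinite.\<close>

lemma (in prob_space) Laplace_cdf:
  assumes [measurable]: "Z \<in> borel_measurable M" and \<theta>: "\<theta> > 0"
  shows "(\<integral>t. prob {\<omega>\<in>space M. Z \<omega> \<le> ennreal t} \<partial>exp_law \<theta>)
    = expectation (\<lambda>\<omega>. if Z \<omega> = \<infinity> then 0 else exp (- \<theta> * enn2real (Z \<omega>)))"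
proof -
  interpret E: prob_space "exp_law \<theta>" by (rule prob_space_exp_law[OF \<theta>])
  interpret pair_prob_space "exp_law \<theta>" M ..
  let ?F = "\<lambda>t \<omega>. (if Z \<omega> \<le> ennreal t then 1 else 0) :: real"
  have [measurable]: "fst \<in> borel_measurable (exp_law \<theta> \<Otimes>\<^sub>M M)"
    by (rule measurable_compose[OF measurable_fst, of "\<lambda>x. x", simplified])
      (auto cong: measurable_cong_sets intro!: measurable_restrict_space1)
  have "(\<lambda>p. ?F (fst p) (snd p)) \<in> borel_measurable (exp_law \<theta> \<Otimes>\<^sub>M M)" by measurable
  then have "integrable (exp_law \<theta> \<Otimes>\<^sub>M M) (case_prod ?F)"
    by (intro integrable_const_bound[where B=1] AE_I2) (auto simp: case_prod_beta)
  from Fubini_integral[OF this]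
  have "(\<integral>\<omega>. \<integral>t. ?F t \<omega> \<partial>exp_law \<theta> \<partial>M) = (\<integral>t. \<integral>\<omega>. ?F t \<omega> \<partial>M \<partial>exp_law \<theta>)" .
  moreover have "(\<integral>\<omega>. ?F t \<omega> \<partial>M) = measure M {\<omega>\<in>space M. Z \<omega> \<le> ennreal t}" for t
  proof -
    have "(\<integral>\<omega>. ?F t \<omega> \<partial>M) = (\<integral>\<omega>. indicator {\<omega>\<in>space M. Z \<omega> \<le> ennreal t} \<omega> \<partial>M)"
      by (intro Bochner_Integration.integral_cong) auto
    also have "\<dots> = measure M {\<omega>\<in>space M. Z \<omega> \<le> ennreal t}" by (simp add: Int_def conj_commute)
    finally show ?thesis .
  qed
  moreover have "(\<integral>t. ?F t \<omega> \<partial>exp_law \<theta>) = (if Z \<omega> = \<infinity> then 0 else exp (- \<theta> * enn2real (Z \<omega>)))" for \<omega>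
  proof (cases "Z \<omega> = \<infinity>")
    case True
    then have "?F t \<omega> = 0" for t by (simp add: top_unique)
    then show ?thesis using True by simp
  next
    case False
    define z where "z = enn2real (Z \<omega>)"
    have z: "Z \<omega> = ennreal z" "0 \<le> z" using False by (auto simp: z_def top.not_eq_extremum)
    have "(\<integral>t. ?F t \<omega> \<partial>exp_law \<theta>) = (\<integral>t. indicator {z..} t \<partial>exp_law \<theta>)"
      using z by (intro Bochner_Integration.integral_cong) (auto simp: ennreal_le_iff)
    also have "\<dots> = measure (exp_law \<theta>) {z..}" using z(2) by (simp add: Int_absorb2)
    also have "\<dots> = exp (- \<theta> * z)" by (rule exp_law_tail[OF \<theta> z(2)])
    finally show ?thesis using False by (simp add: z_def)
  qed
  ultimately show ?thesis by simp
qed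

text \<open>\<open>ennreal\<close> sends the negative values of the variable, a null event, to 0;
  \<open>max 0\<close> reproduces this on the side of real numbers.\<close>

lemma Laplace_exponential:
  assumes D: "distributed N lborel Y (exponential_density l)" and l: "l > 0" and \<theta>: "\<theta> > 0"
  shows "(\<integral>\<omega>. exp (- \<theta> * max 0 (Y \<omega>)) \<partial>N) = l / (l + \<theta>)"
proof -
  have lt: "0 < l + \<theta>" using l \<theta> by simp
  interpret E: prob_space "exp_law (l + \<theta>)" by (rule prob_space_exp_law[OF lt])
  have "(\<integral>\<omega>. exp (- \<theta> * max 0 (Y \<omega>)) \<partial>N) = (\<integral>x. exponential_density l x * exp (- \<theta> * max 0 x) \<partial>lborel)"
    by (rule distributed_integral[OF D, symmetric]) (auto simp: exponential_density_nonneg l)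
  also have "\<dots> = (LBINT x:{0..}. l / (l + \<theta>) * ((l + \<theta>) * exp (- (l + \<theta>) * x) * 1))"
    unfolding set_lebesgue_integral_def
  proof (rule Bochner_Integration.integral_cong[OF refl])
    fix x :: real
    have "exp (- l * x) * exp (- \<theta> * x) = exp (- (l + \<theta>) * x)" by (simp add: exp_add[symmetric] algebra_simps)
    with lt show "exponential_density l x * exp (- \<theta> * max 0 x)
        = indicator {0..} x *\<^sub>R (l / (l + \<theta>) * ((l + \<theta>) * exp (- (l + \<theta>) * x) * 1))"
      by (simp add: exponential_density_def mult.commute[of x] mult.assoc)
  qed
  also have "\<dots> = l / (l + \<theta>) * (LBINT x:{0..}. (l + \<theta>) * exp (- (l + \<theta>) * x) * 1)" by (rule set_integral_mult_right)
  also have "(LBINT x:{0..}. (l + \<theta>) * exp (- (l + \<theta>) * x) * 1) = (\<integral>x. (1::real) \<partial>exp_law (l + \<theta>))"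
    by (rule integral_exp_law[OF lt, symmetric]) simp
  also have "\<dots> = 1" using E.prob_space by simp
  finally show ?thesis by simp
qed

text \<open>The transform of a partial sum is the product of the numbers lam i / (lam i + \<theta>),
  the reciprocal of a partial product. Dominated convergence passes to the limit, with value 0 where
  the series diverges.\<close>

lemma (in prob_space) Laplace_sum_exponentials:
  fixes Wi :: "nat \<Rightarrow> 'a \<Rightarrow> real" and lam :: "nat \<Rightarrow> real"
  assumes ind: "indep_vars (\<lambda>_. borel) Wi UNIV"
    and D: "\<And>i. distributed M lborel (Wi i) (exponential_density (lam i))" and lam: "\<And>i. lam i > 0"
    and \<theta>: "\<theta> > 0" and lim: "(\<lambda>n. \<Prod>i<n. 1 + \<theta> / lam i) \<longlonglongrightarrow> G" and G: "G > 0"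
  defines "Z \<equiv> \<lambda>\<omega>. \<Sum>i. ennreal (Wi i \<omega>)"
  shows "expectation (\<lambda>\<omega>. if Z \<omega> = \<infinity> then 0 else exp (- \<theta> * enn2real (Z \<omega>))) = 1 / G"
proof -
  have Wm [measurable]: "Wi i \<in> borel_measurable M" for i
    using distributed_measurable[OF D[of i]] by simp
  have Zm [measurable]: "Z \<in> borel_measurable M" unfolding Z_def by measurable
  let ?e = "\<lambda>\<omega>. if Z \<omega> = \<infinity> then 0 else exp (- \<theta> * enn2real (Z \<omega>))"
  let ?p = "\<lambda>n \<omega>. \<Prod>i<n. exp (- \<theta> * max 0 (Wi i \<omega>))"
  have p_eq: "?p n \<omega> = exp (- \<theta> * (\<Sum>i<n. max 0 (Wi i \<omega>)))" for n \<omega>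
    by (simp add: exp_sum[symmetric] sum_distrib_left sum_negf)
  have S: "(\<lambda>n. ennreal (\<Sum>i<n. max 0 (Wi i \<omega>))) \<longlonglongrightarrow> Z \<omega>" for \<omega>
  proof -
    have "(\<lambda>n. \<Sum>i<n. ennreal (Wi i \<omega>)) \<longlonglongrightarrow> Z \<omega>"
      unfolding Z_def by (rule summable_LIMSEQ) simp
    moreover have "(\<Sum>i<n. ennreal (Wi i \<omega>)) = ennreal (\<Sum>i<n. max 0 (Wi i \<omega>))" for n
    proof -
      have "ennreal (\<Sum>i<n. max 0 (Wi i \<omega>)) = (\<Sum>i<n. ennreal (max 0 (Wi i \<omega>)))"
        by (rule sum_ennreal[symmetric]) simp
      also have "\<dots> = (\<Sum>i<n. ennreal (Wi i \<omega>))" 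
        by (rule sum.cong[OF refl]) (simp add: max_def ennreal_neg)
      finally show ?thesis ..
    qed
    ultimately show ?thesis by simp
  qed
  have plim: "(\<lambda>n. ?p n \<omega>) \<longlonglongrightarrow> ?e \<omega>" for \<omega>
  proof (cases "Z \<omega> = \<infinity>")
    case True
    have "filterlim (\<lambda>n. \<Sum>i<n. max 0 (Wi i \<omega>)) at_top sequentially"
      unfolding filterlim_at_top_dense
    proof
      fix B :: real
      have "eventually (\<lambda>n. ennreal (max 0 B) < ennreal (\<Sum>i<n. max 0 (Wi i \<omega>))) sequentially"
        by (rule order_tendstoD(1)[OF S]) (use True in simp)
      then show "eventually (\<lambda>n. B < (\<Sum>i<n. max 0 (Wi i \<omega>))) sequentially"
      proof eventually_elim
        case (elim n)
        have "0 \<le> (\<Sum>i<n. max 0 (Wi i \<omega>))" by (intro sum_nonneg) auto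
        have "max 0 B < (\<Sum>i<n. max 0 (Wi i \<omega>))"
          by (rule iffD1[OF ennreal_less_iff elim]) simp
        then show ?case by simp
      qed
    qed
    then have "filterlim (\<lambda>n. - \<theta> * (\<Sum>i<n. max 0 (Wi i \<omega>))) at_bot sequentially"
      by (intro filterlim_tendsto_neg_mult_at_bot[OF tendsto_const]) (use \<theta> in auto)
    then have "(\<lambda>n. exp (- \<theta> * (\<Sum>i<n. max 0 (Wi i \<omega>)))) \<longlonglongrightarrow> 0"
      by (rule filterlim_compose[OF exp_at_bot])
    then show ?thesis by (simp only: p_eq True refl if_True)
  next
    case False
    then have "Z \<omega> = ennreal (enn2real (Z \<omega>))" by (simp add: top.not_eq_extremum)
    then have "(\<lambda>n. \<Sum>i<n. max 0 (Wi i \<omega>)) \<longlonglongrightarrow> enn2real (Z \<omega>)"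
      using S[of \<omega>] by (subst tendsto_ennreal_iff[symmetric]) (auto intro!: always_eventually sum_nonneg)
    then have "(\<lambda>n. exp (- \<theta> * (\<Sum>i<n. max 0 (Wi i \<omega>)))) \<longlonglongrightarrow> exp (- \<theta> * enn2real (Z \<omega>))"
      by (intro tendsto_intros)
    then show ?thesis by (simp only: p_eq False if_False)
  qed
  have "(\<lambda>n. expectation (?p n)) \<longlonglongrightarrow> expectation ?e"
  proof (rule integral_dominated_convergence[where w="\<lambda>_. 1"])
    show "AE \<omega> in M. norm (?p n \<omega>) \<le> 1" for n
    proof (rule AE_I2)
      fix \<omega>
      have "0 \<le> (\<Sum>i<n. max 0 (Wi i \<omega>))" by (intro sum_nonneg) auto
      then show "norm (?p n \<omega>) \<le> 1" unfolding p_eq using \<theta> by simp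
    qed
    show "AE \<omega> in M. (\<lambda>n. ?p n \<omega>) \<longlonglongrightarrow> ?e \<omega>" using plim by (intro AE_I2)
  qed measurable
  moreover have "expectation (?p n) = 1 / (\<Prod>i<n. 1 + \<theta> / lam i)" for n
  proof -
    have "expectation (?p n) = (\<Prod>i<n. expectation (\<lambda>\<omega>. exp (- \<theta> * max 0 (Wi i \<omega>))))"
    proof (rule indep_vars_lebesgue_integral)
      show "indep_vars (\<lambda>_. borel) (\<lambda>i \<omega>. exp (- \<theta> * max 0 (Wi i \<omega>))) {..<n}"
        by (rule indep_vars_compose2[OF indep_vars_subset[OF ind]]) auto
      show "integrable M (\<lambda>\<omega>. exp (- \<theta> * max 0 (Wi i \<omega>)))" for i
        using \<theta> by (intro integrable_const_bound[where B=1] AE_I2) auto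
    qed simp
    also have "\<dots> = (\<Prod>i<n. lam i / (lam i + \<theta>))"
      by (intro prod.cong refl Laplace_exponential[OF D lam \<theta>])
    also have "\<dots> = (\<Prod>i<n. 1 / (1 + \<theta> / lam i))"
    proof (rule prod.cong[OF refl])
      fix i
      show "lam i / (lam i + \<theta>) = 1 / (1 + \<theta> / lam i)" using lam[of i] \<theta> by (simp add: field_simps)
    qed
    also have "\<dots> = 1 / (\<Prod>i<n. 1 + \<theta> / lam i)" by (simp add: prod_dividef)
    finally show ?thesis .
  qed
  ultimately have "(\<lambda>n. 1 / (\<Prod>i<n. 1 + \<theta> / lam i)) \<longlonglongrightarrow> expectation ?e" by simp
  moreover have "(\<lambda>n. 1 / (\<Prod>i<n. 1 + \<theta> / lam i)) \<longlonglongrightarrow> 1 / G"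
    using G by (intro tendsto_intros lim) auto
  ultimately show ?thesis using LIMSEQ_unique by blast
qed

lemma (in prob_space) monotone_prob_measurable:
  assumes H: "\<And>t. t \<ge> 0 \<Longrightarrow> H t \<in> events" and mono: "\<And>r t. 0 \<le> r \<Longrightarrow> r \<le> t \<Longrightarrow> H r \<subseteq> H t"
  shows "(\<lambda>t. prob (H t)) \<in> borel_measurable (restrict_space borel {0::real..})"
proof (rule borel_measurable_mono_on_fnc, rule mono_onI)
  fix r t :: real
  assume "r \<in> {0..}" "t \<in> {0..}" "r \<le> t"
  then show "prob (H r) \<le> prob (H t)" by (intro finite_measure_mono mono H) auto
qed

section \<open>The hitting time as a sum of exponential variables\<close>

context regular_boundaries begin

text \<open>Shows that an exhaustive list of eigenvalues exhausts the zeros of \<open>sp.G\<close>.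
  The work lies in turning the flux form back into two classical derivatives of u.\<close>

lemma eigenpair_of_G_zero:
  assumes z: "sp.G (- of_real l) = 0"
  shows "eigenpair a b l (sp.U (\<lambda>n. (- l) ^ n))"
proof -
  let ?u = "sp.U (\<lambda>n. (- l) ^ n)" and ?F = "sp.Fl (\<lambda>n. (- l) ^ n)"
  note Z = sp.G_zero_imp_eigenfunction[OF z]
  note P = sp.flux_pairD[OF Z(1)]
  have du: "deriv ?u x = s x * ?F x" if "x \<in> {0<..<1}" for x
    using P(4)[of x] that by (auto intro: DERIV_imp_deriv)
  let ?D = "\<lambda>x. - (2 * a x / b x) * s x * ?F x + s x * (2 * m x * (- l * ?u x))"
  have d2: "(deriv ?u has_real_derivative ?D x) (at x)" if x: "x \<in> {0<..<1}" for x
  proof (rule has_field_derivative_transform_within_open[of "\<lambda>x. s x * ?F x" _ _ "{0<..<1}"])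
    have x': "0 < x" "x < 1" using x by auto
    show "((\<lambda>x. s x * ?F x) has_real_derivative ?D x) (at x)"
      by (rule DERIV_cong[OF DERIV_mult[OF s_deriv[OF x'] P(5)[OF x']]]) (simp add: algebra_simps)
  qed (use x du in auto)
  have sub: "{0<..<1} \<subseteq> {0..1::real}" by auto
  have bn: "\<forall>x\<in>{0<..<1}. b x \<noteq> 0" using b_pos by (auto simp: less_imp_neq[symmetric])
  have uc: "continuous_on {0<..<1} ?u" "continuous_on {0<..<1} ?F"
    using P(1,2) sub by (auto intro: continuous_on_subset)
  have "?u C1_differentiable_on {0<..<1}"
    unfolding C1_differentiable_on_def
  proof (intro exI[of _ "\<lambda>x. s x * ?F x"] conjI ballI)
    show "continuous_on {0<..<1} (\<lambda>x. s x * ?F x)" by (intro continuous_intros s_cont uc)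
    show "(?u has_vector_derivative s x * ?F x) (at x)" if "x \<in> {0<..<1}" for x
      using P(4)[of x] that by (simp add: has_real_derivative_iff_has_vector_derivative)
  qed
  moreover have "deriv ?u C1_differentiable_on {0<..<1}"
    unfolding C1_differentiable_on_def
  proof (intro exI[of _ ?D] conjI ballI)
    show "continuous_on {0<..<1} ?D" by (intro continuous_intros s_cont m_cont a_cont b_cont uc bn)
    show "(deriv ?u has_vector_derivative ?D x) (at x)" if "x \<in> {0<..<1}" for x
      using d2[OF that] by (simp add: has_real_derivative_iff_has_vector_derivative)
  qed
  moreover have "diff_op a b ?u x + l * ?u x = 0" if x: "x \<in> {0<..<1}" for x
  proof -
    have "deriv (deriv ?u) x = ?D x" by (rule DERIV_imp_deriv[OF d2[OF x]])
    \<comment> \<open>The drift terms cancel and b s m = 1 leaves -l u. With plain reals in place of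
      the functions the identity is purely algebraic.\<close>
    moreover have "(1/2) * B * (- (2 * A / B) * r * f + r * (2 * (1 / (r * B)) * (- l * w))) + A * (r * f) + l * w = 0"
      if "B > 0" "r > 0" for A B r f w :: real using that by (simp add: divide_simps) algebra?
    ultimately show ?thesis
      using x b_pos[of x] s_pos[of x] unfolding diff_op_def du[OF x] speed_density_def by simp
  qed
  moreover have "\<exists>x\<in>{0<..<1}. ?u x \<noteq> 0"
    using sp.continuous_nonvanish_near_0[OF P(1)] Z(3) by (metis greaterThanLessThan_iff zero_neq_one)
  moreover have fe: "deriv ?u x / s x = ?F x" if "x \<in> {0<..<1}" for x
    using du[OF that] s_pos[of x] by (simp add: less_imp_neq[symmetric] del: s_pos)
  have "dS0_zero a b ?u"
  proof -
    have "(?F \<longlongrightarrow> 0) (at_right 0)" using continuous_on_unit_lim(1)[OF P(2)] by simp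
    moreover have "eventually (\<lambda>x. ?F x = deriv ?u x / s x) (at_right 0)"
      using fe by (intro eventually_at_rightI[of 0 1]) auto
    ultimately show ?thesis unfolding dS0_zero_def by (rule Lim_transform_eventually)
  qed
  moreover have "dS1_zero a b ?u"
  proof -
    have "(?F \<longlongrightarrow> 0) (at_left 1)" using continuous_on_unit_lim(2)[OF P(2)] Z(2) by simp
    moreover have "eventually (\<lambda>x. ?F x = deriv ?u x / s x) (at_left 1)"
      using fe by (intro eventually_at_leftI[of 0 1]) auto
    ultimately show ?thesis unfolding dS1_zero_def by (rule Lim_transform_eventually)
  qed
  ultimately show ?thesis unfolding eigenpair_def C2_interior_def by blast
qed

lemma eigenpair_imp_G_zero:
  assumes e: "eigenpair a b l v" and l: "l > 0"
  shows "sp.G (- of_real l) = 0"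
proof -
  have C2: "C2_interior v" using e by (simp add: eigenpair_def)
  obtain x1 where x1: "0 < x1" "x1 < 1" "v x1 \<noteq> 0" using e by (auto simp: eigenpair_def)
  show ?thesis
  proof (rule sp.eigenvalue_imp_G_zero[where v=v and l=l and E="\<lambda>x. deriv v x / s x", OF _ _ l _ _ x1])
    fix x :: real assume x: "0 < x" "x < 1"
    show "(v has_real_derivative s x * (deriv v x / s x)) (at x)"
      using flux_deriv(1)[OF C2 x] s_pos[of x] by (simp add: less_imp_neq[symmetric] del: s_pos)
    have "diff_op a b v x = - l * v x" using e x by (auto simp: eigenpair_def add_eq_0_iff)
    then show "((\<lambda>x. deriv v x / s x) has_real_derivative 2 * m x * (- l * v x)) (at x)"
      using flux_deriv(2)[OF C2 x] by simp
  next
    show "((\<lambda>x. deriv v x / s x) \<longlongrightarrow> 0) (at_right 0)" "((\<lambda>x. deriv v x / s x) \<longlongrightarrow> 0) (at_left 1)"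
      using e by (auto simp: eigenpair_def dS0_zero_def dS1_zero_def)
  qed
qed

text \<open>Eigenvalues and zeros of \<open>sp.G\<close> correspond under l |-> -l, so the complex
  product expansion runs over the given list and is then read off on the real axis.\<close>

lemma eigenvalue_product:
  fixes lam :: "nat \<Rightarrow> real"
  assumes e: "\<And>i. eigenpair a b (lam i) (v i)" and all: "\<And>l u. l > 0 \<Longrightarrow> eigenpair a b l u \<Longrightarrow> l \<in> range lam"
    and lam: "0 < lam 0" "strict_mono lam"
  shows "(\<lambda>n. \<Prod>i<n. 1 + \<theta> / lam i) \<longlonglongrightarrow> sp.g \<theta>"
proof -
  have pos: "lam i > 0" for i using lam strict_mono_less_eq[of lam 0 i] by auto
  have z: "sp.G (- of_real (lam i)) = 0" for i by (rule eigenpair_imp_G_zero[OF e pos])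
  have "(\<lambda>n. \<Prod>i<n. 1 + of_real \<theta> / complex_of_real (lam i)) \<longlonglongrightarrow> sp.G (of_real \<theta>)"
  proof (rule product_formula_minimal_type[OF sp.G_holomorphic sp.G_0 sp.G_growth lam(2,1) z])
    fix w assume w: "sp.G w = 0"
    then obtain l where l: "l > 0" "w = - of_real l" using sp.G_zero_real by blast
    then have "eigenpair a b l (sp.U (\<lambda>n. (- l) ^ n))" using w by (intro eigenpair_of_G_zero) simp
    from all[OF l(1) this] show "\<exists>i. w = - of_real (lam i)" using l(2) by auto
  next
    fix i
    show "deriv sp.G (- of_real (lam i)) \<noteq> 0" using sp.G_zero_simple[of "- lam i"] z[of i] by simp
  qed
  moreover have "(\<Prod>i<n. 1 + of_real \<theta> / complex_of_real (lam i)) = of_real (\<Prod>i<n. 1 + \<theta> / lam i)" for n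
    by simp
  ultimately have "(\<lambda>n. complex_of_real (\<Prod>i<n. 1 + \<theta> / lam i)) \<longlonglongrightarrow> of_real (sp.g \<theta>)"
    by (simp only: sp.G_of_real)
  then show ?thesis by (simp only: tendsto_of_real_iff)
qed

end

text \<open>Tested on the indicator of {0}: \<Lambda> reproduces it, since for x > 0 the link does
  not charge 0. So the initial law of the dual gives {0} mass 1.\<close>

lemma (in dual_diffusion) dual_start:
  assumes \<mu>s: "prob_space \<mu>s" "sets \<mu>s = sets unit_borel"
    and eq: "\<And>f. f \<in> bounded_measurable_unit \<Longrightarrow> (\<integral>x. f x \<partial>return unit_borel 0) = (\<integral>x. link a b f x \<partial>\<mu>s)"
  shows "\<mu>s = return unit_borel 0"
proof (rule measure_unit_eqI[OF \<mu>s])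
  have sp: "space unit_borel = {0..1::real}" by (simp add: space_restrict_space)
  have spm: "space \<mu>s = {0..1}" using sets_eq_imp_space_eq[OF \<mu>s(2)] sp by simp
  interpret prob_space \<mu>s by fact
  let ?f = "indicator {0} :: real \<Rightarrow> real"
  have zero: "{0} \<in> sets unit_borel" by (intro unit_borel_setsI) auto
  have fm: "?f \<in> borel_measurable unit_borel" by (rule borel_measurable_indicator[OF zero])
  have f: "?f \<in> bounded_measurable_unit"
    unfolding bounded_measurable_unit_def using fm by (auto intro!: boundedI[of _ 1] simp: indicator_def)
  have lk: "link a b ?f x = ?f x" if "x \<in> {0..1}" for x
  proof (cases "x = 0")
    case False
    then have "link a b ?f x = (\<integral>y. ?f y \<partial>link_law x)" using that fm by (intro link_eq_integral)
    also have "\<dots> = measure (link_law x) {0}" using zero by (simp add: sets_link_law)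
    finally show ?thesis using link_law_0[of x] that False by simp
  qed (simp add: link_def)
  have "1 = (\<integral>x. ?f x \<partial>return unit_borel 0)" using fm by (subst integral_return) (auto simp: sp)
  also have "\<dots> = (\<integral>x. link a b ?f x \<partial>\<mu>s)" by (rule eq[OF f])
  also have "\<dots> = (\<integral>x. ?f x \<partial>\<mu>s)" by (intro Bochner_Integration.integral_cong refl lk) (simp add: spm)
  also have "\<dots> = prob {0}" using zero \<mu>s(2) by (simp add: spm)
  finally have p0: "prob {0} = 1" by simp
  show "prob_space (return unit_borel (0::real))" by (intro prob_space_return) (simp add: sp)
  show "measure \<mu>s {0..c} = measure (return unit_borel 0) {0..c}" if c: "c \<in> {0..1}" for c
  proof -
    have A: "{0..c} \<in> sets unit_borel" by (rule Icc_unit[OF c])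
    have "prob {0} \<le> prob {0..c}" using A c \<mu>s(2) by (intro finite_measure_mono) auto
    then have "prob {0..c} = 1" using p0 prob_le_1[of "{0..c}"] by simp
    then show ?thesis using measure_return[OF A, of 0] c by simp
  qed
qed simp

text \<open>The first conjunct is the claim that the dual starts at 0. \<open>W\<close> takes values
  in [0, \<infinity>] and is tied to the series through its law alone, so it may live on another
  probability space.\<close>

theorem theorem6p3:
  fixes a b :: "real \<Rightarrow> real"
    and P :: "real \<Rightarrow> 'w measure" and X :: "real \<Rightarrow> 'w \<Rightarrow> real"
    and Ps :: "real \<Rightarrow> 'v measure" and Xs :: "real \<Rightarrow> 'v \<Rightarrow> real"
    and \<mu>s :: "real measure"
    and lam :: "nat \<Rightarrow> real" and v :: "nat \<Rightarrow> real \<Rightarrow> real"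
    and N :: "'u measure" and Wi :: "nat \<Rightarrow> 'u \<Rightarrow> real"
    and Q :: "'z measure" and W :: "'z \<Rightarrow> ennreal"
  assumes "continuous_on {0<..<1} a"
    and "b C1_differentiable_on {0<..<1}"
    and "\<forall>x\<in>{0<..<1}. b x > 0"
    and "feller_diffusion P X"
    and "regular_diffusion P X"
    and "has_coefficients P X a b"
    and "reflecting0 P X a b \<or> entrance0 a b"
    and "reflecting1 P X a b"
    and "\<forall>i. eigenpair a b (lam i) (v i)"
    and "\<forall>l u. l > 0 \<and> eigenpair a b l u \<longrightarrow> l \<in> range lam"
    and "0 < lam 0"
    and "strict_mono lam"
    and "strong_stationary_dual a b P X (return unit_borel 0) Ps Xs \<mu>s"
    and "prob_space N"
    and "prob_space.indep_vars N (\<lambda>_. borel) Wi UNIV"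
    and "\<forall>i. distributed N lborel (Wi i) (exponential_density (lam i))"
    and "prob_space Q"
    and "W \<in> borel_measurable Q"
    and "distr Q borel W = distr N borel (\<lambda>\<omega>. \<Sum>i. ennreal (Wi i \<omega>))"
  shows "\<mu>s = return unit_borel 0 \<and>
    (\<forall>t>0.
       separation (stat_measure a b) (distr (P 0) unit_borel (X t))
         = measure (Ps 0) {\<omega>\<in>space (Ps 0). hitting_time Xs 1 \<omega> > ereal t} \<and>
       measure (Ps 0) {\<omega>\<in>space (Ps 0). hitting_time Xs 1 \<omega> > ereal t}
         = measure Q {\<omega>\<in>space Q. W \<omega> > ennreal t})"
proof -
  have lamp: "lam i > 0" for i using assms(11,12) strict_mono_less_eq[of lam 0 i] by auto
  have bc: "continuous_on {0<..<1} b" using assms(2) by (rule C1_differentiable_imp_continuous_on)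
  have r1: "N1 a b < \<infinity>" "Sigma1 a b < \<infinity>" using assms(8) by (auto simp: reflecting1_def)
  have r0: "N0 a b < \<infinity>" using assms(7) by (auto simp: reflecting0_def entrance0_def)
  note dual = assms(13)[unfolded strong_stationary_dual_def]
  interpret dual_diffusion a b P X Ps Xs
    by unfold_locales (use assms dual bc r0 r1 in auto)
  have \<mu>s: "\<mu>s = return unit_borel 0" by (rule dual_start) (use dual in auto)
  interpret N: prob_space N by fact
  interpret Q: prob_space Q by fact
  interpret H: prob_space "Ps 0" by (rule D.prob_P) simp
  define Z where "Z \<omega> = (\<Sum>i. ennreal (Wi i \<omega>))" for \<omega>
  have Wm [measurable]: "Wi i \<in> borel_measurable N" for i
    using assms(16) distributed_measurable[of N lborel "Wi i" "exponential_density (lam i)"] by simp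
  have Zm [measurable]: "Z \<in> borel_measurable N" unfolding Z_def by measurable
  let ?B = "\<lambda>t. {\<omega>\<in>space N. Z \<omega> \<le> ennreal t}"
  have BM: "?B t \<in> sets N" for t by measurable
  have Bmono: "?B u \<subseteq> ?B t" if "u \<le> t" for u t
    using ennreal_leI[OF that] by (auto intro: order_trans)
  have hit_mono: "hit u \<subseteq> hit t" if "0 \<le> u" "u \<le> t" for u t using that by (force simp: hit_def)
  \<comment> \<open>Both sides are right continuous in t and have the transform
    \<open>1 / sp.g (real n)\<close> at every integer n \<ge> 1.\<close>
  have key: "measure (Ps 0) (hit t) = measure N (?B t)" if t: "t \<ge> 0" for t
  proof -
    have m1: "(\<lambda>t. measure (Ps 0) (hit t)) \<in> borel_measurable (restrict_space borel {0..})"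
      by (rule H.monotone_prob_measurable[OF hit_measurable hit_mono])
    have m2: "(\<lambda>t. measure N (?B t)) \<in> borel_measurable (restrict_space borel {0..})"
      by (rule N.monotone_prob_measurable[OF BM Bmono])
    have "measure (Ps 0) (hit t) - measure N (?B t) = 0"
    proof (rule Laplace_uniqueness[where g="\<lambda>t. measure (Ps 0) (hit t) - measure N (?B t)" and B=1, OF _ _ _ _ t])
      show "(\<lambda>t. measure (Ps 0) (hit t) - measure N (?B t)) \<in> borel_measurable (restrict_space borel {0..})"
        using m1 m2 by (rule borel_measurable_diff)
      show "\<bar>measure (Ps 0) (hit t) - measure N (?B t)\<bar> \<le> 1" for t
        using H.prob_le_1[of "hit t"] N.prob_le_1[of "?B t"] measure_nonneg[of "Ps 0" "hit t"] measure_nonneg[of N "?B t"]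
        by linarith
      show "((\<lambda>t. measure (Ps 0) (hit t) - measure N (?B t)) \<longlongrightarrow> measure (Ps 0) (hit t) - measure N (?B t)) (at_right t)"
        if t: "t \<ge> 0" for t
      proof (intro tendsto_diff measure_hit_right_continuous t)
        show "((\<lambda>t. measure N (?B t)) \<longlongrightarrow> measure N (?B t)) (at_right t)"
        proof (rule N.measure_right_continuous[of ?B, OF BM Bmono _ t])
          fix t :: real and \<omega> assume t: "t \<ge> 0" and a: "\<And>u. u > t \<Longrightarrow> \<omega> \<in> ?B u"
          have "Z \<omega> \<le> ennreal t"
          proof (rule ennreal_le_epsilon)
            fix e :: real assume "e > 0"
            then have "Z \<omega> \<le> ennreal (t + e)" using a[of "t + e"] by simp
            then show "Z \<omega> \<le> ennreal t + ennreal e" using t \<open>e > 0\<close> by simp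
          qed
          then show "\<omega> \<in> ?B t" using a[of "t + 1"] by simp
        qed
      qed
      fix n :: nat assume "n \<ge> 1"
      then have n: "real n > 0" by simp
      have g1: "sp.g (real n) > 0" using sp.g_ge_1[of "real n"] by simp
      have lim: "(\<lambda>k. \<Prod>i<k. 1 + real n / lam i) \<longlonglongrightarrow> sp.g (real n)"
        by (rule eigenvalue_product[of lam v]) (use assms(9-12) in auto)
      have "(\<integral>t. measure N (?B t) \<partial>exp_law (real n)) = 1 / sp.g (real n)"
        unfolding N.Laplace_cdf[OF Zm n] unfolding Z_def
        by (rule N.Laplace_sum_exponentials[OF assms(15) _ lamp n lim g1]) (use assms(16) in auto)
      moreover have "(\<integral>t. measure (Ps 0) (hit t) \<partial>exp_law (real n)) = 1 / sp.g (real n)" by (rule Laplace_hit[OF n])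
      moreover have "integrable (exp_law (real n)) (\<lambda>t. measure (Ps 0) (hit t))" "integrable (exp_law (real n)) (\<lambda>t. measure N (?B t))"
        using integrable_exp_law_bounded[OF n m1, of 1] integrable_exp_law_bounded[OF n m2, of 1]
          H.prob_le_1 N.prob_le_1 by auto
      ultimately show "(\<integral>t. measure (Ps 0) (hit t) - measure N (?B t) \<partial>exp_law (real n)) = 0" by simp
    qed
    then show ?thesis by simp
  qed
  have W: "measure Q {\<omega>\<in>space Q. W \<omega> > ennreal t} = 1 - measure N (?B t)" for t
  proof -
    have [measurable]: "W \<in> borel_measurable Q" by fact
    have "measure Q {\<omega>\<in>space Q. W \<omega> > ennreal t} = measure (distr Q borel W) {ennreal t<..}"
      by (subst measure_distr) (auto intro: arg_cong[where f="measure Q"])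
    also have "\<dots> = measure (distr N borel Z) {ennreal t<..}"
      using assms(19) by (simp add: Z_def[abs_def])
    also have "\<dots> = measure N {\<omega>\<in>space N. Z \<omega> > ennreal t}"
      by (subst measure_distr) (auto intro: arg_cong[where f="measure N"])
    also have "{\<omega>\<in>space N. Z \<omega> > ennreal t} = space N - ?B t" by (auto simp: not_le)
    also have "measure N \<dots> = 1 - measure N (?B t)" by (rule N.prob_compl[OF BM])
    finally show ?thesis .
  qed
  have "separation (stat_measure a b) (distr (P 0) unit_borel (X t))
         = measure (Ps 0) {\<omega>\<in>space (Ps 0). hitting_time Xs 1 \<omega> > ereal t} \<and>
       measure (Ps 0) {\<omega>\<in>space (Ps 0). hitting_time Xs 1 \<omega> > ereal t}
         = measure Q {\<omega>\<in>space Q. W \<omega> > ennreal t}" if t: "t > 0" for t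
  proof -
    have t0: "t \<ge> 0" using t by simp
    show ?thesis
      using separation_eq[OF t] measure_hit[OF t0] measure_hitting_time[OF t0] key[OF t0] W[of t]
      by (simp add: law_def)
  qed
  then show ?thesis using \<mu>s by blast
qed

end
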